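(* Let $\epsilon>0$ be fixed (small), let $\sigma\geq\frac12+\epsilon$ be fixed and let $x>0$ be fixed. Let $\varphi_1$ be a Jacob's ladder and for sufficiently large $y$ write $\overset{1}{y}=[y]^1=\varphi_1^{-1}(y)$. Put $u=u(\tau)=\frac{2\pi^2}{\zeta^4(2\sigma)}x\tau$. Then \[ \lim_{\tau\to\infty}\frac{1}{\tau}\,\frac{\left\{\int_{u}^{[u]^1}|\zeta(\sigma+it)|^2{\rm d}t\right\}^4\int_0^{u}\left|\zeta\left(\frac{1}{2}+it\right)\right|^4{\rm d}t}{\sum_{s=0}^4c_s\left\{\int_{u}^{[u]^1}\left|\zeta\left(\frac{1}{2}+it\right)\right|^2{\rm d}t\right\}^{4-s}\left\{\int_{u}^{[u]^1}|\zeta(\sigma+it)|^2{\rm d}t\right\}^s}=x, \] where $c_0=1$ and $c_s=2\pi^2\{\zeta(2\sigma)\}^{-s}a_s$, $s=1,2,3,4$.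
   Context: $\zeta$ is the Riemann zeta-function. The constants $a_0,\dots,a_4$ are those of the Ingham / Heath-Brown fourth moment formula: $\int_0^T|\zeta(\frac12+it)|^4{\rm d}t=T\sum_{s=0}^4a_s\ln^{4-s}T+\mathcal{O}(T^{7/8+\epsilon})$ as $T\to\infty$, with $a_0=\frac{1}{2\pi^2}$. A Jacob's ladder (in the sense of J. Moser) is a function $\varphi_1(T)=\frac12\varphi(T)$, where $\varphi(T)=x(T)$ is a solution of the nonlinear integral equation $\int_0^{\mu[x(T)]}Z^2(t)e^{-\frac{2}{x(T)}t}{\rm d}t=\int_0^T Z^2(t){\rm d}t$, with $Z(t)$ the Hardy function (so $Z^2(t)=|\zeta(\frac12+it)|^2$) and $\mu$ an increasing function with $\mu(y)\geq 7y\ln y$; it is known that $\varphi_1$ is increasing for sufficiently large arguments, so $\varphi_1^{-1}(y)$ is defined for sufficiently large $y$, and $\int_y^{[y]^1}|\zeta(\frac12+it)|^2{\rm d}t\sim(1-c)y$ as $y\to\infty$, where $c$ is Euler's constant. *)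

theory Defs
  imports "HOL-Complex_Analysis.Complex_Analysis" "HOL-Library.Landau_Symbols"
begin

text \<open>
  The Riemann zeta-function: the analytic continuation of the Dirichlet series
  \<open>1 + 1/2\<^sup>s + 1/3\<^sup>s + \<dots>\<close> from the half-plane \<open>Re s > 1\<close> to the plane without the pole at 1.
  By the identity theorem it is unique up to its value at the pole, which is set to 0 by convention.
\<close>

definition zeta :: "complex \<Rightarrow> complex" where
  "zeta = (THE f. f holomorphic_on (- {1}) \<and>
                  (\<forall>s. Re s > 1 \<longrightarrow> f s = (\<Sum>n. 1 / of_nat (Suc n) powr s)) \<and>
                  f 1 = 0)"

definition zeta_moment :: "nat \<Rightarrow> real \<Rightarrow> real \<Rightarrow> real \<Rightarrow> real" where
  "zeta_moment k \<sigma> a b = integral {a..b} (\<lambda>t. norm (zeta (Complex \<sigma> t)) ^ k)"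

text \<open>
  The square of the Hardy function \<open>Z(t) = exp(i \<theta>(t)) \<zeta>(1/2 + i t)\<close>.  As \<open>\<theta>\<close> and \<open>Z\<close> are
  real-valued, it does not involve the phase \<open>\<theta>\<close>.
\<close>

definition hardy_Z_sq :: "real \<Rightarrow> real" where
  "hardy_Z_sq t = norm (zeta (Complex (1/2) t)) ^ 2"

text \<open>
  Jacob's ladders live on a half-line \<open>{T0..}\<close>: only there is the integral equation imposed, and the
  values of \<open>\<phi>\<^sub>1\<close> to the left of \<open>T0\<close> are irrelevant.  Likewise \<open>\<mu>\<close> is a function on a half-line
  \<open>{y0..}\<close>, which has to contain the solution.
\<close>

definition jacobs_ladder :: "real \<Rightarrow> (real \<Rightarrow> real) \<Rightarrow> bool" where
  "jacobs_ladder T0 \<phi>\<^sub>1 \<longleftrightarrow>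
     T0 \<ge> 0 \<and>
     (\<exists>(\<mu> :: real \<Rightarrow> real) (y0 :: real) (\<phi> :: real \<Rightarrow> real).
        y0 > 0 \<and> mono_on {y0..} \<mu> \<and> (\<forall>y\<ge>y0. \<mu> y \<ge> 7 * y * ln y) \<and>
        (\<forall>T\<ge>T0. \<phi> T \<ge> y0 \<and>
           integral {0..\<mu> (\<phi> T)} (\<lambda>t. hardy_Z_sq t * exp (- (2 / \<phi> T) * t)) =
             integral {0..T} hardy_Z_sq \<and>
           \<phi>\<^sub>1 T = \<phi> T / 2))"

text \<open>
  The inverse \<open>[y]\<^sup>1 = \<phi>\<^sub>1\<^sup>-\<^sup>1(y)\<close> on that half-line.  For a ladder it is a genuine inverse: \<open>\<phi>\<^sub>1\<close> is
  injective on \<open>{T0..}\<close>, because the right-hand side of the integral equation is strictly increasing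
  in \<open>T\<close>, and its values there include all sufficiently large \<open>y\<close>.
\<close>

definition ladder_inv :: "real \<Rightarrow> (real \<Rightarrow> real) \<Rightarrow> real \<Rightarrow> real" where
  "ladder_inv T0 \<phi>\<^sub>1 y = inv_into {T0..} \<phi>\<^sub>1 y"

end

theory Submission
  imports Defs "HOL-Probability.Probability" "HOL-Real_Asymp.Real_Asymp"
begin

text \<open>
  Write \<open>v = u(\<tau>)\<close> and \<open>V = [v]\<^sup>1\<close>. Everything follows from three asymptotic relations as \<open>v \<rightarrow> \<infinity>\<close>:
  \<open>\<integral>\<^sub>v\<^sup>V |\<zeta>(\<sigma> + it)|\<^sup>2 dt \<sim> \<zeta>(2\<sigma>) (V - v)\<close>, \<open>\<integral>\<^sub>v\<^sup>V |\<zeta>(1/2 + it)|\<^sup>2 dt \<sim> (V - v) ln v\<close> and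
  \<open>\<integral>\<^sub>0\<^sup>v |\<zeta>(1/2 + it)|\<^sup>4 dt \<sim> v ln\<^sup>4 v / (2\<pi>\<^sup>2)\<close>. By the first two, the term \<open>s = 0\<close> dominates the denominator.

  The mean squares over short intervals come from local means \<open>E |\<zeta>(\<sigma> + i(\<tau> + GX))|\<^sup>2\<close> with a standard
  Gaussian \<open>X\<close> and \<open>G\<close> of order \<open>\<tau>\<^sup>3\<^sup>/\<^sup>5\<close>. For \<open>1/2 \<le> \<sigma> < 1\<close>, \<open>\<zeta>\<close> is replaced by the smoothed series
  \<open>\<Sum> n\<^sup>-\<^sup>s e\<^sup>-\<^sup>n\<^sup>/\<^sup>N\<close> with \<open>N = \<tau>\<^sup>3\<close>. Its diagonal terms give \<open>\<zeta>(2\<sigma>)\<close> or \<open>ln (N/2)\<close>; the off-diagonal terms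
  with \<open>n - m = h\<close> fixed are a Riemann sum in \<open>y = ln (n/m)\<close>, and the resulting integral splits into a
  part homogeneous in \<open>N\<close>, which must vanish asymptotically since \<open>N\<close> and \<open>2N\<close> give the same \<open>\<zeta>\<close>, and a
  part that is negligible for \<open>\<sigma> > 1/2\<close> and turns \<open>ln (N/2)\<close> into \<open>ln \<tau> + const\<close> for \<open>\<sigma> = 1/2\<close>.

  For the ladder, partial integration in its integral equation and \<open>\<integral>\<^sub>0\<^sup>t |\<zeta>(1/2 + it)|\<^sup>2 = t ln t + \<alpha>t + o(t)\<close>
  show that \<open>\<integral>\<^sub>v\<^sup>V |\<zeta>(1/2 + it)|\<^sup>2 dt\<close> is at least a constant multiple of \<open>v\<close>, so \<open>V - v\<close> is at least of order
  \<open>v / ln v\<close>, which the error terms allow.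
\<close>

section \<open>Analytic continuation\<close>

text \<open>The definition of \<open>zeta\<close> gives a continuation but no functional equation,
  so all estimates start from Euler summation of partial sums, whose remainder grows with |s|. This
  forces the smoothed series to be longer than the square of the height; the surplus of ln N over ln
  \<tau> then has to be recovered exactly from the off-diagonal terms. The exponential cut-off is
  chosen because for n - m = h both (m n)^-\<sigma> and exp (-(m + n) / N) are elementary functions
  of y = ln (n / m), the very frequency that the Gaussian damps like exp (-(G y)^2 / 2). The
  obstacle is the pole of \<open>zeta\<close> at 1: it puts a term of formal size N^(2 - 2 \<sigma>)
  times an oscillating integral into the off-diagonal sum, and it spoils the smoothed series near t
  = 0. Lines \<sigma> \<ge> 1 are treated apart, by Dirichlet polynomials: the line \<sigma> = 1
  runs through the pole, where Gamma (2 - 2 \<sigma>) is infinite. Since the intervals are as long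
  as v / ln v, an error T^(19/20) is affordable, and the exponents are chosen with slack rather than
  optimised.\<close>

lemma holomorphic_on_suminf:
  fixes f :: "nat \<Rightarrow> complex \<Rightarrow> complex"
  assumes "open S" and hol: "\<And>n. f n holomorphic_on S"
    and bound: "\<And>z. z \<in> S \<Longrightarrow> \<exists>d M. 0 < d \<and> cball z d \<subseteq> S \<and> summable M \<and>
                  (\<forall>n. \<forall>w\<in>cball z d. norm (f n w) \<le> M n)"
  shows "(\<lambda>z. \<Sum>n. f n z) holomorphic_on S"
proof (rule holomorphic_uniform_sequence)
  show "open S" by fact
  show "(\<lambda>z. \<Sum>k<n. f k z) holomorphic_on S" for n
    by (intro holomorphic_intros hol)
  fix z assume "z \<in> S"
  from bound[OF this] obtain d M where "0 < d" "cball z d \<subseteq> S" and M: "summable M"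
    "\<And>n w. w \<in> cball z d \<Longrightarrow> norm (f n w) \<le> M n" by blast
  moreover have "uniform_limit (cball z d) (\<lambda>n z. \<Sum>k<n. f k z) (\<lambda>z. \<Sum>n. f n z) sequentially"
    by (rule Weierstrass_m_test) (use M in auto)
  ultimately show "\<exists>d>0. cball z d \<subseteq> S \<and>
      uniform_limit (cball z d) (\<lambda>n z. \<Sum>k<n. f k z) (\<lambda>z. \<Sum>n. f n z) sequentially" by blast
qed

lemma norm_Suc_powr: "norm ((of_nat (Suc n) :: complex) powr s) = real (Suc n) powr Re s"
  by (metis norm_powr_real_powr of_nat_0_le_iff of_real_of_nat_eq Reals_of_nat Re_complex_of_real complex_Re_of_nat)

text \<open>Taylor's formula for z^\<alpha> on the segment from 1 to 2, where 1 \<le> |z| \<le> 2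
  bounds every power by 2^R. That \<alpha> enters only through R is what gives locally uniform
  convergence, hence holomorphy, of the series built from it.\<close>

lemma binomial_remainder_bound:
  fixes \<alpha> :: complex and x :: real
  assumes "0 \<le> x" "x \<le> 1" "norm \<alpha> \<le> R"
  shows "norm ((1 + of_real x) powr \<alpha> - (\<Sum>i\<le>K. (\<alpha> gchoose i) * of_real x ^ i))
           \<le> (\<Prod>j\<le>K. (R + real j)) * 2 powr R * x ^ Suc K / fact K"
proof -
  define f where "f = (\<lambda>i (z::complex). (\<Prod>j<i. (\<alpha> - of_nat j)) * z powr (\<alpha> - of_nat i))"
  define S where "S = closed_segment (1::complex) 2"
  have S: "\<exists>t. z = of_real t \<and> 1 \<le> t \<and> t \<le> 2" if "z \<in> S" for z
  proof -
    from that obtain u where u: "0 \<le> u" "u \<le> 1" "z = (1 - u) *\<^sub>R 1 + u *\<^sub>R 2"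
      unfolding S_def closed_segment_def by auto
    have "z = of_real (1 + u)" using u(3) by (simp add: scaleR_conv_of_real)
    then show ?thesis using u by (intro exI[of _ "1+u"]) auto
  qed
  have "cmod (f 0 (1 + of_real x) - (\<Sum>i\<le>K. f i 1 * ((1 + of_real x) - 1) ^ i / fact i))
      \<le> ((\<Prod>j\<le>K. (R + real j)) * 2 powr R) * cmod ((1 + of_real x) - 1) ^ Suc K / fact K"
  proof (rule complex_Taylor[where S = S])
    show "convex S" by (simp add: S_def)
    show "1 \<in> S" by (simp add: S_def)
    have "1 + complex_of_real x = (1 - x) *\<^sub>R 1 + x *\<^sub>R 2" by (simp add: scaleR_conv_of_real)
    then show "1 + complex_of_real x \<in> S" using assms unfolding S_def closed_segment_def by blast
    show "(f i has_field_derivative f (Suc i) z) (at z within S)" if z: "z \<in> S" for i z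
    proof -
      obtain t where t: "z = of_real t" "1 \<le> t" using S[OF z] by auto
      have "z \<notin> \<real>\<^sub>\<le>\<^sub>0" using t by (auto simp: complex_nonpos_Reals_iff)
      then have "((\<lambda>z. z powr (\<alpha> - of_nat i)) has_field_derivative (\<alpha> - of_nat i) * z powr (\<alpha> - of_nat i - 1)) (at z within S)"
        by (rule DERIV_subset[OF has_field_derivative_powr]) auto
      from DERIV_cmult[OF this, of "\<Prod>j<i. (\<alpha> - of_nat j)"] show ?thesis
        unfolding f_def by (simp add: algebra_simps)
    qed
    show "cmod (f (Suc K) z) \<le> (\<Prod>j\<le>K. (R + real j)) * 2 powr R" if z: "z \<in> S" for z
    proof -
      obtain t where t: "z = of_real t" "1 \<le> t" "t \<le> 2" using S[OF z] by auto
      have R: "0 \<le> R" using assms(3) norm_ge_zero order_trans by blast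
      have "cmod (z powr (\<alpha> - of_nat (Suc K))) = t powr (Re \<alpha> - real (Suc K))"
        using t by (simp add: norm_powr_real_powr)
      also have "\<dots> \<le> t powr R"
        using t assms(3) complex_Re_le_cmod[of \<alpha>] by (intro powr_mono) auto
      also have "\<dots> \<le> 2 powr R" using t R by (intro powr_mono2) auto
      finally have 1: "cmod (z powr (\<alpha> - of_nat (Suc K))) \<le> 2 powr R" .
      have 2: "cmod (\<Prod>j\<le>K. (\<alpha> - of_nat j)) \<le> (\<Prod>j\<le>K. (R + real j))"
        unfolding prod_norm[symmetric]
      proof (intro prod_mono conjI norm_ge_zero)
        fix j show "cmod (\<alpha> - of_nat j) \<le> R + real j"
          using norm_triangle_ineq4[of \<alpha> "of_nat j"] assms(3) by simp
      qed
      show ?thesis unfolding f_def norm_mult lessThan_Suc_atMost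
        by (intro mult_mono 1 2 prod_nonneg) (use R in auto)
    qed
  qed
  moreover have "f i 1 * ((1 + of_real x) - 1) ^ i / fact i = (\<alpha> gchoose i) * of_real x ^ i" for i
    by (simp add: f_def gbinomial_prod_rev lessThan_atLeast0)
  ultimately show ?thesis using assms(1)
    by (simp add: f_def)
qed

section \<open>The Dirichlet series and its continuation by a binomial recursion\<close>

definition dirichlet_zeta :: "complex \<Rightarrow> complex" where
  "dirichlet_zeta s = (\<Sum>n. of_nat (Suc n) powr (-s))"

lemma summable_Suc_powr: "a < -1 \<Longrightarrow> summable (\<lambda>n. real (Suc n) powr a)"
  using summable_real_powr_iff[of a] by (subst summable_Suc_iff[of "\<lambda>n. real n powr a"]) auto

lemma summable_Suc_powr_complex: "Re s > 1 \<Longrightarrow> summable (\<lambda>n. (of_nat (Suc n) :: complex) powr (-s))"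
  by (rule summable_norm_cancel) (subst norm_Suc_powr, rule summable_Suc_powr, simp)

lemma dirichlet_zeta_holomorphic: "dirichlet_zeta holomorphic_on {s. Re s > 1}"
  unfolding dirichlet_zeta_def
proof (rule holomorphic_on_suminf)
  show "open {s. Re s > 1}" by (rule open_halfspace_Re_gt)
  show "(\<lambda>s. (of_nat (Suc n) :: complex) powr (-s)) holomorphic_on {s. 1 < Re s}" for n
    by (intro holomorphic_intros)
  fix z assume z: "z \<in> {s. 1 < Re s}"
  define d where "d = (Re z - 1) / 2"
  have d: "d > 0" using z by (simp add: d_def)
  have Re: "Re w \<ge> Re z - d" if "w \<in> cball z d" for w
    using that abs_Re_le_cmod[of "z - w"] by (auto simp: dist_norm)
  have "summable (\<lambda>n. real (Suc n) powr (-(1 + d)))" using d by (intro summable_Suc_powr) auto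
  moreover have "norm ((of_nat (Suc n) :: complex) powr (-w)) \<le> real (Suc n) powr (-(1 + d))"
    if "w \<in> cball z d" for n w
    using Re[OF that] unfolding norm_Suc_powr by (intro powr_mono) (auto simp: d_def field_simps)
  moreover have "cball z d \<subseteq> {s. 1 < Re s}"
  proof
    fix w assume "w \<in> cball z d"
    from Re[OF this] show "w \<in> {s. 1 < Re s}" using d by (simp add: d_def field_simps)
  qed
  ultimately show "\<exists>d M. 0 < d \<and> cball z d \<subseteq> {s. 1 < Re s} \<and> summable M \<and>
      (\<forall>n. \<forall>w\<in>cball z d. norm ((of_nat (Suc n) :: complex) powr (-w)) \<le> M n)"
    using d Re by (intro exI[of _ d] exI[of _ "\<lambda>n. real (Suc n) powr (-(1 + d))"]) blast
qed

text \<open>The remainder of the binomial expansion of (N + 1)^(1 - s) in powers of 1/N, with N = n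
  + 1. It decays like N^(-Re s - K). Summed over n, the powers telescope and the expansion terms
  become values of the Dirichlet series at s, s + 1, ..., which yields the recursion behind the
  continuation.\<close>

definition binomial_tail :: "nat \<Rightarrow> nat \<Rightarrow> complex \<Rightarrow> complex" where
  "binomial_tail K n s = of_nat (Suc (Suc n)) powr (1 - s)
     - (\<Sum>i\<le>K. ((1 - s) gchoose i) * of_nat (Suc n) powr (1 - s - of_nat i))"

lemma binomial_tail_bound:
  assumes "norm (1 - s) \<le> R"
  shows "norm (binomial_tail K n s)
           \<le> (\<Prod>j\<le>K. (R + real j)) * 2 powr R / fact K * real (Suc n) powr (- Re s - real K)"
proof -
  define N where "N = real (Suc n)"
  have N: "N > 0" "complex_of_real N \<noteq> 0" by (simp_all add: N_def del: of_nat_Suc)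
  have cN: "(of_nat (Suc n) :: complex) = of_real N" by (simp add: N_def)
  have 1: "(of_nat (Suc (Suc n)) :: complex) powr (1 - s) = of_real N powr (1 - s) * (1 + of_real (1 / N)) powr (1 - s)"
  proof -
    have "(of_nat (Suc (Suc n)) :: complex) = of_real (N * (1 + 1 / N))"
      using N by (simp add: field_simps N_def)
    also have "\<dots> powr (1 - s) = of_real N powr (1 - s) * of_real (1 + 1 / N) powr (1 - s)"
      unfolding of_real_mult using N by (intro powr_times_real) (auto intro!: add_nonneg_nonneg)
    finally show ?thesis by simp
  qed
  have 2: "of_real N powr (1 - s - of_nat i) = of_real N powr (1 - s) * of_real (1 / N) ^ i" for i
    unfolding powr_diff[of _ "1 - s"] using N by (simp add: powr_nat' field_simps)
  have "binomial_tail K n s = of_real N powr (1 - s) * ((1 + of_real (1 / N)) powr (1 - s)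
           - (\<Sum>i\<le>K. ((1 - s) gchoose i) * of_real (1 / N) ^ i))"
    unfolding binomial_tail_def 1 unfolding cN 2
    by (simp add: algebra_simps sum_distrib_left)
  also have "norm \<dots> \<le> N powr Re (1 - s) * ((\<Prod>j\<le>K. (R + real j)) * 2 powr R * (1 / N) ^ Suc K / fact K)"
    unfolding norm_mult
  proof (rule mult_mono)
    show "norm (of_real N powr (1 - s)) \<le> N powr Re (1 - s)"
      using N by (simp add: norm_powr_real_powr)
    show "norm ((1 + of_real (1 / N)) powr (1 - s) - (\<Sum>i\<le>K. ((1 - s) gchoose i) * of_real (1 / N) ^ i))
      \<le> (\<Prod>j\<le>K. (R + real j)) * 2 powr R * (1 / N) ^ Suc K / fact K"
      by (rule binomial_remainder_bound) (use assms in \<open>auto simp: N_def\<close>)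
  qed auto
  also have "N powr Re (1 - s) * ((\<Prod>j\<le>K. (R + real j)) * 2 powr R * (1 / N) ^ Suc K / fact K)
      = (\<Prod>j\<le>K. (R + real j)) * 2 powr R / fact K * (N powr Re (1 - s) * (1 / N) ^ Suc K)"
    by (simp only: times_divide_eq_left times_divide_eq_right mult_ac)
  also have "N powr Re (1 - s) * (1 / N) ^ Suc K = N powr (- Re s - real K)"
  proof -
    have "(1 / N) ^ Suc K = N powr (- real (Suc K))"
      using N by (simp only: powr_minus powr_realpow power_one_over inverse_eq_divide)
    then show ?thesis by (simp only: powr_add[symmetric]) simp
  qed
  finally show ?thesis by (simp add: N_def)
qed

lemma binomial_tail_summable:
  assumes "Re s + real K > 1" shows "summable (\<lambda>n. binomial_tail K n s)"
proof (rule summable_comparison_test)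
  show "\<exists>N. \<forall>n\<ge>N. norm (binomial_tail K n s) \<le>
     (\<Prod>j\<le>K. (norm (1 - s) + real j)) * 2 powr norm (1 - s) / fact K * real (Suc n) powr (- Re s - real K)"
    by (intro exI allI impI binomial_tail_bound) simp
  show "summable (\<lambda>n. (\<Prod>j\<le>K. (norm (1 - s) + real j)) * 2 powr norm (1 - s) / fact K * real (Suc n) powr (- Re s - real K))"
    by (intro summable_mult summable_Suc_powr) (use assms in auto)
qed

lemma binomial_tail_suminf_holomorphic:
  "(\<lambda>s. \<Sum>n. binomial_tail K n s) holomorphic_on {s. Re s > 1 - real K}"
proof (rule holomorphic_on_suminf)
  show "open {s. Re s > 1 - real K}" by (rule open_halfspace_Re_gt)
  show "binomial_tail K n holomorphic_on {s. Re s > 1 - real K}" for n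
    unfolding binomial_tail_def gbinomial_prod_rev by (intro holomorphic_intros) (simp_all del: of_nat_Suc)
  fix z assume z: "z \<in> {s. Re s > 1 - real K}"
  define d where "d = (Re z - (1 - real K)) / 2"
  have d: "d > 0" using z by (simp add: d_def)
  have Re: "Re w \<ge> Re z - d" if "w \<in> cball z d" for w
    using that abs_Re_le_cmod[of "z - w"] by (auto simp: dist_norm)
  define R where "R = norm (1 - z) + d"
  have R0: "R \<ge> 0" using d by (simp add: R_def)
  define C where "C = (\<Prod>j\<le>K. (R + real j)) * 2 powr R / fact K"
  have C0: "C \<ge> 0" unfolding C_def using R0 by (intro divide_nonneg_nonneg mult_nonneg_nonneg prod_nonneg) auto
  have "summable (\<lambda>n. C * real (Suc n) powr (-(1 + d)))" using d by (intro summable_mult summable_Suc_powr) auto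
  moreover have "norm (binomial_tail K n w) \<le> C * real (Suc n) powr (-(1 + d))"
    if w: "w \<in> cball z d" for n w
  proof -
    have "norm (1 - w) \<le> norm (1 - z) + norm (z - w)" by (metis diff_add_cancel add_diff_eq norm_triangle_ineq diff_add_eq)
    then have "norm (1 - w) \<le> R" using w by (simp add: R_def dist_norm)
    from binomial_tail_bound[OF this, of K n]
    have "norm (binomial_tail K n w) \<le> C * real (Suc n) powr (- Re w - real K)" by (simp add: C_def)
    also have "\<dots> \<le> C * real (Suc n) powr (-(1 + d))"
      using Re[OF w] C0 by (intro mult_left_mono powr_mono) (auto simp: d_def field_simps)
    finally show ?thesis .
  qed
  moreover have "cball z d \<subseteq> {s. 1 - real K < Re s}"
  proof
    fix w assume "w \<in> cball z d"
    from Re[OF this] show "w \<in> {s. 1 - real K < Re s}" using d by (simp add: d_def field_simps)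
  qed
  ultimately show "\<exists>d M. 0 < d \<and> cball z d \<subseteq> {s. 1 - real K < Re s} \<and> summable M \<and>
      (\<forall>n. \<forall>w\<in>cball z d. norm (binomial_tail K n w) \<le> M n)"
    using d Re by (intro exI[of _ d] exI[of _ "\<lambda>n. C * real (Suc n) powr (-(1 + d))"]) blast
qed

text \<open>Exposes the factor s + i - 1. In the recursion it meets the value of the Dirichlet
  series at s + i, so that only the pole-free product (z - 1) zeta(z) occurs.\<close>

lemma gbinomial_eq_factor:
  "((1 - s) gchoose (Suc i)) = - ((1 - s) gchoose i) / of_nat (Suc i) * ((s::complex) + of_nat i - 1)"
proof -
  have "of_nat (Suc i) * ((1 - s) gchoose (Suc i)) = ((1 - s) - of_nat i) * ((1 - s) gchoose i)"
    using gbinomial_absorb_comp[of "1 - s" i] Suc_times_gbinomial[of i "1-s-1"] 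
    by (metis gbinomial_absorption)
  then show ?thesis by (simp add: field_simps del: of_nat_Suc)
qed


lemma summable_Suc_powr_shift:
  "Re s > 1 \<Longrightarrow> (\<lambda>n. (of_nat (Suc n) :: complex) powr (1 - s - of_nat (Suc i))) sums dirichlet_zeta (s + of_nat i)"
proof -
  assume "Re s > 1"
  then have "Re (s + of_nat i) > 1" by simp
  from summable_sums[OF summable_Suc_powr_complex[OF this]] 
  show ?thesis unfolding dirichlet_zeta_def by (simp add: algebra_simps)
qed

lemma telescope_powr_sums:
  assumes "Re s > 1"
  shows "(\<lambda>n. (of_nat (Suc (Suc n)) :: complex) powr (1 - s) - of_nat (Suc n) powr (1 - s)) sums (-1)"
proof -
  have "(\<lambda>n. real (Suc n) powr (1 - Re s)) \<longlonglongrightarrow> 0" using assms by real_asymp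
  then have "(\<lambda>n. (of_nat (Suc n) :: complex) powr (1 - s)) \<longlonglongrightarrow> 0"
    by (subst tendsto_norm_zero_iff[symmetric], subst norm_Suc_powr) simp
  from telescope_sums[OF this] show ?thesis by simp
qed

text \<open>Sum \<open>binomial_tail (Suc K) n s\<close> over n: the differences of powers telescope
  to -1, and the expansion term of order i contributes the series at s + i - 1. The term of order 1
  gives (1 - s) times the value at s; by \<open>gbinomial_eq_factor\<close> the later ones contain
  (z - 1) zeta(z) at z = s + 1, ..., s + K.\<close>

lemma dirichlet_zeta_recursion:
  assumes s: "Re s > 1"
  shows "(s - 1) * dirichlet_zeta s = 1 + (\<Sum>n. binomial_tail (Suc K) n s)
     - (\<Sum>i<K. ((1 - s) gchoose (Suc i)) / of_nat (Suc (Suc i)) * ((s + of_nat i) * dirichlet_zeta (s + of_nat i + 1)))"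
proof -
  have "(\<lambda>n. \<Sum>i\<le>K. ((1 - s) gchoose (Suc i)) * of_nat (Suc n) powr (1 - s - of_nat (Suc i)))
      sums (\<Sum>i\<le>K. ((1 - s) gchoose (Suc i)) * dirichlet_zeta (s + of_nat i))"
    by (intro sums_sum sums_mult summable_Suc_powr_shift s)
  from sums_diff[OF telescope_powr_sums[OF s] this]
  have "(\<lambda>n. binomial_tail (Suc K) n s) sums (-1 - (\<Sum>i\<le>K. ((1 - s) gchoose (Suc i)) * dirichlet_zeta (s + of_nat i)))"
    unfolding binomial_tail_def sum.atMost_Suc_shift by (simp add: algebra_simps)
  then have "(\<Sum>n. binomial_tail (Suc K) n s) = -1 - (\<Sum>i<Suc K. ((1 - s) gchoose (Suc i)) * dirichlet_zeta (s + of_nat i))"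
    by (simp add: sums_iff lessThan_Suc_atMost)
  also have "(\<Sum>i<Suc K. ((1 - s) gchoose (Suc i)) * dirichlet_zeta (s + of_nat i))
      = (1 - s) * dirichlet_zeta s + (\<Sum>i<K. ((1 - s) gchoose (Suc (Suc i))) * dirichlet_zeta (s + of_nat (Suc i)))"
    by (subst sum.lessThan_Suc_shift) simp
  also have "(\<Sum>i<K. ((1 - s) gchoose (Suc (Suc i))) * dirichlet_zeta (s + of_nat (Suc i)))
     = - (\<Sum>i<K. ((1 - s) gchoose (Suc i)) / of_nat (Suc (Suc i)) * ((s + of_nat i) * dirichlet_zeta (s + of_nat i + 1)))"
    unfolding sum_negf[symmetric]
    by (intro sum.cong refl, subst gbinomial_eq_factor) (simp add: algebra_simps add_divide_distrib)
  finally show ?thesis by (simp add: algebra_simps)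
qed

text \<open>Each induction step gains a strip of width 1: the right-hand side of the recursion
  involves the function only at s + 1, s + 2, ..., where the induction hypothesis supplies it, and a
  tail series that converges in the larger half-plane.\<close>

lemma dirichlet_zeta_strip:
  "\<exists>W. W holomorphic_on {s. Re s > 1 - real k} \<and> (\<forall>s. Re s > 1 \<longrightarrow> W s = (s - 1) * dirichlet_zeta s)"
proof (induction k)
  case 0
  show ?case
    by (intro exI[of _ "\<lambda>s. (s - 1) * dirichlet_zeta s"])
       (auto intro!: holomorphic_intros dirichlet_zeta_holomorphic)
next
  case (Suc k)
  then obtain W where W: "W holomorphic_on {s. Re s > 1 - real k}"
    "\<And>s. Re s > 1 \<Longrightarrow> W s = (s - 1) * dirichlet_zeta s" by blast
  define V where "V = (\<lambda>s. 1 + (\<Sum>n. binomial_tail (Suc k) n s)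
     - (\<Sum>i<k. ((1 - s) gchoose (Suc i)) / of_nat (Suc (Suc i)) * W (s + of_nat i + 1)))"
  have "(\<lambda>s. W (s + of_nat i + 1)) holomorphic_on {s. Re s > 1 - real (Suc k)}" for i
    by (rule holomorphic_on_compose_gen[where g = W, unfolded comp_def, OF _ W(1)])
       (auto intro!: holomorphic_intros)
  then have "V holomorphic_on {s. Re s > 1 - real (Suc k)}"
    unfolding V_def gbinomial_prod_rev
    by (intro holomorphic_intros binomial_tail_suminf_holomorphic) (simp_all del: of_nat_Suc)
  moreover have "V s = (s - 1) * dirichlet_zeta s" if "Re s > 1" for s
    unfolding dirichlet_zeta_recursion[OF that, of k] V_def using that
    by (simp add: W(2))
  ultimately show ?case by blast
qed

lemma zeta_spec_exists:
  "\<exists>f. f holomorphic_on (- {1}) \<and> (\<forall>s. Re s > 1 \<longrightarrow> f s = (\<Sum>n. 1 / of_nat (Suc n) powr s)) \<and> f 1 = 0"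
proof -
  obtain W where W: "\<And>k. W k holomorphic_on {s. Re s > 1 - real k}"
    "\<And>k s. Re s > 1 \<Longrightarrow> W k s = (s - 1) * dirichlet_zeta s"
    using dirichlet_zeta_strip by metis
  have eq: "W j s = W k s" if "j \<le> k" "Re s > 1 - real j" for j k s
  proof -
    have "W j s - W k s = 0"
    proof (rule analytic_continuation_open[where s = "{s. Re s > 1}" and s' = "{s. Re s > 1 - real j}" and f = "\<lambda>s. W j s - W k s" and g = "\<lambda>_. 0"])
      show "open {s. Re s > 1}" "open {s. Re s > 1 - real j}" by (auto intro: open_halfspace_Re_gt)
      show "{s. Re s > 1} \<noteq> {}" by (auto intro: exI[of _ "2::complex"])
      show "connected {s. Re s > 1 - real j}" by (intro convex_connected convex_halfspace_Re_gt)
      show "(\<lambda>s. W j s - W k s) holomorphic_on {s. Re s > 1 - real j}"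
        by (intro holomorphic_intros W holomorphic_on_subset[OF W(1)[of k]]) (use that in auto)
    qed (use that W(2) in auto)
    then show ?thesis by simp
  qed
  \<comment> \<open>The index is any k with Re s > 1 - k; by \<open>eq\<close> the choice does not
    influence the value.\<close>
  define f where "f = (\<lambda>s. if s = 1 then 0 else W (nat \<lceil>2 - Re s\<rceil>) s / (s - 1))"
  have f: "f s = W k s / (s - 1)" if "Re s > 1 - real k" "s \<noteq> 1" for s k
  proof -
    have "Re s > 1 - real (nat \<lceil>2 - Re s\<rceil>)" by linarith
    then have "W (nat \<lceil>2 - Re s\<rceil>) s = W k s" using eq that(1) by (metis nat_le_linear)
    then show ?thesis using that by (simp add: f_def)
  qed
  have "f holomorphic_on (\<Union>k. {s. Re s > 1 - real k} - {1})"
  proof (rule holomorphic_on_UN_open)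
    fix k
    show "open ({s. Re s > 1 - real k} - {1})" by (intro open_Diff open_halfspace_Re_gt) auto
    have "(\<lambda>s. W k s / (s - 1)) holomorphic_on ({s. Re s > 1 - real k} - {1})"
      by (intro holomorphic_intros holomorphic_on_subset[OF W(1)[of k]]) auto
    then show "f holomorphic_on ({s. Re s > 1 - real k} - {1})"
      by (rule holomorphic_transform) (use f in auto)
  qed
  also have "(\<Union>k. {s. Re s > 1 - real k} - {1}) = - {1}"
  proof -
    have "\<exists>k. Re s > 1 - real k" for s by (metis diff_less_eq reals_Archimedean2 add.commute)
    then show ?thesis by auto
  qed
  finally have "f holomorphic_on - {1}" .
  moreover have "f s = (\<Sum>n. 1 / of_nat (Suc n) powr s)" if "Re s > 1" for s
  proof -
    have "s \<noteq> 1" using that by auto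
    have "f s = W 0 s / (s - 1)" by (rule f) (use that in auto)
    also have "\<dots> = dirichlet_zeta s" using W(2)[OF that, of 0] \<open>s \<noteq> 1\<close> by simp
    finally show ?thesis by (simp add: dirichlet_zeta_def powr_minus inverse_eq_divide)
  qed
  moreover have "f 1 = 0" by (simp add: f_def)
  ultimately show ?thesis by blast
qed

lemma zeta_spec_unique:
  assumes f: "f holomorphic_on - {1}" "\<And>s. Re s > 1 \<Longrightarrow> f s = (\<Sum>n. 1 / of_nat (Suc n) powr s)" "f 1 = 0"
    and g: "g holomorphic_on - {1}" "\<And>s. Re s > 1 \<Longrightarrow> g s = (\<Sum>n. 1 / of_nat (Suc n) powr s)" "g 1 = 0"
  shows "f = g"
proof
  fix s show "f s = g s"
  proof (cases "s = 1")
    case False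
    have "f s - g s = 0"
    proof (rule analytic_continuation_open[where s = "{s. Re s > 1}" and s' = "- {1}" and f = "\<lambda>s. f s - g s" and g = "\<lambda>_. 0"])
      show "open {s. Re s > 1}" by (auto intro: open_halfspace_Re_gt)
      show "{s. Re s > 1} \<noteq> {}" by (auto intro: exI[of _ "2::complex"])
      show "connected (- {1} :: complex set)" by (rule connected_punctured_universe) auto
      show "(\<lambda>s. f s - g s) holomorphic_on - {1}" by (intro holomorphic_intros f g)
    qed (use False f g in auto)
    then show ?thesis by simp
  qed (use f g in auto)
qed

lemma zeta_spec:
  "zeta holomorphic_on - {1} \<and> (\<forall>s. Re s > 1 \<longrightarrow> zeta s = (\<Sum>n. 1 / of_nat (Suc n) powr s)) \<and> zeta 1 = 0"
proof -
  have "\<exists>!f. f holomorphic_on (- {1}) \<and> (\<forall>s. Re s > 1 \<longrightarrow> f s = (\<Sum>n. 1 / of_nat (Suc n) powr s)) \<and> f 1 = 0"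
    by (rule ex_ex1I[OF zeta_spec_exists], rule zeta_spec_unique) blast+
  from theI'[OF this] show ?thesis unfolding zeta_def .
qed

lemma zeta_holomorphic: "zeta holomorphic_on - {1}"
  and zeta_eq_dirichlet: "Re s > 1 \<Longrightarrow> zeta s = dirichlet_zeta s"
  using zeta_spec by (auto simp: dirichlet_zeta_def powr_minus inverse_eq_divide)

text \<open>Differences \<open>n\<^sup>-\<^sup>s - \<integral>\<^sub>n\<^sup>n\<^sup>+\<^sup>1 x\<^sup>-\<^sup>s dx\<close> are the case \<open>K = 1\<close> of the continuation formula.\<close>

lemma zeta_right_half_plane:
  assumes "Re s > 0" "s \<noteq> 1"
  shows "(s - 1) * zeta s = 1 + (\<Sum>n. binomial_tail 1 n s)"
proof -
  have "(s - 1) * zeta s - (1 + (\<Sum>n. binomial_tail 1 n s)) = 0"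
  proof (rule analytic_continuation_open[where s = "{s. Re s > 1}" and s' = "{s. Re s > 0} - {1}" and f = "\<lambda>s. (s - 1) * zeta s - (1 + (\<Sum>n. binomial_tail 1 n s))" and g = "\<lambda>_. 0"])
    show "open {s. Re s > 1}" "open ({s. Re s > 0} - {1})" by (auto intro: open_halfspace_Re_gt)
    show "{s. Re s > 1} \<noteq> {}" by (auto intro: exI[of _ "2::complex"])
    show "connected ({s. Re s > 0} - {1})"
      by (intro connected_open_delete convex_connected convex_halfspace_Re_gt open_halfspace_Re_gt) auto
    show "(\<lambda>s. (s - 1) * zeta s - (1 + (\<Sum>n. binomial_tail 1 n s))) holomorphic_on {s. Re s > 0} - {1}"
      by (intro holomorphic_intros holomorphic_on_subset[OF zeta_holomorphic]
            holomorphic_on_subset[OF binomial_tail_suminf_holomorphic[of 1]]) auto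
    show "(z - 1) * zeta z - (1 + (\<Sum>n. binomial_tail 1 n z)) = 0" if "z \<in> {s. Re s > 1}" for z
      using dirichlet_zeta_recursion[of z 0] that by (simp add: zeta_eq_dirichlet)
  qed (use assms in auto)
  then show ?thesis by simp
qed

section \<open>Approximation by Dirichlet polynomials and smoothed series\<close>

text \<open>Second-order Taylor estimate on [x, x + 1]; \<open>Re \<alpha> \<le> 2\<close> makes the
  second derivative largest at the left end. It is the single step of Euler summation and serves for
  \<alpha> = 1 - s as well as \<alpha> = 2 - s.\<close>

lemma powr_step_bound:
  fixes \<alpha> :: complex and x :: real
  assumes "x > 0" "Re \<alpha> \<le> 2"
  shows "norm (of_real (x + 1) powr \<alpha> - of_real x powr \<alpha> - \<alpha> * of_real x powr (\<alpha> - 1))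
           \<le> norm \<alpha> * norm (\<alpha> - 1) * x powr (Re \<alpha> - 2)"
proof -
  define f where "f = (\<lambda>i (z::complex). (\<Prod>j<i. (\<alpha> - of_nat j)) * z powr (\<alpha> - of_nat i))"
  define S where "S = closed_segment (complex_of_real x) (of_real (x + 1))"
  have S: "\<exists>t. z = of_real t \<and> x \<le> t \<and> t \<le> x + 1" if "z \<in> S" for z
    using that unfolding S_def closed_segment_of_real using assms by (auto simp: closed_segment_eq_real_ivl)
  have "cmod (f 0 (of_real (x + 1)) - (\<Sum>i\<le>1. f i (of_real x) * (of_real (x + 1) - of_real x) ^ i / fact i))
      \<le> (norm \<alpha> * norm (\<alpha> - 1) * x powr (Re \<alpha> - 2)) * cmod (of_real (x + 1) - of_real x) ^ Suc 1 / fact 1"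
  proof (rule complex_Taylor[where S = S])
    show "convex S" "of_real x \<in> S" "complex_of_real (x + 1) \<in> S" by (simp_all add: S_def)
    show "(f i has_field_derivative f (Suc i) z) (at z within S)" if z: "z \<in> S" for i z
    proof -
      obtain t where t: "z = of_real t" "x \<le> t" using S[OF z] by auto
      have "z \<notin> \<real>\<^sub>\<le>\<^sub>0" using t assms by (auto simp: complex_nonpos_Reals_iff)
      then have "((\<lambda>z. z powr (\<alpha> - of_nat i)) has_field_derivative (\<alpha> - of_nat i) * z powr (\<alpha> - of_nat i - 1)) (at z within S)"
        by (rule DERIV_subset[OF has_field_derivative_powr]) auto
      from DERIV_cmult[OF this, of "\<Prod>j<i. (\<alpha> - of_nat j)"] show ?thesis
        unfolding f_def by (simp add: algebra_simps)
    qed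
    show "cmod (f (Suc 1) z) \<le> norm \<alpha> * norm (\<alpha> - 1) * x powr (Re \<alpha> - 2)" if z: "z \<in> S" for z
    proof -
      obtain t where t: "z = of_real t" "x \<le> t" using S[OF z] by auto
      have "cmod (z powr (\<alpha> - 2)) = t powr (Re \<alpha> - 2)"
        using t assms by (simp add: norm_powr_real_powr)
      also have "\<dots> \<le> x powr (Re \<alpha> - 2)"
        using t assms by (intro powr_mono2') auto
      finally show ?thesis unfolding f_def
        by (simp add: norm_mult lessThan_Suc mult.commute mult_left_mono)
    qed
  qed
  then show ?thesis by (simp add: f_def diff_diff_eq)
qed

text \<open>Dominates x^(-3/2) by a telescoping difference, so that tails of the Euler remainder can
  be summed exactly.\<close>

lemma inverse_sqrt_diff: 
  assumes "x > 0" shows "1 / (sqrt (x + 1) * (x + 1)) \<le> 2 * (1 / sqrt x - 1 / sqrt (x + 1))"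
proof -
  have s: "sqrt x > 0" "sqrt (x+1) > 0" "sqrt x \<le> sqrt (x + 1)" using assms by auto
  have "sqrt (x+1) + sqrt x \<noteq> 0" using s by linarith
  moreover have "(sqrt (x+1) - sqrt x) * (sqrt (x+1) + sqrt x) = 1"
    using assms by (simp add: algebra_simps)
  ultimately have d: "sqrt (x+1) - sqrt x = 1 / (sqrt (x+1) + sqrt x)"
    by (rule eq_divide_imp)
  have "1 / sqrt x - 1 / sqrt (x + 1) = (sqrt (x+1) - sqrt x) / (sqrt x * sqrt (x+1))"
    using s diff_frac_eq[of "sqrt x" "sqrt (x+1)" 1 1] by simp
  also have "\<dots> = 1 / ((sqrt x * sqrt (x+1)) * (sqrt (x+1) + sqrt x))" unfolding d by simp
  also have "\<dots> \<ge> 1 / ((sqrt (x+1) * sqrt (x+1)) * (sqrt (x+1) + sqrt (x+1)))"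
    using s by (intro divide_left_mono mult_mono add_mono mult_pos_pos add_pos_pos) auto
  also have "(sqrt (x+1) * sqrt (x+1)) * (sqrt (x+1) + sqrt (x+1)) = 2 * (sqrt (x + 1) * (x + 1))"
    using assms by simp
  finally have "1 / (2 * (sqrt (x + 1) * (x + 1))) \<le> 1 / sqrt x - 1 / sqrt (x + 1)" by simp
  from mult_left_mono[OF this, of 2] show ?thesis by simp
qed

lemma powr_three_halves: "x > 0 \<Longrightarrow> (x::real) powr (-3/2) = 1 / (sqrt x * x)"
proof -
  assume "x > 0"
  have "x powr (-3/2) = x powr (-(1/2) + -1)" by simp
  also have "\<dots> = 1 / (sqrt x * x)" using \<open>x > 0\<close> 
    unfolding powr_add by (simp add: powr_minus powr_half_sqrt field_simps)
  finally show ?thesis .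
qed

lemma sum_inverse_sqrt: "(\<Sum>i\<le>M. 1 / sqrt (real (Suc i))) \<le> 2 * sqrt (real (Suc M))"
proof (induction M)
  case (Suc M)
  define x where "x = real (Suc M)"
  have x: "x > 0" by (simp add: x_def)
  have s: "sqrt x > 0" "sqrt (x+1) > 0" "sqrt x \<le> sqrt (x + 1)" using x by auto
  have "sqrt (x+1) + sqrt x \<noteq> 0" using s by linarith
  moreover have "(sqrt (x+1) - sqrt x) * (sqrt (x+1) + sqrt x) = 1"
    using x by (simp add: algebra_simps)
  ultimately have d: "sqrt (x+1) - sqrt x = 1 / (sqrt (x+1) + sqrt x)"
    by (rule eq_divide_imp)
  have "1 / (2 * sqrt (x+1)) \<le> 1 / (sqrt (x+1) + sqrt x)"
    using s by (intro divide_left_mono mult_pos_pos add_pos_pos) auto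
  then have "1 / sqrt (x + 1) \<le> 2 * (sqrt (x + 1) - sqrt x)" unfolding d by (simp add: field_simps)
  with Suc show ?case by (simp add: x_def add_ac)
qed simp

text \<open>Remainder of the Euler summation formula for the M-term partial sum. The main term is
  taken at M + 1, not at M, because that is where the telescoping of \<open>binomial_tail\<close>
  ends.\<close>

definition zeta_error :: "nat \<Rightarrow> complex \<Rightarrow> complex" where
  "zeta_error M s = (\<Sum>n<M. of_nat (Suc n) powr (-s)) - zeta s - of_nat (Suc M) powr (1 - s) / (1 - s)"

text \<open>\<open>binomial_tail_bound\<close> contains a factor 2^R that is exponential in |s|.
  Here the growth is only quadratic, and the factor |1 - s| is going to cancel.\<close>

lemma binomial_tail_1_bound:
  assumes "Re s \<ge> 0"
  shows "norm (binomial_tail 1 n s) \<le> norm (1 - s) * norm s * real (Suc n) powr (- Re s - 1)"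
proof -
  have "norm (of_real (real (Suc n) + 1) powr (1 - s) - of_real (real (Suc n)) powr (1 - s) - (1 - s) * of_real (real (Suc n)) powr ((1 - s) - 1))
     \<le> norm (1 - s) * norm ((1 - s) - 1) * real (Suc n) powr (Re (1 - s) - 2)"
    by (rule powr_step_bound) (use assms in auto)
  moreover have "Re (1 - s) - 2 = - Re s - 1" "norm ((1 - s) - 1) = norm s" by auto
  moreover have "of_real (real (Suc n) + 1) powr (1 - s) - of_real (real (Suc n)) powr (1 - s)
      - (1 - s) * of_real (real (Suc n)) powr ((1 - s) - 1) = binomial_tail 1 n s"
    by (simp add: binomial_tail_def algebra_simps)
  ultimately show ?thesis by (simp only:)
qed

text \<open>The finite sums of \<open>binomial_tail 1\<close> are, up to the factor 1 - s, the
  partial sums of the Dirichlet series; hence (1 - s) times \<open>zeta_error M s\<close> is the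
  tail from M on of the series in \<open>zeta_right_half_plane\<close>. The majorant
  \<open>b\<close> is left open so that it can be chosen telescoping.\<close>

lemma zeta_error_bound_gen:
  assumes "Re s > 0" "s \<noteq> 1" and b: "\<And>n. real (Suc (n + M)) powr (- Re s - 1) \<le> b n" and "b sums B"
  shows "norm (zeta_error M s) \<le> norm s * B"
proof -
  have sm: "summable (\<lambda>n. binomial_tail 1 n s)" by (rule binomial_tail_summable) (use assms in auto)
  have part: "(\<Sum>n<M. binomial_tail 1 n s) = of_nat (Suc M) powr (1 - s) - 1 - (1 - s) * (\<Sum>n<M. of_nat (Suc n) powr (-s))" for M
    by (induction M) (simp_all add: binomial_tail_def algebra_simps)
  have "(s - 1) * zeta s = 1 + ((\<Sum>n. binomial_tail 1 (n + M) s) + (\<Sum>n<M. binomial_tail 1 n s))"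
    unfolding zeta_right_half_plane[OF assms(1,2)] suminf_split_initial_segment[OF sm, of M] ..
  then have "(1 - s) * zeta_error M s = (\<Sum>n. binomial_tail 1 (n + M) s)"
    unfolding part zeta_error_def right_diff_distrib using assms(2) by simp (simp add: algebra_simps)
  moreover have "norm (\<Sum>n. binomial_tail 1 (n + M) s) \<le> norm (1 - s) * norm s * B"
  proof -
    have "norm (binomial_tail 1 (n + M) s) \<le> norm (1 - s) * norm s * b n" for n
      by (rule order_trans[OF binomial_tail_1_bound]) (use assms in \<open>auto intro!: mult_left_mono\<close>)
    moreover have "(\<lambda>n. norm (1 - s) * norm s * b n) sums (norm (1 - s) * norm s * B)"
      by (intro sums_mult assms)
    ultimately show ?thesis 
      using norm_suminf_le[of "\<lambda>n. binomial_tail 1 (n + M) s" "\<lambda>n. norm (1 - s) * norm s * b n"]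
      by (auto simp: sums_iff)
  qed
  ultimately have "norm (1 - s) * norm (zeta_error M s) \<le> norm (1 - s) * (norm s * B)"
    by (metis norm_mult mult.assoc)
  then show ?thesis using assms(2) by simp
qed

lemma zeta_error_bound_sqrt:
  assumes "Re s \<ge> 1/2" "s \<noteq> 1" "M > 0"
  shows "norm (zeta_error M s) \<le> 2 * norm s / sqrt (real M)"
proof -
  have "norm (zeta_error M s) \<le> norm s * (2 * (1 / sqrt (real M)))"
  proof (rule zeta_error_bound_gen)
    show "real (Suc (n + M)) powr (- Re s - 1) \<le> 2 * (1 / sqrt (real (n + M)) - 1 / sqrt (real (Suc n + M)))" for n
    proof -
      have "real (Suc (n + M)) powr (- Re s - 1) \<le> real (Suc (n + M)) powr (-3/2)"
        using assms by (intro powr_mono) auto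
      also have "\<dots> = 1 / (sqrt (real (n + M) + 1) * (real (n + M) + 1))"
        by (subst powr_three_halves) (auto simp: add_ac)
      also have "\<dots> \<le> 2 * (1 / sqrt (real (n + M)) - 1 / sqrt (real (n + M) + 1))"
        by (rule inverse_sqrt_diff) (use assms in auto)
      finally show ?thesis by (simp add: add_ac)
    qed
    have "(\<lambda>n. 1 / sqrt (real (n + M))) \<longlonglongrightarrow> 0" by real_asymp
    from telescope_sums'[OF this] 
    have "(\<lambda>n. 1 / sqrt (real (n + M)) - 1 / sqrt (real (Suc n + M))) sums (1 / sqrt (real M))" by simp
    then show "(\<lambda>n. 2 * (1 / sqrt (real (n + M)) - 1 / sqrt (real (Suc n + M)))) sums (2 * (1 / sqrt (real M)))"
      by (rule sums_mult)
  qed (use assms in auto)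
  then show ?thesis by (simp add: mult_ac)
qed

lemma zeta_error_bound_1:
  assumes "Re s \<ge> 1" "s \<noteq> 1" "M > 0"
  shows "norm (zeta_error M s) \<le> norm s / real M"
proof -
  have "norm (zeta_error M s) \<le> norm s * (1 / real M)"
  proof (rule zeta_error_bound_gen)
    show "real (Suc (n + M)) powr (- Re s - 1) \<le> 1 / real (n + M) - 1 / real (Suc n + M)" for n
    proof -
      have "real (Suc (n + M)) powr (- Re s - 1) \<le> real (Suc (n + M)) powr (-2)"
        using assms by (intro powr_mono) auto
      also have "\<dots> = 1 / (real (Suc (n + M)))\<^sup>2" 
        by (simp add: powr_minus powr_numeral divide_inverse)
      also have "\<dots> \<le> 1 / real (n + M) - 1 / real (Suc n + M)"
      proof -
        define x where "x = real (n + M)"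
        have x: "x > 0" using assms by (simp add: x_def)
        have "1 / (x + 1)\<^sup>2 \<le> 1 / (x * (x + 1))"
          using x by (intro divide_left_mono) (auto simp: power2_eq_square)
        also have "\<dots> = 1 / x - 1 / (x + 1)" using x by (simp add: field_simps)
        finally show ?thesis by (simp add: x_def add_ac)
      qed
      finally show ?thesis .
    qed
    have "(\<lambda>n. 1 / real (n + M)) \<longlonglongrightarrow> 0" by real_asymp
    from telescope_sums'[OF this] 
    show "(\<lambda>n. 1 / real (n + M) - 1 / real (Suc n + M)) sums (1 / real M)" by simp
  qed (use assms in auto)
  then show ?thesis by simp
qed

text \<open>A partial sum with the single term 1 (the case M = 1) is already good enough for linear
  growth in |s|.\<close>

lemma norm_zeta_le:
  assumes "Re s \<ge> 1/2" "s \<noteq> 1"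
  shows "norm (zeta s) \<le> 1 + 2 / norm (1 - s) + 2 * norm s"
proof -
  have "zeta s = 1 - 2 powr (1 - s) / (1 - s) - zeta_error 1 s" by (simp add: zeta_error_def)
  then have "norm (zeta s) \<le> norm (1 :: complex) + norm (2 powr (1 - s) / (1 - s)) + norm (zeta_error 1 s)"
    by (metis norm_triangle_ineq4 order_trans add_right_mono)
  moreover have "norm (2 powr (1 - s)) \<le> 2"
    using norm_Suc_powr[of 1 "1 - s"] powr_mono[of "1 - Re s" 1 2] assms by simp
  then have "norm (2 powr (1 - s) / (1 - s)) \<le> 2 / norm (1 - s)"
    by (simp add: norm_divide divide_right_mono)
  moreover have "norm (zeta_error 1 s) \<le> 2 * norm s" using zeta_error_bound_sqrt[of s 1] assms by simp
  ultimately show ?thesis by simp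
qed

text \<open>Cauchy product with the geometric series. It converts knowledge about partial sums,
  which Euler summation provides, into knowledge about the damped series.\<close>

lemma abel_summation:
  fixes a :: "nat \<Rightarrow> 'a :: {real_normed_field, banach}" and r :: real
  assumes "summable (\<lambda>n. norm (a n) * r ^ n)" "0 \<le> r" "r < 1"
  shows "(\<lambda>n. a n * of_real r ^ n) sums (\<Sum>n. a n * of_real r ^ n)"
    and "(\<lambda>M. of_real r ^ M * (\<Sum>i\<le>M. a i)) sums ((\<Sum>n. a n * of_real r ^ n) / of_real (1 - r))"
proof -
  have 1: "summable (\<lambda>n. norm (a n * of_real r ^ n))" using assms by (simp add: norm_mult norm_power)
  then show "(\<lambda>n. a n * of_real r ^ n) sums (\<Sum>n. a n * of_real r ^ n)"
    by (rule summable_sums[OF summable_norm_cancel])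
  have "(\<lambda>k. \<Sum>i\<le>k. (a i * of_real r ^ i) * of_real r ^ (k - i)) sums ((\<Sum>n. a n * of_real r ^ n) * (\<Sum>n. of_real r ^ n))"
    by (rule Cauchy_product_sums[OF 1]) (use assms in \<open>auto simp: norm_power intro: summable_geometric\<close>)
  moreover have "(\<Sum>i\<le>k. (a i * of_real r ^ i) * of_real r ^ (k - i)) = of_real r ^ k * (\<Sum>i\<le>k. a i)" for k
    unfolding sum_distrib_left
  proof (intro sum.cong refl)
    fix i assume "i \<in> {..k}"
    then have "(of_real r :: 'a) ^ k = of_real r ^ i * of_real r ^ (k - i)" by (simp flip: power_add)
    then show "a i * of_real r ^ i * of_real r ^ (k - i) = of_real r ^ k * a i" by simp
  qed
  moreover have "(\<Sum>n. (of_real r :: 'a) ^ n) = 1 / of_real (1 - r)"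
    using suminf_geometric[of "of_real r :: 'a"] assms by simp
  ultimately show "(\<lambda>M. of_real r ^ M * (\<Sum>i\<le>M. a i)) sums ((\<Sum>n. a n * of_real r ^ n) / of_real (1 - r))"
    by simp
qed


section \<open>Integer and fractional moments of the geometric series\<close>

lemma geometric_moment_1:
  fixes r :: real
  assumes "0 \<le> r" "r < 1"
  shows "(\<lambda>M. r ^ M * real (Suc M)) sums (1 / (1 - r)\<^sup>2)"
proof -
  have "(\<lambda>M. r ^ M * (\<Sum>i\<le>M. 1)) sums ((\<Sum>n. 1 * r ^ n) / (1 - r))"
    using abel_summation(2)[of "\<lambda>_. 1::real" r] assms by (simp add: summable_geometric)
  then show ?thesis using assms by (simp add: suminf_geometric power2_eq_square)
qed

lemma geometric_moment_2:
  fixes r :: real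
  assumes "0 \<le> r" "r < 1"
  shows "(\<lambda>M. r ^ M * (real (Suc M) * real (Suc (Suc M)))) sums (2 / (1 - r) ^ 3)"
proof -
  have S: "(\<lambda>n. real (Suc n) * r ^ n) sums (1 / (1 - r)\<^sup>2)"
    using geometric_moment_1[OF assms] by (simp add: mult.commute)
  have "(\<lambda>M. r ^ M * (\<Sum>i\<le>M. real (Suc i))) sums ((\<Sum>n. real (Suc n) * r ^ n) / (1 - r))"
    using abel_summation(2)[of "\<lambda>n. real (Suc n)" r] assms sums_summable[OF S] by simp
  also have "(\<Sum>n. real (Suc n) * r ^ n) / (1 - r) = 1 / (1 - r) ^ 3"
    using S assms by (simp add: sums_iff eval_nat_numeral)
  finally have "(\<lambda>M. 2 * (r ^ M * (\<Sum>i\<le>M. real (Suc i)))) sums (2 * (1 / (1 - r) ^ 3))" by (rule sums_mult)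
  moreover have "(\<Sum>i\<le>M. real (Suc i)) = real (Suc M) * real (Suc (Suc M)) / 2" for M
    by (induction M) (auto simp: field_simps)
  then have "2 * (r ^ M * (\<Sum>i\<le>M. real (Suc i))) = r ^ M * (real (Suc M) * real (Suc (Suc M)))" for M
    by (simp only:)
  ultimately show ?thesis by (simp only: mult_1_right times_divide_eq_right)
qed

lemma suminf_le_sums_bound:
  fixes f g :: "nat \<Rightarrow> real"
  assumes "\<And>n. 0 \<le> f n" "\<And>n. f n \<le> g n" "g sums G"
  shows "summable f" "suminf f \<le> G"
proof -
  show "summable f" by (rule summable_comparison_test'[OF sums_summable[OF assms(3)], of 0]) (use assms in auto)
  then show "suminf f \<le> G" using suminf_le[OF assms(2) _ sums_summable[OF assms(3)]] assms(3) by (simp add: sums_iff)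
qed

text \<open>The inequality of the arithmetic and geometric mean for x sqrt q and 1 / sqrt q. With q
  = 1 - r both terms contribute the same power of q to a moment, so fractional moments follow from
  integer ones without losing the order.\<close>

lemma sqrt_le_linear: "q > 0 \<Longrightarrow> x \<ge> 0 \<Longrightarrow> sqrt x \<le> (x * sqrt q + 1 / sqrt q) / 2"
proof -
  assume q: "q > 0" "x \<ge> 0"
  define a where "a = sqrt q"
  have a: "a > 0" "a * a = q" using q by (auto simp: a_def)
  have "(sqrt x * a - 1)\<^sup>2 \<ge> 0" by simp
  then have "2 * sqrt x * a \<le> x * a * a + 1" using q by (simp add: power2_eq_square algebra_simps)
  then show ?thesis using a(1) unfolding a_def[symmetric] by (simp add: field_simps)
qed

lemma geometric_sqrt_moment:
  fixes r :: real
  assumes "0 \<le> r" "r < 1"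
  defines "q \<equiv> 1 - r"
  shows "summable (\<lambda>M. r ^ M * sqrt (real (Suc M)))"
    and "(\<Sum>M. r ^ M * sqrt (real (Suc M))) \<le> 1 / (q * sqrt q)"
proof -
  have q: "q > 0" "sqrt q > 0" "sqrt q * sqrt q = q" using assms by auto
  let ?g = "\<lambda>M. (sqrt q * (r ^ M * real (Suc M)) + 1 / sqrt q * r ^ M) / 2"
  have "?g sums ((sqrt q * (1 / q\<^sup>2) + 1 / sqrt q * (1 / q)) / 2)"
    unfolding q_def using assms
    by (intro sums_divide sums_add sums_mult geometric_moment_1 geometric_sums) auto
  also have "(sqrt q * (1 / q\<^sup>2) + 1 / sqrt q * (1 / q)) / 2 = 1 / (q * sqrt q)"
  proof -
    have "sqrt q * (1 / q\<^sup>2) = 1 / (q * sqrt q)"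
      using q by (simp add: power2_eq_square divide_simps) 
    then show ?thesis by (simp add: mult.commute)
  qed
  finally have g: "?g sums (1 / (q * sqrt q))" .
  have le: "r ^ M * sqrt (real (Suc M)) \<le> ?g M" for M
  proof -
    have "r ^ M * sqrt (real (Suc M)) \<le> r ^ M * ((real (Suc M) * sqrt q + 1 / sqrt q) / 2)"
      by (intro mult_left_mono sqrt_le_linear) (use q assms in auto)
    also have "\<dots> = ?g M" by (simp add: algebra_simps add_divide_distrib)
    finally show ?thesis .
  qed
  show "summable (\<lambda>M. r ^ M * sqrt (real (Suc M)))" "(\<Sum>M. r ^ M * sqrt (real (Suc M))) \<le> 1 / (q * sqrt q)"
    by (rule suminf_le_sums_bound[OF _ le g], use assms in simp)+
qed

lemma geometric_three_halves_moment:
  fixes r :: real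
  assumes "0 \<le> r" "r < 1"
  defines "q \<equiv> 1 - r"
  shows "summable (\<lambda>M. r ^ M * (real (Suc M) * sqrt (real (Suc M))))"
    and "(\<Sum>M. r ^ M * (real (Suc M) * sqrt (real (Suc M)))) \<le> 3 / 2 / (q\<^sup>2 * sqrt q)"
proof -
  have q: "q > 0" "sqrt q > 0" "sqrt q * sqrt q = q" using assms by auto
  let ?g = "\<lambda>M. (sqrt q * (r ^ M * (real (Suc M) * real (Suc (Suc M)))) + 1 / sqrt q * (r ^ M * real (Suc M))) / 2"
  have "?g sums ((sqrt q * (2 / q ^ 3) + 1 / sqrt q * (1 / q\<^sup>2)) / 2)"
    unfolding q_def using assms
    by (intro sums_divide sums_add sums_mult geometric_moment_1 geometric_moment_2) auto
  also have "(sqrt q * (2 / q ^ 3) + 1 / sqrt q * (1 / q\<^sup>2)) / 2 = 3 / 2 / (q\<^sup>2 * sqrt q)"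
  proof -
    have "sqrt q * (2 / q ^ 3) = 2 * (1 / (q\<^sup>2 * sqrt q))"
      using q by (simp add: eval_nat_numeral divide_simps) 
    then show ?thesis by (simp add: mult.commute)
  qed
  finally have g: "?g sums (3 / 2 / (q\<^sup>2 * sqrt q))" .
  have le: "r ^ M * (real (Suc M) * sqrt (real (Suc M))) \<le> ?g M" for M
  proof -
    have "r ^ M * (real (Suc M) * sqrt (real (Suc M))) \<le> r ^ M * (real (Suc M) * ((real (Suc M) * sqrt q + 1 / sqrt q) / 2))"
      by (intro mult_left_mono sqrt_le_linear) (use q assms in auto)
    also have "\<dots> = (sqrt q * (r ^ M * (real (Suc M) * real (Suc M))) + 1 / sqrt q * (r ^ M * real (Suc M))) / 2"
      by (simp add: algebra_simps add_divide_distrib)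
    also have "\<dots> \<le> ?g M"
      using q assms by (intro divide_right_mono add_right_mono mult_left_mono) auto
    finally show ?thesis .
  qed
  show "summable (\<lambda>M. r ^ M * (real (Suc M) * sqrt (real (Suc M))))"
    "(\<Sum>M. r ^ M * (real (Suc M) * sqrt (real (Suc M)))) \<le> 3 / 2 / (q\<^sup>2 * sqrt q)"
    by (rule suminf_le_sums_bound[OF _ le g], use assms in simp)+
qed

text \<open>Abel summation turns this moment into q times one with weights \<Sum> 1 / sqrt i \<le> 2
  sqrt (M + 1), which is the moment already known.\<close>

lemma geometric_inverse_sqrt_moment:
  fixes r :: real
  assumes "0 \<le> r" "r < 1"
  defines "q \<equiv> 1 - r"
  shows "summable (\<lambda>M. r ^ M * (1 / sqrt (real (Suc M))))"
    and "(\<Sum>M. r ^ M * (1 / sqrt (real (Suc M)))) \<le> 2 / sqrt q"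
proof -
  have q: "q > 0" using assms by auto
  show S: "summable (\<lambda>M. r ^ M * (1 / sqrt (real (Suc M))))"
    by (rule summable_comparison_test'[OF summable_geometric[of r], of 0])
       (use assms in \<open>auto intro!: mult_left_le simp: divide_le_eq_1 simp del: times_divide_eq_right\<close>)
  then have "summable (\<lambda>n. norm (1 / sqrt (real (Suc n))) * r ^ n)" by (simp add: mult_ac)
  from abel_summation(2)[OF this] assms S
  have 1: "(\<lambda>M. r ^ M * (\<Sum>i\<le>M. 1 / sqrt (real (Suc i)))) sums ((\<Sum>M. r ^ M * (1 / sqrt (real (Suc M)))) / q)"
    by (simp add: mult_ac)
  have "(\<Sum>M. r ^ M * (1 / sqrt (real (Suc M)))) / q = (\<Sum>M. r ^ M * (\<Sum>i\<le>M. 1 / sqrt (real (Suc i))))"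
    using 1 by (simp add: sums_iff)
  also have "\<dots> \<le> (\<Sum>M. 2 * (r ^ M * sqrt (real (Suc M))))"
  proof (rule suminf_le)
    show "r ^ M * (\<Sum>i\<le>M. 1 / sqrt (real (Suc i))) \<le> 2 * (r ^ M * sqrt (real (Suc M)))" for M
      using mult_left_mono[OF sum_inverse_sqrt, of "r ^ M" M] assms by (simp add: mult_ac)
    show "summable (\<lambda>M. r ^ M * (\<Sum>i\<le>M. 1 / sqrt (real (Suc i))))" using 1 by (rule sums_summable)
    show "summable (\<lambda>M. 2 * (r ^ M * sqrt (real (Suc M))))"
      by (intro summable_mult geometric_sqrt_moment assms)
  qed
  also have "\<dots> = 2 * (\<Sum>M. r ^ M * sqrt (real (Suc M)))"
    by (intro suminf_mult geometric_sqrt_moment assms)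
  also have "\<dots> \<le> 2 * (1 / (q * sqrt q))"
    unfolding q_def by (intro mult_left_mono geometric_sqrt_moment assms) auto
  finally show "(\<Sum>M. r ^ M * (1 / sqrt (real (Suc M)))) \<le> 2 / sqrt q" using q by (simp add: field_simps)
qed

definition smoothed_zeta :: "real \<Rightarrow> complex \<Rightarrow> complex" where
  "smoothed_zeta r s = (\<Sum>n. of_nat (Suc n) powr (-s) * of_real (r ^ Suc n))"

lemma norm_suminf_bound:
  fixes f :: "nat \<Rightarrow> complex" and g :: "nat \<Rightarrow> real"
  assumes "\<And>n. norm (f n) \<le> g n" "summable g" "suminf g \<le> G"
  shows "summable f" "norm (suminf f) \<le> G"
proof -
  show "summable f" by (rule summable_comparison_test'[OF assms(2), of 0]) (use assms in auto)
  show "norm (suminf f) \<le> G" using norm_suminf_le[OF assms(1,2)] assms(3) by linarith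
qed

text \<open>Abel summation is applied twice. First the partial sums of n^-s are replaced by zeta(s),
  a main term (M + 2)^(1 - s) / (1 - s) and \<open>zeta_error\<close>. The main terms form again a
  damped series V, the contribution of the pole, whose partial sums are compared with (M + 3)^(2 -
  s) / (2 - s). The second denominator 2 - s brings the decay 1/t^2 that the Gaussian mean needs; it
  stands in for the factor Gamma (1 - s) of a Mellin transform proof.\<close>

lemma smoothed_zeta_approx_aux:
  assumes s: "Re s \<ge> 1/2" "s \<noteq> 1" "s \<noteq> 2" and r: "0 < r" "r < 1"
  defines "q \<equiv> 1 - r"
  shows "norm (smoothed_zeta r s - zeta s)
     \<le> q * norm (zeta s) + (14 / (sqrt q * norm (1 - s) * norm (2 - s)) + (2 + 4 * norm s) * sqrt q)"
proof -
  have q: "q > 0" "sqrt q > 0" "sqrt q * sqrt q = q" "q \<le> 1" using r by (auto simp: q_def)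
  have r': "0 \<le> r" using r by simp
  define a where "a = (\<lambda>n. (of_nat (Suc n) :: complex) powr (-s))"
  define b where "b = (\<lambda>n. (of_nat (Suc (Suc n)) :: complex) powr (1 - s))"
  define B where "B = (\<lambda>M. \<Sum>i\<le>M. b i)"
  have na: "norm (a n) \<le> 1" for n
    unfolding a_def norm_Suc_powr using powr_mono[of "Re (-s)" 0 "real (Suc n)"] s by simp
  have suma: "summable (\<lambda>n. norm (a n) * r ^ n)"
    by (rule summable_comparison_test'[OF summable_geometric[of r], of 0])
       (use na r in \<open>auto simp: mult_le_cancel_right1\<close>)
  have nb: "norm (b n) \<le> 2 * sqrt (real (Suc n))" for n
  proof -
    have "norm (b n) = real (Suc (Suc n)) powr (1 - Re s)"
      using norm_Suc_powr[of "Suc n" "1 - s"] unfolding b_def by simp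
    also have "\<dots> \<le> real (Suc (Suc n)) powr (1/2)" using s by (intro powr_mono) auto
    also have "\<dots> = sqrt (real (Suc (Suc n)))" by (simp add: powr_half_sqrt)
    also have "\<dots> \<le> sqrt (4 * real (Suc n))" by (intro real_sqrt_le_mono) auto
    also have "\<dots> = 2 * sqrt (real (Suc n))" by (simp only: real_sqrt_mult real_sqrt_four)
    finally show ?thesis .
  qed
  have sumb: "summable (\<lambda>n. norm (b n) * r ^ n)"
    by (rule summable_comparison_test'[OF summable_mult[OF geometric_sqrt_moment(1)[OF r' r(2)], of 2], of 0])
       (use mult_right_mono[OF nb, of "r ^ _"] r in \<open>auto simp: mult_ac\<close>)
  note A1 = abel_summation[OF suma r' r(2)]
  note B1 = abel_summation[OF sumb r' r(2)]
  define V where "V = (\<Sum>n. b n * of_real r ^ n)"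
  have B2: "(\<lambda>M. of_real r ^ M * B M) sums (V / of_real q)" using B1(2) by (simp add: B_def V_def q_def)

  have Bb: "norm (B M) \<le> 9 / norm (2 - s) * (real (Suc M) * sqrt (real (Suc M))) + 2 * norm (1 - s) * sqrt (real (Suc M))" for M
  proof -
    \<comment> \<open>A discrete antiderivative: c (n + 1) - c n is (2 - s) b n up to an error of
      order 1 / sqrt n, so the partial sums of b are c / (2 - s) up to boundary and error
      terms.\<close>
    define c where "c = (\<lambda>n. (of_nat (Suc (Suc n)) :: complex) powr (2 - s))"
    have step: "norm (c (Suc i) - c i - (2 - s) * b i) \<le> norm (2 - s) * norm (1 - s) * (1 / sqrt (real (Suc i)))" for i
    proof -
      have "norm (of_real (real (Suc (Suc i)) + 1) powr (2 - s) - of_real (real (Suc (Suc i))) powr (2 - s)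
            - (2 - s) * of_real (real (Suc (Suc i))) powr ((2 - s) - 1))
         \<le> norm (2 - s) * norm ((2 - s) - 1) * real (Suc (Suc i)) powr (Re (2 - s) - 2)"
        by (rule powr_step_bound) (use s in auto)
      also have "real (Suc (Suc i)) powr (Re (2 - s) - 2) \<le> real (Suc (Suc i)) powr (-(1/2))"
        using s by (intro powr_mono) auto
      also have "\<dots> \<le> real (Suc i) powr (-(1/2))"
        by (intro powr_mono2') auto
      also have "\<dots> = 1 / sqrt (real (Suc i))"
        unfolding powr_minus by (simp only: powr_half_sqrt[OF of_nat_0_le_iff] inverse_eq_divide)
      finally have "norm (of_real (real (Suc (Suc i)) + 1) powr (2 - s) - of_real (real (Suc (Suc i))) powr (2 - s)
            - (2 - s) * of_real (real (Suc (Suc i))) powr ((2 - s) - 1))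
          \<le> norm (2 - s) * norm ((2 - s) - 1) * (1 / sqrt (real (Suc i)))"
        by (simp add: mult_left_mono)
      moreover have "(2 - s) - 1 = 1 - s" "complex_of_real (real (Suc (Suc i)) + 1) = of_nat (Suc (Suc (Suc i)))"
        "complex_of_real (real (Suc (Suc i))) = of_nat (Suc (Suc i))" by simp_all
      ultimately show ?thesis unfolding c_def b_def by (simp only:)
    qed
    have "c (Suc M) - c 0 - (2 - s) * B M = (\<Sum>i\<le>M. c (Suc i) - c i - (2 - s) * b i)"
      unfolding B_def by (induction M) (auto simp: algebra_simps)
    then have "norm (c (Suc M) - c 0 - (2 - s) * B M) \<le> (\<Sum>i\<le>M. norm (2 - s) * norm (1 - s) * (1 / sqrt (real (Suc i))))"
      by (simp only:) (intro sum_norm_le step)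
    also have "\<dots> \<le> norm (2 - s) * norm (1 - s) * (2 * sqrt (real (Suc M)))"
      unfolding sum_distrib_left[symmetric] by (intro mult_left_mono sum_inverse_sqrt) auto
    finally have 1: "norm (c (Suc M) - c 0 - (2 - s) * B M) \<le> norm (2 - s) * norm (1 - s) * (2 * sqrt (real (Suc M)))" .
    have cb: "norm (c n) \<le> real (Suc (Suc n)) * sqrt (real (Suc (Suc n)))" for n
    proof -
      have "norm (c n) = real (Suc (Suc n)) powr (2 - Re s)"
        using norm_Suc_powr[of "Suc n" "2 - s"] unfolding c_def by simp
      also have "\<dots> \<le> real (Suc (Suc n)) powr (1 + 1/2)" using s by (intro powr_mono) auto
      also have "\<dots> = real (Suc (Suc n)) * sqrt (real (Suc (Suc n)))"
        unfolding powr_add by (simp add: powr_half_sqrt)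
      finally show ?thesis .
    qed
    have "norm (c (Suc M)) \<le> (3 * real (Suc M)) * (2 * sqrt (real (Suc M)))"
    proof (rule order_trans[OF cb], rule mult_mono)
      have "sqrt (real (Suc (Suc (Suc M)))) \<le> sqrt (4 * real (Suc M))" by (intro real_sqrt_le_mono) auto
      then show "sqrt (real (Suc (Suc (Suc M)))) \<le> 2 * sqrt (real (Suc M))" by (simp only: real_sqrt_mult real_sqrt_four)
    qed auto
    moreover have "norm (c 0) \<le> 3 * (real (Suc M) * sqrt (real (Suc M)))"
    proof -
      have "norm (c 0) \<le> 2 * sqrt 2" using cb[of 0] by simp
      also have "sqrt 2 \<le> 3 / 2" by (rule real_le_lsqrt) (auto simp: power2_eq_square)
      then have "2 * sqrt 2 \<le> 3" by simp
      also have "\<dots> \<le> 3 * (real (Suc M) * sqrt (real (Suc M)))"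
        by (auto intro!: mult_ge1_I simp: le_add_same_cancel1)
      finally show ?thesis .
    qed
    moreover have "norm ((2 - s) * B M) \<le> norm (c (Suc M)) + norm (c 0) + norm (c (Suc M) - c 0 - (2 - s) * B M)"
    proof -
      have "(2 - s) * B M = (c (Suc M) - c 0) - (c (Suc M) - c 0 - (2 - s) * B M)" by simp
      then have "norm ((2 - s) * B M) \<le> norm (c (Suc M) - c 0) + norm (c (Suc M) - c 0 - (2 - s) * B M)"
        by (metis norm_triangle_ineq4)
      then show ?thesis using norm_triangle_ineq4[of "c (Suc M)" "c 0"] by linarith
    qed
    note * = calculation this
    ultimately have "norm (2 - s) * norm (B M) \<le> 9 * (real (Suc M) * sqrt (real (Suc M))) + norm (2 - s) * norm (1 - s) * (2 * sqrt (real (Suc M)))"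
    proof -
      have "(3 * real (Suc M)) * (2 * sqrt (real (Suc M))) = 6 * (real (Suc M) * sqrt (real (Suc M)))" by simp
      with * 1 show ?thesis unfolding norm_mult[of "2 - s"] by linarith
    qed
    moreover have "norm (2 - s) > 0" using s by auto
    ultimately show ?thesis
      by (simp add: field_simps)
  qed
  have nV: "norm V \<le> 27 / 2 / (norm (2 - s) * (q * sqrt q)) + 2 * norm (1 - s) / sqrt q"
  proof -
    let ?g = "\<lambda>M. 9 / norm (2 - s) * (r ^ M * (real (Suc M) * sqrt (real (Suc M)))) + 2 * norm (1 - s) * (r ^ M * sqrt (real (Suc M)))"
    have g: "summable ?g"
      by (intro summable_add summable_mult geometric_three_halves_moment geometric_sqrt_moment r r')
    have "suminf ?g = 9 / norm (2 - s) * (\<Sum>M. r ^ M * (real (Suc M) * sqrt (real (Suc M)))) + 2 * norm (1 - s) * (\<Sum>M. r ^ M * sqrt (real (Suc M)))"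
      by (subst suminf_add[symmetric]) (rule refl | intro summable_mult geometric_three_halves_moment geometric_sqrt_moment r r' | subst suminf_mult)+
    also have "\<dots> \<le> 9 / norm (2 - s) * (3 / 2 / (q\<^sup>2 * sqrt q)) + 2 * norm (1 - s) * (1 / (q * sqrt q))"
      unfolding q_def by (intro add_mono mult_left_mono geometric_three_halves_moment geometric_sqrt_moment r r') auto
    finally have g2: "suminf ?g \<le> 9 / norm (2 - s) * (3 / 2 / (q\<^sup>2 * sqrt q)) + 2 * norm (1 - s) * (1 / (q * sqrt q))" .
    have "norm (\<Sum>M. of_real r ^ M * B M) \<le> 9 / norm (2 - s) * (3 / 2 / (q\<^sup>2 * sqrt q)) + 2 * norm (1 - s) * (1 / (q * sqrt q))"
    proof (rule norm_suminf_bound(2)[OF _ g g2])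
      fix M
      have "norm (of_real r ^ M * B M) = r ^ M * norm (B M)" using r by (simp add: norm_mult norm_power)
      also have "\<dots> \<le> r ^ M * (9 / norm (2 - s) * (real (Suc M) * sqrt (real (Suc M))) + 2 * norm (1 - s) * sqrt (real (Suc M)))"
        by (intro mult_left_mono Bb) (use r in auto)
      also have "\<dots> = ?g M" by (simp add: algebra_simps)
      finally show "norm (of_real r ^ M * B M) \<le> ?g M" .
    qed
    also have "(\<Sum>M. of_real r ^ M * B M) = V / of_real q" using B2 by (simp add: sums_iff)
    finally have "norm V / q \<le> 9 / norm (2 - s) * (3 / 2 / (q\<^sup>2 * sqrt q)) + 2 * norm (1 - s) * (1 / (q * sqrt q))"
      using q by (simp add: norm_divide)
    then have "norm V \<le> q * (9 / norm (2 - s) * (3 / 2 / (q\<^sup>2 * sqrt q)) + 2 * norm (1 - s) * (1 / (q * sqrt q)))"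
      using q(1) by (simp add: divide_le_eq mult.commute)
    also have "\<dots> = 27 / 2 / (norm (2 - s) * (q * sqrt q)) + 2 * norm (1 - s) / sqrt q"
      using q by (simp add: distrib_left power2_eq_square)
    finally show ?thesis .
  qed
  define S0 where "S0 = (\<Sum>n. a n * of_real r ^ n)"
  define E where "E = (\<Sum>M. of_real r ^ M * zeta_error (Suc M) s)"
  have eM: "norm (of_real r ^ M * zeta_error (Suc M) s) \<le> 2 * norm s * (r ^ M * (1 / sqrt (real (Suc M))))" for M
  proof -
    have "norm (of_real r ^ M * zeta_error (Suc M) s) = r ^ M * norm (zeta_error (Suc M) s)"
      using r by (simp add: norm_mult norm_power)
    also have "\<dots> \<le> r ^ M * (2 * norm s / sqrt (real (Suc M)))"
      by (intro mult_left_mono zeta_error_bound_sqrt) (use s r in auto)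
    finally show ?thesis by (simp add: mult_ac)
  qed
  have gE: "summable (\<lambda>M. 2 * norm s * (r ^ M * (1 / sqrt (real (Suc M)))))"
    by (intro summable_mult geometric_inverse_sqrt_moment r r')
  have gE2: "(\<Sum>M. 2 * norm s * (r ^ M * (1 / sqrt (real (Suc M))))) \<le> 2 * norm s * (2 / sqrt q)"
    unfolding q_def by (subst suminf_mult) (intro geometric_inverse_sqrt_moment mult_left_mono r r' | simp)+
  have sE: "summable (\<lambda>M. of_real r ^ M * zeta_error (Suc M) s)" 
    and nE: "norm E \<le> 4 * norm s / sqrt q"
    using norm_suminf_bound[OF eM gE gE2] by (auto simp: E_def)
  \<comment> \<open>The sum of the first M + 1 terms is
    \<open>zeta s + b M / (1 - s) + zeta_error (Suc M) s\<close>; multiply by r^M and sum over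
    M.\<close>
  have S0: "S0 / of_real q = zeta s / of_real q + V / (1 - s) + E"
  proof -
    have "(\<lambda>M. of_real r ^ M * (\<Sum>i\<le>M. a i)) sums (S0 / of_real q)" using A1(2) by (simp add: S0_def q_def)
    moreover have "(\<lambda>M. of_real r ^ M * zeta s + (b M * of_real r ^ M) / (1 - s) + of_real r ^ M * zeta_error (Suc M) s)
          sums ((1 / (1 - of_real r)) * zeta s + V / (1 - s) + E)"
      unfolding E_def V_def by (intro sums_add sums_divide sums_mult2 B1(1) summable_sums[OF sE] geometric_sums) (use r in auto)
    moreover have "of_real r ^ M * zeta s + (b M * of_real r ^ M) / (1 - s) + of_real r ^ M * zeta_error (Suc M) s
        = of_real r ^ M * (\<Sum>i\<le>M. a i)" for M
      unfolding zeta_error_def a_def b_def lessThan_Suc_atMost by (simp add: algebra_simps)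
    ultimately show ?thesis by (simp add: sums_iff q_def)
  qed
  have "S0 = (S0 / of_real q) * of_real q" using q by simp
  also have "\<dots> = zeta s + of_real q * (V / (1 - s)) + of_real q * E" unfolding S0 using q by (simp add: field_simps)
  finally have S0': "S0 - zeta s = of_real q * (V / (1 - s)) + of_real q * E" by simp
  have "norm (S0 - zeta s) \<le> q * (norm V / norm (1 - s)) + q * norm E"
    unfolding S0' by (rule order_trans[OF norm_triangle_ineq]) (use q in \<open>simp add: norm_mult norm_divide\<close>)
  also have "\<dots> \<le> q * ((27 / 2 / (norm (2 - s) * (q * sqrt q)) + 2 * norm (1 - s) / sqrt q) / norm (1 - s)) + q * (4 * norm s / sqrt q)"
    by (intro add_mono mult_left_mono divide_right_mono nV nE) (use q in auto)
  also have "\<dots> = 27 / 2 / (sqrt q * norm (1 - s) * norm (2 - s)) + (2 + 4 * norm s) * sqrt q"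
  proof -
    have "q * (1 / sqrt q) = sqrt q" using q by (simp add: field_simps)
    then have e: "q / sqrt q = sqrt q" by simp
    have n: "norm (1 - s) \<noteq> 0" using s by auto
    have "q * ((27 / 2 / (norm (2 - s) * (q * sqrt q)) + 2 * norm (1 - s) / sqrt q) / norm (1 - s))
       = 27 / 2 / (sqrt q * norm (1 - s) * norm (2 - s)) + 2 * (q / sqrt q)"
      using q(1) n by (simp add: add_divide_distrib distrib_left mult_ac)
    moreover have "q * (4 * norm s / sqrt q) = 4 * norm s * (q / sqrt q)" by simp
    ultimately show ?thesis unfolding e by (simp add: algebra_simps)
  qed
  also have "\<dots> \<le> 14 / (sqrt q * norm (1 - s) * norm (2 - s)) + (2 + 4 * norm s) * sqrt q"
    using q by (intro add_right_mono divide_right_mono) auto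
  finally have main: "norm (S0 - zeta s) \<le> 14 / (sqrt q * norm (1 - s) * norm (2 - s)) + (2 + 4 * norm s) * sqrt q" .
  \<comment> \<open>\<open>smoothed_zeta\<close> damps the n-th term by r^(n+1) and S0 by r^n. The
    extra factor r = 1 - q is the origin of the term \<open>q * norm (zeta s)\<close>.\<close>
  have "smoothed_zeta r s = of_real r * S0"
    unfolding smoothed_zeta_def S0_def using A1(1)
    by (subst suminf_mult[symmetric]) (auto simp: sums_iff a_def mult_ac)
  then have "smoothed_zeta r s - zeta s = of_real r * (S0 - zeta s) - of_real q * zeta s"
    by (simp add: q_def algebra_simps)
  then have "norm (smoothed_zeta r s - zeta s) \<le> norm (of_real r * (S0 - zeta s)) + norm (of_real q * zeta s)"
    by (metis norm_triangle_ineq4)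
  also have "\<dots> \<le> 1 * norm (S0 - zeta s) + q * norm (zeta s)"
    unfolding norm_mult using r q by (intro add_mono mult_right_mono) auto
  finally show ?thesis using main by simp
qed

section \<open>Gaussian means\<close>

lemma infsum_nat_eq_suminf:
  fixes f :: "nat \<Rightarrow> real"
  assumes "f summable_on UNIV"
  shows "infsum f UNIV = suminf f" "summable f"
  using has_sum_imp_sums[OF has_sum_infsum[OF assms]] by (auto simp: sums_iff)

lemma infsum_prod_eq_suminf:
  fixes f :: "nat \<times> nat \<Rightarrow> real"
  assumes "f summable_on UNIV"
  shows "infsum f UNIV = (\<Sum>m. \<Sum>n. f (m, n))" "summable (\<lambda>m. \<Sum>n. f (m, n))" "summable (\<lambda>n. f (m, n))"
proof -
  have S: "f summable_on Sigma UNIV (\<lambda>_. UNIV)" using assms by (simp flip: UNIV_Times_UNIV)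
  have 1: "(\<lambda>n. f (m, n)) summable_on UNIV" for m
    using S by (intro summable_on_SigmaD1[where A = UNIV and B = "\<lambda>_. UNIV" and f = "\<lambda>m n. f (m, n)"]) auto
  then show "summable (\<lambda>n. f (m, n))" by (rule infsum_nat_eq_suminf)
  have 2: "(\<lambda>m. infsum (\<lambda>n. f (m, n)) UNIV) summable_on UNIV"
    using S by (intro summable_on_Sigma_banach) (auto simp: case_prod_unfold)
  have 3: "infsum (\<lambda>m. infsum (\<lambda>n. f (m, n)) UNIV) UNIV = infsum f UNIV"
    using infsum_Sigma_banach[OF S] by (simp flip: UNIV_Times_UNIV)
  have 4: "infsum (\<lambda>n. f (m, n)) UNIV = (\<Sum>n. f (m, n))" for m using infsum_nat_eq_suminf[OF 1] by simp
  show "infsum f UNIV = (\<Sum>m. \<Sum>n. f (m, n))" "summable (\<lambda>m. \<Sum>n. f (m, n))"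
    using infsum_nat_eq_suminf[OF 2] 3 unfolding 4 by simp_all
qed

text \<open>The product majorant makes the double series absolutely convergent, so it may be
  regrouped into the diagonal and the lines n = m + h + 1; symmetry folds the lower triangle onto
  the upper one.\<close>

lemma double_sum_split:
  fixes b :: "nat \<Rightarrow> nat \<Rightarrow> real" and a :: "nat \<Rightarrow> real"
  assumes b: "\<And>m n. \<bar>b m n\<bar> \<le> a m * a n" and a: "summable a" "\<And>n. 0 \<le> a n" and sym: "\<And>m n. b m n = b n m"
  shows "(\<Sum>m. \<Sum>n. b m n) = (\<Sum>m. b m m) + 2 * (\<Sum>h. \<Sum>m. b m (m + Suc h))"
    and "summable (\<lambda>h. \<Sum>m. b m (m + Suc h))" and "summable (\<lambda>m. b m (m + Suc h))"
proof -
  define f where "f = (\<lambda>(m, n). b m n)"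
  have aa: "(\<lambda>(m, n). a m * a n) summable_on UNIV \<times> UNIV"
  proof (rule summable_on_SigmaI[where g = "\<lambda>m. a m * suminf a"])
    have "(a has_sum suminf a) UNIV" by (intro sums_nonneg_imp_has_sum summable_sums a)
    then show "((\<lambda>n. case (m, n) of (m, n) \<Rightarrow> a m * a n) has_sum a m * suminf a) UNIV" for m
      using has_sum_cmult_right by fastforce
    show "(\<lambda>m. a m * suminf a) summable_on UNIV"
      by (intro summable_on_cmult_left summable_nonneg_imp_summable_on a)
  qed (use a in auto)
  have fs: "f summable_on A" for A
  proof -
    have "(\<lambda>x. norm (f x)) summable_on UNIV"
      unfolding f_def by (rule summable_on_comparison_test[OF aa[simplified]])
        (use b in \<open>auto simp: case_prod_unfold\<close>)
    then have "f summable_on UNIV" by (rule abs_summable_summable)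
    then show ?thesis by (rule summable_on_subset_banach) auto
  qed
  define D where "D = (\<lambda>m::nat. (m, m)) ` UNIV"
  define U where "U = (\<lambda>(h, m). (m, m + Suc h)) ` UNIV"
  define L where "L = (\<lambda>(h, m). (m + Suc h, m)) ` UNIV"
  have un: "UNIV = D \<union> (U \<union> L)"
  proof -
    have "(m, n) \<in> D \<union> (U \<union> L)" for m n
    proof (cases m n rule: linorder_cases)
      case less
      then obtain h where "n = m + Suc h" by (metis add_Suc_right less_imp_Suc_add)
      then have "(m, n) = (\<lambda>(h, m). (m, m + Suc h)) (h, m)" by simp
      then show ?thesis unfolding U_def by blast
    next
      case equal then show ?thesis unfolding D_def by blast
    next
      case greater
      then obtain h where "m = n + Suc h" by (metis add_Suc_right less_imp_Suc_add)
      then have "(m, n) = (\<lambda>(h, m). (m + Suc h, m)) (h, n)" by simp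
      then show ?thesis unfolding L_def by blast
    qed
    then show ?thesis by auto
  qed
  have iU: "inj (\<lambda>(h::nat, m::nat). (m, m + Suc h))" and iL: "inj (\<lambda>(h::nat, m::nat). (m + Suc h, m))"
    and iD: "inj (\<lambda>m::nat. (m, m))" by (auto simp: inj_def)
  have "infsum f UNIV = infsum f D + (infsum f U + infsum f L)"
    unfolding un by (subst infsum_Un_disjoint[OF fs fs], fastforce simp: D_def U_def L_def)
      (subst infsum_Un_disjoint[OF fs fs], auto simp: U_def L_def)
  moreover have "infsum f D = (\<Sum>m. b m m)"
  proof -
    have "(\<lambda>m. f (m, m)) summable_on UNIV" using fs[of D] unfolding D_def summable_on_reindex[OF iD] by (simp add: o_def)
    then show ?thesis unfolding D_def infsum_reindex[OF iD] o_def using infsum_nat_eq_suminf by (auto simp: f_def)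
  qed
  moreover have sU: "(\<lambda>(h, m). f (m, m + Suc h)) summable_on UNIV"
    using fs[of U] unfolding U_def summable_on_reindex[OF iU] by (simp add: o_def case_prod_unfold)
  have "infsum f U = infsum (\<lambda>(h, m). f (m, m + Suc h)) UNIV"
    unfolding U_def infsum_reindex[OF iU] by (simp add: o_def case_prod_unfold)
  moreover have "infsum f L = infsum (\<lambda>(h, m). f (m, m + Suc h)) UNIV"
    unfolding L_def infsum_reindex[OF iL] by (rule infsum_cong) (auto simp: f_def sym)
  ultimately have "infsum f UNIV = (\<Sum>m. b m m) + 2 * infsum (\<lambda>(h, m). f (m, m + Suc h)) UNIV" by simp
  moreover have "infsum (\<lambda>(h, m). f (m, m + Suc h)) UNIV = (\<Sum>h. \<Sum>m. b m (m + Suc h))"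
    using infsum_prod_eq_suminf(1)[OF sU] by (simp add: f_def)
  moreover have "infsum f UNIV = (\<Sum>m. \<Sum>n. b m n)"
    using infsum_prod_eq_suminf(1)[OF fs[of UNIV]] by (simp add: f_def)
  ultimately show "(\<Sum>m. \<Sum>n. b m n) = (\<Sum>m. b m m) + 2 * (\<Sum>h. \<Sum>m. b m (m + Suc h))" by simp
  show "summable (\<lambda>h. \<Sum>m. b m (m + Suc h))" "summable (\<lambda>m. b m (m + Suc h))"
    using infsum_prod_eq_suminf(2,3)[OF sU] by (auto simp: f_def)
qed

lemma norm_trig_series_sq:
  fixes a \<omega> :: "nat \<Rightarrow> real"
  assumes a: "summable a" "\<And>n. 0 \<le> a n"
  shows "(norm (\<Sum>n. of_real (a n) * cis (- \<omega> n * t)))\<^sup>2 = (\<Sum>m. \<Sum>n. a m * a n * cos ((\<omega> m - \<omega> n) * t))"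
proof -
  define z where "z = (\<lambda>n. of_real (a n) * cis (- \<omega> n * t))"
  have nz: "norm (z n) = a n" for n using a by (simp add: z_def norm_mult)
  have sz: "summable z" by (rule summable_norm_cancel) (simp add: nz a)
  have szc: "(\<lambda>n. cnj (z n)) sums cnj (suminf z)" using sz by (simp add: sums_cnj summable_sums)
  have re: "Re (z m * cnj (z n)) = a m * a n * cos ((\<omega> m - \<omega> n) * t)" for m n
    by (simp add: z_def algebra_simps cos_diff)
  have "(norm (suminf z))\<^sup>2 = Re (suminf z * cnj (suminf z))"
    by (simp add: complex_norm_square[symmetric] flip: of_real_power)
  also have "suminf z * cnj (suminf z) = (\<Sum>m. z m * cnj (suminf z))"
    using sz by (simp add: suminf_mult2)
  also have "Re \<dots> = (\<Sum>m. Re (z m * cnj (suminf z)))"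
    by (rule Re_suminf) (intro summable_mult2 sz)
  also have "\<dots> = (\<Sum>m. \<Sum>n. a m * a n * cos ((\<omega> m - \<omega> n) * t))"
  proof (rule suminf_cong)
    fix m
    have "(\<lambda>n. Re (z m * cnj (z n))) sums Re (z m * cnj (suminf z))"
      by (intro sums_Re sums_mult szc)
    then show "Re (z m * cnj (suminf z)) = (\<Sum>n. a m * a n * cos ((\<omega> m - \<omega> n) * t))"
      unfolding re by (simp add: sums_iff)
  qed
  finally show ?thesis by (simp add: z_def)
qed

abbreviation gauss :: "real measure" where "gauss \<equiv> std_normal_distribution"

interpretation gauss: real_distribution gauss by (rule real_dist_normal_dist)

definition gauss_mean :: "(real \<Rightarrow> real) \<Rightarrow> real \<Rightarrow> real \<Rightarrow> real" where
  "gauss_mean w \<tau> G = (\<integral>x. w (\<tau> + G * x) \<partial>gauss)"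

lemma gauss_integrable_bounded:
  assumes "f \<in> borel_measurable borel" "\<And>x. \<bar>f x\<bar> \<le> B"
  shows "integrable gauss (f :: real \<Rightarrow> real)"
  by (rule gauss.integrable_const_bound[where B = B]) (use assms in auto)

text \<open>Real part of the characteristic function of the normal distribution, rotated by the
  centre \<tau>. Frequencies well above 1/G are suppressed.\<close>

lemma gauss_mean_cos: "gauss_mean (\<lambda>t. cos (\<omega> * t)) \<tau> G = cos (\<omega> * \<tau>) * exp (- (G * \<omega>)\<^sup>2 / 2)"
proof -
  have i: "integrable gauss (\<lambda>x. iexp (\<omega> * \<tau>) * iexp (\<omega> * G * x))"
    by (intro integrable_mult_right gauss.integrable_iexp) auto
  have "cos (\<omega> * (\<tau> + G * x)) = Re (iexp (\<omega> * \<tau>) * iexp (\<omega> * G * x))" for x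
    unfolding exp_add[symmetric] by (simp add: Re_exp algebra_simps)
  then have "gauss_mean (\<lambda>t. cos (\<omega> * t)) \<tau> G = (\<integral>x. Re (iexp (\<omega> * \<tau>) * iexp (\<omega> * G * x)) \<partial>gauss)"
    by (simp add: gauss_mean_def)
  also have "\<dots> = Re (\<integral>x. iexp (\<omega> * \<tau>) * iexp (\<omega> * G * x) \<partial>gauss)"
    by (rule integral_Re[OF i])
  also have "(\<integral>x. iexp (\<omega> * \<tau>) * iexp (\<omega> * G * x) \<partial>gauss) = iexp (\<omega> * \<tau>) * char gauss (\<omega> * G)"
    unfolding char_def by (simp add: mult_ac)
  also have "Re \<dots> = cos (\<omega> * \<tau>) * exp (- (G * \<omega>)\<^sup>2 / 2)"
    unfolding char_std_normal_distribution by (simp add: Re_exp mult_ac)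
  finally show ?thesis .
qed

lemma gauss_mean_trig_series_sq:
  fixes a \<omega> :: "nat \<Rightarrow> real"
  assumes a: "summable a" "\<And>n. 0 \<le> a n"
  shows "gauss_mean (\<lambda>t. (norm (\<Sum>n. of_real (a n) * cis (- \<omega> n * t)))\<^sup>2) \<tau> G
       = (\<Sum>m. \<Sum>n. a m * a n * (cos ((\<omega> m - \<omega> n) * \<tau>) * exp (- (G * (\<omega> m - \<omega> n))\<^sup>2 / 2)))"
proof -
  define g where "g = (\<lambda>m n x. a m * a n * cos ((\<omega> m - \<omega> n) * (\<tau> + G * x)))"
  have gm [measurable]: "g m n \<in> borel_measurable borel" for m n unfolding g_def by measurable
  have gb: "\<bar>g m n x\<bar> \<le> a m * a n" for m n x
  proof -
    have "\<bar>g m n x\<bar> = (a m * a n) * \<bar>cos ((\<omega> m - \<omega> n) * (\<tau> + G * x))\<bar>"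
      unfolding g_def abs_mult using a by simp
    also have "\<dots> \<le> a m * a n" using a by (intro mult_left_le) auto
    finally show ?thesis .
  qed
  have sa: "summable (\<lambda>n. a m * a n)" for m by (intro summable_mult a)
  have sg: "summable (\<lambda>n. g m n x)" "summable (\<lambda>n. \<bar>g m n x\<bar>)" for m x
    by (rule summable_comparison_test'[OF sa[of m], of 0], use gb in simp)+
  have gi: "integrable gauss (g m n)" for m n by (rule gauss_integrable_bounded[OF gm gb])
  have Gb: "\<bar>\<Sum>n. g m n x\<bar> \<le> a m * suminf a" for m x
  proof -
    have "norm (\<Sum>n. g m n x) \<le> (\<Sum>n. a m * a n)" by (rule norm_suminf_le) (use gb sa in auto)
    then show ?thesis using a by (simp add: suminf_mult)
  qed
  have Gm [measurable]: "(\<lambda>x. \<Sum>n. g m n x) \<in> borel_measurable borel" for m by measurable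
  have Gi: "integrable gauss (\<lambda>x. \<Sum>n. g m n x)" for m by (rule gauss_integrable_bounded[OF Gm Gb])
  have int_le: "(\<integral>x. \<bar>f x\<bar> \<partial>gauss) \<le> B" if "f \<in> borel_measurable borel" "\<And>x. \<bar>f x\<bar> \<le> B" for f :: "real \<Rightarrow> real" and B
  proof -
    have "(\<integral>x. \<bar>f x\<bar> \<partial>gauss) \<le> (\<integral>x. B \<partial>gauss)"
      by (intro integral_mono integrable_abs gauss_integrable_bounded[OF that]) (use that in auto)
    also have "\<dots> = B" by (simp add: gauss.prob_space[simplified])
    finally show ?thesis .
  qed
  have "gauss_mean (\<lambda>t. (norm (\<Sum>n. of_real (a n) * cis (- \<omega> n * t)))\<^sup>2) \<tau> G = (\<integral>x. (\<Sum>m. \<Sum>n. g m n x) \<partial>gauss)"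
    unfolding gauss_mean_def norm_trig_series_sq[OF a] g_def ..
  also have "\<dots> = (\<Sum>m. \<integral>x. (\<Sum>n. g m n x) \<partial>gauss)"
  proof (rule integral_suminf[OF Gi])
    have s: "summable (\<lambda>m. a m * suminf a)" by (intro summable_mult2 a)
    show "AE x in gauss. summable (\<lambda>m. norm (\<Sum>n. g m n x))"
      by (intro AE_I2 summable_comparison_test'[OF s, of 0]) (use Gb in auto)
    show "summable (\<lambda>m. \<integral>x. norm (\<Sum>n. g m n x) \<partial>gauss)"
      by (intro summable_comparison_test'[OF s, of 0]) (auto intro!: int_le Gb)
  qed
  also have "\<dots> = (\<Sum>m. \<Sum>n. \<integral>x. g m n x \<partial>gauss)"
  proof (intro suminf_cong integral_suminf[OF gi])
    fix m
    show "AE x in gauss. summable (\<lambda>n. norm (g m n x))" using sg by simp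
    show "summable (\<lambda>n. \<integral>x. norm (g m n x) \<partial>gauss)"
      by (intro summable_comparison_test'[OF sa[of m], of 0]) (auto intro!: int_le gb)
  qed
  also have "\<dots> = (\<Sum>m. \<Sum>n. a m * a n * (cos ((\<omega> m - \<omega> n) * \<tau>) * exp (- (G * (\<omega> m - \<omega> n))\<^sup>2 / 2)))"
  proof (intro suminf_cong)
    fix m n
    show "(\<integral>x. g m n x \<partial>gauss) = a m * a n * (cos ((\<omega> m - \<omega> n) * \<tau>) * exp (- (G * (\<omega> m - \<omega> n))\<^sup>2 / 2))"
      unfolding g_def using gauss_mean_cos[of "\<omega> m - \<omega> n" \<tau> G] by (simp add: gauss_mean_def)
  qed
  finally show ?thesis .
qed

lemma of_nat_powr_line:
  "(of_nat (Suc n) :: complex) powr (- Complex \<sigma> t) = of_real (real (Suc n) powr (- \<sigma>)) * cis (- ln (real (Suc n)) * t)"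
proof -
  have "(of_nat (Suc n) :: complex) powr (- Complex \<sigma> t) = exp (- Complex \<sigma> t * of_real (ln (real (Suc n))))"
    by (simp add: powr_def Ln_of_nat del: of_nat_Suc)
  also have "- Complex \<sigma> t * of_real (ln (real (Suc n))) = of_real (- \<sigma> * ln (real (Suc n))) + \<i> * of_real (- ln (real (Suc n)) * t)"
    by (simp add: complex_eq_iff)
  also have "exp \<dots> = of_real (exp (- \<sigma> * ln (real (Suc n)))) * cis (- ln (real (Suc n)) * t)"
    unfolding exp_add by (simp add: cis_conv_exp flip: exp_of_real)
  also have "exp (- \<sigma> * ln (real (Suc n))) = real (Suc n) powr (-\<sigma>)" by (simp add: powr_def)
  finally show ?thesis .
qed

lemma smoothed_zeta_trig:
  "smoothed_zeta r (Complex \<sigma> t)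
     = (\<Sum>n. of_real (real (Suc n) powr (-\<sigma>) * r ^ Suc n) * cis (- ln (real (Suc n)) * t))"
  unfolding smoothed_zeta_def of_nat_powr_line by (simp add: mult_ac)

lemma gauss_mean_smoothed_zeta:
  fixes \<sigma> r \<tau> G :: real
  assumes "0 \<le> \<sigma>" "0 < r" "r < 1"
  defines "a \<equiv> \<lambda>n. real (Suc n) powr (-\<sigma>) * r ^ Suc n"
  defines "b \<equiv> \<lambda>m n. a m * a n * (cos (ln (real (Suc n) / real (Suc m)) * \<tau>) * exp (- (G * ln (real (Suc n) / real (Suc m)))\<^sup>2 / 2))"
  shows "gauss_mean (\<lambda>t. (norm (smoothed_zeta r (Complex \<sigma> t)))\<^sup>2) \<tau> G
      = (\<Sum>m. (a m)\<^sup>2) + 2 * (\<Sum>h. \<Sum>m. b m (m + Suc h))"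
    and "summable (\<lambda>h. \<Sum>m. b m (m + Suc h))" and "summable (\<lambda>m. b m (m + Suc h))"
proof -
  have a0: "0 \<le> a n" for n using assms by (auto simp: a_def)
  have "a n \<le> r * r ^ n" for n
  proof -
    have "real (Suc n) powr (-\<sigma>) \<le> real (Suc n) powr 0" by (intro powr_mono) (use assms in auto)
    then have "a n \<le> 1 * r ^ Suc n" unfolding a_def using assms by (intro mult_right_mono) auto
    then show ?thesis by simp
  qed
  then have sa: "summable a"
    by (intro summable_comparison_test'[OF summable_mult[OF summable_geometric[of r], of r], of 0]) (use a0 assms in auto)
  have ln: "ln (real (Suc n) / real (Suc m)) = - (ln (real (Suc m)) - ln (real (Suc n)))" for m n
    by (subst ln_div) auto
  have b: "b m n = a m * a n * (cos ((ln (real (Suc m)) - ln (real (Suc n))) * \<tau>) * exp (- (G * (ln (real (Suc m)) - ln (real (Suc n))))\<^sup>2 / 2))" for m n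
    unfolding b_def ln by (simp only: minus_mult_left[symmetric] minus_mult_right[symmetric] cos_minus power2_minus)
  have sym: "b m n = b n m" for m n
  proof -
    have "ln (real (Suc n)) - ln (real (Suc m)) = - (ln (real (Suc m)) - ln (real (Suc n)))" by simp
    then show ?thesis unfolding b[of m n] b[of n m]
      by (simp only: minus_mult_left[symmetric] minus_mult_right[symmetric] cos_minus power2_minus mult.commute[of "a n"])
  qed
  have bb: "\<bar>b m n\<bar> \<le> a m * a n" for m n
  proof -
    have "\<bar>cos x * exp (- y\<^sup>2 / 2)\<bar> \<le> 1" for x y :: real
      unfolding abs_mult using mult_mono[of "\<bar>cos x\<bar>" 1 "\<bar>exp (- y\<^sup>2 / 2)\<bar>" 1] by simp
    then show ?thesis unfolding b abs_mult[of "a m * a n"] using a0 by (simp add: mult_left_le)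
  qed
  have "gauss_mean (\<lambda>t. (norm (smoothed_zeta r (Complex \<sigma> t)))\<^sup>2) \<tau> G = (\<Sum>m. \<Sum>n. b m n)"
    unfolding smoothed_zeta_trig b using gauss_mean_trig_series_sq[OF sa a0] unfolding a_def .
  also have "\<dots> = (\<Sum>m. b m m) + 2 * (\<Sum>h. \<Sum>m. b m (m + Suc h))"
    by (rule double_sum_split[OF bb sa a0 sym])
  also have "(\<lambda>m. b m m) = (\<lambda>m. (a m)\<^sup>2)" by (simp add: b_def power2_eq_square)
  finally show "gauss_mean (\<lambda>t. (norm (smoothed_zeta r (Complex \<sigma> t)))\<^sup>2) \<tau> G
      = (\<Sum>m. (a m)\<^sup>2) + 2 * (\<Sum>h. \<Sum>m. b m (m + Suc h))" .
  show "summable (\<lambda>h. \<Sum>m. b m (m + Suc h))" "summable (\<lambda>m. b m (m + Suc h))"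
    by (rule double_sum_split[OF bb sa a0 sym])+
qed

section \<open>Off-diagonal terms\<close>

lemma derivative_abs_integral_bound:
  fixes \<rho> \<rho>' :: "real \<Rightarrow> real"
  assumes "a < y" and \<rho>: "\<And>x. a \<le> x \<Longrightarrow> (\<rho> has_real_derivative \<rho>' x) (at x)" and cont: "continuous_on {a..} \<rho>'"
    and int: "set_integrable lborel J \<rho>'" and sub: "{a<..<y} \<subseteq> J"
  shows "\<bar>\<rho> y - \<rho> a\<bar> \<le> (LBINT x:J. \<bar>\<rho>' x\<bar>)"
proof -
  have ii: "set_integrable lborel {a<..<y} \<rho>'" by (rule set_integrable_subset[OF int]) (use sub in auto)
  have "\<rho> y - \<rho> a = (LBINT x=a..y. \<rho>' x)"
    by (rule interval_integral_FTC_finite[symmetric])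
       (use assms in \<open>auto intro!: continuous_on_subset[OF cont] DERIV_subset[OF \<rho>]
          simp flip: has_real_derivative_iff_has_vector_derivative\<close>)
  also have "\<dots> = (LBINT x:{a<..<y}. \<rho>' x)" using assms(1) by (simp add: interval_integral_Ioo)
  also have "\<bar>\<dots>\<bar> \<le> (LBINT x:{a<..<y}. \<bar>\<rho>' x\<bar>)"
    using integral_norm_bound[of lborel "\<lambda>x. indicator {a<..<y} x *\<^sub>R \<rho>' x"]
    by (simp add: set_lebesgue_integral_def abs_mult)
  also have "\<dots> \<le> (LBINT x:J. \<bar>\<rho>' x\<bar>)"
    unfolding set_lebesgue_integral_def
    by (rule integral_mono)
       (use set_integrable_abs[OF ii] set_integrable_abs[OF int] sub in \<open>auto simp: set_integrable_def split: split_indicator\<close>)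
  finally show ?thesis .
qed

text \<open>A Riemann sum with error controlled by total variation. Each cell J j lies directly to
  the right of y j and has \<kappa>-mass 1, so \<rho> (y j) differs from the \<kappa>-average of
  \<rho> over the cell by at most the variation of \<rho> there; the variations add up to the
  integral of |\<rho>'|. The points y j decrease to 0, and the cell with index 0 is a ray.\<close>

lemma partition_sum_integral:
  fixes y :: "nat \<Rightarrow> real" and \<kappa> \<rho> \<rho>' :: "real \<Rightarrow> real"
  assumes y: "\<And>j. y (Suc j) < y j" "\<And>j. 0 < y j" "y \<longlonglongrightarrow> 0"
  defines "J \<equiv> \<lambda>j. case j of 0 \<Rightarrow> {y 0<..} | Suc i \<Rightarrow> {y (Suc i)<..<y i}"
  assumes \<kappa>: "\<And>x. 0 < x \<Longrightarrow> 0 \<le> \<kappa> x" "\<And>j. set_integrable lborel (J j) \<kappa>" "\<And>j. (LBINT x:J j. \<kappa> x) = 1"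
    and \<rho>: "\<And>x. 0 < x \<Longrightarrow> (\<rho> has_real_derivative \<rho>' x) (at x)" and cont: "continuous_on {0<..} \<rho>'"
    and int: "set_integrable lborel {0<..} \<rho>'" "set_integrable lborel {0<..} (\<lambda>x. \<rho> x * \<kappa> x)"
  shows "summable (\<lambda>j. \<rho> (y j))"
    and "\<bar>(\<Sum>j. \<rho> (y j)) - (LBINT x:{0<..}. \<rho> x * \<kappa> x)\<bar> \<le> (LBINT x:{0<..}. \<bar>\<rho>' x\<bar>)"
proof -
  have mono: "y j \<le> y i" if "i \<le> j" for i j using lift_Suc_antimono_le[of y] y(1) that less_imp_le by blast
  have Jm [measurable]: "J j \<in> sets borel" for j by (cases j) (auto simp: J_def)
  have J0: "J j \<subseteq> {0<..}" for j
  proof (cases j)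
    case 0 then show ?thesis using y(2)[of 0] by (auto simp: J_def)
  next
    case (Suc i) show ?thesis using y(2)[of "Suc i"] Suc by (auto simp: J_def)
  qed
  have Jpos: "J j \<subseteq> {y j<..}" for j by (cases j) (auto simp: J_def)
  have Jint: "{y j<..<x} \<subseteq> J j" if "x \<in> J j" for x j using that by (cases j) (auto simp: J_def)
  have disj': "J i \<inter> J j = {}" if "i < j" for i j
  proof -
    define k where "k = j - 1"
    have k: "j = Suc k" "i \<le> k" using that by (auto simp: k_def)
    have "J j \<subseteq> {..<y i}" using mono[OF k(2)] by (auto simp: J_def k)
    moreover have "J i \<subseteq> {y i<..}" by (rule Jpos)
    ultimately show ?thesis by fastforce
  qed
  have disj: "J i \<inter> J j = {}" if "i \<noteq> j" for i j
    using disj'[of i j] disj'[of j i] that by (cases i j rule: linorder_cases) auto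
  have cover: "x \<in> (\<Union>j. J j) \<union> range y" if "x > 0" for x
  proof -
    from y(3) \<open>x > 0\<close> have "eventually (\<lambda>j. y j < x) sequentially" by (rule order_tendstoD(2))
    then have ex: "\<exists>j. y j < x" by (auto simp: eventually_sequentially)
    define j where "j = (LEAST j. y j < x)"
    have j: "y j < x" unfolding j_def by (rule LeastI_ex[OF ex])
    show ?thesis
    proof (cases j)
      case 0 then have "x \<in> J 0" using j by (auto simp: J_def) then show ?thesis by blast
    next
      case (Suc i)
      then have "\<not> y i < x" unfolding j_def by (metis lessI not_less_Least)
      then have "x = y i \<or> x \<in> J (Suc i)" using j Suc by (auto simp: J_def)
      then show ?thesis by blast
    qed
  qed
  have AE: "AE x in lborel. (x \<in> (\<Union>j. J j)) = (x \<in> {0<..})"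
  proof -
    have "AE x in lborel. x \<notin> range y"
      by (intro AE_not_in countable_imp_null_set_lborel) auto
    then show ?thesis by eventually_elim (use cover J0 in blast)
  qed
  have split: "(\<lambda>j. LBINT x:J j. f x) sums (LBINT x:{0<..}. f x)"
    if f: "set_integrable lborel {0<..} f" for f :: "real \<Rightarrow> real"
  proof -
    have U: "(\<Union>j. J j) \<in> sets lborel" by simp
    have fU: "set_integrable lborel (\<Union>j. J j) f"
      by (rule set_integrable_subset[OF f]) (use J0 in auto)
    have "(LBINT x:{0<..}. f x) = (LBINT x:(\<Union>j. J j). f x)"
      by (rule set_integral_cong_set) (use f fU AE in \<open>auto simp: set_integrable_def set_borel_measurable_def\<close>)
    also have "\<dots> = (\<Sum>j. LBINT x:J j. f x)"
      by (rule lebesgue_integral_countable_add[OF _ disj fU]) auto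
    finally have 1: "(LBINT x:{0<..}. f x) = (\<Sum>j. LBINT x:J j. f x)" .
    have "summable (\<lambda>j. \<integral>x. indicator (J j) x *\<^sub>R f x \<partial>lborel)"
    proof (rule summable_norm_cancel, rule summable_comparison_test')
      show "summable (\<lambda>j. LBINT x:J j. \<bar>f x\<bar>)"
      proof (rule summableI_nonneg_bounded)
        fix n
        show "0 \<le> (LBINT x:J n. \<bar>f x\<bar>)" by (simp add: set_lebesgue_integral_def)
        have "(\<Sum>j<n. LBINT x:J j. \<bar>f x\<bar>) = (LBINT x:(\<Union>j<n. J j). \<bar>f x\<bar>)"
          by (rule set_integral_finite_Union[symmetric])
             (use disj J0 in \<open>auto simp: disjoint_family_on_def intro!: set_integrable_abs set_integrable_subset[OF f]\<close>)
        also have "\<dots> \<le> (LBINT x:{0<..}. \<bar>f x\<bar>)"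
          unfolding set_lebesgue_integral_def
        proof (rule integral_mono)
          have "set_integrable lborel (\<Union>j<n. J j) (\<lambda>x. \<bar>f x\<bar>)"
            by (intro set_integrable_abs set_integrable_subset[OF f]) (use J0 in auto)
          then show "integrable lborel (\<lambda>x. indicator (\<Union>j<n. J j) x *\<^sub>R \<bar>f x\<bar>)" by (simp add: set_integrable_def)
          show "integrable lborel (\<lambda>x. indicator {0<..} x *\<^sub>R \<bar>f x\<bar>)"
            using set_integrable_abs[OF f] by (simp add: set_integrable_def)
        qed (use J0 in \<open>auto split: split_indicator\<close>)
        finally show "(\<Sum>j<n. LBINT x:J j. \<bar>f x\<bar>) \<le> (LBINT x:{0<..}. \<bar>f x\<bar>)" .
      qed
      show "norm (norm (\<integral>x. indicator (J j) x *\<^sub>R f x \<partial>lborel)) \<le> (LBINT x:J j. \<bar>f x\<bar>)" for j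
        using integral_norm_bound[of lborel "\<lambda>x. indicator (J j) x *\<^sub>R f x"]
        by (simp add: set_lebesgue_integral_def abs_mult)
    qed
    then show ?thesis unfolding 1 by (simp add: set_lebesgue_integral_def summable_sums)
  qed
  define v where "v = (\<lambda>j. LBINT x:J j. \<bar>\<rho>' x\<bar>)"
  have block: "\<bar>\<rho> (y j) - (LBINT x:J j. \<rho> x * \<kappa> x)\<bar> \<le> v j" for j
  proof -
    have r': "set_integrable lborel (J j) \<rho>'" by (rule set_integrable_subset[OF int(1)]) (use J0 in auto)
    have rk: "set_integrable lborel (J j) (\<lambda>x. \<rho> x * \<kappa> x)" by (rule set_integrable_subset[OF int(2)]) (use J0 in auto)
    have b: "\<bar>\<rho> x - \<rho> (y j)\<bar> \<le> v j" if "x \<in> J j" for x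
      unfolding v_def
    proof (rule derivative_abs_integral_bound[where a = "y j" and y = x and \<rho> = \<rho>])
      show "y j < x" using that Jpos by auto
      show "(\<rho> has_real_derivative \<rho>' u) (at u)" if "y j \<le> u" for u using that y(2)[of j] by (intro \<rho>) auto
      show "continuous_on {y j..} \<rho>'" by (rule continuous_on_subset[OF cont]) (use y(2)[of j] in auto)
    qed (use that r' Jint in auto)
    have c: "set_integrable lborel (J j) (\<lambda>x. \<rho> (y j) * \<kappa> x)" using \<kappa>(2) by simp
    have "(LBINT x:J j. \<rho> x * \<kappa> x) - \<rho> (y j) = (LBINT x:J j. \<rho> x * \<kappa> x - \<rho> (y j) * \<kappa> x)"
      using \<kappa>(2,3) by (simp add: set_integral_diff[OF rk c])
    also have "\<bar>\<dots>\<bar> \<le> (LBINT x:J j. \<bar>\<rho> x * \<kappa> x - \<rho> (y j) * \<kappa> x\<bar>)"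
      using integral_norm_bound[of lborel "\<lambda>x. indicator (J j) x *\<^sub>R (\<rho> x * \<kappa> x - \<rho> (y j) * \<kappa> x)"]
      by (simp add: set_lebesgue_integral_def abs_mult)
    also have "\<dots> \<le> (LBINT x:J j. v j * \<kappa> x)"
    proof (rule set_integral_mono)
      show "set_integrable lborel (J j) (\<lambda>x. \<bar>\<rho> x * \<kappa> x - \<rho> (y j) * \<kappa> x\<bar>)"
        by (intro set_integrable_abs set_integral_diff rk c)
      show "set_integrable lborel (J j) (\<lambda>x. v j * \<kappa> x)" using \<kappa>(2) by simp
      fix x assume x: "x \<in> J j"
      have kx: "0 \<le> \<kappa> x" using \<kappa>(1)[of x] x J0[of j] by auto
      then have "\<bar>\<rho> x * \<kappa> x - \<rho> (y j) * \<kappa> x\<bar> = \<bar>\<rho> x - \<rho> (y j)\<bar> * \<kappa> x"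
        by (simp add: abs_mult left_diff_distrib[symmetric])
      also have "\<dots> \<le> v j * \<kappa> x" by (intro mult_right_mono b x kx)
      finally show "\<bar>\<rho> x * \<kappa> x - \<rho> (y j) * \<kappa> x\<bar> \<le> v j * \<kappa> x" .
    qed
    also have "\<dots> = v j" using \<kappa>(3) by simp
    finally show ?thesis by (simp add: abs_minus_commute)
  qed
  have sv: "v sums (LBINT x:{0<..}. \<bar>\<rho>' x\<bar>)" unfolding v_def by (intro split set_integrable_abs int)
  have sr: "(\<lambda>j. LBINT x:J j. \<rho> x * \<kappa> x) sums (LBINT x:{0<..}. \<rho> x * \<kappa> x)" by (rule split[OF int(2)])
  have sd: "summable (\<lambda>j. \<rho> (y j) - (LBINT x:J j. \<rho> x * \<kappa> x))"
    by (rule summable_comparison_test'[OF sums_summable[OF sv], of 0]) (use block in auto)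
  from summable_add[OF sd sums_summable[OF sr]] show sy: "summable (\<lambda>j. \<rho> (y j))" by simp
  have "(\<Sum>j. \<rho> (y j)) - (LBINT x:{0<..}. \<rho> x * \<kappa> x) = (\<Sum>j. \<rho> (y j) - (LBINT x:J j. \<rho> x * \<kappa> x))"
    using sr by (subst suminf_diff[symmetric]) (auto simp: sums_iff sy)
  also have "\<bar>\<dots>\<bar> \<le> suminf v"
    using norm_suminf_le[of "\<lambda>j. \<rho> (y j) - (LBINT x:J j. \<rho> x * \<kappa> x)" v] block sums_summable[OF sv] by simp
  also have "suminf v = (LBINT x:{0<..}. \<bar>\<rho>' x\<bar>)" using sv by (simp add: sums_iff)
  finally show "\<bar>(\<Sum>j. \<rho> (y j)) - (LBINT x:{0<..}. \<rho> x * \<kappa> x)\<bar> \<le> (LBINT x:{0<..}. \<bar>\<rho>' x\<bar>)" .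
qed


text \<open>\<open>dsinh y\<close> is 2 sinh (y/2) and \<open>hcoth y\<close> is coth (y/2). At y =
  ln (n / m) with n - m = h they take the values h / sqrt (m n) and (m + n) / h.\<close>

definition dsinh :: "real \<Rightarrow> real" where "dsinh y = exp (y / 2) - exp (- y / 2)"
definition hcoth :: "real \<Rightarrow> real" where "hcoth y = (exp y + 1) / (exp y - 1)"

lemma dsinh_sq: "(dsinh y)\<^sup>2 = (exp y - 1)\<^sup>2 / exp y"
proof -
  define z where "z = exp (y / 2)"
  have z: "z > 0" "exp y = z * z" "exp (- y / 2) = 1 / z"
    by (auto simp: z_def exp_minus inverse_eq_divide simp flip: exp_add)
  show ?thesis unfolding dsinh_def z(2,3) z_def[symmetric] using z(1)
    by (simp add: field_simps power2_eq_square)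
qed

lemma dsinh_pos: "y > 0 \<Longrightarrow> dsinh y > 0" by (simp add: dsinh_def)

lemma dsinh_ge: "y \<ge> 0 \<Longrightarrow> dsinh y \<ge> y"
proof -
  assume "y \<ge> 0"
  have "(\<lambda>x. dsinh x - x) 0 \<le> (\<lambda>x. dsinh x - x) y"
  proof (rule DERIV_nonneg_imp_nondecreasing[OF \<open>y \<ge> 0\<close>])
    fix x :: real
    have "((\<lambda>x. dsinh x - x) has_real_derivative (exp (x / 2) / 2 + exp (- x / 2) / 2 - 1)) (at x)"
      unfolding dsinh_def by (auto intro!: derivative_eq_intros)
    moreover have "exp (x / 2) + exp (- x / 2) \<ge> 2"
      using exp_ge_add_one_self[of "x/2"] exp_ge_add_one_self[of "-x/2"] by linarith
    ultimately show "\<exists>d. ((\<lambda>x. dsinh x - x) has_real_derivative d) (at x) \<and> 0 \<le> d" by (intro exI conjI) auto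
  qed
  then show ?thesis by (simp add: dsinh_def)
qed

lemma dsinh_le: "y \<ge> 0 \<Longrightarrow> dsinh y \<le> y * exp y" "y \<ge> 0 \<Longrightarrow> dsinh y \<le> exp y"
proof -
  assume y: "y \<ge> 0"
  have "dsinh y = exp (y / 2) * (1 - exp (- y))"
    by (simp add: dsinh_def right_diff_distrib flip: exp_add)
  also have "\<dots> \<le> exp y * y"
    using y exp_ge_add_one_self[of "-y"] by (intro mult_mono) auto
  finally show "dsinh y \<le> y * exp y" by (simp add: mult.commute)
  have "dsinh y \<le> exp (y / 2)" by (simp add: dsinh_def)
  also have "\<dots> \<le> exp y" using y by simp
  finally show "dsinh y \<le> exp y" .
qed

lemma hcoth_ge_1: "y > 0 \<Longrightarrow> hcoth y > 1" by (simp add: hcoth_def field_simps)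

lemma dsinh_hcoth: "y > 0 \<Longrightarrow> (dsinh y)\<^sup>2 * hcoth y = dsinh y * (exp (y / 2) + exp (- y / 2))"
proof -
  assume "y > 0"
  define w where "w = exp y"
  have w: "w > 1" using \<open>y > 0\<close> by (simp add: w_def)
  have "dsinh y * (exp (y / 2) + exp (- y / 2)) = exp y - exp (- y)"
    by (simp add: dsinh_def algebra_simps flip: exp_add)
  also have "\<dots> = w - 1 / w" by (simp add: w_def exp_minus inverse_eq_divide)
  also have "\<dots> = (w - 1)\<^sup>2 / w * ((w + 1) / (w - 1))"
    using w by (simp add: power2_eq_square) (simp add: field_simps)
  finally show ?thesis unfolding dsinh_sq hcoth_def w_def ..
qed

lemma exp_plus_exp_minus_ge: "exp (y / 2) + exp (- y / 2) \<ge> (2::real)"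
  using exp_ge_add_one_self[of "y/2"] exp_ge_add_one_self[of "-y/2"] by linarith

lemma dsinh_hcoth_ge: "y > 0 \<Longrightarrow> 2 * dsinh y \<le> (dsinh y)\<^sup>2 * hcoth y"
  unfolding dsinh_hcoth using mult_left_mono[OF exp_plus_exp_minus_ge[of y], of "dsinh y"] dsinh_pos[of y]
  by simp

lemma DERIV_dsinh: "(dsinh has_real_derivative (exp (y / 2) + exp (- y / 2)) / 2) (at y)"
  unfolding dsinh_def by (auto intro!: derivative_eq_intros simp: add_divide_distrib)

lemma DERIV_hcoth: "y > 0 \<Longrightarrow> (hcoth has_real_derivative - 2 / (dsinh y)\<^sup>2) (at y)"
  unfolding hcoth_def dsinh_sq
  by (auto intro!: derivative_eq_intros simp: divide_simps power2_eq_square algebra_simps)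

lemma continuous_on_dsinh [continuous_intros]: "continuous_on A f \<Longrightarrow> continuous_on A (\<lambda>x. dsinh (f x))"
  unfolding dsinh_def by (intro continuous_intros) auto

lemma continuous_on_hcoth [continuous_intros]:
  "continuous_on A f \<Longrightarrow> (\<And>x. x \<in> A \<Longrightarrow> f x \<noteq> 0) \<Longrightarrow> continuous_on A (\<lambda>x. hcoth (f x))"
  unfolding hcoth_def by (intro continuous_intros) auto

lemma powr_between_bounds:
  fixes s p :: real
  assumes "s > 0" "1 \<le> p" "p \<le> 2"
  shows "s powr p \<le> s * (1 + s)" "s powr (p - 1) \<le> 1 + s"
proof -
  show 1: "s powr (p - 1) \<le> 1 + s"
  proof (cases "s \<le> 1")
    case True then have "s powr (p - 1) \<le> 1" using assms powr_le1[of "p - 1" s] by auto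
    then show ?thesis using assms by simp
  next
    case False then have "s powr (p - 1) \<le> s powr 1" using assms by (intro powr_mono) auto
    then show ?thesis using assms by simp
  qed
  have "s powr p = s * s powr (p - 1)" using assms by (simp add: powr_mult_base)
  then show "s powr p \<le> s * (1 + s)" using 1 assms by simp
qed

text \<open>With p = 2 \<sigma> and y = ln ((m + h) / m) this is the averaged term of the pair (m, m
  + h): the power equals (m (m + h))^-\<sigma> and the last factor is the cut-off exp (-(2 m + h) /
  N).\<close>

definition offdiag :: "real \<Rightarrow> real \<Rightarrow> real \<Rightarrow> real \<Rightarrow> real \<Rightarrow> real \<Rightarrow> real" where
  "offdiag p N \<tau> G h y = (dsinh y / h) powr p * cos (\<tau> * y) * exp (- (G * y)\<^sup>2 / 2) * exp (- (h / N) * hcoth y)"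

definition offdiag_deriv :: "real \<Rightarrow> real \<Rightarrow> real \<Rightarrow> real \<Rightarrow> real \<Rightarrow> real \<Rightarrow> real" where
  "offdiag_deriv p N \<tau> G h y =
     p * (dsinh y / h) powr (p - 1) * ((exp (y / 2) + exp (- y / 2)) / 2 / h) * cos (\<tau> * y) * exp (- (G * y)\<^sup>2 / 2) * exp (- (h / N) * hcoth y)
   - (dsinh y / h) powr p * (\<tau> * sin (\<tau> * y)) * exp (- (G * y)\<^sup>2 / 2) * exp (- (h / N) * hcoth y)
   - (dsinh y / h) powr p * cos (\<tau> * y) * (G\<^sup>2 * y * exp (- (G * y)\<^sup>2 / 2)) * exp (- (h / N) * hcoth y)
   + (dsinh y / h) powr p * cos (\<tau> * y) * exp (- (G * y)\<^sup>2 / 2) * (exp (- (h / N) * hcoth y) * ((h / N) * (2 / (dsinh y)\<^sup>2)))"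

lemma DERIV_offdiag:
  assumes "y > 0" "h > 0"
  shows "(offdiag p N \<tau> G h has_real_derivative offdiag_deriv p N \<tau> G h y) (at y)"
proof -
  have 1: "((\<lambda>y. (dsinh y / h) powr p) has_real_derivative p * (dsinh y / h) powr (p - 1) * ((exp (y / 2) + exp (- y / 2)) / 2 / h)) (at y)"
    by (rule DERIV_chain2[OF has_real_derivative_powr DERIV_cdivide[OF DERIV_dsinh]])
       (use dsinh_pos[OF assms(1)] assms(2) in simp)
  have 2: "((\<lambda>y. cos (\<tau> * y)) has_real_derivative - (\<tau> * sin (\<tau> * y))) (at y)"
    by (auto intro!: derivative_eq_intros)
  have 3: "((\<lambda>y. exp (- (G * y)\<^sup>2 / 2)) has_real_derivative - (G\<^sup>2 * y * exp (- (G * y)\<^sup>2 / 2))) (at y)"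
    by (auto intro!: derivative_eq_intros simp: power2_eq_square)
  have 4: "((\<lambda>y. exp (- (h / N) * hcoth y)) has_real_derivative exp (- (h / N) * hcoth y) * ((h / N) * (2 / (dsinh y)\<^sup>2))) (at y)"
    by (rule DERIV_cong[OF DERIV_fun_exp[OF DERIV_cmult[OF DERIV_hcoth[OF assms(1)]]]]) simp
  show ?thesis unfolding offdiag_def[abs_def]
    by (rule DERIV_cong[OF DERIV_mult[OF DERIV_mult[OF DERIV_mult[OF 1 2] 3] 4]])
       (simp add: offdiag_deriv_def algebra_simps)
qed

lemma gauss_exp_bound: "exp (- v\<^sup>2 / 2) * exp (2 * v) \<le> exp 8 * exp (- 2 * (v::real))"
proof -
  have "0 \<le> (v - 4)\<^sup>2" by simp
  then have "- v\<^sup>2 / 2 + 2 * v \<le> 8 + - 2 * v" by (simp add: power2_eq_square algebra_simps)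
  then show ?thesis by (simp flip: exp_add)
qed

text \<open>The Gaussian confines y to order 1/G. There the derivative of cos (\<tau> y) is the
  dominant one: it costs \<tau> y, that is \<tau> / G, and integration over y gains another 1/G.
  Half of the cut-off, exp (-h / (2 N)), is kept for the later sum over h.\<close>

lemma offdiag_deriv_bound:
  assumes y: "y > 0" and h: "h > 0" and N: "N > 0" and p: "1 \<le> p" "p \<le> 2" and G: "G \<ge> 1" and \<tau>: "\<tau> \<ge> 0"
  shows "\<bar>offdiag_deriv p N \<tau> G h y\<bar> \<le> h powr (-p) * exp (- h / (2 * N)) * (exp 8 * (10 + 2 * \<tau> / G) * exp (- G * y))"
proof -
  define s where "s = dsinh y"
  define C where "C = (exp (y / 2) + exp (- y / 2)) / 2"
  define E where "E = exp (- (G * y)\<^sup>2 / 2)"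
  define D where "D = exp (- (h / N) * hcoth y)"
  define d where "d = exp (- h / (2 * N))"
  define H where "H = h powr (-p)"
  have s: "s > 0" "s \<le> y * exp y" "s \<le> exp y" using y by (auto simp: s_def dsinh_pos dsinh_le)
  have pos: "C \<ge> 1" "E > 0" "D > 0" "d > 0" "H > 0"
    using exp_plus_exp_minus_ge[of y] h by (auto simp: C_def E_def D_def d_def H_def)
  have a: "(s / h) powr p = s powr p * H" using s h by (simp add: H_def powr_divide powr_minus_divide)
  have a': "(s / h) powr (p - 1) / h = s powr (p - 1) * H"
    using s h by (simp add: H_def powr_divide powr_diff powr_minus_divide)
  define z where "z = (h / N) * hcoth y"
  have z: "z \<ge> h / N" using mult_left_mono[of 1 "hcoth y" "h / N"] hcoth_ge_1[OF y] h N by (simp add: z_def)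
  have D: "D \<le> d"
  proof -
    have "- z \<le> - h / (2 * N)" using z h N by (simp add: field_simps)
    then show ?thesis by (simp add: D_def d_def z_def)
  qed
  \<comment> \<open>Half of the exponent pays for the factor z, because z \<le> exp (z / 2).\<close>
  have Dz: "D * z \<le> d"
  proof -
    have z0: "z \<ge> 0" using order_trans[OF _ z, of 0] h N by simp
    have "0 \<le> (z - 2)\<^sup>2" by simp
    then have "z \<le> 1 + z / 2 + (z / 2)\<^sup>2 / 2" by (simp add: power2_eq_square algebra_simps)
    also have "\<dots> \<le> exp (z / 2)" using exp_lower_Taylor_quadratic[of "z/2"] z0 by simp
    finally have "z \<le> exp (z / 2)" .
    then have "exp (- z) * z \<le> exp (- z) * exp (z / 2)" by simp
    moreover have "D = exp (- z)" by (simp add: D_def z_def)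
    ultimately have "D * z \<le> exp (- z) * exp (z / 2)" by simp
    also have "\<dots> = exp (- (z / 2))" by (simp flip: exp_add)
    also have "\<dots> \<le> d" using z h N unfolding d_def by (simp add: field_simps)
    finally show ?thesis .
  qed
  \<comment> \<open>The derivative of \<open>hcoth\<close> is singular like 1/s^2, but
    \<open>dsinh_hcoth_ge\<close> trades one factor 1/s for \<open>hcoth y\<close>, which belongs to
    z. The remaining 1/s is absorbed by s^p, as p \<ge> 1.\<close>
  have Dd: "D * ((h / N) * (2 / s\<^sup>2)) \<le> d / s"
  proof -
    have k: "2 * s \<le> s\<^sup>2 * hcoth y" using dsinh_hcoth_ge[OF y] by (simp add: s_def)
    have kpos: "hcoth y > 0" using hcoth_ge_1[OF y] by simp
    have "D * ((h / N) * (2 / s\<^sup>2)) = (D * z) * (2 / (s\<^sup>2 * hcoth y))" using kpos by (simp add: z_def)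
    also have "\<dots> \<le> d * (2 / (2 * s))"
    proof (intro mult_mono Dz)
      show "2 / (s\<^sup>2 * hcoth y) \<le> 2 / (2 * s)" by (rule divide_left_mono[OF k]) (use s kpos in auto)
    qed (use pos s kpos in auto)
    finally show ?thesis by simp
  qed
  have t1: "\<bar>p * (s / h) powr (p - 1) * (C / h) * cos (\<tau> * y) * E * D\<bar> \<le> H * d * E * (2 * C * (1 + s))"
  proof -
    have "\<bar>p * (s / h) powr (p - 1) * (C / h) * cos (\<tau> * y) * E * D\<bar>
        = p * C * ((s / h) powr (p - 1) / h) * \<bar>cos (\<tau> * y)\<bar> * E * D"
      using p pos h by (simp add: abs_mult)
    also have "\<dots> \<le> 2 * C * ((1 + s) * H) * 1 * E * d"
      unfolding a' using p pos D powr_between_bounds[OF s(1) p] s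
      by (intro mult_mono) auto
    finally show ?thesis by (simp add: mult_ac)
  qed
  have sp: "(s / h) powr p \<le> H * (s * (1 + s))" "0 \<le> (s / h) powr p"
    unfolding a using powr_between_bounds[OF s(1) p] pos by (simp_all add: mult.commute)
  have t2: "\<bar>(s / h) powr p * (\<tau> * sin (\<tau> * y)) * E * D\<bar> \<le> H * d * E * (\<tau> * (s * (1 + s)))"
  proof -
    have "\<bar>(s / h) powr p * (\<tau> * sin (\<tau> * y)) * E * D\<bar> = (s / h) powr p * (\<tau> * \<bar>sin (\<tau> * y)\<bar>) * E * D"
      using \<tau> pos by (simp add: abs_mult)
    also have "\<dots> \<le> (H * (s * (1 + s))) * (\<tau> * 1) * E * d"
      using sp pos D \<tau> s by (intro mult_mono) auto
    finally show ?thesis by (simp add: mult_ac)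
  qed
  have t3: "\<bar>(s / h) powr p * cos (\<tau> * y) * (G\<^sup>2 * y * E) * D\<bar> \<le> H * d * E * (G\<^sup>2 * y * (s * (1 + s)))"
  proof -
    have "\<bar>(s / h) powr p * cos (\<tau> * y) * (G\<^sup>2 * y * E) * D\<bar> = (s / h) powr p * \<bar>cos (\<tau> * y)\<bar> * (G\<^sup>2 * y * E) * D"
      using pos y by (simp add: abs_mult)
    also have "\<dots> \<le> (H * (s * (1 + s))) * 1 * (G\<^sup>2 * y * E) * d"
      using sp pos D s y by (intro mult_mono) auto
    finally show ?thesis by (simp add: mult_ac)
  qed
  have t4: "\<bar>(s / h) powr p * cos (\<tau> * y) * E * (D * ((h / N) * (2 / s\<^sup>2)))\<bar> \<le> H * d * E * (1 + s)"
  proof -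
    have "\<bar>(s / h) powr p * cos (\<tau> * y) * E * (D * ((h / N) * (2 / s\<^sup>2)))\<bar>
        = (s / h) powr p * \<bar>cos (\<tau> * y)\<bar> * E * (D * ((h / N) * (2 / s\<^sup>2)))"
      using pos h N by (simp add: abs_mult)
    also have "\<dots> \<le> (H * (s * (1 + s))) * 1 * E * (d / s)"
      using sp pos Dd s h N by (intro mult_mono) auto
    also have "\<dots> = H * d * E * (1 + s)" using s by simp
    finally show ?thesis .
  qed
  have "\<bar>offdiag_deriv p N \<tau> G h y\<bar> \<le> H * d * E * (2 * C * (1 + s)) + H * d * E * (\<tau> * (s * (1 + s)))
       + H * d * E * (G\<^sup>2 * y * (s * (1 + s))) + H * d * E * (1 + s)"
    using t1 t2 t3 t4 unfolding offdiag_deriv_def s_def[symmetric] C_def[symmetric] E_def[symmetric] D_def[symmetric]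
    by linarith
  also have "\<dots> = H * d * (E * ((1 + s) * (2 * C + 1 + (\<tau> + G\<^sup>2 * y) * s)))"
    by (simp add: algebra_simps)
  \<comment> \<open>The hyperbolic functions grow at most like exp (2 y). As G \<ge> 1, y is at most
    v = G y, so the Gaussian in v beats this growth and still leaves exp (-v).\<close>
  also have "E * ((1 + s) * (2 * C + 1 + (\<tau> + G\<^sup>2 * y) * s)) \<le> exp 8 * (10 + 2 * \<tau> / G) * exp (- G * y)"
  proof -
    define v where "v = G * y"
    have v: "v > 0" "y \<le> v" using y G by (auto simp: v_def)
    have ey: "exp y \<ge> 1" using y by simp
    have C1: "2 * C + 1 \<le> 3 * exp y"
    proof -
      have "exp (y / 2) \<le> exp y" "exp (- y / 2) \<le> exp y" using y by auto
      moreover have "2 * C = exp (y / 2) + exp (- y / 2)" by (simp add: C_def)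
      ultimately show ?thesis using ey by (simp only:)
    qed
    have s1: "1 + s \<le> 2 * exp y" using s ey by linarith
    have "(\<tau> + G\<^sup>2 * y) * s \<le> (\<tau> + G\<^sup>2 * y) * (y * exp y)"
      using \<tau> y s by (intro mult_left_mono) auto
    then have "2 * C + 1 + (\<tau> + G\<^sup>2 * y) * s \<le> exp y * (3 + (\<tau> + G\<^sup>2 * y) * y)"
      using C1 by (simp add: algebra_simps)
    also have "(\<tau> + G\<^sup>2 * y) * y = \<tau> / G * v + v\<^sup>2" using G by (simp add: v_def power2_eq_square field_simps)
    finally have b2: "2 * C + 1 + (\<tau> + G\<^sup>2 * y) * s \<le> exp y * (3 + (\<tau> / G * v + v\<^sup>2))" .
    have nn: "0 \<le> \<tau> / G" using \<tau> G by simp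
    have "(1 + s) * (2 * C + 1 + (\<tau> + G\<^sup>2 * y) * s) \<le> (2 * exp y) * (exp y * (3 + (\<tau> / G * v + v\<^sup>2)))"
      using s1 b2 s pos \<tau> y by (intro mult_mono) auto
    also have "\<dots> = exp (2 * y) * (6 + 2 * (\<tau> / G) * v + 2 * v\<^sup>2)"
    proof -
      have "exp (2 * y) = exp y * exp y" by (simp flip: exp_add)
      then show ?thesis by (simp add: algebra_simps)
    qed
    also have "\<dots> \<le> exp (2 * v) * (exp v * (10 + 2 * (\<tau> / G)))"
    proof (rule mult_mono)
      show "exp (2 * y) \<le> exp (2 * v)" using v by simp
      have "v \<le> exp v" using exp_ge_add_one_self[of v] by linarith
      have "2 * v\<^sup>2 \<le> 4 * exp v" using exp_lower_Taylor_quadratic[of v] v by simp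
      moreover have "2 * (\<tau> / G) * v \<le> 2 * (\<tau> / G) * exp v"
        using \<open>v \<le> exp v\<close> nn by (intro mult_left_mono) auto
      moreover have "exp v \<ge> 1" using v by simp
      moreover have "exp v * (10 + 2 * (\<tau> / G)) = 10 * exp v + 2 * (\<tau> / G) * exp v" by (simp add: algebra_simps)
      ultimately show "6 + 2 * (\<tau> / G) * v + 2 * v\<^sup>2 \<le> exp v * (10 + 2 * (\<tau> / G))"
        by linarith
      have "0 \<le> 2 * (\<tau> / G) * v" using nn v by (intro mult_nonneg_nonneg) auto
      then show "0 \<le> 6 + 2 * (\<tau> / G) * v + 2 * v\<^sup>2" by simp
    qed auto
    finally have b3: "(1 + s) * (2 * C + 1 + (\<tau> + G\<^sup>2 * y) * s) \<le> exp (2 * v) * (exp v * (10 + 2 * (\<tau> / G)))" .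
    have "E * ((1 + s) * (2 * C + 1 + (\<tau> + G\<^sup>2 * y) * s)) \<le> exp (- v\<^sup>2 / 2) * (exp (2 * v) * (exp v * (10 + 2 * (\<tau> / G))))"
      using b3 pos by (simp add: E_def v_def)
    also have "\<dots> = (exp (- v\<^sup>2 / 2) * exp (2 * v)) * (exp v * (10 + 2 * (\<tau> / G)))" by simp
    also have "\<dots> \<le> (exp 8 * exp (- 2 * v)) * (exp v * (10 + 2 * (\<tau> / G)))"
      by (intro mult_right_mono gauss_exp_bound) (use nn in auto)
    also have "\<dots> = exp 8 * (10 + 2 * \<tau> / G) * exp (- G * y)"
    proof -
      have "exp (- 2 * v) * exp v = exp (- G * y)" by (simp add: v_def flip: exp_add)
      then show ?thesis by (simp add: mult_ac)
    qed
    finally show ?thesis .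
  qed
  finally show ?thesis using pos by (simp add: H_def d_def)
qed

section \<open>The integrals that replace the off-diagonal sums\<close>

lemma exp_integral_half_line:
  fixes G :: real
  assumes "G > 0"
  shows "set_integrable lborel {0<..} (\<lambda>y. exp (- G * y))" "(LBINT y:{0<..}. exp (- G * y)) = 1 / G"
proof -
  have 1: "set_integrable lborel (einterval (ereal 0) \<infinity>) (\<lambda>y. exp (- G * y))"
    "(LBINT y=ereal 0..\<infinity>. exp (- G * y)) = 0 - (- (1 / G))"
  proof -
    have D: "((\<lambda>y. - (exp (- G * y) / G)) has_real_derivative exp (- G * y)) (at y)" for y
      using assms by (auto intro!: derivative_eq_intros)
    have A: "(((\<lambda>y. - (exp (- G * y) / G)) \<circ> real_of_ereal) \<longlongrightarrow> - (1 / G)) (at_right (ereal 0))"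
      unfolding ereal_tendsto_simps using assms by (auto intro!: tendsto_eq_intros)
    have B: "(((\<lambda>y. - (exp (- G * y) / G)) \<circ> real_of_ereal) \<longlongrightarrow> 0) (at_left \<infinity>)"
      unfolding ereal_tendsto_simps using assms by real_asymp
    show "set_integrable lborel (einterval (ereal 0) \<infinity>) (\<lambda>y. exp (- G * y))"
      "(LBINT y=ereal 0..\<infinity>. exp (- G * y)) = 0 - (- (1 / G))"
      by (rule interval_integral_FTC_nonneg[OF _ D _ _ A B]; auto intro!: continuous_intros)+
  qed
  have e: "einterval (ereal 0) \<infinity> = {0<..}" by auto
  show "set_integrable lborel {0<..} (\<lambda>y. exp (- G * y))" using 1(1) unfolding e .
  show "(LBINT y:{0<..}. exp (- G * y)) = 1 / G"
    using 1(2) unfolding interval_integral_to_infinity_eq by simp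
qed

lemma set_integrable_half_line_bound:
  fixes f g :: "real \<Rightarrow> real"
  assumes "continuous_on {0<..} f" "set_integrable lborel {0<..} g" "\<And>y. 0 < y \<Longrightarrow> \<bar>f y\<bar> \<le> g y"
  shows "set_integrable lborel {0<..} f" "(LBINT y:{0<..}. \<bar>f y\<bar>) \<le> (LBINT y:{0<..}. g y)"
    "\<bar>LBINT y:{0<..}. f y\<bar> \<le> (LBINT y:{0<..}. g y)"
proof -
  show f: "set_integrable lborel {0<..} f"
  proof (rule set_integrable_bound[OF assms(2)])
    show "set_borel_measurable lborel {0<..} f"
      unfolding set_borel_measurable_def using borel_measurable_continuous_on_indicator[OF _ assms(1)] by simp
    show "AE y in lborel. y \<in> {0<..} \<longrightarrow> norm (f y) \<le> norm (g y)" using assms(3) by (force intro!: AE_I2)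
  qed
  show le: "(LBINT y:{0<..}. \<bar>f y\<bar>) \<le> (LBINT y:{0<..}. g y)"
    by (intro set_integral_mono set_integrable_abs f assms) (use assms(3) in auto)
  have "\<bar>LBINT y:{0<..}. f y\<bar> \<le> (LBINT y:{0<..}. \<bar>f y\<bar>)"
    using integral_norm_bound[of lborel "\<lambda>x. indicator {0<..} x *\<^sub>R f x"]
    by (simp add: set_lebesgue_integral_def abs_mult)
  with le show "\<bar>LBINT y:{0<..}. f y\<bar> \<le> (LBINT y:{0<..}. g y)" by linarith
qed

text \<open>\<open>offdiag\<close> times the density h / (dsinh y)^2 of the sample points ln ((m +
  h) / m), which comes from inverting m = h / (e^y - 1).\<close>

definition offint :: "real \<Rightarrow> real \<Rightarrow> real \<Rightarrow> real \<Rightarrow> real \<Rightarrow> real \<Rightarrow> real" where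
  "offint p N \<tau> G h y = h powr (1 - p) * dsinh y powr (p - 2) * cos (\<tau> * y) * exp (- (G * y)\<^sup>2 / 2) * exp (- (h / N) * hcoth y)"

lemma continuous_on_offint: "h > 0 \<Longrightarrow> continuous_on {0<..} (offint p N \<tau> G h)"
  unfolding offint_def[abs_def] using dsinh_pos
  by (intro continuous_intros) (auto simp: less_imp_neq[symmetric])

text \<open>The cut-off is spent as exp (-z) \<le> 2 / z^2 to make the bound summable over h. The
  price N^2 is harmless: the bound only serves integrability and the interchange of sum and
  integral.\<close>

lemma offint_bound:
  assumes y: "y > 0" and h: "h \<ge> 1" and N: "N > 0" and p: "1 \<le> p" "p \<le> 2" and G: "G \<ge> 1"
  shows "\<bar>offint p N \<tau> G h y\<bar> \<le> 2 * N\<^sup>2 * exp 8 / h\<^sup>2 * exp (- G * y)"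
proof -
  define s where "s = dsinh y"
  define E where "E = exp (- (G * y)\<^sup>2 / 2)"
  define k where "k = hcoth y"
  have s: "s > 0" "s \<le> exp y" using y by (auto simp: s_def dsinh_pos dsinh_le)
  have k: "k > 1" "2 * s \<le> s\<^sup>2 * k" using hcoth_ge_1[OF y] dsinh_hcoth_ge[OF y] by (auto simp: k_def s_def)
  have E: "E > 0" by (simp add: E_def)
  define z where "z = (h / N) * k"
  have z: "z > 0" using h N k by (simp add: z_def)
  have ez: "exp (- z) \<le> 2 / z\<^sup>2"
  proof -
    have "z\<^sup>2 / 2 \<le> exp z" using exp_lower_Taylor_quadratic[of z] z by simp
    then have "1 / exp z \<le> 1 / (z\<^sup>2 / 2)" using z by (intro divide_left_mono) auto
    then show ?thesis by (simp add: exp_minus inverse_eq_divide)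
  qed
  \<comment> \<open>\<open>hcoth\<close> is large where \<open>dsinh\<close> is small, so this
    factor removes the singularity of s^(p - 2) at 0.\<close>
  have k2: "1 / k\<^sup>2 \<le> s / 2"
  proof -
    have "s * 2 \<le> s * (s * k)" using k(2) by (simp add: power2_eq_square mult_ac)
    then have "2 \<le> s * k" using s by simp
    then have "1 / k \<le> s / 2" using k by (simp add: field_simps)
    moreover have "1 / k\<^sup>2 \<le> 1 / k" using k by (intro divide_left_mono) (auto simp: power2_eq_square)
    ultimately show ?thesis by linarith
  qed
  have "\<bar>offint p N \<tau> G h y\<bar> = h powr (1 - p) * s powr (p - 2) * \<bar>cos (\<tau> * y)\<bar> * E * exp (- z)"
    unfolding offint_def by (simp add: abs_mult s_def E_def z_def k_def)
  also have "\<dots> \<le> 1 * s powr (p - 2) * 1 * E * (2 / z\<^sup>2)"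
  proof (intro mult_mono ez)
    show "h powr (1 - p) \<le> 1" using powr_mono[of "1 - p" 0 h] h p by simp
  qed (use E s in auto)
  also have "\<dots> = 2 * N\<^sup>2 / h\<^sup>2 * E * (s powr (p - 2) * (1 / k\<^sup>2))"
    by (simp add: z_def power_mult_distrib power_divide)
  also have "\<dots> \<le> 2 * N\<^sup>2 / h\<^sup>2 * E * (s powr (p - 2) * (s / 2))"
    using E k2 by (intro mult_left_mono) auto
  also have "s powr (p - 2) * (s / 2) = s powr (p - 1) / 2"
    using s powr_mult_base[of s "p - 2"] by (simp add: mult.commute)
  also have "2 * N\<^sup>2 / h\<^sup>2 * E * (s powr (p - 1) / 2) \<le> 2 * N\<^sup>2 / h\<^sup>2 * E * (exp (2 * y))"
  proof (intro mult_left_mono)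
    have "s powr (p - 1) \<le> 1 + s" using powr_between_bounds[OF s(1) p] by simp
    also have "\<dots> \<le> 2 * exp y" using s y by (smt (verit) exp_less_one_iff one_le_exp_iff)
    also have "exp y \<le> exp (2 * y)" using y by simp
    finally show "s powr (p - 1) / 2 \<le> exp (2 * y)" by simp
  qed (use E in auto)
  also have "\<dots> \<le> 2 * N\<^sup>2 / h\<^sup>2 * (exp 8 * exp (- G * y))"
  proof -
    define v where "v = G * y"
    have v: "v > 0" "y \<le> v" using y G by (auto simp: v_def)
    have "E * exp (2 * y) \<le> exp (- v\<^sup>2 / 2) * exp (2 * v)" using v by (simp add: E_def v_def)
    also have "\<dots> \<le> exp 8 * exp (- 2 * v)" by (rule gauss_exp_bound)
    also have "\<dots> \<le> exp 8 * exp (- G * y)" using v by (simp add: v_def)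
    finally have "E * exp (2 * y) \<le> exp 8 * exp (- G * y)" .
    then show ?thesis by (simp only: mult.assoc) (intro mult_left_mono, auto)
  qed
  finally show ?thesis by (simp add: mult_ac)
qed

text \<open>\<kappa> is the derivative of -h / (e^x - 1), which takes the value -m at x = ln ((m +
  h) / m). Between neighbouring points it therefore has mass 1; on the ray beyond the point with m =
  1 the antiderivative runs from -1 to 0.\<close>

lemma kappa_mass:
  fixes h :: real
  assumes h: "h > 0"
  defines "y \<equiv> \<lambda>j. ln ((real (Suc j) + h) / real (Suc j))"
  defines "\<kappa> \<equiv> \<lambda>x. h * exp x / (exp x - 1)\<^sup>2"
  defines "J \<equiv> \<lambda>j. case j of 0 \<Rightarrow> {y 0<..} | Suc i \<Rightarrow> {y (Suc i)<..<y i}"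
  shows "y (Suc j) < y j" "0 < y j" "y \<longlonglongrightarrow> 0"
    "set_integrable lborel (J j) \<kappa>" "(LBINT x:J j. \<kappa> x) = 1"
proof -
  show y0: "0 < y j" for j using h by (simp add: y_def)
  show ymono: "y (Suc j) < y j" for j
    using h unfolding y_def by (subst ln_less_cancel_iff) (auto simp: divide_simps algebra_simps intro!: divide_pos_pos add_pos_pos)
  show "y \<longlonglongrightarrow> 0" unfolding y_def using h by real_asymp
  have ey: "exp (y j) = (real (Suc j) + h) / real (Suc j)" for j using h by (simp add: y_def add_pos_pos)
  define F where "F = (\<lambda>x. - (h / (exp x - 1)))"
  have Fy: "F (y j) = - real (Suc j)" for j unfolding F_def ey using h by (simp add: field_simps)
  have D: "(F has_real_derivative \<kappa> x) (at x)" if "x > 0" for x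
    unfolding F_def \<kappa>_def using that by (auto intro!: derivative_eq_intros simp: power2_eq_square)
  have cont: "isCont \<kappa> x" if "x > 0" for x
    unfolding \<kappa>_def using that by (auto intro!: continuous_intros)
  have contF: "isCont F x" if "x > 0" for x using D[OF that] by (rule DERIV_isCont)
  have nn: "0 \<le> \<kappa> x" for x using h by (simp add: \<kappa>_def)
  have tR: "((F \<circ> real_of_ereal) \<longlongrightarrow> F a) (at_right (ereal a))" if "a > 0" for a
    unfolding ereal_tendsto_simps using contF[OF that] by (simp add: isCont_def filterlim_at_split)
  have tL: "((F \<circ> real_of_ereal) \<longlongrightarrow> F a) (at_left (ereal a))" if "a > 0" for a
    unfolding ereal_tendsto_simps using contF[OF that] by (simp add: isCont_def filterlim_at_split)
  have tI: "((F \<circ> real_of_ereal) \<longlongrightarrow> 0) (at_left \<infinity>)"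
    unfolding ereal_tendsto_simps F_def using h by real_asymp
  have "set_integrable lborel (J j) \<kappa> \<and> (LBINT x:J j. \<kappa> x) = 1"
  proof (cases j)
    case 0
    have pos: "0 < x" if "ereal (y 0) < ereal x" for x using y0[of 0] that by auto
    have "set_integrable lborel (einterval (ereal (y 0)) \<infinity>) \<kappa>" "(LBINT x=ereal (y 0)..\<infinity>. \<kappa> x) = 0 - F (y 0)"
      by (rule interval_integral_FTC_nonneg[OF _ D cont _ tR tI]; use pos y0 nn in auto)+
    moreover have "einterval (ereal (y 0)) \<infinity> = {y 0<..}" by auto
    ultimately show ?thesis using 0 unfolding interval_integral_to_infinity_eq by (simp add: J_def Fy)
  next
    case (Suc i)
    have pos: "0 < x" if "ereal (y (Suc i)) < ereal x" for x using y0[of "Suc i"] that by auto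
    have "set_integrable lborel (einterval (ereal (y (Suc i))) (ereal (y i))) \<kappa>"
      "(LBINT x=ereal (y (Suc i))..ereal (y i). \<kappa> x) = F (y i) - F (y (Suc i))"
      by (rule interval_integral_FTC_nonneg[OF _ D cont _ tR tL]; use pos y0 nn ymono in auto)+
    moreover have "einterval (ereal (y (Suc i))) (ereal (y i)) = {y (Suc i)<..<y i}" by auto
    ultimately show ?thesis using Suc ymono[of i] by (simp add: J_def Fy interval_integral_Ioo less_imp_le)
  qed
  then show "set_integrable lborel (J j) \<kappa>" "(LBINT x:J j. \<kappa> x) = 1" by auto
qed

lemma offdiag_kappa:
  assumes "y > 0" "h > 0"
  shows "offdiag p N \<tau> G h y * (h * exp y / (exp y - 1)\<^sup>2) = offint p N \<tau> G h y"
proof -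
  have s: "dsinh y > 0" by (rule dsinh_pos) fact
  have "h * exp y / (exp y - 1)\<^sup>2 = h / (dsinh y)\<^sup>2" unfolding dsinh_sq by simp
  moreover have "(dsinh y / h) powr p * (h / (dsinh y)\<^sup>2) = h powr (1 - p) * dsinh y powr (p - 2)"
    using s assms by (simp add: powr_divide powr_diff powr_numeral)
  moreover have "a * b * c * d * q = (a * q) * b * c * d" for a b c d q :: real by simp
  ultimately show ?thesis unfolding offdiag_def offint_def by (simp only:)
qed

lemma continuous_on_offdiag_deriv: "h > 0 \<Longrightarrow> continuous_on {0<..} (offdiag_deriv p N \<tau> G h)"
  unfolding offdiag_deriv_def[abs_def] using dsinh_pos
  by (intro continuous_intros) (auto simp: less_imp_neq[symmetric])

text \<open>The integrated derivative bound has order 1/G + \<tau> / G^2. This is the estimate that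
  requires G to exceed sqrt \<tau>.\<close>

lemma offdiag_sum_integral:
  assumes h: "h \<ge> 1" and N: "N > 0" and p: "1 \<le> p" "p \<le> 2" and G: "G \<ge> 1" and \<tau>: "\<tau> \<ge> 0"
  defines "y \<equiv> \<lambda>j. ln ((real (Suc j) + h) / real (Suc j))"
  shows "\<bar>(\<Sum>j. offdiag p N \<tau> G h (y j)) - (LBINT x:{0<..}. offint p N \<tau> G h x)\<bar>
           \<le> h powr (-p) * exp (- h / (2 * N)) * (exp 8 * (10 + 2 * \<tau> / G) / G)"
proof -
  have h0: "h > 0" using h by simp
  have G0: "G > 0" using G by simp
  note e = exp_integral_half_line[OF G0]
  define B where "B = h powr (-p) * exp (- h / (2 * N)) * (exp 8 * (10 + 2 * \<tau> / G))"
  have Bi: "set_integrable lborel {0<..} (\<lambda>x. B * exp (- G * x))" using e(1) by simp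
  have Bb: "\<bar>offdiag_deriv p N \<tau> G h x\<bar> \<le> B * exp (- G * x)" if "0 < x" for x
    using offdiag_deriv_bound[OF that h0 N p G \<tau>] unfolding B_def by (simp only: mult.assoc)
  note d = set_integrable_half_line_bound(1,2)[OF continuous_on_offdiag_deriv[OF h0] Bi Bb]
  have oi: "set_integrable lborel {0<..} (offint p N \<tau> G h)"
    by (rule set_integrable_half_line_bound(1)[OF continuous_on_offint[OF h0] _ offint_bound[OF _ h N p G]])
       (use e(1) in auto)
  have ok: "set_integrable lborel {0<..} (\<lambda>x. offdiag p N \<tau> G h x * (h * exp x / (exp x - 1)\<^sup>2))"
    using oi by (subst set_integrable_cong[OF refl refl offdiag_kappa]) (use h0 in auto)
  have "\<bar>(\<Sum>j. offdiag p N \<tau> G h (y j)) - (LBINT x:{0<..}. offdiag p N \<tau> G h x * (h * exp x / (exp x - 1)\<^sup>2))\<bar>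
     \<le> (LBINT x:{0<..}. \<bar>offdiag_deriv p N \<tau> G h x\<bar>)"
    unfolding y_def
    by (rule partition_sum_integral(2)[OF kappa_mass(1-3)[OF h0] _ kappa_mass(4,5)[OF h0] DERIV_offdiag continuous_on_offdiag_deriv[OF h0] d(1) ok])
       (use h0 in auto)
  also have "\<dots> \<le> B / G" using d(2) e by simp
  also have "(LBINT x:{0<..}. offdiag p N \<tau> G h x * (h * exp x / (exp x - 1)\<^sup>2)) = (LBINT x:{0<..}. offint p N \<tau> G h x)"
    by (rule set_lebesgue_integral_cong) (use offdiag_kappa h0 in auto)
  finally show ?thesis by (simp add: B_def mult_ac)
qed


text \<open>The polylogarithm of order p - 1 at e^-q. It arises with q = hcoth y / N when
  \<open>offint\<close> is summed over h; for p < 2 it is asymptotic to Gamma (2 - p) q^(p - 2) as q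
  tends to 0.\<close>

definition polyexp_sum :: "real \<Rightarrow> real \<Rightarrow> real" where
  "polyexp_sum p q = (\<Sum>k. real (Suc k) powr (1 - p) * exp (- real (Suc k) * q))"

text \<open>The series is -ln (1 - x) at x = exp (-1 / N), and 1 - x \<ge> 1 / (1 + N). It sums the
  Riemann sum errors over h, so that all of them together cost only a logarithm.\<close>

lemma log_series_exp:
  fixes N :: real
  assumes N: "N > 0"
  shows "summable (\<lambda>k. exp (- real (Suc k) / N) / real (Suc k))"
    and "(\<Sum>k. exp (- real (Suc k) / N) / real (Suc k)) \<le> ln (1 + N)"
proof -
  define x where "x = exp (- 1 / N)"
  have x: "0 < x" "x < 1" using N by (auto simp: x_def)
  have pw: "exp (- real k / N) = x ^ k" for k
    unfolding x_def by (subst exp_of_nat_mult[symmetric]) simp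
  have "(\<lambda>n. - ((- (- x)) ^ n) / real n) sums ln (1 + (- x))"
    by (rule ln_series') (use x in auto)
  then have "(\<lambda>n. - (- ((- (- x)) ^ n) / real n)) sums (- ln (1 + (- x)))" by (rule sums_minus)
  then have "(\<lambda>n. x ^ n / real n) sums (- ln (1 - x))" by simp
  then have "(\<lambda>n. x ^ Suc n / real (Suc n)) sums (- ln (1 - x) - x ^ 0 / real 0)"
    by (subst sums_Suc_iff) simp
  then have S: "(\<lambda>k. exp (- real (Suc k) / N) / real (Suc k)) sums (- ln (1 - x))"
    unfolding pw by simp
  then show "summable (\<lambda>k. exp (- real (Suc k) / N) / real (Suc k))" by (rule sums_summable)
  have "1 + 1 / N \<le> exp (1 / N)" by (rule exp_ge_add_one_self)
  then have "x \<le> 1 / (1 + 1 / N)"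
    using N unfolding x_def by (simp add: exp_minus field_simps)
  also have "\<dots> = N / (N + 1)" using N by (simp add: field_simps)
  finally have "1 / (1 + N) \<le> 1 - x" using N by (simp add: field_simps)
  then have "ln (1 / (1 + N)) \<le> ln (1 - x)" using N x by (subst ln_le_cancel_iff) auto
  then have "- ln (1 - x) \<le> ln (1 + N)" using N by (simp add: ln_div)
  then show "(\<Sum>k. exp (- real (Suc k) / N) / real (Suc k)) \<le> ln (1 + N)" using S by (simp add: sums_iff)
qed

lemma offint_suminf:
  assumes N: "N > 0" and p: "1 \<le> p" "p \<le> 2" and G: "G \<ge> 1"
  shows "summable (\<lambda>k. LBINT y:{0<..}. offint p N \<tau> G (real (Suc k)) y)"
    and "(\<Sum>k. LBINT y:{0<..}. offint p N \<tau> G (real (Suc k)) y)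
      = (LBINT y:{0<..}. dsinh y powr (p - 2) * cos (\<tau> * y) * exp (- (G * y)\<^sup>2 / 2) * polyexp_sum p (hcoth y / N))"
    and "set_integrable lborel {0<..} (\<lambda>y. dsinh y powr (p - 2) * cos (\<tau> * y) * exp (- (G * y)\<^sup>2 / 2) * polyexp_sum p (hcoth y / N))"
proof -
  have G0: "G > 0" using G by simp
  note e = exp_integral_half_line[OF G0]
  define f where "f = (\<lambda>k y. indicator {0<..} y *\<^sub>R offint p N \<tau> G (real (Suc k)) y)"
  define c where "c = 2 * N\<^sup>2 * exp 8"
  have b: "\<bar>offint p N \<tau> G (real (Suc k)) y\<bar> \<le> c / (real (Suc k))\<^sup>2 * exp (- G * y)" if "0 < y" for k y
    using offint_bound[OF that _ N p G, of "real (Suc k)" \<tau>] by (simp add: c_def)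
  have i: "set_integrable lborel {0<..} (offint p N \<tau> G (real (Suc k)))"
    "(LBINT y:{0<..}. \<bar>offint p N \<tau> G (real (Suc k)) y\<bar>) \<le> (LBINT y:{0<..}. c / (real (Suc k))\<^sup>2 * exp (- G * y))" for k
    by (rule set_integrable_half_line_bound(1,2)[OF continuous_on_offint _ b]; use e in simp)+
  have sq: "summable (\<lambda>k. C / (real (Suc k))\<^sup>2)" for C :: real
    using summable_mult[OF summable_Suc_powr[of "-2"], of C]
    by (simp add: powr_minus divide_inverse powr_numeral)
  have fi: "integrable lborel (f k)" for k using i(1) by (simp add: set_integrable_def f_def)
  have fs: "AE y in lborel. summable (\<lambda>k. norm (f k y))"
  proof (intro AE_I2)
    fix y
    show "summable (\<lambda>k. norm (f k y))"
    proof (cases "y > 0")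
      case True
      have "summable (\<lambda>k. c * exp (- G * y) / (real (Suc k))\<^sup>2)" by (rule sq)
      then show ?thesis
        by (rule summable_comparison_test'[of _ 0]) (use b[OF True] True in \<open>auto simp: f_def mult_ac\<close>)
    qed (simp add: f_def)
  qed
  have fn: "summable (\<lambda>k. \<integral>y. norm (f k y) \<partial>lborel)"
  proof (rule summable_comparison_test')
    show "summable (\<lambda>k. (c / G) / (real (Suc k))\<^sup>2)" by (rule sq)
    show "norm (\<integral>y. norm (f k y) \<partial>lborel) \<le> (c / G) / (real (Suc k))\<^sup>2" for k
    proof -
      have "norm (\<integral>y. norm (f k y) \<partial>lborel) = (LBINT y:{0<..}. \<bar>offint p N \<tau> G (real (Suc k)) y\<bar>)"
        by (simp add: f_def set_lebesgue_integral_def abs_mult)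
      also have "\<dots> \<le> (c / G) / (real (Suc k))\<^sup>2" using i(2)[of k] e by (simp add: mult_ac)
      finally show ?thesis .
    qed
  qed
  have sumf: "(\<Sum>k. f k y) = indicator {0<..} y *\<^sub>R (dsinh y powr (p - 2) * cos (\<tau> * y) * exp (- (G * y)\<^sup>2 / 2) * polyexp_sum p (hcoth y / N))" for y
  proof (cases "y > 0")
    case True
    then have f: "f k y = dsinh y powr (p - 2) * cos (\<tau> * y) * exp (- (G * y)\<^sup>2 / 2) * (real (Suc k) powr (1 - p) * exp (- real (Suc k) * (hcoth y / N)))" for k
    proof -
      have "- (a / N) * b = - a * (b / N)" for a b :: real by simp
      then have "- (real (Suc k) / N) * hcoth y = - real (Suc k) * (hcoth y / N)" .
      with True show ?thesis by (simp only: f_def offint_def) (simp add: mult_ac)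
    qed
    have "summable (\<lambda>k. real (Suc k) powr (1 - p) * exp (- real (Suc k) * (hcoth y / N)))"
    proof (rule summable_comparison_test')
      define x where "x = exp (- (hcoth y / N))"
      have x: "0 < x" "x < 1" using N hcoth_ge_1[OF True] by (auto simp: x_def)
      show "summable (\<lambda>k. x ^ Suc k)" using x by (subst summable_Suc_iff) (auto intro: summable_geometric)
      fix k
      have "exp (- real (Suc k) * (hcoth y / N)) = x ^ Suc k"
        unfolding x_def exp_of_nat_mult[symmetric] by (simp only: mult_minus_left mult_minus_right)
      moreover have "real (Suc k) powr (1 - p) \<le> 1" using powr_mono[of "1 - p" 0 "real (Suc k)"] p by simp
      ultimately show "norm (real (Suc k) powr (1 - p) * exp (- real (Suc k) * (hcoth y / N))) \<le> x ^ Suc k"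
        unfolding norm_mult using x by (simp only: real_norm_def abs_of_nonneg powr_ge_zero zero_le_power less_imp_le)
          (intro mult_left_le_one_le, auto simp del: power_Suc)
    qed
    from suminf_mult[OF this, of "dsinh y powr (p - 2) * cos (\<tau> * y) * exp (- (G * y)\<^sup>2 / 2)"]
    have "(\<Sum>k. f k y) = dsinh y powr (p - 2) * cos (\<tau> * y) * exp (- (G * y)\<^sup>2 / 2) * polyexp_sum p (hcoth y / N)"
      unfolding f polyexp_sum_def .
    moreover have "indicator {0<..} y = (1::real)" using True by simp
    ultimately show ?thesis by (simp only: scaleR_one)
  qed (simp add: f_def)
  from summable_integral[OF fi fs fn] 
  show "summable (\<lambda>k. LBINT y:{0<..}. offint p N \<tau> G (real (Suc k)) y)"
    by (simp add: f_def set_lebesgue_integral_def)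
  from integral_suminf[OF fi fs fn, unfolded sumf]
  show "(\<Sum>k. LBINT y:{0<..}. offint p N \<tau> G (real (Suc k)) y)
      = (LBINT y:{0<..}. dsinh y powr (p - 2) * cos (\<tau> * y) * exp (- (G * y)\<^sup>2 / 2) * polyexp_sum p (hcoth y / N))"
    by (simp add: f_def set_lebesgue_integral_def)
  from integrable_suminf[OF fi fs fn, unfolded sumf]
  show "set_integrable lborel {0<..} (\<lambda>y. dsinh y powr (p - 2) * cos (\<tau> * y) * exp (- (G * y)\<^sup>2 / 2) * polyexp_sum p (hcoth y / N))"
    by (simp add: set_integrable_def)
qed

lemma offdiag_at_log:
  assumes N: "N > 0" and m: "m > 0" and h: "h > 0"
  defines "y \<equiv> ln ((m + h) / m)"
  shows "(dsinh y / h) powr (2 * \<sigma>) = m powr (-\<sigma>) * (m + h) powr (-\<sigma>)" "h * hcoth y = 2 * m + h"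
proof -
  have ey: "exp y = (m + h) / m" using m h by (simp add: y_def)
  have y: "y > 0" using m h by (simp add: y_def)
  have "(dsinh y)\<^sup>2 = h\<^sup>2 / (m * (m + h))"
    unfolding dsinh_sq ey using m h by (simp add: field_simps power2_eq_square)
  then have sq: "(dsinh y / h)\<^sup>2 = 1 / (m * (m + h))" using h by (simp add: power_divide)
  have "(dsinh y / h) powr (2 * \<sigma>) = ((dsinh y / h) powr 2) powr \<sigma>" by (simp add: powr_powr)
  also have "(dsinh y / h) powr 2 = 1 / (m * (m + h))"
    using dsinh_pos[OF y] h sq by (simp add: powr_numeral)
  also have "\<dots> powr \<sigma> = m powr (-\<sigma>) * (m + h) powr (-\<sigma>)"
    using m h by (simp add: powr_divide powr_mult powr_minus_divide)
  finally show "(dsinh y / h) powr (2 * \<sigma>) = m powr (-\<sigma>) * (m + h) powr (-\<sigma>)" .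
  show "h * hcoth y = 2 * m + h" unfolding hcoth_def ey using m h by (simp add: field_simps)
qed

text \<open>\<open>offdiag_sum_integral\<close> is applied to each difference h. Since h^-p \<le>
  1/h, the errors add up to order (1/G + \<tau> / G^2) ln N.\<close>

lemma gauss_mean_smoothed_zeta_eval:
  fixes \<sigma> N \<tau> G :: real
  assumes \<sigma>: "1/2 \<le> \<sigma>" "\<sigma> \<le> 1" and N: "N > 0" and G: "G \<ge> 1" and \<tau>: "\<tau> \<ge> 0"
  shows "\<bar>gauss_mean (\<lambda>t. (norm (smoothed_zeta (exp (- 1 / N)) (Complex \<sigma> t)))\<^sup>2) \<tau> G
      - (\<Sum>m. real (Suc m) powr (- 2 * \<sigma>) * exp (- 2 * real (Suc m) / N))
      - 2 * (LBINT y:{0<..}. dsinh y powr (2 * \<sigma> - 2) * cos (\<tau> * y) * exp (- (G * y)\<^sup>2 / 2) * polyexp_sum (2 * \<sigma>) (hcoth y / N))\<bar>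
    \<le> 2 * (exp 8 * (10 + 2 * \<tau> / G) / G) * ln (1 + 2 * N)"
proof -
  define r where "r = exp (- 1 / N)"
  define p where "p = 2 * \<sigma>"
  have p: "1 \<le> p" "p \<le> 2" using \<sigma> by (auto simp: p_def)
  have r: "0 < r" "r < 1" using N by (auto simp: r_def)
  have rp: "r ^ n = exp (- real n / N)" for n unfolding r_def by (subst exp_of_nat_mult[symmetric]) simp
  define a where "a = (\<lambda>n. real (Suc n) powr (-\<sigma>) * r ^ Suc n)"
  define b where "b = (\<lambda>m n. a m * a n * (cos (ln (real (Suc n) / real (Suc m)) * \<tau>) * exp (- (G * ln (real (Suc n) / real (Suc m)))\<^sup>2 / 2)))"
  define y where "y = (\<lambda>h j. ln ((real (Suc j) + h) / real (Suc j)))"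
  have gm: "gauss_mean (\<lambda>t. (norm (smoothed_zeta r (Complex \<sigma> t)))\<^sup>2) \<tau> G
      = (\<Sum>m. (a m)\<^sup>2) + 2 * (\<Sum>h. \<Sum>m. b m (m + Suc h))"
    and sb: "summable (\<lambda>h. \<Sum>m. b m (m + Suc h))"
    unfolding b_def a_def by (rule gauss_mean_smoothed_zeta; use \<sigma> r in simp)+
  have be: "b m (m + Suc h) = offdiag p N \<tau> G (real (Suc h)) (y (real (Suc h)) m)" for m h
  proof -
    define M H where "M = real (Suc m)" and "H = real (Suc h)"
    have MH: "M > 0" "H > 0" by (auto simp: M_def H_def)
    have SM: "real (Suc (m + Suc h)) = M + H" by (simp add: M_def H_def)
    define Y where "Y = y H m"
    have Y: "Y = ln ((M + H) / M)" by (simp add: Y_def y_def M_def)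
    note o = offdiag_at_log[OF N MH, folded Y]
    have "a m * a (m + Suc h) = (dsinh Y / H) powr p * (r ^ Suc m * r ^ Suc (m + Suc h))"
      unfolding a_def SM p_def o(1) M_def[symmetric] by (simp add: mult_ac)
    also have "r ^ Suc m * r ^ Suc (m + Suc h) = exp (- (H / N) * hcoth Y)"
    proof -
      have "- (H / N) * hcoth Y = - (H * hcoth Y) / N" by simp
      also have "\<dots> = - (2 * M + H) / N" unfolding o(2) ..
      also have "\<dots> = - real (Suc m) / N + - real (Suc (m + Suc h)) / N"
        unfolding SM M_def[symmetric] add_divide_distrib[symmetric] by simp
      finally show ?thesis unfolding rp by (simp only: exp_add)
    qed
    finally have "b m (m + Suc h) = (dsinh Y / H) powr p * exp (- (H / N) * hcoth Y) * (cos (Y * \<tau>) * exp (- (G * Y)\<^sup>2 / 2))"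
      unfolding b_def SM M_def[symmetric] Y[symmetric] by (simp only:)
    then show ?thesis unfolding offdiag_def Y_def[symmetric] H_def[symmetric] by (simp add: mult_ac)
  qed
  define I where "I = (\<lambda>h. LBINT x:{0<..}. offint p N \<tau> G (real (Suc h)) x)"
  have sI: "summable I" and SI: "suminf I = (LBINT y:{0<..}. dsinh y powr (p - 2) * cos (\<tau> * y) * exp (- (G * y)\<^sup>2 / 2) * polyexp_sum p (hcoth y / N))"
    unfolding I_def by (rule offint_suminf[OF N p G])+
  define c where "c = exp 8 * (10 + 2 * \<tau> / G) / G"
  have c: "c \<ge> 0" using G \<tau> by (simp add: c_def)
  have hb: "\<bar>(\<Sum>m. b m (m + Suc h)) - I h\<bar> \<le> c * (exp (- real (Suc h) / (2 * N)) / real (Suc h))" for h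
  proof -
    have "\<bar>(\<Sum>m. b m (m + Suc h)) - I h\<bar> \<le> real (Suc h) powr (-p) * exp (- real (Suc h) / (2 * N)) * c"
      unfolding be y_def I_def c_def by (rule offdiag_sum_integral) (use N p G \<tau> in auto)
    also have "\<dots> \<le> real (Suc h) powr (-1) * exp (- real (Suc h) / (2 * N)) * c"
      using p c by (intro mult_right_mono powr_mono) auto
    finally show ?thesis by (simp add: powr_minus_divide mult_ac)
  qed
  have N2: "2 * N > 0" using N by simp
  note L = log_series_exp[OF N2]
  have "\<bar>(\<Sum>h. \<Sum>m. b m (m + Suc h)) - suminf I\<bar> = \<bar>\<Sum>h. (\<Sum>m. b m (m + Suc h)) - I h\<bar>"
    using suminf_diff[OF sb sI] by simp
  also have "\<dots> \<le> (\<Sum>h. c * (exp (- real (Suc h) / (2 * N)) / real (Suc h)))"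
    using norm_suminf_le[OF _ summable_mult[OF L(1), of c], of "\<lambda>h. (\<Sum>m. b m (m + Suc h)) - I h"] hb by simp
  also have "\<dots> = c * (\<Sum>h. exp (- real (Suc h) / (2 * N)) / real (Suc h))" by (rule suminf_mult[OF L(1)])
  also have "\<dots> \<le> c * ln (1 + 2 * N)" by (intro mult_left_mono L c)
  finally have main: "\<bar>(\<Sum>h. \<Sum>m. b m (m + Suc h)) - suminf I\<bar> \<le> c * ln (1 + 2 * N)" .
  have a2: "(a m)\<^sup>2 = real (Suc m) powr (- 2 * \<sigma>) * exp (- 2 * real (Suc m) / N)" for m
  proof -
    have "(real (Suc m) powr (-\<sigma>))\<^sup>2 = real (Suc m) powr (- 2 * \<sigma>)"
      by (simp add: power2_eq_square flip: powr_add)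
    moreover have "(r ^ Suc m)\<^sup>2 = exp (- 2 * real (Suc m) / N)"
      unfolding rp by (simp add: power2_eq_square flip: exp_add)
    ultimately show ?thesis unfolding a_def power_mult_distrib by (simp only:)
  qed
  have "\<bar>gauss_mean (\<lambda>t. (norm (smoothed_zeta r (Complex \<sigma> t)))\<^sup>2) \<tau> G - (\<Sum>m. (a m)\<^sup>2) - 2 * suminf I\<bar>
       = 2 * \<bar>(\<Sum>h. \<Sum>m. b m (m + Suc h)) - suminf I\<bar>"
  proof -
    have "\<bar>A + 2 * X - A - 2 * Y\<bar> = 2 * \<bar>X - Y\<bar>" for A X Y :: real by (simp add: abs_if)
    then show ?thesis unfolding gm .
  qed
  also have "\<dots> \<le> 2 * (c * ln (1 + 2 * N))" using main by simp
  finally show ?thesis unfolding SI a2 r_def p_def c_def by (simp add: mult_ac)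
qed

section \<open>Separating the contribution of the pole\<close>

lemma gamma_half_line:
  fixes a q :: real
  assumes a: "a > -1" and q: "q > 0"
  shows "set_integrable lborel {0<..} (\<lambda>x. x powr a * exp (- q * x))"
    "(LBINT x:{0<..}. x powr a * exp (- q * x)) = Gamma (a + 1) * q powr (- a - 1)"
proof -
  define f where "f = (\<lambda>x::real. indicator {0<..} x * (x powr a * exp (- x)))"
  have m: "f \<in> borel_measurable lborel" unfolding f_def by measurable
  have "(\<integral>\<^sup>+x. ennreal (f x) \<partial>lborel) = ennreal (Gamma (a + 1))"
    by (subst Gamma_conv_nn_integral_real)
       (use a in \<open>auto intro!: nn_integral_cong simp: f_def exp_minus divide_inverse split: split_indicator\<close>)
  then have "integrable lborel f \<and> integral\<^sup>L lborel f = Gamma (a + 1)"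
    by (subst nn_integral_eq_integrable[symmetric])
       (use m a in \<open>auto simp: f_def less_imp_le[OF Gamma_real_pos]\<close>)
  then have i: "integrable lborel f" "integral\<^sup>L lborel f = Gamma (a + 1)" by auto
  have eq: "indicator {0<..} x *\<^sub>R (x powr a * exp (- q * x)) = q powr (- a) * f (0 + q * x)" for x
    using q by (auto simp: f_def powr_mult powr_minus field_simps split: split_indicator simp: zero_less_mult_iff)
  show "set_integrable lborel {0<..} (\<lambda>x. x powr a * exp (- q * x))"
    unfolding set_integrable_def eq
    by (intro integrable_mult_right lborel_integrable_real_affine i) (use q in auto)
  have "integral\<^sup>L lborel f = q * (\<integral>x. f (0 + q * x) \<partial>lborel)"
    using lborel_integral_real_affine[of q f 0] q by simp
  then have "(\<integral>x. f (0 + q * x) \<partial>lborel) = Gamma (a + 1) / q" using q i by (simp add: field_simps)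
  then show "(LBINT x:{0<..}. x powr a * exp (- q * x)) = Gamma (a + 1) * q powr (- a - 1)"
    unfolding set_lebesgue_integral_def eq using q by (simp add: powr_diff)
qed

text \<open>The main term is the integral of the decreasing function x^(1 - p) exp (-q x), and the
  sum samples it at 1, 2, .... They differ by at most the integral over (0, 1], which is bounded
  uniformly in q.\<close>

lemma polyexp_sum_approx:
  fixes p q :: real
  assumes p: "1 < p" "p < 2" and q: "q > 0"
  shows "\<bar>Gamma (2 - p) * q powr (p - 2) - polyexp_sum p q\<bar> \<le> exp 1 * Gamma (2 - p) + 1"
proof -
  define g where "g = (\<lambda>x. x powr (1 - p) * exp (- q * x))"
  have gi: "set_integrable lborel {0<..} g" and gI: "(LBINT x:{0<..}. g x) = Gamma (2 - p) * q powr (p - 2)"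
    using gamma_half_line[of "1 - p" q] p q by (auto simp: g_def algebra_simps)
  have anti: "g y \<le> g x" if "0 < x" "x \<le> y" for x y
    unfolding g_def using that p q by (intro mult_mono powr_mono2') auto
  have g0: "0 \<le> g x" for x by (simp add: g_def)
  define A where "A = (\<lambda>k::nat. {real k<..real (Suc k)})"
  have Ai: "set_integrable lborel (A k) g" for k
    by (rule set_integrable_subset[OF gi]) (auto simp: A_def)
  define v where "v = (\<lambda>k. LBINT x:A k. g x)"
  have UA: "(\<Union>k. A k) = {0<..}"
  proof safe
    fix x :: real assume "x > 0"
    define k where "k = nat (\<lceil>x\<rceil> - 1)"
    have "real k < x \<and> x \<le> real (Suc k)" using \<open>x > 0\<close> unfolding k_def by linarith
    then have "x \<in> A k" by (auto simp: A_def)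
    then show "x \<in> (\<Union>k. A k)" by blast
  qed (auto simp: A_def intro: le_less_trans)
  have disj: "A i \<inter> A j = {}" if "i \<noteq> j" for i j
  proof -
    have "A i \<inter> A j = {}" if "i < j" for i j :: nat
    proof -
      have "real (Suc i) \<le> real j" using that by (simp only: of_nat_le_iff Suc_le_eq)
      then show ?thesis by (auto simp: A_def)
    qed
    then show ?thesis using \<open>i \<noteq> j\<close> by (metis Int_commute linorder_neqE_nat)
  qed
  have sv: "(LBINT x:{0<..}. g x) = (\<Sum>k. v k)"
    unfolding v_def UA[symmetric] by (rule lebesgue_integral_countable_add[OF _ disj]) (use gi UA in \<open>auto simp: A_def\<close>)
  have one: "(LBINT x:A k. c) = c" for k and c :: real by (simp add: A_def set_lebesgue_integral_def)
  have ic: "set_integrable lborel (A k) (\<lambda>x. c)" for k and c :: real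
    by (simp add: A_def set_integrable_def)
  have lo: "g (real (Suc k)) \<le> v k" for k
  proof -
    have "(LBINT x:A k. g (real (Suc k))) \<le> v k"
      unfolding v_def by (rule set_integral_mono[OF ic Ai]) (auto simp: A_def intro!: anti)
    then show ?thesis by (simp add: one)
  qed
  have hi: "v (Suc k) \<le> g (real (Suc k))" for k
  proof -
    have "v (Suc k) \<le> (LBINT x:A (Suc k). g (real (Suc k)))"
      unfolding v_def by (rule set_integral_mono[OF Ai ic]) (auto simp: A_def intro!: anti)
    then show ?thesis by (simp add: one)
  qed
  \<comment> \<open>On (0, 1] one has exp (-q x) \<le> 1 \<le> e exp (-x), so the Gamma integral
    with q = 1 bounds the first cell for every q.\<close>
  have v0: "v 0 \<le> exp 1 * Gamma (2 - p)"
  proof -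
    have i1: "set_integrable lborel {0<..} (\<lambda>x. x powr (1 - p) * exp (- 1 * x))"
      and I1: "(LBINT x:{0<..}. x powr (1 - p) * exp (- 1 * x)) = Gamma (2 - p)"
      using gamma_half_line[of "1 - p" 1] p by auto
    have "v 0 \<le> (LBINT x:A 0. exp 1 * (x powr (1 - p) * exp (- 1 * x)))"
      unfolding v_def
    proof (rule set_integral_mono[OF Ai])
      show "set_integrable lborel (A 0) (\<lambda>x. exp 1 * (x powr (1 - p) * exp (- 1 * x)))"
        by (intro set_integrable_mult_right impI set_integrable_subset[OF i1]) (auto simp: A_def)
      fix x assume x: "x \<in> A 0"
      have "exp (- q * x) \<le> 1" using x q by (auto simp: A_def)
      also have "1 \<le> exp 1 * exp (- 1 * x)" using x by (auto simp: A_def simp flip: exp_add)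
      finally have "x powr (1 - p) * exp (- q * x) \<le> x powr (1 - p) * (exp 1 * exp (- 1 * x))"
        by (intro mult_left_mono) auto
      then show "g x \<le> exp 1 * (x powr (1 - p) * exp (- 1 * x))" by (simp add: g_def mult_ac)
    qed
    also have "\<dots> = exp 1 * (LBINT x:A 0. x powr (1 - p) * exp (- 1 * x))" by simp
    also have "\<dots> \<le> exp 1 * Gamma (2 - p)"
    proof (rule mult_left_mono)
      show "(LBINT x:A 0. x powr (1 - p) * exp (- 1 * x)) \<le> Gamma (2 - p)"
        unfolding I1[symmetric] set_lebesgue_integral_def
      proof (rule integral_mono)
        have "set_integrable lborel (A 0) (\<lambda>x. x powr (1 - p) * exp (- 1 * x))"
          by (rule set_integrable_subset[OF i1]) (auto simp: A_def)
        then show "integrable lborel (\<lambda>x. indicator (A 0) x *\<^sub>R (x powr (1 - p) * exp (- 1 * x)))"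
          by (simp add: set_integrable_def)
      qed (use i1 in \<open>auto simp: set_integrable_def A_def split: split_indicator\<close>)
    qed auto
    finally show ?thesis .
  qed
  have v_nn: "0 \<le> v k" for k using lo[of k] g0[of "real (Suc k)"] by linarith
  have gs: "summable (\<lambda>k. g (real (Suc k)))"
  proof (rule summable_comparison_test')
    define x where "x = exp (- q)"
    have x: "0 < x" "x < 1" using q by (auto simp: x_def)
    show "summable (\<lambda>k. x ^ Suc k)" using x by (subst summable_Suc_iff) (auto intro: summable_geometric)
    fix k
    have "exp (- q * real (Suc k)) = x ^ Suc k"
      unfolding x_def exp_of_nat_mult[symmetric] by (simp only: mult.commute mult_minus_left mult_minus_right)
    moreover have "real (Suc k) powr (1 - p) \<le> 1" using powr_mono[of "1 - p" 0 "real (Suc k)"] p by simp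
    ultimately show "norm (g (real (Suc k))) \<le> x ^ Suc k"
      unfolding g_def norm_mult using x by (simp only: real_norm_def abs_of_nonneg powr_ge_zero zero_le_power less_imp_le)
          (intro mult_left_le_one_le, auto simp del: power_Suc)
  qed
  have vs: "summable (\<lambda>k. v (Suc k))"
    by (rule summable_comparison_test'[OF gs, of 0]) (use hi v_nn in auto)
  then have vs': "summable v" by (subst (asm) summable_Suc_iff)
  have gsum: "(\<Sum>k. g (real (Suc k))) = polyexp_sum p q"
  proof -
    have "- q * real (Suc k) = - real (Suc k) * q" for k by (simp only: mult_minus_left mult.commute)
    then show ?thesis unfolding polyexp_sum_def g_def by (simp only:)
  qed
  have "polyexp_sum p q \<le> suminf v" unfolding gsum[symmetric] by (rule suminf_le[OF lo gs vs'])
  moreover have "suminf v \<le> exp 1 * Gamma (2 - p) + polyexp_sum p q"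
  proof -
    have "suminf v = (\<Sum>k. v (Suc k)) + v 0" using suminf_split_initial_segment[OF vs', of 1] by simp
    moreover have "(\<Sum>k. v (Suc k)) \<le> polyexp_sum p q" unfolding gsum[symmetric] by (rule suminf_le[OF hi vs gs])
    ultimately show ?thesis using v0 by linarith
  qed
  ultimately show ?thesis using gI sv by linarith
qed

lemma polyexp_sum_1: "q > 0 \<Longrightarrow> polyexp_sum 1 q = 1 / (exp q - 1)"
proof -
  assume q: "q > 0"
  define x where "x = exp (- q)"
  have x: "0 < x" "x < 1" using q by (auto simp: x_def)
  have e: "exp (- real (Suc k) * q) = x * x ^ k" for k
    using exp_of_nat_mult[of "Suc k" "- q"] unfolding x_def by (simp only: mult_minus_left mult_minus_right power_Suc)
  have "polyexp_sum 1 q = (\<Sum>k. x * x ^ k)"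
    unfolding polyexp_sum_def e by simp
  also have "\<dots> = x / (1 - x)" using x by (subst suminf_mult) (auto simp: suminf_geometric intro: summable_geometric)
  also have "\<dots> = 1 / (exp q - 1)" using q by (simp add: x_def exp_minus field_simps)
  finally show ?thesis .
qed

text \<open>
  The part of the off-diagonal integral that comes from \<open>\<Gamma>(2 - p) q\<^sup>p\<^sup>-\<^sup>2\<close>, the leading term of
  \<open>polyexp_sum p q\<close>, is homogeneous in the smoothing parameter \<open>N\<close>.
\<close>

definition pole_part :: "real \<Rightarrow> real \<Rightarrow> real \<Rightarrow> real" where
  "pole_part p \<tau> G = Gamma (2 - p) *
     (LBINT y:{0<..}. dsinh y powr (p - 2) * cos (\<tau> * y) * exp (- (G * y)\<^sup>2 / 2) * hcoth y powr (p - 2))"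

text \<open>The sign is main term minus sum, so \<open>rest_part\<close> is subtracted in
  \<open>polyexp_integral_split\<close>. For p = 1 this makes the kernel nonnegative.\<close>

definition rest_part :: "real \<Rightarrow> real \<Rightarrow> real \<Rightarrow> real \<Rightarrow> real" where
  "rest_part p N \<tau> G =
     (LBINT y:{0<..}. dsinh y powr (p - 2) * cos (\<tau> * y) * exp (- (G * y)\<^sup>2 / 2)
        * (Gamma (2 - p) * (hcoth y / N) powr (p - 2) - polyexp_sum p (hcoth y / N)))"

lemma gauss_exp_bound_1: "exp (- v\<^sup>2 / 2) \<le> exp 1 * exp (- (v::real))"
proof -
  have "0 \<le> (v - 1)\<^sup>2" by simp
  then have "- v\<^sup>2 / 2 \<le> 1 + - v" by (simp add: power2_eq_square algebra_simps)
  then show ?thesis by (simp flip: exp_add)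
qed

lemma polyexp_integral_split:
  assumes N: "N > 0" and p: "1 \<le> p" "p < 2" and G: "G \<ge> 1"
  shows "(LBINT y:{0<..}. dsinh y powr (p - 2) * cos (\<tau> * y) * exp (- (G * y)\<^sup>2 / 2) * polyexp_sum p (hcoth y / N))
       = N powr (2 - p) * pole_part p \<tau> G - rest_part p N \<tau> G"
    and "set_integrable lborel {0<..} (\<lambda>y. dsinh y powr (p - 2) * cos (\<tau> * y) * exp (- (G * y)\<^sup>2 / 2)
        * (Gamma (2 - p) * (hcoth y / N) powr (p - 2) - polyexp_sum p (hcoth y / N)))"
proof -
  define w where "w = (\<lambda>y. dsinh y powr (p - 2) * cos (\<tau> * y) * exp (- (G * y)\<^sup>2 / 2))"
  have G0: "G > 0" using G by simp
  note e = exp_integral_half_line[OF G0]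
  have i1: "set_integrable lborel {0<..} (\<lambda>y. w y * hcoth y powr (p - 2))"
  proof (rule set_integrable_half_line_bound(1))
    show "continuous_on {0<..} (\<lambda>y. w y * hcoth y powr (p - 2))"
    proof -
      have "dsinh x \<noteq> 0" "hcoth x \<noteq> 0" if "x > 0" for x
        using dsinh_pos[OF that] hcoth_ge_1[OF that] by auto
      then show ?thesis unfolding w_def by (intro continuous_intros) auto
    qed
    show "set_integrable lborel {0<..} (\<lambda>y. exp 1 * exp (- G * y))" using e by simp
    fix y :: real assume y: "0 < y"
    define s k where "s = dsinh y" and "k = hcoth y"
    have sk: "s > 0" "k > 1" "2 * s \<le> s\<^sup>2 * k" using dsinh_pos hcoth_ge_1 dsinh_hcoth_ge y by (auto simp: s_def k_def)
    have "s * 2 \<le> s * (s * k)" using sk(3) by (simp add: power2_eq_square mult_ac)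
    then have "1 \<le> s * k" using sk by simp
    then have "(s * k) powr (p - 2) \<le> (s * k) powr 0" using p by (intro powr_mono) auto
    then have le: "s powr (p - 2) * k powr (p - 2) \<le> 1" using sk \<open>1 \<le> s * k\<close> by (simp add: powr_mult)
    have "\<bar>w y * hcoth y powr (p - 2)\<bar> = (s powr (p - 2) * k powr (p - 2)) * \<bar>cos (\<tau> * y)\<bar> * exp (- (G * y)\<^sup>2 / 2)"
      by (simp add: w_def s_def k_def abs_mult)
    also have "\<dots> \<le> 1 * 1 * exp (- (G * y)\<^sup>2 / 2)" by (intro mult_mono le) auto
    also have "\<dots> \<le> exp 1 * exp (- G * y)" using gauss_exp_bound_1[of "G * y"] by simp
    finally show "\<bar>w y * hcoth y powr (p - 2)\<bar> \<le> exp 1 * exp (- G * y)" .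
  qed
  have i2: "set_integrable lborel {0<..} (\<lambda>y. w y * polyexp_sum p (hcoth y / N))"
    unfolding w_def by (rule offint_suminf(3)) (use assms in auto)
  define c where "c = Gamma (2 - p) * N powr (2 - p)"
  have eq: "w y * (Gamma (2 - p) * (hcoth y / N) powr (p - 2) - polyexp_sum p (hcoth y / N))
      = c * (w y * hcoth y powr (p - 2)) - w y * polyexp_sum p (hcoth y / N)" if "y > 0" for y
  proof -
    have "(hcoth y / N) powr (p - 2) = hcoth y powr (p - 2) * N powr (2 - p)"
      using N hcoth_ge_1[OF that] by (simp add: powr_divide powr_diff field_simps)
    then show ?thesis by (simp add: c_def algebra_simps)
  qed
  have i3: "set_integrable lborel {0<..} (\<lambda>y. c * (w y * hcoth y powr (p - 2)) - w y * polyexp_sum p (hcoth y / N))"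
    by (intro set_integral_diff i2 set_integrable_mult_right impI i1)
  have i4: "set_integrable lborel {0<..} (\<lambda>y. w y * (Gamma (2 - p) * (hcoth y / N) powr (p - 2) - polyexp_sum p (hcoth y / N)))"
    by (subst set_integrable_cong[OF refl refl eq]) (use i3 in auto)
  then show "set_integrable lborel {0<..} (\<lambda>y. dsinh y powr (p - 2) * cos (\<tau> * y) * exp (- (G * y)\<^sup>2 / 2)
        * (Gamma (2 - p) * (hcoth y / N) powr (p - 2) - polyexp_sum p (hcoth y / N)))"
    unfolding w_def .
  have "rest_part p N \<tau> G = (LBINT y:{0<..}. c * (w y * hcoth y powr (p - 2)) - w y * polyexp_sum p (hcoth y / N))"
    unfolding rest_part_def by (rule set_lebesgue_integral_cong) (use eq[unfolded w_def] in \<open>auto simp: w_def\<close>)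
  also have "\<dots> = (LBINT y:{0<..}. c * (w y * hcoth y powr (p - 2))) - (LBINT y:{0<..}. w y * polyexp_sum p (hcoth y / N))"
    by (intro set_integral_diff i2 set_integrable_mult_right impI i1)
  also have "(LBINT y:{0<..}. c * (w y * hcoth y powr (p - 2))) = N powr (2 - p) * pole_part p \<tau> G"
    by (simp add: pole_part_def w_def c_def)
  finally show "(LBINT y:{0<..}. dsinh y powr (p - 2) * cos (\<tau> * y) * exp (- (G * y)\<^sup>2 / 2) * polyexp_sum p (hcoth y / N))
       = N powr (2 - p) * pole_part p \<tau> G - rest_part p N \<tau> G"
    unfolding w_def by simp
qed

text \<open>The kernel is bounded, and y^(p - 2) is integrable at 0 precisely because p > 1; the
  Gaussian then gives G^(1 - p). The argument breaks down at p = 1, where y^-1 is not integrable and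
  the oscillation of cos (\<tau> y) must be used.\<close>

lemma rest_part_bound:
  assumes N: "N > 0" and p: "1 < p" "p < 2" and G: "G \<ge> 1"
  shows "\<bar>rest_part p N \<tau> G\<bar> \<le> (exp 1 * Gamma (2 - p) + 1) * exp 1 * Gamma (p - 1) * G powr (1 - p)"
proof -
  define B where "B = exp 1 * Gamma (2 - p) + 1"
  have B: "B \<ge> 0" using p by (auto simp: B_def intro!: add_nonneg_nonneg mult_nonneg_nonneg less_imp_le[OF Gamma_real_pos])
  have G0: "G > 0" using G by simp
  define f where "f = (\<lambda>y. dsinh y powr (p - 2) * cos (\<tau> * y) * exp (- (G * y)\<^sup>2 / 2)
        * (Gamma (2 - p) * (hcoth y / N) powr (p - 2) - polyexp_sum p (hcoth y / N)))"
  have fi: "set_integrable lborel {0<..} f" unfolding f_def by (rule polyexp_integral_split(2)) (use assms in auto)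
  have gi: "set_integrable lborel {0<..} (\<lambda>x. x powr (p - 2) * exp (- G * x))"
    and gI: "(LBINT x:{0<..}. x powr (p - 2) * exp (- G * x)) = Gamma (p - 1) * G powr (1 - p)"
    using gamma_half_line[of "p - 2" G] p G by auto
  have "\<bar>rest_part p N \<tau> G\<bar> \<le> (LBINT y:{0<..}. \<bar>f y\<bar>)"
    unfolding rest_part_def f_def[symmetric]
    using integral_norm_bound[of lborel "\<lambda>x. indicator {0<..} x *\<^sub>R f x"]
    by (simp add: set_lebesgue_integral_def abs_mult)
  also have "\<dots> \<le> (LBINT y:{0<..}. B * exp 1 * (y powr (p - 2) * exp (- G * y)))"
  proof (intro set_integral_mono set_integrable_abs fi set_integrable_mult_right impI gi)
    fix y :: real assume "y \<in> {0<..}"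
    then have y: "y > 0" by simp
    have q: "hcoth y / N > 0" using hcoth_ge_1[OF y] N by simp
    have "\<bar>f y\<bar> = dsinh y powr (p - 2) * \<bar>cos (\<tau> * y)\<bar> * exp (- (G * y)\<^sup>2 / 2)
        * \<bar>Gamma (2 - p) * (hcoth y / N) powr (p - 2) - polyexp_sum p (hcoth y / N)\<bar>"
      by (simp add: f_def abs_mult)
    also have "\<dots> \<le> y powr (p - 2) * 1 * (exp 1 * exp (- (G * y))) * B"
    proof (intro mult_mono gauss_exp_bound_1)
      show "dsinh y powr (p - 2) \<le> y powr (p - 2)"
        using dsinh_ge[of y] y p by (intro powr_mono2') auto
      show "\<bar>Gamma (2 - p) * (hcoth y / N) powr (p - 2) - polyexp_sum p (hcoth y / N)\<bar> \<le> B"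
        unfolding B_def by (rule polyexp_sum_approx[OF p q])
    qed auto
    finally show "\<bar>f y\<bar> \<le> B * exp 1 * (y powr (p - 2) * exp (- G * y))" by (simp add: mult_ac)
  qed
  also have "\<dots> = B * exp 1 * (Gamma (p - 1) * G powr (1 - p))" by (simp only: set_integral_mult_right gI)
  finally show ?thesis by (simp add: B_def mult_ac)
qed

section \<open>Gaussian means of zeta and of its smoothed series\<close>

lemma zeta_line_growth:
  assumes \<sigma>: "1/2 \<le> \<sigma>" "\<sigma> < 1"
  shows "norm (zeta (Complex \<sigma> t)) \<le> (3 + 2 / (1 - \<sigma>)) * (1 + \<bar>t\<bar>)"
proof -
  define s where "s = Complex \<sigma> t"
  have s: "Re s = \<sigma>" "s \<noteq> 1" using \<sigma> by (auto simp: s_def complex_eq_iff)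
  have ns: "norm s \<le> 1 + \<bar>t\<bar>" using cmod_le[of s] \<sigma> by (simp add: s_def)
  have "norm (1 - s) \<ge> 1 - \<sigma>" using abs_Re_le_cmod[of "1 - s"] \<sigma> by (simp add: s_def)
  then have "2 / norm (1 - s) \<le> 2 / (1 - \<sigma>)" using \<sigma> s by (intro divide_left_mono mult_pos_pos) auto
  also have "\<dots> \<le> 2 / (1 - \<sigma>) * (1 + \<bar>t\<bar>)" using \<sigma> by (simp add: mult_le_cancel_left1 distrib_left)
  finally have "norm (zeta s) \<le> 1 + 2 / (1 - \<sigma>) * (1 + \<bar>t\<bar>) + 2 * (1 + \<bar>t\<bar>)"
    using norm_zeta_le[of s] s \<sigma> ns by auto
  then show ?thesis unfolding s_def by (simp add: algebra_simps)
qed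

lemma one_minus_exp_bounds:
  assumes "N \<ge> (1::real)"
  shows "1 / (2 * N) \<le> 1 - exp (- 1 / N)" "1 - exp (- 1 / N) \<le> 1 / N"
proof -
  show "1 - exp (- 1 / N) \<le> 1 / N" using exp_ge_add_one_self[of "-1/N"] by simp
  have "1 + 1 / N \<le> exp (1 / N)" by (rule exp_ge_add_one_self)
  then have "exp (- 1 / N) \<le> 1 / (1 + 1 / N)" using assms by (simp add: exp_minus field_simps)
  also have "\<dots> = N / (N + 1)" using assms by (simp add: field_simps)
  also have "\<dots> \<le> 1 - 1 / (2 * N)" using assms by (simp add: field_simps)
  finally show "1 / (2 * N) \<le> 1 - exp (- 1 / N)" by simp
qed

text \<open>Uniform in N and t. The first term is the remainder of Euler summation; the second is
  the pole, of size sqrt N but concentrated near t = 0.\<close>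

lemma smoothed_zeta_error:
  assumes \<sigma>: "1/2 \<le> \<sigma>" "\<sigma> < 1"
  obtains C where "C \<ge> 0"
    "\<And>N t. N \<ge> 1 \<Longrightarrow> norm (smoothed_zeta (exp (- 1 / N)) (Complex \<sigma> t) - zeta (Complex \<sigma> t))
        \<le> C * ((1 + \<bar>t\<bar>) / sqrt N + sqrt N / (1 + t\<^sup>2))"
proof
  define C0 where "C0 = 3 + 2 / (1 - \<sigma>)"
  have C0: "C0 \<ge> 0" using \<sigma> by (auto simp: C0_def)
  define C where "C = C0 + 6 + 28 / (1 - \<sigma>)"
  show "C \<ge> 0" using C0 \<sigma> by (auto simp: C_def)
  fix N t :: real assume N: "N \<ge> 1"
  define s where "s = Complex \<sigma> t"
  define q where "q = 1 - exp (- 1 / N)"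
  have qb: "1 / (2 * N) \<le> q" "q \<le> 1 / N" using one_minus_exp_bounds[OF N] by (auto simp: q_def)
  have q: "q > 0" "q \<le> 1" 
  proof -
    have "1 / (2 * N) > 0" "1 / N \<le> 1" using N by auto
    then show "q > 0" "q \<le> 1" using qb by linarith+
  qed
  have s: "Re s = \<sigma>" "s \<noteq> 1" "s \<noteq> 2" using \<sigma> by (auto simp: s_def complex_eq_iff)
  have ns: "norm s \<le> 1 + \<bar>t\<bar>" using cmod_le[of s] \<sigma> by (simp add: s_def)
  have n1: "norm (1 - s) \<ge> (1 - \<sigma>) * sqrt (1 + t\<^sup>2)"
  proof -
    have "(1 - \<sigma>)\<^sup>2 * t\<^sup>2 \<le> 1 * t\<^sup>2" using \<sigma> by (intro mult_right_mono power_le_one) auto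
    then have "(1 - \<sigma>)\<^sup>2 * (1 + t\<^sup>2) \<le> (1 - \<sigma>)\<^sup>2 + t\<^sup>2" by (simp add: distrib_left)
    then have "sqrt ((1 - \<sigma>)\<^sup>2 * (1 + t\<^sup>2)) \<le> norm (1 - s)" by (simp add: cmod_def s_def)
    then show ?thesis using \<sigma> by (simp add: real_sqrt_mult)
  qed
  have n2: "norm (2 - s) \<ge> sqrt (1 + t\<^sup>2)"
  proof -
    have "1 \<le> (2 - \<sigma>)\<^sup>2" using \<sigma> by (intro one_le_power) auto
    then show ?thesis by (simp add: cmod_def s_def)
  qed
  have n12: "norm (1 - s) * norm (2 - s) \<ge> (1 - \<sigma>) * (1 + t\<^sup>2)"
  proof -
    have "((1 - \<sigma>) * sqrt (1 + t\<^sup>2)) * sqrt (1 + t\<^sup>2) \<le> norm (1 - s) * norm (2 - s)"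
      by (intro mult_mono n1 n2) auto
    then show ?thesis by (simp add: mult.assoc)
  qed
  have sq: "sqrt q \<le> 1 / sqrt N" using qb N real_sqrt_le_mono[of q "1/N"] by (simp add: real_sqrt_divide)
  have sq': "1 / sqrt q \<le> 2 * sqrt N"
  proof -
    have "sqrt (1 / (2 * N)) \<le> sqrt q" using qb(1) by (rule real_sqrt_le_mono)
    then have "1 / sqrt q \<le> 1 / sqrt (1 / (2 * N))" using q N by (intro divide_left_mono) auto
    also have "\<dots> = sqrt (2 * N)" using N by (simp add: real_sqrt_divide)
    also have "\<dots> \<le> sqrt (4 * N)" using N by (intro real_sqrt_le_mono) auto
    also have "\<dots> = 2 * sqrt N" by (simp only: real_sqrt_mult real_sqrt_four)
    finally show ?thesis .
  qed
  have qsq: "q \<le> sqrt q" using q real_sqrt_le_mono[of "q\<^sup>2" q] by (simp add: power2_eq_square mult_left_le)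
  have "norm (smoothed_zeta (exp (- 1 / N)) s - zeta s) \<le> q * norm (zeta s) + (14 / (sqrt q * norm (1 - s) * norm (2 - s)) + (2 + 4 * norm s) * sqrt q)"
    unfolding q_def by (rule smoothed_zeta_approx_aux) (use s \<sigma> N in auto)
  also have "\<dots> \<le> (1 / sqrt N) * (C0 * (1 + \<bar>t\<bar>)) + (28 / (1 - \<sigma>) * (sqrt N / (1 + t\<^sup>2)) + (6 * (1 + \<bar>t\<bar>)) * (1 / sqrt N))"
  proof (intro add_mono)
    show "q * norm (zeta s) \<le> (1 / sqrt N) * (C0 * (1 + \<bar>t\<bar>))"
      using qsq sq zeta_line_growth[OF \<sigma>, of t] q N by (intro mult_mono) (auto simp: s_def C0_def)
    show "(2 + 4 * norm s) * sqrt q \<le> (6 * (1 + \<bar>t\<bar>)) * (1 / sqrt N)"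
      using ns sq q by (intro mult_mono) auto
    have pos: "(1 - \<sigma>) * (1 + t\<^sup>2) > 0" using \<sigma> by (intro mult_pos_pos) (auto intro: add_pos_nonneg)
    have "14 / (sqrt q * norm (1 - s) * norm (2 - s)) = 14 * (1 / sqrt q) * (1 / (norm (1 - s) * norm (2 - s)))" by simp
    also have "\<dots> \<le> 14 * (2 * sqrt N) * (1 / ((1 - \<sigma>) * (1 + t\<^sup>2)))"
    proof (intro mult_mono)
      show "1 / (norm (1 - s) * norm (2 - s)) \<le> 1 / ((1 - \<sigma>) * (1 + t\<^sup>2))"
        by (rule divide_left_mono[OF n12 zero_le_one mult_pos_pos[OF less_le_trans[OF pos n12] pos]])
    qed (use sq' N q in auto)
    also have "\<dots> = 28 / (1 - \<sigma>) * (sqrt N / (1 + t\<^sup>2))" by simp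
    finally show "14 / (sqrt q * norm (1 - s) * norm (2 - s)) \<le> 28 / (1 - \<sigma>) * (sqrt N / (1 + t\<^sup>2))" .
  qed
  also have "\<dots> = (C0 + 6) * ((1 + \<bar>t\<bar>) / sqrt N) + 28 / (1 - \<sigma>) * (sqrt N / (1 + t\<^sup>2))"
  proof -
    have "(1 / n) * (C0 * a) + (k + (6 * a) * (1 / n)) = (C0 + 6) * (a / n) + k" for n a k :: real
      by (simp add: distrib_right add_divide_distrib)
    then show ?thesis .
  qed
  also have "\<dots> \<le> C * ((1 + \<bar>t\<bar>) / sqrt N) + C * (sqrt N / (1 + t\<^sup>2))"
    using \<sigma> C0 N by (intro add_mono mult_right_mono) (auto simp: C_def)
  finally show "norm (smoothed_zeta (exp (- 1 / N)) (Complex \<sigma> t) - zeta (Complex \<sigma> t))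
        \<le> C * ((1 + \<bar>t\<bar>) / sqrt N + sqrt N / (1 + t\<^sup>2))" by (simp add: s_def distrib_left)
qed

lemma gauss_integrable_poly:
  fixes f :: "real \<Rightarrow> real"
  assumes "f \<in> borel_measurable borel" "\<And>x. \<bar>f x\<bar> \<le> a + b * x ^ k"
  shows "integrable gauss f"
proof (rule Bochner_Integration.integrable_bound)
  show "integrable gauss (\<lambda>x. a + b * x ^ k)"
    by (intro Bochner_Integration.integrable_add integrable_mult_right integrable_std_normal_distribution_moment) auto
  show "AE x in gauss. norm (f x) \<le> norm (a + b * x ^ k)" using assms(2) by (auto intro!: AE_I2 order_trans[OF assms(2)])
qed (use assms in simp)

lemma continuous_on_zeta_line:
  assumes "\<sigma> \<noteq> 1" shows "continuous_on A (\<lambda>t. zeta (Complex \<sigma> t))"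
proof -
  have "continuous_on A (\<lambda>t. zeta (Complex \<sigma> t))"
  proof (rule continuous_on_compose2[OF holomorphic_on_imp_continuous_on[OF zeta_holomorphic]])
    have "(\<lambda>t. Complex \<sigma> t) = (\<lambda>t. of_real \<sigma> + \<i> * of_real t)" by (simp add: complex_eq_iff fun_eq_iff)
    then show "continuous_on A (\<lambda>t. Complex \<sigma> t)" by (simp add: continuous_intros)
  qed (use assms in \<open>auto simp: complex_eq_iff\<close>)
  then show ?thesis .
qed

lemma smoothed_zeta_line_measurable [measurable]: "(\<lambda>t. smoothed_zeta r (Complex \<sigma> t)) \<in> borel_measurable borel"
  unfolding smoothed_zeta_trig
  by (intro borel_measurable_suminf borel_measurable_continuous_onI continuous_intros)

lemma smoothed_zeta_line_bounded:
  assumes "0 \<le> \<sigma>" "0 < r" "r < 1"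
  shows "norm (smoothed_zeta r (Complex \<sigma> t)) \<le> 1 / (1 - r)"
  unfolding smoothed_zeta_trig
proof (rule norm_suminf_bound(2))
  show "summable (\<lambda>n. r ^ n)" "(\<Sum>n. r ^ n) \<le> 1 / (1 - r)" using assms by (auto simp: suminf_geometric intro: summable_geometric)
  fix n
  have "norm (complex_of_real (real (Suc n) powr (-\<sigma>) * r ^ Suc n) * cis (- ln (real (Suc n)) * t)) = real (Suc n) powr (-\<sigma>) * r ^ Suc n"
    using assms by (simp add: norm_mult norm_power)
  also have "\<dots> \<le> 1 * r ^ Suc n"
    using powr_mono[of "-\<sigma>" 0 "real (Suc n)"] assms by (intro mult_right_mono) auto
  also have "\<dots> \<le> r ^ n" using assms by (simp add: mult_left_le_one_le)
  finally show "norm (complex_of_real (real (Suc n) powr (-\<sigma>) * r ^ Suc n) * cis (- ln (real (Suc n)) * t)) \<le> r ^ n" .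
qed

text \<open>The pole term is large only near t = 0, which requires |G X| \<ge> \<tau> / 2. A
  Chebyshev argument with the eighth moment E X^8 = 105 turns this into (2 G / \<tau>)^8; elsewhere
  t \<ge> \<tau> / 2 and the term is at most 16 N / \<tau>^4.\<close>

lemma gauss_mean_error_bound:
  fixes C N \<tau> G :: real
  assumes "\<tau> > 0" "G > 0" "N \<ge> 1"
  defines "e \<equiv> \<lambda>t. (C * ((1 + \<bar>t\<bar>) / sqrt N + sqrt N / (1 + t\<^sup>2)))\<^sup>2"
  shows "integrable gauss (\<lambda>x. e (\<tau> + G * x))"
    and "gauss_mean e \<tau> G \<le> 2 * C\<^sup>2 * (3 * (1 + \<tau>\<^sup>2 + G\<^sup>2) / N + N * (16 / \<tau> ^ 4 + 105 * (2 * G / \<tau>) ^ 8))"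
proof -
  define g where "g = (\<lambda>x. 2 * C\<^sup>2 * (3 * (1 + \<tau>\<^sup>2 + G\<^sup>2 * x ^ (2 * 1)) / N + N * (16 / \<tau> ^ 4 + (2 * G / \<tau>) ^ 8 * x ^ (2 * 4))))"
  have gi: "integrable gauss g"
    unfolding g_def
    by (intro integrable_mult_right Bochner_Integration.integrable_add integrable_divide std_normal_distribution_even_moments) auto
  have "integral\<^sup>L gauss g = 2 * C\<^sup>2 * (3 * (1 + \<tau>\<^sup>2 + G\<^sup>2 * 1) / N + N * (16 / \<tau> ^ 4 + (2 * G / \<tau>) ^ 8 * 105))"
  proof -
    note m = std_normal_distribution_even_moments[of 1] std_normal_distribution_even_moments[of 4]
    have f: "(fact 8 :: real) = 40320" "(fact 4 :: real) = 24" by (simp_all add: fact_numeral)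
    show ?thesis unfolding g_def
      using m by (simp add: gauss.prob_space[simplified] f)
  qed
  then have gI: "integral\<^sup>L gauss g = 2 * C\<^sup>2 * (3 * (1 + \<tau>\<^sup>2 + G\<^sup>2) / N + N * (16 / \<tau> ^ 4 + 105 * (2 * G / \<tau>) ^ 8))"
    by (simp add: mult.commute)
  have le: "e (\<tau> + G * x) \<le> g x" for x
  proof -
    define t where "t = \<tau> + G * x"
    define A B where "A = (1 + \<bar>t\<bar>) / sqrt N" and "B = sqrt N / (1 + t\<^sup>2)"
    have "e t = C\<^sup>2 * (A + B)\<^sup>2" by (simp add: e_def A_def B_def power_mult_distrib)
    also have "\<dots> \<le> C\<^sup>2 * (2 * (A\<^sup>2 + B\<^sup>2))"
      using sum_squares_bound[of A B] by (intro mult_left_mono) (auto simp: power2_sum)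
    finally have eAB: "e t \<le> C\<^sup>2 * (2 * (A\<^sup>2 + B\<^sup>2))" .
    have A2: "A\<^sup>2 \<le> 3 * (1 + \<tau>\<^sup>2 + G\<^sup>2 * x ^ (2 * 1)) / N"
    proof -
      have sq: "(a + b + c)\<^sup>2 \<le> 3 * (a\<^sup>2 + b\<^sup>2 + c\<^sup>2)" for a b c :: real
        using sum_squares_bound[of a b] sum_squares_bound[of a c] sum_squares_bound[of b c]
        by (simp add: power2_eq_square algebra_simps)
      have "(1 + \<bar>t\<bar>)\<^sup>2 \<le> (1 + \<bar>\<tau>\<bar> + \<bar>G * x\<bar>)\<^sup>2" unfolding t_def by (intro power_mono) auto
      also have "\<dots> \<le> 3 * (1\<^sup>2 + \<bar>\<tau>\<bar>\<^sup>2 + \<bar>G * x\<bar>\<^sup>2)" by (rule sq)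
      also have "\<dots> = 3 * (1 + \<tau>\<^sup>2 + G\<^sup>2 * x ^ (2 * 1))" by (simp add: power_mult_distrib)
      finally show ?thesis using assms by (simp add: A_def power_divide divide_right_mono)
    qed
    have Bsq: "B\<^sup>2 = N * (1 / (1 + t\<^sup>2)\<^sup>2)" using assms by (simp add: B_def power_divide)
    have p1: "0 < 1 + t\<^sup>2" by (intro add_pos_nonneg) auto
    have "1 / (1 + t\<^sup>2)\<^sup>2 \<le> 16 / \<tau> ^ 4 + (2 * G / \<tau>) ^ 8 * x ^ (2 * 4)"
    proof (cases "\<bar>G * x\<bar> \<le> \<tau> / 2")
      case True
      then have "\<tau> / 2 \<le> t" unfolding t_def by linarith
      then have "(\<tau> / 2)\<^sup>2 \<le> t\<^sup>2" using assms by (intro power_mono) auto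
      then have "((\<tau> / 2)\<^sup>2)\<^sup>2 \<le> (1 + t\<^sup>2)\<^sup>2" by (intro power_mono) auto
      moreover have "((\<tau> / 2)\<^sup>2)\<^sup>2 = \<tau> ^ 4 / 16" by (simp add: power_divide)
      ultimately have "\<tau> ^ 4 / 16 \<le> (1 + t\<^sup>2)\<^sup>2" by (simp only:)
      then have "1 / (1 + t\<^sup>2)\<^sup>2 \<le> 1 / (\<tau> ^ 4 / 16)"
        by (rule divide_left_mono) (use assms p1 in \<open>auto intro!: mult_pos_pos\<close>)
      also have "1 / (\<tau> ^ 4 / 16) = 16 / \<tau> ^ 4" by simp
      finally have le: "1 / (1 + t\<^sup>2)\<^sup>2 \<le> 16 / \<tau> ^ 4" .
      have "0 \<le> (2 * G / \<tau>) ^ 8 * x ^ (2 * 4)" using assms by (intro mult_nonneg_nonneg) auto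
      then show ?thesis using le by (rule add_increasing2)
    next
      case False
      then have "1 \<le> 2 * \<bar>G * x\<bar> / \<tau>" using assms by (simp add: le_divide_eq)
      also have "\<dots> = \<bar>2 * G / \<tau> * x\<bar>" using assms by (simp add: abs_mult)
      finally have "1 \<le> \<bar>2 * G / \<tau> * x\<bar>" .
      then have "1 \<le> \<bar>2 * G / \<tau> * x\<bar> ^ 8" by (rule one_le_power)
      also have "\<dots> = (2 * G / \<tau> * x) ^ 8" by (rule power_even_abs) simp
      also have "\<dots> = (2 * G / \<tau>) ^ 8 * x ^ (2 * 4)" by (simp only: power_mult_distrib) simp
      finally have 1: "1 \<le> (2 * G / \<tau>) ^ 8 * x ^ (2 * 4)" .
      have "1 \<le> (1 + t\<^sup>2)\<^sup>2" by (intro one_le_power) auto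
      then have "1 / (1 + t\<^sup>2)\<^sup>2 \<le> 1 / 1" by (rule divide_left_mono) (use p1 in \<open>auto intro!: mult_pos_pos\<close>)
      also have "1 / 1 \<le> 16 / \<tau> ^ 4 + (2 * G / \<tau>) ^ 8 * x ^ (2 * 4)"
        unfolding div_by_1 by (rule add_increasing[OF _ 1]) (use assms in simp)
      finally show ?thesis .
    qed
    then have B2: "B\<^sup>2 \<le> N * (16 / \<tau> ^ 4 + (2 * G / \<tau>) ^ 8 * x ^ (2 * 4))"
      unfolding Bsq by (rule mult_left_mono) (use assms in simp)
    have "C\<^sup>2 * (2 * (A\<^sup>2 + B\<^sup>2)) \<le> C\<^sup>2 * (2 * (3 * (1 + \<tau>\<^sup>2 + G\<^sup>2 * x ^ (2 * 1)) / N + N * (16 / \<tau> ^ 4 + (2 * G / \<tau>) ^ 8 * x ^ (2 * 4))))"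
      by (rule mult_left_mono[OF mult_left_mono[OF add_mono[OF A2 B2]]]) auto
    also have "\<dots> = g x" unfolding g_def by (simp only: mult.left_commute[of "C\<^sup>2"] mult.assoc)
    finally show ?thesis using eAB unfolding t_def by (rule order_trans[rotated])
  qed
  have em: "(\<lambda>x. e (\<tau> + G * x)) \<in> borel_measurable gauss" unfolding e_def by simp
  show ei: "integrable gauss (\<lambda>x. e (\<tau> + G * x))"
    by (rule Bochner_Integration.integrable_bound[OF gi em]) (use le in \<open>auto intro!: AE_I2 simp: e_def intro: order_trans[OF _ abs_ge_self]\<close>)
  show "gauss_mean e \<tau> G \<le> 2 * C\<^sup>2 * (3 * (1 + \<tau>\<^sup>2 + G\<^sup>2) / N + N * (16 / \<tau> ^ 4 + 105 * (2 * G / \<tau>) ^ 8))"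
    unfolding gauss_mean_def gI[symmetric] by (rule integral_mono[OF ei gi le])
qed

text \<open>Pointwise |b^2 - a^2| \<le> 2 a d + d^2 with 2 a d \<le> \<eta> a^2 + d^2 / \<eta>. The
  free parameter \<eta> replaces a Cauchy-Schwarz estimate of the means, and the same pointwise
  inequality shows that |zeta|^2 is integrable at all.\<close>

lemma gauss_mean_compare:
  assumes \<sigma>: "1/2 \<le> \<sigma>" "\<sigma> < 1" and "\<tau> > 0" "G > 0" "N \<ge> 1" "\<eta> > 0"
    and C: "\<And>t. norm (smoothed_zeta (exp (- 1 / N)) (Complex \<sigma> t) - zeta (Complex \<sigma> t))
        \<le> C * ((1 + \<bar>t\<bar>) / sqrt N + sqrt N / (1 + t\<^sup>2))"
  shows "\<bar>gauss_mean (\<lambda>t. (norm (zeta (Complex \<sigma> t)))\<^sup>2) \<tau> G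
        - gauss_mean (\<lambda>t. (norm (smoothed_zeta (exp (- 1 / N)) (Complex \<sigma> t)))\<^sup>2) \<tau> G\<bar>
      \<le> \<eta> * gauss_mean (\<lambda>t. (norm (smoothed_zeta (exp (- 1 / N)) (Complex \<sigma> t)))\<^sup>2) \<tau> G
       + (1 + 1 / \<eta>) * (2 * C\<^sup>2 * (3 * (1 + \<tau>\<^sup>2 + G\<^sup>2) / N + N * (16 / \<tau> ^ 4 + 105 * (2 * G / \<tau>) ^ 8)))"
proof -
  define S where "S = (\<lambda>t. (norm (smoothed_zeta (exp (- 1 / N)) (Complex \<sigma> t)))\<^sup>2)"
  define Z where "Z = (\<lambda>t. (norm (zeta (Complex \<sigma> t)))\<^sup>2)"
  define e where "e = (\<lambda>t. (C * ((1 + \<bar>t\<bar>) / sqrt N + sqrt N / (1 + t\<^sup>2)))\<^sup>2)"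
  have r: "0 < exp (- 1 / N)" "exp (- 1 / N) < 1" using assms by auto
  have pt: "\<bar>Z t - S t\<bar> \<le> \<eta> * S t + (1 + 1 / \<eta>) * e t" for t
  proof -
    define a b d where "a = norm (smoothed_zeta (exp (- 1 / N)) (Complex \<sigma> t))"
      and "b = norm (zeta (Complex \<sigma> t))" and "d = norm (smoothed_zeta (exp (- 1 / N)) (Complex \<sigma> t) - zeta (Complex \<sigma> t))"
    have nn: "0 \<le> a" "0 \<le> b" "0 \<le> d" by (auto simp: a_def b_def d_def)
    have ab: "\<bar>b - a\<bar> \<le> d" unfolding a_def b_def d_def by (metis norm_triangle_ineq3 abs_minus_commute)
    have "d\<^sup>2 \<le> e t" unfolding d_def e_def by (intro power_mono C) auto
    have "\<bar>b\<^sup>2 - a\<^sup>2\<bar> = \<bar>b - a\<bar> * (b + a)" using nn by (simp add: square_diff_square_factored power2_eq_square abs_mult mult.commute)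
    also have "\<dots> \<le> d * (2 * a + d)" using ab nn by (intro mult_mono) auto
    also have "\<dots> = 2 * a * d + d\<^sup>2" by (simp add: power2_eq_square algebra_simps)
    also have "2 * a * d \<le> \<eta> * a\<^sup>2 + d\<^sup>2 / \<eta>"
    proof -
      have "0 \<le> (\<eta> * a - d)\<^sup>2" by simp
      then have "\<eta> * (2 * a * d) \<le> \<eta> * (\<eta> * a\<^sup>2 + d\<^sup>2 / \<eta>)" using \<open>\<eta> > 0\<close>
        by (simp add: power2_eq_square algebra_simps)
      then show ?thesis using \<open>\<eta> > 0\<close> by simp
    qed
    finally have "\<bar>b\<^sup>2 - a\<^sup>2\<bar> \<le> \<eta> * a\<^sup>2 + (1 + 1 / \<eta>) * d\<^sup>2" by (simp add: algebra_simps)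
    also have "\<dots> \<le> \<eta> * a\<^sup>2 + (1 + 1 / \<eta>) * e t"
      using \<open>d\<^sup>2 \<le> e t\<close> \<open>\<eta> > 0\<close> by (intro add_left_mono mult_left_mono) auto
    finally show ?thesis by (simp add: Z_def S_def a_def b_def)
  qed
  have ei: "integrable gauss (\<lambda>x. e (\<tau> + G * x))" and eI: "gauss_mean e \<tau> G \<le> 2 * C\<^sup>2 * (3 * (1 + \<tau>\<^sup>2 + G\<^sup>2) / N + N * (16 / \<tau> ^ 4 + 105 * (2 * G / \<tau>) ^ 8))"
    unfolding e_def by (rule gauss_mean_error_bound; use assms in simp)+
  have Si: "integrable gauss (\<lambda>x. S (\<tau> + G * x))"
  proof (rule gauss_integrable_bounded)
    have [measurable]: "S \<in> borel_measurable borel" unfolding S_def by measurable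
    show "(\<lambda>x. S (\<tau> + G * x)) \<in> borel_measurable borel" by measurable
    show "\<bar>S (\<tau> + G * x)\<bar> \<le> (1 / (1 - exp (- 1 / N)))\<^sup>2" for x
      unfolding S_def using smoothed_zeta_line_bounded[OF _ r, of \<sigma>] \<sigma> by (simp add: power_mono)
  qed
  have Zc: "continuous_on UNIV Z" unfolding Z_def using \<sigma> by (intro continuous_intros continuous_on_zeta_line) auto
  have Zm [measurable]: "Z \<in> borel_measurable borel" by (rule borel_measurable_continuous_onI[OF Zc])
  have ri: "integrable gauss (\<lambda>x. \<eta> * S (\<tau> + G * x) + (1 + 1 / \<eta>) * e (\<tau> + G * x))"
    by (intro Bochner_Integration.integrable_add integrable_mult_right Si ei)
  have di: "integrable gauss (\<lambda>x. Z (\<tau> + G * x) - S (\<tau> + G * x))"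
  proof (rule Bochner_Integration.integrable_bound[OF ri])
    have [measurable]: "S \<in> borel_measurable borel" unfolding S_def by measurable
    show "(\<lambda>x. Z (\<tau> + G * x) - S (\<tau> + G * x)) \<in> borel_measurable gauss" by simp
  qed (use pt in \<open>auto intro!: AE_I2 intro: order_trans[OF _ abs_ge_self]\<close>)
  have Zi: "integrable gauss (\<lambda>x. Z (\<tau> + G * x))" using Bochner_Integration.integrable_add[OF di Si] by simp
  have "gauss_mean Z \<tau> G - gauss_mean S \<tau> G = (\<integral>x. Z (\<tau> + G * x) - S (\<tau> + G * x) \<partial>gauss)"
    unfolding gauss_mean_def by (rule Bochner_Integration.integral_diff[OF Zi Si, symmetric])
  then have "\<bar>gauss_mean Z \<tau> G - gauss_mean S \<tau> G\<bar> \<le> (\<integral>x. \<bar>Z (\<tau> + G * x) - S (\<tau> + G * x)\<bar> \<partial>gauss)" by (simp only: integral_abs_bound)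
  also have "\<dots> \<le> (\<integral>x. \<eta> * S (\<tau> + G * x) + (1 + 1 / \<eta>) * e (\<tau> + G * x) \<partial>gauss)"
    by (rule integral_mono[OF integrable_abs[OF di] ri]) (rule pt)
  also have "\<dots> = \<eta> * gauss_mean S \<tau> G + (1 + 1 / \<eta>) * gauss_mean e \<tau> G"
    unfolding gauss_mean_def
    by (subst Bochner_Integration.integral_add[OF integrable_mult_right[OF Si] integrable_mult_right[OF ei]]) simp
  also have "\<dots> \<le> \<eta> * gauss_mean S \<tau> G + (1 + 1 / \<eta>) * (2 * C\<^sup>2 * (3 * (1 + \<tau>\<^sup>2 + G\<^sup>2) / N + N * (16 / \<tau> ^ 4 + 105 * (2 * G / \<tau>) ^ 8)))"
    using \<open>\<eta> > 0\<close> by (intro add_left_mono mult_left_mono eI) auto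
  finally show ?thesis by (simp add: Z_def S_def)
qed

text \<open>
  Two smoothed sums with parameters \<open>N\<close> and \<open>2N\<close> are both close to \<open>\<zeta>\<close>, while their pole parts \<open>X\<close>
  differ by the factor \<open>\<kappa> \<noteq> 1\<close>; hence \<open>X\<close> is negligible.
\<close>

lemma pole_part_negligible:
  fixes a b z d1 d2 X e1 e2 \<eta> \<delta> l :: "'i \<Rightarrow> real" and \<kappa> :: real
  assumes \<kappa>: "\<kappa> > 1"
    and a: "\<forall>\<^sub>F i in F. a i = d1 i + X i + e1 i" and b: "\<forall>\<^sub>F i in F. b i = d2 i + \<kappa> * X i + e2 i"
    and za: "\<forall>\<^sub>F i in F. \<bar>z i - a i\<bar> \<le> \<eta> i * \<bar>a i\<bar> + \<delta> i" and zb: "\<forall>\<^sub>F i in F. \<bar>z i - b i\<bar> \<le> \<eta> i * \<bar>b i\<bar> + \<delta> i"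
    and \<eta>0: "\<forall>\<^sub>F i in F. \<eta> i \<ge> 0"
    and d1: "((\<lambda>i. d1 i - l i) \<longlongrightarrow> 0) F" and d2: "((\<lambda>i. d2 i - l i) \<longlongrightarrow> 0) F"
    and e1: "(e1 \<longlongrightarrow> 0) F" and e2: "(e2 \<longlongrightarrow> 0) F" and \<eta>: "(\<eta> \<longlongrightarrow> 0) F" and \<eta>l: "((\<lambda>i. \<eta> i * l i) \<longlongrightarrow> 0) F"
    and \<delta>: "(\<delta> \<longlongrightarrow> 0) F"
  shows "((\<lambda>i. z i - l i) \<longlongrightarrow> 0) F"
proof -
  \<comment> \<open>The diagonal terms d1 and d2 may grow like l, which is logarithmic on the
    critical line; \<eta> must beat this growth.\<close>
  have \<eta>d1: "((\<lambda>i. \<eta> i * d1 i) \<longlongrightarrow> 0) F" and \<eta>d2: "((\<lambda>i. \<eta> i * d2 i) \<longlongrightarrow> 0) F"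
    using tendsto_add[OF \<eta>l tendsto_mult[OF \<eta> d1]] tendsto_add[OF \<eta>l tendsto_mult[OF \<eta> d2]]
    by (simp_all add: algebra_simps)
  define \<omega> where "\<omega> = (\<lambda>i. \<bar>d1 i - l i\<bar> + \<bar>d2 i - l i\<bar> + \<bar>e1 i\<bar> + \<bar>e2 i\<bar> + (\<bar>\<eta> i * d1 i\<bar> + \<bar>\<eta> i * d2 i\<bar> + \<eta> i * \<bar>e1 i\<bar> + \<eta> i * \<bar>e2 i\<bar>) + 2 * \<delta> i)"
  have \<omega>: "(\<omega> \<longlongrightarrow> 0) F"
    unfolding \<omega>_def by (rule d1 d2 e1 e2 \<eta> \<delta> \<eta>d1 \<eta>d2 | rule tendsto_add_zero tendsto_rabs_zero tendsto_mult_right_zero | rule tendsto_mult_zero)+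
  \<comment> \<open>The comparison errors contain \<eta> |X| and \<eta> \<kappa> |X|. Moved to the
    left they reduce the coefficient \<kappa> - 1 of |X| to this one, which stays positive.\<close>
  have "((\<lambda>i. \<kappa> - 1 - \<eta> i * (1 + \<kappa>)) \<longlongrightarrow> \<kappa> - 1) F" using \<eta> by (auto intro!: tendsto_eq_intros)
  then have ev: "\<forall>\<^sub>F i in F. \<kappa> - 1 - \<eta> i * (1 + \<kappa>) > (\<kappa> - 1) / 2" by (rule order_tendstoD(1)) (use \<kappa> in auto)
  have Xb: "\<forall>\<^sub>F i in F. norm (X i) \<le> 2 / (\<kappa> - 1) * \<omega> i"
    using a b za zb \<eta>0 ev
  proof eventually_elim
    case (elim i)
    have ai: "\<bar>a i\<bar> \<le> \<bar>d1 i\<bar> + \<bar>X i\<bar> + \<bar>e1 i\<bar>" using elim(1) by linarith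
    have bi: "\<bar>b i\<bar> \<le> \<bar>d2 i\<bar> + \<kappa> * \<bar>X i\<bar> + \<bar>e2 i\<bar>"
    proof -
      have "\<bar>\<kappa> * X i\<bar> = \<kappa> * \<bar>X i\<bar>" using \<kappa> by (simp add: abs_mult)
      then show ?thesis using elim(2) by linarith
    qed
    have ea: "\<eta> i * \<bar>a i\<bar> \<le> \<bar>\<eta> i * d1 i\<bar> + \<eta> i * \<bar>X i\<bar> + \<eta> i * \<bar>e1 i\<bar>"
      using mult_left_mono[OF ai elim(5)] elim(5) by (simp add: abs_mult algebra_simps)
    have eb: "\<eta> i * \<bar>b i\<bar> \<le> \<bar>\<eta> i * d2 i\<bar> + \<eta> i * \<kappa> * \<bar>X i\<bar> + \<eta> i * \<bar>e2 i\<bar>"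
      using mult_left_mono[OF bi elim(5)] elim(5) by (simp add: abs_mult algebra_simps)
    have "(\<kappa> - 1) * \<bar>X i\<bar> = \<bar>(\<kappa> - 1) * X i\<bar>" using \<kappa> by (simp add: abs_mult)
    also have "(\<kappa> - 1) * X i = (b i - a i) - (d2 i - l i) + (d1 i - l i) - e2 i + e1 i"
      using elim(1,2) by (simp add: algebra_simps)
    also have "\<bar>\<dots>\<bar> \<le> \<bar>z i - a i\<bar> + \<bar>z i - b i\<bar> + \<bar>d2 i - l i\<bar> + \<bar>d1 i - l i\<bar> + \<bar>e2 i\<bar> + \<bar>e1 i\<bar>"
      by linarith
    finally have "(\<kappa> - 1) * \<bar>X i\<bar> \<le> \<omega> i + \<eta> i * \<bar>X i\<bar> + \<eta> i * \<kappa> * \<bar>X i\<bar>"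
      using elim(3,4) ea eb unfolding \<omega>_def by linarith
    then have "(\<kappa> - 1 - \<eta> i * (1 + \<kappa>)) * \<bar>X i\<bar> \<le> \<omega> i" by (simp add: algebra_simps)
    moreover have "(\<kappa> - 1) / 2 * \<bar>X i\<bar> \<le> (\<kappa> - 1 - \<eta> i * (1 + \<kappa>)) * \<bar>X i\<bar>"
      using elim(6) by (intro mult_right_mono) auto
    ultimately have "(\<kappa> - 1) / 2 * \<bar>X i\<bar> \<le> \<omega> i" by linarith
    then show ?case using \<kappa> by (simp add: field_simps)
  qed
  have "((\<lambda>i. 2 / (\<kappa> - 1) * \<omega> i) \<longlongrightarrow> 0) F" using \<omega> by (rule tendsto_mult_right_zero)
  then have X: "(X \<longlongrightarrow> 0) F" by (rule Lim_null_comparison[OF Xb])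
  define \<psi> where "\<psi> = (\<lambda>i. \<bar>d1 i - l i\<bar> + \<bar>X i\<bar> + \<bar>e1 i\<bar> + (\<bar>\<eta> i * d1 i\<bar> + \<eta> i * \<bar>X i\<bar> + \<eta> i * \<bar>e1 i\<bar>) + \<delta> i)"
  have \<psi>: "(\<psi> \<longlongrightarrow> 0) F" unfolding \<psi>_def by (rule d1 d2 e1 e2 \<eta> \<delta> \<eta>d1 \<eta>d2 X | rule tendsto_add_zero tendsto_rabs_zero tendsto_mult_right_zero | rule tendsto_mult_zero)+
  have "\<forall>\<^sub>F i in F. norm (z i - l i) \<le> \<psi> i"
    using a za \<eta>0
  proof eventually_elim
    case (elim i)
    have ai: "\<bar>a i\<bar> \<le> \<bar>d1 i\<bar> + \<bar>X i\<bar> + \<bar>e1 i\<bar>" using elim(1) by linarith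
    have ea: "\<eta> i * \<bar>a i\<bar> \<le> \<bar>\<eta> i * d1 i\<bar> + \<eta> i * \<bar>X i\<bar> + \<eta> i * \<bar>e1 i\<bar>"
      using mult_left_mono[OF ai elim(3)] elim(3) by (simp add: abs_mult algebra_simps)
    have "\<bar>z i - l i\<bar> \<le> \<bar>z i - a i\<bar> + \<bar>d1 i - l i\<bar> + \<bar>X i\<bar> + \<bar>e1 i\<bar>" using elim(1) by linarith
    then show ?case using elim(2) ea unfolding \<psi>_def by simp
  qed
  then show ?thesis by (rule Lim_null_comparison[OF _ \<psi>])
qed

section \<open>Local means\<close>

text \<open>
  Limits for a centre \<open>\<tau> \<rightarrow> \<infinity>\<close> and a width \<open>G\<close> of order \<open>\<tau>\<^sup>3\<^sup>/\<^sup>5\<close>, uniformly in \<open>G\<close>. The exponent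
  only has to lie strictly between 1/2 (Euler summation of the off-diagonal terms) and 1.
\<close>

definition width_range :: "real \<Rightarrow> real set" where
  "width_range \<tau> = {\<tau> powr (3/5) / 2 .. 2 * \<tau> powr (3/5)}"

definition window_filter :: "(real \<times> real) filter" where
  "window_filter = filtercomap fst at_top \<sqinter> principal {(\<tau>, G). G \<in> width_range \<tau>}"

lemma eventually_window_filter:
  "eventually P window_filter \<longleftrightarrow> (\<exists>\<tau>0. \<forall>\<tau>\<ge>\<tau>0. \<forall>G\<in>width_range \<tau>. P (\<tau>, G))"
  unfolding window_filter_def eventually_inf_principal eventually_filtercomap_at_top_linorder
  by fastforce

lemma window_filter_fst: "(f \<longlongrightarrow> L) at_top \<Longrightarrow> ((\<lambda>i. f (fst i)) \<longlongrightarrow> L) window_filter"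
proof -
  assume f: "(f \<longlongrightarrow> L) at_top"
  have "filterlim fst at_top window_filter"
    unfolding window_filter_def by (rule filterlim_mono[OF filterlim_filtercomap order_refl]) simp
  from filterlim_compose[OF f this] show ?thesis .
qed

lemma window_filter_squeeze:
  assumes "\<And>\<tau> G. \<tau> \<ge> \<tau>0 \<Longrightarrow> G \<in> width_range \<tau> \<Longrightarrow> \<bar>f (\<tau>, G)\<bar> \<le> g \<tau>" "(g \<longlongrightarrow> 0) at_top"
  shows "(f \<longlongrightarrow> (0::real)) window_filter"
proof (rule Lim_null_comparison)
  show "\<forall>\<^sub>F i in window_filter. norm (f i) \<le> g (fst i)"
    unfolding eventually_window_filter using assms(1) by auto
  show "((\<lambda>i. g (fst i)) \<longlongrightarrow> 0) window_filter" by (rule window_filter_fst) fact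
qed

text \<open>The threshold 32 = 2^5 makes \<tau>^(3/5) = 8 computable.\<close>

lemma width_range_ge_1:
  assumes "\<tau> \<ge> 32" "G \<in> width_range \<tau>" shows "G \<ge> 1"
proof -
  have "(32::real) powr (3/5) = 8"
  proof -
    have "(32::real) powr (3/5) = (2 powr 5) powr (3/5)" by simp
    also have "\<dots> = 8" unfolding powr_powr by (simp add: powr_numeral)
    finally show ?thesis .
  qed
  moreover have "(32::real) powr (3/5) \<le> \<tau> powr (3/5)" using assms by (intro powr_mono2) auto
  ultimately show ?thesis using assms by (auto simp: width_range_def)
qed

definition diagonal_sum :: "real \<Rightarrow> real \<Rightarrow> real" where
  "diagonal_sum p N = (\<Sum>m. real (Suc m) powr (- p) * exp (- 2 * real (Suc m) / N))"

lemma gauss_mean_smoothed_zeta_decomp: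
  fixes \<sigma> N \<tau> G :: real
  assumes \<sigma>: "1/2 \<le> \<sigma>" "\<sigma> < 1" and N: "N > 0" and G: "G \<ge> 1" and \<tau>: "\<tau> \<ge> 0"
  shows "\<bar>gauss_mean (\<lambda>t. (norm (smoothed_zeta (exp (- 1 / N)) (Complex \<sigma> t)))\<^sup>2) \<tau> G
      - (diagonal_sum (2 * \<sigma>) N - 2 * rest_part (2 * \<sigma>) N \<tau> G) - 2 * N powr (2 - 2 * \<sigma>) * pole_part (2 * \<sigma>) \<tau> G\<bar>
    \<le> 2 * (exp 8 * (10 + 2 * \<tau> / G) / G) * ln (1 + 2 * N)"
proof -
  have p: "1 \<le> 2 * \<sigma>" "2 * \<sigma> < 2" using \<sigma> by auto
  show ?thesis
    using gauss_mean_smoothed_zeta_eval[OF \<sigma>(1) less_imp_le[OF \<sigma>(2)] N G \<tau>]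
    unfolding polyexp_integral_split(1)[OF N p G] diagonal_sum_def
    by (simp add: algebra_simps)
qed

text \<open>The parameters are N = k \<tau>^3, G of order \<tau>^(3/5) and \<eta> = \<tau>^(-1/10).
  The Riemann sum error is then \<tau> / G^2 = \<tau>^(-1/5) times a logarithm, the Euler remainder
  contributes \<tau>^2 / (N \<eta>) = \<tau>^(-9/10), and the pole contributes N (G / \<tau>)^8 /
  \<eta> = \<tau>^(-1/10). All of them tend to 0, and \<eta> l does so for logarithmic l.\<close>

lemma local_mean_limit:
  fixes \<sigma> :: real and l :: "real \<Rightarrow> real"
  assumes \<sigma>: "1/2 \<le> \<sigma>" "\<sigma> < 1"
    and l: "((\<lambda>\<tau>. \<tau> powr (-1/10) * l \<tau>) \<longlongrightarrow> 0) at_top"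
    and d: "\<And>k. k \<in> {1, 2} \<Longrightarrow> ((\<lambda>(\<tau>, G). diagonal_sum (2 * \<sigma>) (k * \<tau> ^ 3)
              - 2 * rest_part (2 * \<sigma>) (k * \<tau> ^ 3) \<tau> G - l \<tau>) \<longlongrightarrow> 0) window_filter"
  shows "((\<lambda>(\<tau>, G). gauss_mean (\<lambda>t. (norm (zeta (Complex \<sigma> t)))\<^sup>2) \<tau> G - l \<tau>) \<longlongrightarrow> 0) window_filter"
proof -
  obtain C where C: "C \<ge> 0"
    "\<And>N t. N \<ge> 1 \<Longrightarrow> norm (smoothed_zeta (exp (- 1 / N)) (Complex \<sigma> t) - zeta (Complex \<sigma> t))
        \<le> C * ((1 + \<bar>t\<bar>) / sqrt N + sqrt N / (1 + t\<^sup>2))"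
    by (rule smoothed_zeta_error[OF \<sigma>]) blast
  define J where "J = (\<lambda>k (i :: real \<times> real). gauss_mean (\<lambda>t. (norm (smoothed_zeta (exp (- 1 / (k * fst i ^ 3))) (Complex \<sigma> t)))\<^sup>2) (fst i) (snd i))"
  define dd where "dd = (\<lambda>k i. diagonal_sum (2 * \<sigma>) (k * fst i ^ 3) - 2 * rest_part (2 * \<sigma>) (k * fst i ^ 3) (fst i) (snd i))"
  define X where "X = (\<lambda>i :: real \<times> real. 2 * (fst i ^ 3) powr (2 - 2 * \<sigma>) * pole_part (2 * \<sigma>) (fst i) (snd i))"
  define \<kappa> where "\<kappa> = 2 powr (2 - 2 * \<sigma>)"
  define z where "z = (\<lambda>i :: real \<times> real. gauss_mean (\<lambda>t. (norm (zeta (Complex \<sigma> t)))\<^sup>2) (fst i) (snd i))"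
  define \<eta> where "\<eta> = (\<lambda>i :: real \<times> real. fst i powr (-1/10))"
  define err where "err = (\<lambda>\<tau> G N. 2 * C\<^sup>2 * (3 * (1 + \<tau>\<^sup>2 + G\<^sup>2) / N + N * (16 / \<tau> ^ 4 + 105 * (2 * G / \<tau>) ^ 8)))"
  \<comment> \<open>Adding the errors for \<tau>^3 and 2 \<tau>^3 gives one \<delta> that serves
    both comparisons.\<close>
  define \<delta> where "\<delta> = (\<lambda>i :: real \<times> real. (1 + 1 / \<eta> i) * (err (fst i) (snd i) (fst i ^ 3) + err (fst i) (snd i) (2 * fst i ^ 3)))"
  have \<kappa>: "\<kappa> > 1" using \<sigma> unfolding \<kappa>_def by (intro gr_one_powr) auto
  have e_lim: "((\<lambda>i. J k i - dd k i - (k powr (2 - 2 * \<sigma>)) * X i) \<longlongrightarrow> 0) window_filter" if k: "k \<in> {1, 2}" for k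
  proof (rule window_filter_squeeze)
    fix \<tau> G :: real assume \<tau>: "32 \<le> \<tau>" and G: "G \<in> width_range \<tau>"
    have G1: "G \<ge> 1" by (rule width_range_ge_1[OF \<tau> G])
    have N: "k * \<tau> ^ 3 > 0" using k \<tau> by auto
    have X': "2 * (k * \<tau> ^ 3) powr (2 - 2 * \<sigma>) * pole_part (2 * \<sigma>) \<tau> G = k powr (2 - 2 * \<sigma>) * X (\<tau>, G)"
      using k \<tau> by (auto simp: X_def powr_mult)
    have "\<bar>J k (\<tau>, G) - dd k (\<tau>, G) - k powr (2 - 2 * \<sigma>) * X (\<tau>, G)\<bar>
        \<le> 2 * (exp 8 * (10 + 2 * \<tau> / G) / G) * ln (1 + 2 * (k * \<tau> ^ 3))"
      unfolding X'[symmetric] J_def dd_def fst_conv snd_conv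
      by (rule gauss_mean_smoothed_zeta_decomp[OF \<sigma> N G1]) (use \<tau> in simp)
    also have "\<dots> \<le> 2 * (exp 8 * (10 + 2 * \<tau> / (\<tau> powr (3/5) / 2)) / (\<tau> powr (3/5) / 2)) * ln (1 + 2 * (2 * \<tau> ^ 3))"
    proof -
      have G': "\<tau> powr (3/5) / 2 \<le> G" "0 < \<tau> powr (3/5) / 2" "0 < G" using G \<tau> G1 by (auto simp: width_range_def)
      have "ln (1 + 2 * (k * \<tau> ^ 3)) \<le> ln (1 + 2 * (2 * \<tau> ^ 3))" using k \<tau> by (subst ln_le_cancel_iff) (auto simp: add_pos_nonneg)
      moreover have "0 \<le> ln (1 + 2 * (k * \<tau> ^ 3))" using N by simp
      moreover have "2 * \<tau> / G \<le> 2 * \<tau> / (\<tau> powr (3/5) / 2)" using G' \<tau> by (intro divide_left_mono mult_pos_pos) auto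
      ultimately show ?thesis using G' \<tau> G1 by (intro mult_mono frac_le add_mono) auto
    qed
    finally show "\<bar>J k (\<tau>, G) - dd k (\<tau>, G) - k powr (2 - 2 * \<sigma>) * X (\<tau>, G)\<bar> \<le> \<dots>" .
  next
    show "((\<lambda>\<tau>::real. 2 * (exp 8 * (10 + 2 * \<tau> / (\<tau> powr (3/5) / 2)) / (\<tau> powr (3/5) / 2)) * ln (1 + 2 * (2 * \<tau> ^ 3))) \<longlongrightarrow> 0) at_top"
      by real_asymp
  qed
  have \<eta>pos: "\<forall>\<^sub>F i in window_filter. \<eta> i \<ge> 0" by (simp add: \<eta>_def)
  have J0: "J k i \<ge> 0" for k i unfolding J_def gauss_mean_def by (rule integral_nonneg_AE) simp
  have cmp: "\<bar>z (\<tau>, G) - J k (\<tau>, G)\<bar> \<le> \<eta> (\<tau>, G) * \<bar>J k (\<tau>, G)\<bar> + \<delta> (\<tau>, G)"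
    if \<tau>: "32 \<le> \<tau>" and G: "G \<in> width_range \<tau>" and k: "k \<in> {1, 2}" for \<tau> G k
  proof -
    have G1: "G \<ge> 1" by (rule width_range_ge_1[OF \<tau> G])
    have \<tau>3: "\<tau> ^ 3 \<ge> 1" using \<tau> by (intro one_le_power) auto
    then have N: "k * \<tau> ^ 3 \<ge> 1" using k by auto
    have \<eta>0: "\<eta> (\<tau>, G) > 0" using \<tau> by (simp add: \<eta>_def)
    have err0: "err \<tau> G N \<ge> 0" if "N > 0" for N
      unfolding err_def using that by (intro mult_nonneg_nonneg add_nonneg_nonneg divide_nonneg_nonneg) auto
    have "\<bar>z (\<tau>, G) - J k (\<tau>, G)\<bar> \<le> \<eta> (\<tau>, G) * J k (\<tau>, G) + (1 + 1 / \<eta> (\<tau>, G)) * err \<tau> G (k * \<tau> ^ 3)"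
      unfolding z_def J_def fst_conv snd_conv err_def
      by (rule gauss_mean_compare[OF \<sigma> _ _ N _ C(2)[OF N]]) (use \<tau> G1 \<eta>0 in auto)
    also have "err \<tau> G (k * \<tau> ^ 3) \<le> err \<tau> G (\<tau> ^ 3) + err \<tau> G (2 * \<tau> ^ 3)"
      using k err0[of "\<tau> ^ 3"] err0[of "2 * \<tau> ^ 3"] \<tau> by auto
    finally show ?thesis using \<eta>0 J0[of k "(\<tau>, G)"] unfolding \<delta>_def by (simp add: mult_left_mono)
  qed
  have \<delta>_lim: "(\<delta> \<longlongrightarrow> 0) window_filter"
  proof (rule window_filter_squeeze)
    fix \<tau> G :: real assume \<tau>: "32 \<le> \<tau>" and G: "G \<in> width_range \<tau>"
    have G1: "G \<ge> 1" by (rule width_range_ge_1[OF \<tau> G])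
    have G': "G \<le> 2 * \<tau> powr (3/5)" using G by (auto simp: width_range_def)
    have em: "err \<tau> G N \<le> err \<tau> (2 * \<tau> powr (3/5)) N" "0 \<le> err \<tau> G N" if "N > 0" for N
    proof -
      show "err \<tau> G N \<le> err \<tau> (2 * \<tau> powr (3/5)) N"
        unfolding err_def using that \<tau> G1 G'
        by (intro mult_left_mono add_mono divide_right_mono power_mono) auto
      show "0 \<le> err \<tau> G N"
        unfolding err_def using that by (intro mult_nonneg_nonneg add_nonneg_nonneg divide_nonneg_nonneg) auto
    qed
    have t3: "\<tau> ^ 3 > 0" "2 * \<tau> ^ 3 > 0" using \<tau> by auto
    have \<eta>0: "\<eta> (\<tau>, G) > 0" using \<tau> by (simp add: \<eta>_def)
    have "\<bar>\<delta> (\<tau>, G)\<bar> = \<delta> (\<tau>, G)" unfolding \<delta>_def fst_conv snd_conv using \<eta>0 em(2)[OF t3(1)] em(2)[OF t3(2)] by simp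
    also have "\<dots> \<le> (1 + 1 / \<tau> powr (-1/10)) * (err \<tau> (2 * \<tau> powr (3/5)) (\<tau> ^ 3) + err \<tau> (2 * \<tau> powr (3/5)) (2 * \<tau> ^ 3))"
      unfolding \<delta>_def fst_conv snd_conv \<eta>_def
      by (intro mult_left_mono add_mono em t3) auto
    finally show "\<bar>\<delta> (\<tau>, G)\<bar> \<le> \<dots>" .
  next
    show "((\<lambda>\<tau>::real. (1 + 1 / \<tau> powr (-1/10)) * (err \<tau> (2 * \<tau> powr (3/5)) (\<tau> ^ 3) + err \<tau> (2 * \<tau> powr (3/5)) (2 * \<tau> ^ 3))) \<longlongrightarrow> 0) at_top"
    proof -
      have lim0: "((\<lambda>\<tau>::real. (1 + 1 / \<tau> powr (-1/10)) * (3 * (1 + \<tau>\<^sup>2 + (2 * \<tau> powr (3/5))\<^sup>2) / (k * \<tau> ^ 3) + (k * \<tau> ^ 3) * (16 / \<tau> ^ 4 + 105 * (2 * (2 * \<tau> powr (3/5)) / \<tau>) ^ 8))) \<longlongrightarrow> 0) at_top"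
        if "k > 0" for k :: real
        using that by real_asymp
      have lim: "((\<lambda>\<tau>. (1 + 1 / \<tau> powr (-1/10)) * err \<tau> (2 * \<tau> powr (3/5)) (k * \<tau> ^ 3)) \<longlongrightarrow> 0) at_top"
        if "k \<in> {1, 2}" for k
      proof -
        have gen: "a * (c * P) = c * (a * P)" for a c P :: real by simp
        from tendsto_mult_right_zero[OF lim0[of k], of "2 * C\<^sup>2"] that
        show ?thesis unfolding err_def gen by auto
      qed
      from tendsto_add[OF lim[of 1] lim[of 2]]
      show ?thesis by (simp only: distrib_left mult_1 add_0_left insert_iff simp_thms)
    qed
  qed
  have "((\<lambda>i. z i - l (fst i)) \<longlongrightarrow> 0) window_filter"
  proof (rule pole_part_negligible[OF \<kappa>, where a = "J 1" and b = "J 2" and ?d1.0 = "dd 1" and ?d2.0 = "dd 2" and X = X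
        and ?e1.0 = "\<lambda>i. J 1 i - dd 1 i - (1 powr (2 - 2 * \<sigma>)) * X i" and ?e2.0 = "\<lambda>i. J 2 i - dd 2 i - (2 powr (2 - 2 * \<sigma>)) * X i" and \<eta> = \<eta> and \<delta> = \<delta>])
    show "\<forall>\<^sub>F i in window_filter. \<bar>z i - J 1 i\<bar> \<le> \<eta> i * \<bar>J 1 i\<bar> + \<delta> i"
      "\<forall>\<^sub>F i in window_filter. \<bar>z i - J 2 i\<bar> \<le> \<eta> i * \<bar>J 2 i\<bar> + \<delta> i"
      unfolding eventually_window_filter using cmp by auto
    show "((\<lambda>i. dd 1 i - l (fst i)) \<longlongrightarrow> 0) window_filter" "((\<lambda>i. dd 2 i - l (fst i)) \<longlongrightarrow> 0) window_filter"
      using d[of 1] d[of 2] by (simp_all add: dd_def case_prod_unfold)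
    show "(\<eta> \<longlongrightarrow> 0) window_filter" unfolding \<eta>_def by (rule window_filter_fst) real_asymp
    show "((\<lambda>i. \<eta> i * l (fst i)) \<longlongrightarrow> 0) window_filter" unfolding \<eta>_def by (rule window_filter_fst[OF l])
  qed (use e_lim[of 1] e_lim[of 2] \<eta>pos \<delta>_lim in \<open>auto simp: \<kappa>_def\<close>)
  then show ?thesis by (simp add: z_def case_prod_unfold)
qed

lemma diagonal_sum_limit:
  assumes p: "p > 1" shows "(diagonal_sum p \<longlongrightarrow> (\<Sum>m. real (Suc m) powr (- p))) at_top"
proof -
  have "eventually (\<lambda>N. summable (\<lambda>k. norm (real (Suc k) powr (- p) * exp (- 2 * real (Suc k) / N)))) (at_top :: real filter) \<and>
        summable (\<lambda>n. norm (real (Suc n) powr (- p))) \<and>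
        (diagonal_sum p \<longlongrightarrow> (\<Sum>m. real (Suc m) powr (- p))) at_top"
    unfolding diagonal_sum_def[abs_def]
  proof (rule tannerys_theorem)
    show "((\<lambda>N::real. real (Suc k) powr (- p) * exp (- 2 * real (Suc k) / N)) \<longlongrightarrow> real (Suc k) powr (- p)) at_top" for k
    proof -
      have "((\<lambda>N::real. exp (- 2 * real (Suc k) / N)) \<longlongrightarrow> 1) at_top" by real_asymp
      from tendsto_mult_left[OF this, of "real (Suc k) powr (- p)"] show ?thesis by simp
    qed
    show "summable (\<lambda>k. real (Suc k) powr (- p))" by (rule summable_Suc_powr) (use p in auto)
    have "\<forall>\<^sub>F N in (at_top :: real filter). N > 0" by (rule eventually_gt_at_top)
    then have "\<forall>\<^sub>F N in (at_top :: real filter). \<forall>k. norm (real (Suc k) powr (- p) * exp (- 2 * real (Suc k) / N)) \<le> real (Suc k) powr (- p)"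
      by eventually_elim (auto simp: abs_mult intro!: mult_left_le divide_nonpos_pos)
    from eventually_compose_filterlim[OF this filterlim_snd]
    show "\<forall>\<^sub>F (k, N) in at_top \<times>\<^sub>F (at_top :: real filter). norm (real (Suc k) powr (- p) * exp (- 2 * real (Suc k) / N)) \<le> real (Suc k) powr (- p)"
      by (rule eventually_mono) (simp only: case_prod_unfold)
  qed simp
  then show ?thesis by blast
qed

lemma local_mean_off_critical:
  assumes \<sigma>: "1/2 < \<sigma>" "\<sigma> < 1"
  shows "((\<lambda>(\<tau>, G). gauss_mean (\<lambda>t. (norm (zeta (Complex \<sigma> t)))\<^sup>2) \<tau> G - (\<Sum>m. real (Suc m) powr (- 2 * \<sigma>))) \<longlongrightarrow> 0) window_filter"
proof (rule local_mean_limit[where l = "\<lambda>_. (\<Sum>m. real (Suc m) powr (- 2 * \<sigma>))"])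
  define p where "p = 2 * \<sigma>"
  have p: "1 < p" "p < 2" using \<sigma> by (auto simp: p_def)
  define L where "L = (\<Sum>m. real (Suc m) powr (- 2 * \<sigma>))"
  show "((\<lambda>\<tau>::real. \<tau> powr (-1/10) * L) \<longlongrightarrow> 0) at_top"
    by (rule tendsto_mult_left_zero) real_asymp
  fix k :: real assume k: "k \<in> {1, 2}"
  have "filterlim (\<lambda>\<tau>::real. k * \<tau> ^ 3) at_top at_top" using k by (auto, real_asymp+)
  from filterlim_compose[OF diagonal_sum_limit[OF p(1)] this]
  have "((\<lambda>\<tau>. diagonal_sum p (k * \<tau> ^ 3)) \<longlongrightarrow> L) at_top" by (simp add: L_def p_def)
  then have "((\<lambda>i. diagonal_sum p (k * fst i ^ 3)) \<longlongrightarrow> L) window_filter" by (rule window_filter_fst)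
  then have 1: "((\<lambda>i. diagonal_sum p (k * fst i ^ 3) - L) \<longlongrightarrow> 0) window_filter" by (rule LIM_zero)
  define c where "c = (exp 1 * Gamma (2 - p) + 1) * exp 1 * Gamma (p - 1)"
  have 2: "((\<lambda>i. rest_part p (k * fst i ^ 3) (fst i) (snd i)) \<longlongrightarrow> 0) window_filter"
  proof (rule window_filter_squeeze)
    fix \<tau> G :: real assume \<tau>: "32 \<le> \<tau>" and G: "G \<in> width_range \<tau>"
    have c0: "c \<ge> 0" using p by (auto simp: c_def intro!: add_nonneg_nonneg mult_nonneg_nonneg less_imp_le[OF Gamma_real_pos])
    have G1: "G \<ge> 1" by (rule width_range_ge_1[OF \<tau> G])
    have "\<bar>rest_part p (k * \<tau> ^ 3) \<tau> G\<bar> \<le> c * G powr (1 - p)"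
      unfolding c_def by (rule rest_part_bound) (use k \<tau> p G1 in auto)
    also have "\<dots> \<le> c * (\<tau> powr (3/5) / 2) powr (1 - p)"
      using G \<tau> p c0 by (intro mult_left_mono powr_mono2') (auto simp: width_range_def)
    finally show "\<bar>rest_part p (k * fst (\<tau>, G) ^ 3) (fst (\<tau>, G)) (snd (\<tau>, G))\<bar> \<le> c * (\<tau> powr (3/5) / 2) powr (1 - p)" by simp
  next
    have "((\<lambda>\<tau>::real. (\<tau> powr (3/5) / 2) powr (1 - p)) \<longlongrightarrow> 0) at_top" using p by real_asymp
    then show "((\<lambda>\<tau>::real. c * (\<tau> powr (3/5) / 2) powr (1 - p)) \<longlongrightarrow> 0) at_top" by (rule tendsto_mult_right_zero)
  qed
  from tendsto_diff[OF 1 tendsto_mult_right_zero[OF 2, of 2]]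
  show "((\<lambda>(\<tau>, G). diagonal_sum (2 * \<sigma>) (k * \<tau> ^ 3) - 2 * rest_part (2 * \<sigma>) (k * \<tau> ^ 3) \<tau> G - L) \<longlongrightarrow> 0) window_filter"
    by (simp add: p_def case_prod_unfold algebra_simps)
qed (use \<sigma> in auto)

section \<open>The critical line\<close>

text \<open>The kernel of \<open>rest_part\<close> for p = 1. The product q bern(q) is 1 - q / (e^q
  - 1), one minus the generating function of the Bernoulli numbers; bern(q) tends to 1/2 as q tends
  to 0.\<close>

definition bern :: "real \<Rightarrow> real" where "bern q = 1 / q - 1 / (exp q - 1)"

lemma bern_bounds:
  assumes q: "q > 0"
  shows "1/2 - q / 4 \<le> bern q" "bern q \<le> 1/2" "0 \<le> bern q" "bern q \<le> 1 / q"
proof -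
  define w where "w = exp q - 1"
  have w: "w \<ge> q" using exp_ge_add_one_self[of q] unfolding w_def by linarith
  then have w: "w > 0" "w \<ge> q" using q by auto
  have w2: "w \<ge> q + q\<^sup>2 / 2" using exp_lower_Taylor_quadratic[of q] q by (simp add: w_def)
  have b: "bern q = 1 / q - 1 / w" by (simp add: bern_def w_def)
  show "0 \<le> bern q" unfolding b using w q by (simp add: frac_le)
  show "bern q \<le> 1 / q" unfolding b using w by simp
  \<comment> \<open>The inequality tanh (q/2) \<le> q/2 in disguise, which is equivalent to bern(q)
    \<le> 1/2.\<close>
  have "(\<lambda>x. 2 + x - (2 - x) * exp x) 0 \<le> (\<lambda>x. 2 + x - (2 - x) * exp x) q"
  proof (rule DERIV_nonneg_imp_nondecreasing[where f = "\<lambda>x. 2 + x - (2 - x) * exp x"])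
    fix x :: real assume "0 \<le> x"
    have "((\<lambda>x. 2 + x - (2 - x) * exp x) has_real_derivative (1 - (1 - x) * exp x)) (at x)"
      by (auto intro!: derivative_eq_intros simp: algebra_simps)
    moreover have "(1 - x) * exp x \<le> 1"
    proof -
      have "(1 - x) * exp x \<le> exp (- x) * exp x" using exp_ge_add_one_self[of "-x"] by (intro mult_right_mono) auto
      then show ?thesis by (simp flip: exp_add)
    qed
    ultimately show "\<exists>y. ((\<lambda>x. 2 + x - (2 - x) * exp x) has_real_derivative y) (at x) \<and> 0 \<le> y" by auto
  qed (use q in auto)
  then have "(2 - q) * w \<le> 2 * q" by (simp add: w_def algebra_simps)
  then show "bern q \<le> 1/2" unfolding b using w q by (simp add: field_simps)
  have "1 / w \<le> 1 / (q * (1 + q / 2))"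
    using w2 q w by (intro divide_left_mono mult_pos_pos) (auto simp: power2_eq_square algebra_simps)
  moreover have "1 / q - 1 / (q * (1 + q / 2)) = 1 / (2 + q)" using q by (simp add: divide_simps)
  moreover have "1/2 - q / 4 \<le> 1 / (2 + q)" using q by (simp add: field_simps)
  ultimately show "1/2 - q / 4 \<le> bern q" unfolding b by linarith
qed

lemma bern_antimono:
  assumes "0 < x" "x \<le> y" shows "bern y \<le> bern x"
proof (rule DERIV_nonpos_imp_nonincreasing[OF assms(2)])
  fix q assume "x \<le> q"
  then have q: "q > 0" using assms by simp
  have e: "exp q - 1 \<noteq> 0" using q by simp
  have "(bern has_real_derivative (- 1 / q\<^sup>2 + exp q / (exp q - 1)\<^sup>2)) (at q)"
    unfolding bern_def[abs_def] using q e by (auto intro!: derivative_eq_intros simp: power2_eq_square)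
  moreover have "exp q / (exp q - 1)\<^sup>2 = 1 / (dsinh q)\<^sup>2" by (simp add: dsinh_sq)
  moreover have "1 / (dsinh q)\<^sup>2 \<le> 1 / q\<^sup>2"
    using dsinh_ge[of q] dsinh_pos[of q] q by (intro divide_left_mono power_mono mult_pos_pos) auto
  ultimately show "\<exists>y. (bern has_real_derivative y) (at q) \<and> y \<le> 0" by force
qed

text \<open>Convexity of exp makes (e^q - 1) / q increasing. Together with
  \<open>bern_antimono\<close> this encloses the variation of \<open>bern\<close> from both
  sides.\<close>

lemma mult_bern_mono:
  assumes "0 < x" "x \<le> y" shows "x * bern x \<le> y * bern y"
proof -
  have ex: "exp x - 1 > 0" "exp y - 1 > 0" using assms by auto
  have "exp ((1 - x / y) *\<^sub>R 0 + (x / y) *\<^sub>R y) \<le> (1 - x / y) * exp 0 + (x / y) * exp y"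
    by (rule convex_onD[OF exp_convex]) (use assms in auto)
  then have "exp x - 1 \<le> (x / y) * (exp y - 1)" using assms by (simp add: algebra_simps)
  then have "y * (exp x - 1) \<le> x * (exp y - 1)" using assms by (simp add: field_simps)
  then have "y / (exp y - 1) \<le> x / (exp x - 1)" using ex by (simp add: field_simps)
  moreover have "x * bern x = 1 - x / (exp x - 1)" "y * bern y = 1 - y / (exp y - 1)"
    using assms by (auto simp: bern_def right_diff_distrib)
  ultimately show ?thesis by linarith
qed

lemma hcoth_eq_bern: "y > 0 \<Longrightarrow> hcoth y = 1 + 2 / y - 2 * bern y"
  by (simp add: hcoth_def bern_def field_simps)

lemma hcoth_bounds: "y > 0 \<Longrightarrow> 2 / y \<le> hcoth y" "y > 0 \<Longrightarrow> hcoth y \<le> 2 / y + 1"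
  using hcoth_eq_bern[of y] bern_bounds[of y] by auto

lemma continuous_on_bern [continuous_intros]:
  "continuous_on A f \<Longrightarrow> (\<And>x. x \<in> A \<Longrightarrow> f x > 0) \<Longrightarrow> continuous_on A (\<lambda>x. bern (f x))"
  unfolding bern_def by (intro continuous_intros) (auto simp: less_imp_neq[symmetric])

definition crit_weight :: "real \<Rightarrow> real \<Rightarrow> real \<Rightarrow> real" where
  "crit_weight N G y = exp (- (G * y)\<^sup>2 / 2) * bern (hcoth y / N) / dsinh y"

text \<open>Not evident factor by factor, since bern (hcoth y / N) increases with y. With q = hcoth
  y / N and hcoth y * dsinh y = 2 cosh (y/2) the weight becomes a product of three decreasing
  nonnegative factors: the Gaussian, q bern(q), and N / (2 cosh (y/2)).\<close>

lemma crit_weight_antimono: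
  assumes N: "N > 0" and "0 < x" "x \<le> y"
  shows "crit_weight N G y \<le> crit_weight N G x"
proof -
  have form: "crit_weight N G y = exp (- (G * y)\<^sup>2 / 2) * (hcoth y / N * bern (hcoth y / N)) * (N / (exp (y / 2) + exp (- y / 2)))"
    if "y > 0" for y
  proof -
    have s: "dsinh y > 0" "hcoth y > 0" using that dsinh_pos hcoth_ge_1[OF that] by auto
    have "dsinh y * hcoth y = exp (y / 2) + exp (- y / 2)"
      using dsinh_hcoth[OF that] s by (simp add: power2_eq_square)
    then have "N / (exp (y / 2) + exp (- y / 2)) = N / (dsinh y * hcoth y)" by simp
    then show ?thesis unfolding crit_weight_def using s N by (simp add: field_simps)
  qed
  have xy: "0 < x" "0 < y" using assms by auto
  have hc: "hcoth y \<le> hcoth x"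
  proof (rule DERIV_nonpos_imp_nonincreasing[OF assms(3)])
    fix z assume "x \<le> z"
    then show "\<exists>d. (hcoth has_real_derivative d) (at z) \<and> d \<le> 0"
      using DERIV_hcoth[of z] xy by (intro exI[of _ "- 2 / (dsinh z)\<^sup>2"]) auto
  qed
  have hp: "hcoth y / N > 0" "hcoth x / N > 0" using hcoth_ge_1[OF xy(2)] hcoth_ge_1[OF xy(1)] N by auto
  have ee: "exp (x / 2) + exp (- x / 2) \<le> exp (y / 2) + exp (- y / 2)"
  proof -
    have "(\<lambda>z. exp (z / 2) + exp (- z / 2)) x \<le> (\<lambda>z. exp (z / 2) + exp (- z / 2)) y"
    proof (rule DERIV_nonneg_imp_nondecreasing[OF assms(3)])
      fix z assume "x \<le> z"
      have "((\<lambda>z. exp (z / 2) + exp (- z / 2)) has_real_derivative dsinh z / 2) (at z)"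
        unfolding dsinh_def by (auto intro!: derivative_eq_intros simp: diff_divide_distrib)
      then show "\<exists>d. ((\<lambda>z. exp (z / 2) + exp (- z / 2)) has_real_derivative d) (at z) \<and> 0 \<le> d"
        using dsinh_pos[of z] \<open>x \<le> z\<close> xy by (intro exI conjI) auto
    qed
    then show ?thesis .
  qed
  show ?thesis unfolding form[OF xy(1)] form[OF xy(2)]
  proof (rule mult_mono[OF mult_mono])
    show "exp (- (G * y)\<^sup>2 / 2) \<le> exp (- (G * x)\<^sup>2 / 2)"
      using power_mono[of x y 2] xy assms(3) by (simp add: power_mult_distrib mult_left_mono)
    show "hcoth y / N * bern (hcoth y / N) \<le> hcoth x / N * bern (hcoth x / N)"
      by (rule mult_bern_mono[OF hp(1)]) (use hc N in \<open>auto intro: divide_right_mono\<close>)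
    show "N / (exp (y / 2) + exp (- y / 2)) \<le> N / (exp (x / 2) + exp (- x / 2))"
      by (rule divide_left_mono[OF ee]) (use N in \<open>auto intro!: mult_pos_pos add_pos_pos\<close>)
    have "0 \<le> bern (hcoth x / N)" "0 \<le> bern (hcoth y / N)"
      using bern_bounds(3)[of "hcoth x / N"] bern_bounds(3)[of "hcoth y / N"] hp by auto
    then show "0 \<le> hcoth y / N * bern (hcoth y / N)" "0 \<le> exp (- (G * x)\<^sup>2 / 2) * (hcoth x / N * bern (hcoth x / N))"
      using hcoth_ge_1[OF xy(1)] hcoth_ge_1[OF xy(2)] N by auto
    show "0 \<le> N / (exp (y / 2) + exp (- y / 2))" using N by (auto intro!: add_nonneg_nonneg divide_nonneg_nonneg)
  qed auto
qed

lemma crit_weight_bounds: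
  assumes "N > 0" "y > 0" shows "0 \<le> crit_weight N G y" "crit_weight N G y \<le> 1 / (2 * y)"
proof -
  have q: "hcoth y / N > 0" using hcoth_ge_1[OF assms(2)] assms by simp
  have s: "dsinh y > 0" "y \<le> dsinh y" using assms dsinh_pos dsinh_ge by auto
  show "0 \<le> crit_weight N G y" unfolding crit_weight_def using bern_bounds(3)[OF q] s by simp
  have "crit_weight N G y \<le> 1 * (1/2) / y"
    unfolding crit_weight_def using bern_bounds[OF q] s assms
    by (intro frac_le mult_mono) auto
  then show "crit_weight N G y \<le> 1 / (2 * y)" by simp
qed

lemma continuous_on_crit_weight: "N > 0 \<Longrightarrow> continuous_on {0<..} (crit_weight N G)"
proof -
  assume N: "N > 0"
  have "dsinh x \<noteq> 0" "hcoth x / N > 0" if "x > 0" for x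
    using dsinh_pos[OF that] hcoth_ge_1[OF that] N by auto
  then show ?thesis unfolding crit_weight_def[abs_def] by (intro continuous_intros) auto
qed

lemma rest_part_1:
  assumes N: "N > 0" and G: "G \<ge> 1"
  shows "rest_part 1 N \<tau> G = (LBINT y:{0<..}. cos (\<tau> * y) * crit_weight N G y)"
    and "set_integrable lborel {0<..} (\<lambda>y. cos (\<tau> * y) * crit_weight N G y)"
proof -
  have eq: "dsinh y powr (1 - 2) * cos (\<tau> * y) * exp (- (G * y)\<^sup>2 / 2) * (Gamma (2 - 1) * (hcoth y / N) powr (1 - 2) - polyexp_sum 1 (hcoth y / N))
       = cos (\<tau> * y) * crit_weight N G y" if "y > 0" for y
  proof -
    have q: "hcoth y / N > 0" using hcoth_ge_1[OF that] N by simp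
    have s: "dsinh y > 0" by (rule dsinh_pos[OF that])
    have "Gamma (2 - 1) * (hcoth y / N) powr (1 - 2) - polyexp_sum 1 (hcoth y / N) = bern (hcoth y / N)"
    proof -
      have "(hcoth y / N) powr (1 - 2) = 1 / (hcoth y / N)" using powr_minus_divide[of "hcoth y / N" 1] powr_one[OF less_imp_le[OF q]] by (simp only:) simp
      then show ?thesis using q by (simp add: polyexp_sum_1 bern_def)
    qed
    moreover have "dsinh y powr (1 - 2) = 1 / dsinh y" using s by (simp add: powr_minus_divide)
    ultimately show ?thesis by (simp add: crit_weight_def mult_ac)
  qed
  show "rest_part 1 N \<tau> G = (LBINT y:{0<..}. cos (\<tau> * y) * crit_weight N G y)"
    unfolding rest_part_def by (rule set_lebesgue_integral_cong) (use eq in auto)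
  have "set_integrable lborel {0<..} (\<lambda>y. dsinh y powr (1 - 2) * cos (\<tau> * y) * exp (- (G * y)\<^sup>2 / 2)
        * (Gamma (2 - 1) * (hcoth y / N) powr (1 - 2) - polyexp_sum 1 (hcoth y / N)))"
    by (rule polyexp_integral_split(2)) (use N G in auto)
  then show "set_integrable lborel {0<..} (\<lambda>y. cos (\<tau> * y) * crit_weight N G y)"
    by (subst (asm) set_integrable_cong[OF refl refl eq]) auto
qed

section \<open>The oscillating integral on the critical line\<close>

lemma cos_integral_bound:
  fixes \<tau> a b :: real
  assumes "\<tau> > 0" "a \<le> b" shows "\<bar>integral {a..b} (\<lambda>y. cos (\<tau> * y))\<bar> \<le> 2 / \<tau>"
proof -
  have "((\<lambda>y. cos (\<tau> * y)) has_integral (sin (\<tau> * b) / \<tau> - sin (\<tau> * a) / \<tau>)) {a..b}"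
    by (rule fundamental_theorem_of_calculus[OF assms(2)])
       (use assms in \<open>auto intro!: derivative_eq_intros simp flip: has_real_derivative_iff_has_vector_derivative\<close>)
  then have "integral {a..b} (\<lambda>y. cos (\<tau> * y)) = (sin (\<tau> * b) - sin (\<tau> * a)) / \<tau>"
    by (simp add: integral_unique diff_divide_distrib)
  moreover have "\<bar>sin (\<tau> * b) - sin (\<tau> * a)\<bar> \<le> 2" using abs_sin_le_one[of "\<tau> * b"] abs_sin_le_one[of "\<tau> * a"] by linarith
  ultimately show ?thesis using assms by (simp add: abs_divide divide_right_mono)
qed

text \<open>The second mean value theorem: a decreasing weight against cos (\<tau> y) integrates to
  at most 4 / \<tau> times its initial value, and that value is at most 1 / (2 a).\<close>

lemma crit_tail_bound:
  assumes N: "N > 0" and G: "G \<ge> 1" and \<tau>: "\<tau> > 0" and a: "a > 0"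
  shows "\<bar>LBINT y:{a..}. cos (\<tau> * y) * crit_weight N G y\<bar> \<le> 2 / (\<tau> * a)"
proof -
  define f where "f = (\<lambda>y. cos (\<tau> * y) * crit_weight N G y)"
  have fi: "set_integrable lborel {a..} f"
    unfolding f_def by (rule set_integrable_subset[OF rest_part_1(2)[OF N G]]) (use a in auto)
  have B: "\<bar>LBINT y:{a..b}. f y\<bar> \<le> 2 / (\<tau> * a)" if b: "b \<ge> a" for b
  proof -
    have "set_integrable lborel {a..b} f" by (rule set_integrable_subset[OF fi]) auto
    then have 1: "(LBINT y:{a..b}. f y) = integral {a..b} f" by (rule set_borel_integral_eq_integral)
    have "(\<lambda>y. cos (\<tau> * y)) integrable_on {a..b}" by (intro integrable_continuous_interval continuous_intros)
    \<comment> \<open>The theorem is stated for increasing functions, so it is applied to the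
      negated weight.\<close>
    then obtain c where c: "c \<in> {a..b}" "((\<lambda>x. - crit_weight N G x * cos (\<tau> * x)) has_integral
        (- crit_weight N G a * integral {a..c} (\<lambda>y. cos (\<tau> * y)) + - crit_weight N G b * integral {c..b} (\<lambda>y. cos (\<tau> * y)))) {a..b}"
      by (rule second_mean_value_theorem_full[OF _ b, where g = "\<lambda>x. - crit_weight N G x"])
         (use crit_weight_antimono[OF N] a in auto)
    from has_integral_neg[OF c(2)]
    have "integral {a..b} f = crit_weight N G a * integral {a..c} (\<lambda>y. cos (\<tau> * y)) + crit_weight N G b * integral {c..b} (\<lambda>y. cos (\<tau> * y))"
      by (simp add: f_def mult.commute integral_unique)
    also have "\<bar>\<dots>\<bar> \<le> crit_weight N G a * (2 / \<tau>) + crit_weight N G b * (2 / \<tau>)"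
    proof (rule order_trans[OF abs_triangle_ineq add_mono])
      show "\<bar>crit_weight N G a * integral {a..c} (\<lambda>y. cos (\<tau> * y))\<bar> \<le> crit_weight N G a * (2 / \<tau>)"
        unfolding abs_mult using crit_weight_bounds(1)[OF N a] cos_integral_bound[OF \<tau>, of a c] c(1) by (intro mult_mono) auto
      show "\<bar>crit_weight N G b * integral {c..b} (\<lambda>y. cos (\<tau> * y))\<bar> \<le> crit_weight N G b * (2 / \<tau>)"
        unfolding abs_mult using crit_weight_bounds(1)[OF N, of b] cos_integral_bound[OF \<tau>, of c b] c(1) a b by (intro mult_mono) auto
    qed
    also have "\<dots> \<le> crit_weight N G a * (2 / \<tau>) + crit_weight N G a * (2 / \<tau>)"
      using crit_weight_antimono[OF N a b] \<tau> by (intro add_left_mono mult_right_mono) auto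
    also have "\<dots> = crit_weight N G a * (4 / \<tau>)" by simp
    also have "\<dots> \<le> 1 / (2 * a) * (4 / \<tau>)" using crit_weight_bounds(2)[OF N a] \<tau> by (intro mult_right_mono) auto
    finally show ?thesis unfolding 1 by (simp add: mult_ac)
  qed
  have "((\<lambda>b. LBINT y:{a..b}. f y) \<longlongrightarrow> (LBINT y:{a..}. f y)) at_top"
    by (rule tendsto_set_lebesgue_integral_at_top) (use fi in auto)
  then have "((\<lambda>b. \<bar>LBINT y:{a..b}. f y\<bar>) \<longlongrightarrow> \<bar>LBINT y:{a..}. f y\<bar>) at_top" by (rule tendsto_rabs)
  then have "\<bar>LBINT y:{a..}. f y\<bar> \<le> 2 / (\<tau> * a)"
    by (rule tendsto_upperbound) (use B in \<open>auto intro!: eventually_at_top_linorderI[of a]\<close>)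
  then show ?thesis by (simp add: f_def)
qed

lemma scale_invariant_integral:
  fixes h :: "real \<Rightarrow> real"
  assumes c: "c > 0"
  shows "(LBINT y:{0<..<a}. h (c * y) / y) = (LBINT v:{0<..<c * a}. h v / v)"
proof -
  have "(LBINT v:{0<..<c * a}. h v / v) = c * (\<integral>y. indicator {0<..<c * a} (0 + c * y) *\<^sub>R (h (0 + c * y) / (0 + c * y)) \<partial>lborel)"
    unfolding set_lebesgue_integral_def
    by (subst lborel_integral_real_affine[of c _ 0]) (use c in auto)
  also have "\<dots> = (\<integral>y. c * (indicator {0<..<c * a} (0 + c * y) *\<^sub>R (h (0 + c * y) / (0 + c * y))) \<partial>lborel)"
    by (rule integral_mult_right_zero[symmetric])
  also have "\<dots> = (LBINT y:{0<..<a}. h (c * y) / y)"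
    unfolding set_lebesgue_integral_def
    by (intro Bochner_Integration.integral_cong) (use c in \<open>auto split: split_indicator simp: zero_less_mult_iff\<close>)
  finally show ?thesis by simp
qed

lemma open_interval_integral_bound:
  fixes f g :: "real \<Rightarrow> real"
  assumes "continuous_on {0<..<a} f" "a \<ge> 0" "\<And>y. 0 < y \<Longrightarrow> y < a \<Longrightarrow> \<bar>f y\<bar> \<le> B"
  shows "set_integrable lborel {0<..<a} f" "\<bar>LBINT y:{0<..<a}. f y\<bar> \<le> B * a"
proof -
  have c: "set_integrable lborel {0<..<a} (\<lambda>_. B)"
    unfolding set_integrable_def using assms(2) by (intro integrable_scaleR_left) (simp add: integrable_indicator_iff)
  show f: "set_integrable lborel {0<..<a} f"
  proof (rule set_integrable_bound[OF c])
    show "set_borel_measurable lborel {0<..<a} f"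
      unfolding set_borel_measurable_def using borel_measurable_continuous_on_indicator[OF _ assms(1)] by simp
    show "AE y in lborel. y \<in> {0<..<a} \<longrightarrow> norm (f y) \<le> norm B" using assms(3) by (force intro!: AE_I2)
  qed
  have "\<bar>LBINT y:{0<..<a}. f y\<bar> \<le> (LBINT y:{0<..<a}. \<bar>f y\<bar>)"
    using integral_norm_bound[of lborel "\<lambda>x. indicator {0<..<a} x *\<^sub>R f x"]
    by (simp add: set_lebesgue_integral_def abs_mult)
  also have "\<dots> \<le> (LBINT y:{0<..<a}. B)"
    by (intro set_integral_mono set_integrable_abs f c) (use assms(3) in auto)
  also have "\<dots> = B * a" using assms(2) by (simp add: set_lebesgue_integral_def)
  finally show "\<bar>LBINT y:{0<..<a}. f y\<bar> \<le> B * a" .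
qed

text \<open>Near 0 the integrand is bounded because bern(q) \<le> 1/q; for large w it approaches 1/w
  because bern tends to 1/2. Hence the integral grows like ln X.\<close>

definition log_kernel :: "real \<Rightarrow> real" where
  "log_kernel X = (LBINT w:{0<..<X}. 2 * bern (1 / w) / w)"

text \<open>The negative of the entire cosine integral Cin(A). It behaves like -ln A, which offsets
  the ln A that enters through \<open>log_kernel (N / (2 * \<tau>) * A)\<close>.\<close>

definition cosine_deficit :: "real \<Rightarrow> real" where
  "cosine_deficit A = (LBINT v:{0<..<A}. (cos v - 1) / v)"

text \<open>For y < A / \<tau> the Gaussian is replaced by 1, \<open>dsinh y\<close> by y and
  \<open>hcoth y\<close> by 2/y; f1 collects the loss. With B = 2 bern (2 / (N y)) the identity cos
  * B = (cos - 1) (B - 1) + (cos - 1) + B then splits the rest into f2, f3 and f4. The part f2 is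
  small since both its factors are, while f3 and f4 depend on y only through \<tau> y or N y and are
  rescaled to \<open>cosine_deficit\<close> and \<open>log_kernel\<close>.\<close>

lemma crit_head_approx:
  assumes N: "N > 0" and G: "G \<ge> 1" and \<tau>: "\<tau> > 0" and A: "A > 0"
  shows "\<bar>2 * (LBINT y:{0<..<A / \<tau>}. cos (\<tau> * y) * crit_weight N G y) - (cosine_deficit A + log_kernel (N / (2 * \<tau>) * A))\<bar>
     \<le> G\<^sup>2 * A\<^sup>2 / (2 * \<tau>\<^sup>2) + A / \<tau> + \<tau> * A / (2 * N)"
proof -
  define a where "a = A / \<tau>"
  have a: "a > 0" using \<tau> A by (simp add: a_def)
  define f1 where "f1 = (\<lambda>y. cos (\<tau> * y) * crit_weight N G y - cos (\<tau> * y) * bern (2 / (N * y)) / y)"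
  define f2 where "f2 = (\<lambda>y. (cos (\<tau> * y) - 1) * (2 * bern (2 / (N * y)) - 1) / y)"
  define f3 where "f3 = (\<lambda>y. (cos (\<tau> * y) - 1) / y)"
  define f4 where "f4 = (\<lambda>y. 2 * bern (2 / (N * y)) / y)"
  have q0: "2 / (N * y) > 0" if "y > 0" for y using that N by simp
  have cosb: "\<bar>cos t - 1\<bar> \<le> t\<^sup>2 / 2" for t :: real
  proof -
    have "1 - cos t = 2 * (sin (t / 2))\<^sup>2" using cos_double_sin[of "t/2"] by simp
    moreover have "(sin (t / 2))\<^sup>2 \<le> (t / 2)\<^sup>2" using abs_sin_x_le_abs_x[of "t / 2"] by (simp only: abs_le_square_iff)
    ultimately show ?thesis by (simp add: power_divide)
  qed
  have cont: "continuous_on {0<..<a} f1" "continuous_on {0<..<a} f2" "continuous_on {0<..<a} f3" "continuous_on {0<..<a} f4"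
    unfolding f1_def f2_def f3_def f4_def using N
    by (auto intro!: continuous_intros continuous_on_subset[OF continuous_on_crit_weight[OF N]] divide_pos_pos mult_pos_pos)
  have b1: "\<bar>f1 y\<bar> \<le> G\<^sup>2 * A / (4 * \<tau>) + 1/2" if y: "0 < y" "y < a" for y
  proof -
    define q1 q2 where "q1 = 2 / (N * y)" and "q2 = hcoth y / N"
    define E where "E = exp (- (G * y)\<^sup>2 / 2)"
    have q: "q1 > 0" "q1 \<le> q2" "q2 \<le> q1 + 1 / N"
      using hcoth_bounds[OF y(1)] y N by (auto simp: q1_def q2_def field_simps)
    have s: "dsinh y > 0" "y \<le> dsinh y" using y dsinh_pos dsinh_ge by auto
    have bb: "0 \<le> bern q2" "bern q2 \<le> 1/2" "bern q1 \<le> 1/2" using bern_bounds[of q1] bern_bounds[of q2] q by auto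
    have E: "0 \<le> 1 - E" "1 - E \<le> (G * y)\<^sup>2 / 2" using exp_ge_add_one_self[of "- (G * y)\<^sup>2 / 2"] by (auto simp: E_def)
    have d1: "\<bar>(E - 1) * (bern q2 / dsinh y)\<bar> \<le> G\<^sup>2 * A / (4 * \<tau>)"
    proof -
      have "\<bar>(E - 1) * (bern q2 / dsinh y)\<bar> = (1 - E) * (bern q2 / dsinh y)" using E bb s by (simp add: abs_mult)
      also have "\<dots> \<le> ((G * y)\<^sup>2 / 2) * ((1/2) / y)" using E bb s y by (intro mult_mono frac_le) auto
      also have "\<dots> = G\<^sup>2 * y / 4" using y by (simp add: power2_eq_square)
      also have "\<dots> \<le> G\<^sup>2 * a / 4" using y by (intro divide_right_mono mult_left_mono) auto
      finally show ?thesis by (simp add: a_def)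
    qed
    have d2: "\<bar>bern q2 * (1 / dsinh y - 1 / y)\<bar> \<le> 1/4"
    proof -
      have le: "1 / dsinh y \<le> 1 / y" using s y by (intro divide_left_mono) auto
      have "dsinh y \<le> y * exp (y / 2)"
      proof -
        have "dsinh y = exp (y / 2) * (1 - exp (- y))" by (simp add: dsinh_def right_diff_distrib flip: exp_add)
        also have "\<dots> \<le> exp (y / 2) * y" using exp_ge_add_one_self[of "-y"] by (intro mult_left_mono) auto
        finally show ?thesis by (simp add: mult.commute)
      qed
      then have "1 / (y * exp (y / 2)) \<le> 1 / dsinh y" using s y by (intro divide_left_mono) auto
      moreover have "1 / (y * exp (y / 2)) = exp (- y / 2) / y" by (simp add: exp_minus field_simps)
      moreover have "(1 + - y / 2) / y \<le> exp (- y / 2) / y" using exp_ge_add_one_self[of "- y/2"] y by (intro divide_right_mono) auto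
      moreover have "(1 + - y / 2) / y = 1 / y - 1/2" using y by (simp add: field_simps)
      ultimately have "1 / y - 1/2 \<le> 1 / dsinh y" by linarith
      then have "\<bar>1 / dsinh y - 1 / y\<bar> \<le> 1/2" using le by linarith
      then have "\<bar>bern q2\<bar> * \<bar>1 / dsinh y - 1 / y\<bar> \<le> 1/2 * (1/2)" using bb by (intro mult_mono) auto
      then show ?thesis by (simp add: abs_mult)
    qed
    \<comment> \<open>Monotonicity of q bern(q) gives q2 (bern q1 - bern q2) \<le> (q2 - q1) bern q1
      \<le> 1 / (2 N), which is a Lipschitz bound; q1 = 2 / (N y) then supplies the factor
      y.\<close>
    have d3: "\<bar>(bern q2 - bern q1) / y\<bar> \<le> 1/4"
    proof -
      have q20: "q2 > 0" using q by linarith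
      have m: "bern q2 \<le> bern q1" by (rule bern_antimono) (use q in auto)
      have "q1 * bern q1 \<le> q2 * bern q2" by (rule mult_bern_mono) (use q in auto)
      then have "q2 * (bern q1 - bern q2) \<le> (q2 - q1) * bern q1" by (simp add: algebra_simps)
      also have "\<dots> \<le> 1 / N * (1/2)" using q bb N bern_bounds(3)[OF q(1)] by (intro mult_mono) auto
      finally have 1: "q2 * (bern q1 - bern q2) \<le> 1 / (2 * N)" by simp
      have "q1 * (bern q1 - bern q2) \<le> q2 * (bern q1 - bern q2)" using q m by (intro mult_right_mono) auto
      with 1 have "q1 * (bern q1 - bern q2) \<le> 1 / (2 * N)" by linarith
      then have "(N * y / 2) * (q1 * (bern q1 - bern q2)) \<le> (N * y / 2) * (1 / (2 * N))"
        using y N by (intro mult_left_mono) auto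
      moreover have "(N * y / 2) * (q1 * (bern q1 - bern q2)) = bern q1 - bern q2" "(N * y / 2) * (1 / (2 * N)) = y / 4"
        using y N by (auto simp: q1_def)
      ultimately have "(bern q1 - bern q2) / y \<le> 1/4" using y by (simp add: divide_le_eq)
      moreover have "\<bar>(bern q2 - bern q1) / y\<bar> = (bern q1 - bern q2) / y" using m y by (simp add: abs_divide)
      ultimately show ?thesis by simp
    qed
    have "f1 y = cos (\<tau> * y) * ((E - 1) * (bern q2 / dsinh y) + bern q2 * (1 / dsinh y - 1 / y) + (bern q2 - bern q1) / y)"
      unfolding f1_def crit_weight_def E_def[symmetric] q1_def[symmetric] q2_def[symmetric]
      by (simp add: algebra_simps diff_divide_distrib)
    also have "\<bar>\<dots>\<bar> \<le> 1 * (G\<^sup>2 * A / (4 * \<tau>) + 1/4 + 1/4)"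
      unfolding abs_mult
    proof (rule mult_mono)
      show "\<bar>(E - 1) * (bern q2 / dsinh y) + bern q2 * (1 / dsinh y - 1 / y) + (bern q2 - bern q1) / y\<bar> \<le> G\<^sup>2 * A / (4 * \<tau>) + 1/4 + 1/4"
        by (intro order_trans[OF abs_triangle_ineq] add_mono d1 d2 d3)
    qed auto
    finally show ?thesis by simp
  qed
  have b2: "\<bar>f2 y\<bar> \<le> \<tau>\<^sup>2 / (2 * N)" if y: "0 < y" "y < a" for y
  proof -
    define q where "q = 2 / (N * y)"
    have q: "q > 0" using q0 y by (simp add: q_def)
    have "\<bar>2 * bern q - 1\<bar> \<le> q / 2" using bern_bounds(1,2)[OF q] q by linarith
    then have "\<bar>(cos (\<tau> * y) - 1) * (2 * bern q - 1)\<bar> \<le> ((\<tau> * y)\<^sup>2 / 2) * (q / 2)"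
      unfolding abs_mult using cosb[of "\<tau> * y"] by (intro mult_mono) auto
    then have "\<bar>(cos (\<tau> * y) - 1) * (2 * bern q - 1)\<bar> / y \<le> ((\<tau> * y)\<^sup>2 / 2) * (q / 2) / y"
      using y by (intro divide_right_mono) auto
    also have "((\<tau> * y)\<^sup>2 / 2) * (q / 2) / y = \<tau>\<^sup>2 / (2 * N)" using y N by (simp add: q_def field_simps power2_eq_square)
    finally show ?thesis using y by (simp add: f2_def q_def abs_divide)
  qed
  have b3: "\<bar>f3 y\<bar> \<le> \<tau> * A / 2" if y: "0 < y" "y < a" for y
  proof -
    have "\<bar>cos (\<tau> * y) - 1\<bar> / y \<le> ((\<tau> * y)\<^sup>2 / 2) / y" using cosb y by (intro divide_right_mono) auto
    also have "\<dots> = \<tau>\<^sup>2 * y / 2" using y by (simp add: power2_eq_square)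
    also have "\<dots> \<le> \<tau>\<^sup>2 * a / 2" using y by (intro divide_right_mono mult_left_mono) auto
    also have "\<dots> = \<tau> * A / 2" using \<tau> by (simp add: a_def power2_eq_square)
    finally show ?thesis using y by (simp add: f3_def abs_divide)
  qed
  have b4: "\<bar>f4 y\<bar> \<le> N" if y: "0 < y" "y < a" for y
  proof -
    have "bern (2 / (N * y)) \<le> N * y / 2" "0 \<le> bern (2 / (N * y))" using bern_bounds(3,4)[OF q0[OF y(1)]] by auto
    then show ?thesis using y by (simp add: f4_def divide_le_eq)
  qed
  have a0: "a \<ge> 0" using a by simp
  note B1 = open_interval_integral_bound[OF cont(1) a0 b1]
  note B2 = open_interval_integral_bound[OF cont(2) a0 b2]
  note B3 = open_interval_integral_bound[OF cont(3) a0 b3]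
  note B4 = open_interval_integral_bound[OF cont(4) a0 b4]
  have dec: "cos (\<tau> * y) * crit_weight N G y = f1 y + (1/2) * (f2 y + f3 y + f4 y)" if "y > 0" for y
    unfolding f1_def f2_def f3_def f4_def using that by (simp add: field_simps)
  have "(LBINT y:{0<..<a}. cos (\<tau> * y) * crit_weight N G y) = (LBINT y:{0<..<a}. f1 y + (1/2) * (f2 y + f3 y + f4 y))"
    by (rule set_lebesgue_integral_cong) (use dec in auto)
  also have "\<dots> = (LBINT y:{0<..<a}. f1 y) + (1/2) * ((LBINT y:{0<..<a}. f2 y) + (LBINT y:{0<..<a}. f3 y) + (LBINT y:{0<..<a}. f4 y))"
    using B1(1) B2(1) B3(1) B4(1) by (simp add: set_integral_add)
  finally have main: "2 * (LBINT y:{0<..<a}. cos (\<tau> * y) * crit_weight N G y)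
      = 2 * (LBINT y:{0<..<a}. f1 y) + (LBINT y:{0<..<a}. f2 y) + (LBINT y:{0<..<a}. f3 y) + (LBINT y:{0<..<a}. f4 y)"
    by simp
  have I3: "(LBINT y:{0<..<a}. f3 y) = cosine_deficit A"
    unfolding f3_def cosine_deficit_def using scale_invariant_integral[OF \<tau>, of a "\<lambda>v. cos v - 1"] \<tau> by (simp add: a_def)
  have I4: "(LBINT y:{0<..<a}. f4 y) = log_kernel (N / (2 * \<tau>) * A)"
  proof -
    have N2: "N / 2 > 0" using N by simp
    have "(LBINT y:{0<..<a}. f4 y) = (LBINT y:{0<..<a}. (\<lambda>w. 2 * bern (1 / w)) (N / 2 * y) / y)" by (simp add: f4_def)
    also have "\<dots> = (LBINT w:{0<..<N / 2 * a}. 2 * bern (1 / w) / w)" by (rule scale_invariant_integral[OF N2])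
    finally show ?thesis unfolding log_kernel_def by (simp add: a_def)
  qed
  have "2 * (LBINT y:{0<..<a}. cos (\<tau> * y) * crit_weight N G y) - (cosine_deficit A + log_kernel (N / (2 * \<tau>) * A))
      = 2 * (LBINT y:{0<..<a}. f1 y) + (LBINT y:{0<..<a}. f2 y)" unfolding main I3 I4 by simp
  also have "\<bar>\<dots>\<bar> \<le> 2 * ((G\<^sup>2 * A / (4 * \<tau>) + 1/2) * a) + \<tau>\<^sup>2 / (2 * N) * a"
    using B1(2) B2(2) by linarith
  also have "\<dots> = G\<^sup>2 * A\<^sup>2 / (2 * \<tau>\<^sup>2) + A / \<tau> + \<tau> * A / (2 * N)"
    using \<tau> N by (simp add: a_def power2_eq_square field_simps)
  finally show ?thesis by (simp add: a_def)
qed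

text \<open>By \<open>bern_bounds\<close> the integrand differs from 1/w by at most 1 / (2 w^2), and
  this integrates to at most 1 / (2 X).\<close>

lemma log_kernel_diff:
  assumes X: "1 \<le> X" "X \<le> Y"
  shows "\<bar>(log_kernel Y - ln Y) - (log_kernel X - ln X)\<bar> \<le> 1 / (2 * X)"
proof -
  define f where "f = (\<lambda>w. 2 * bern (1 / w) / w)"
  have cf: "continuous_on {0<..} f"
    unfolding f_def by (intro continuous_intros) auto
  have bf: "\<bar>f y\<bar> \<le> 2" if "0 < y" "y < Y" for y
    using bern_bounds(3,4)[of "1 / y"] that by (simp add: f_def divide_le_eq)
  have Y0: "0 \<le> Y" using X by simp
  have i: "set_integrable lborel {0<..<Y} f"
    by (rule open_interval_integral_bound(1)[OF continuous_on_subset[OF cf] Y0 bf]) auto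
  have "(LBINT w:{0<..<X} \<union> {X..<Y}. f w) = (LBINT w:{0<..<X}. f w) + (LBINT w:{X..<Y}. f w)"
    by (rule set_integral_Un) (use X in \<open>auto intro!: set_integrable_subset[OF i]\<close>)
  moreover have "{0<..<X} \<union> {X..<Y} = {0<..<Y}" using X by auto
  moreover have "(LBINT w:{X..<Y}. f w) = integral {X..Y} f"
  proof -
    have "(LBINT w:{X..<Y}. f w) = integral {X..<Y} f"
      by (rule set_borel_integral_eq_integral(2)) (use X in \<open>auto intro!: set_integrable_subset[OF i]\<close>)
    also have "\<dots> = integral {X..Y} f"
      by (rule integral_subset_negligible) (auto intro: negligible_subset[OF negligible_sing[of Y]])
    finally show ?thesis .
  qed
  ultimately have 1: "log_kernel Y - log_kernel X = integral {X..Y} f" by (simp add: log_kernel_def f_def)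
  have "((\<lambda>w. 1 / w) has_integral (ln Y - ln X)) {X..Y}"
    by (rule fundamental_theorem_of_calculus[OF X(2)])
       (use X in \<open>auto intro!: derivative_eq_intros simp flip: has_real_derivative_iff_has_vector_derivative\<close>)
  moreover have "(f has_integral integral {X..Y} f) {X..Y}"
    by (intro integrable_integral integrable_continuous_interval continuous_on_subset[OF cf]) (use X in auto)
  ultimately have d: "((\<lambda>w. f w - 1 / w) has_integral (integral {X..Y} f - (ln Y - ln X))) {X..Y}"
    by (intro has_integral_diff)
  have "((\<lambda>w. - (1 / w) / 2) has_vector_derivative 1 / (2 * w\<^sup>2)) (at w within {X..Y})" if "X \<le> w" for w
    unfolding has_real_derivative_iff_has_vector_derivative[symmetric]
    using that X by (auto intro!: derivative_eq_intros simp: power2_eq_square)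
  then have e: "((\<lambda>w. 1 / (2 * w\<^sup>2)) has_integral (- (1 / Y) / 2 - - (1 / X) / 2)) {X..Y}"
    by (intro fundamental_theorem_of_calculus[OF X(2)]) auto
  have b: "- (1 / (2 * w\<^sup>2)) \<le> f w - 1 / w \<and> f w - 1 / w \<le> 0" if "X \<le> w" for w
  proof -
    have w: "w > 0" using that X by simp
    have "1/2 - 1 / w / 4 \<le> bern (1 / w)" "bern (1 / w) \<le> 1/2" using bern_bounds(1,2)[of "1 / w"] w by auto
    then have "- (1 / (2 * w)) \<le> 2 * bern (1 / w) - 1" "2 * bern (1 / w) - 1 \<le> 0" by auto
    then have "- (1 / (2 * w)) / w \<le> (2 * bern (1 / w) - 1) / w" "(2 * bern (1 / w) - 1) / w \<le> 0"
      using w by (intro divide_right_mono divide_nonpos_pos; simp)+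
    then show ?thesis by (simp add: f_def diff_divide_distrib power2_eq_square)
  qed
  have "integral {X..Y} f - (ln Y - ln X) \<le> 0" by (rule has_integral_le[OF d has_integral_0]) (use b in auto)
  moreover have "- (- (1 / Y) / 2 - - (1 / X) / 2) \<le> integral {X..Y} f - (ln Y - ln X)"
    by (rule has_integral_le[OF has_integral_neg[OF e] d]) (use b in auto)
  moreover have "- (- (1 / Y) / 2 - - (1 / X) / 2) \<ge> - (1 / (2 * X))"
  proof -
    have "1 / Y \<ge> 0" using X by simp
    then show ?thesis by (simp add: mult.commute)
  qed
  ultimately show ?thesis using 1 by linarith
qed

text \<open>Only the existence of the constant in the local mean on the critical line matters; it comes from
  this Cauchy criterion and is never evaluated.\<close>

lemma tendsto_of_oscillation:
  fixes h :: "real \<Rightarrow> real"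
  assumes osc: "\<And>X Y. 1 \<le> X \<Longrightarrow> X \<le> Y \<Longrightarrow> \<bar>h Y - h X\<bar> \<le> B / X"
  obtains c where "\<And>X. X \<ge> 1 \<Longrightarrow> \<bar>h X - c\<bar> \<le> B / X"
proof -
  have B: "B \<ge> 0" using osc[of 1 1] by simp
  have "Cauchy (\<lambda>n. h (real (Suc n)))"
  proof (rule metric_CauchyI)
    fix e :: real assume e: "e > 0"
    obtain M :: nat where M: "B / e < real M" using reals_Archimedean2 by blast
    have M2: "B / real (Suc m) < e" if "m \<ge> M" for m
    proof -
      have "B / e < real (Suc m)" using M that by linarith
      then show ?thesis using e by (simp add: field_simps)
    qed
    have *: "dist (h (real (Suc m))) (h (real (Suc n))) < e" if "M \<le> m" "m \<le> n" for m n
      using osc[of "real (Suc m)" "real (Suc n)"] M2[of m] that by (simp add: dist_real_def abs_minus_commute)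
    have "dist (h (real (Suc m))) (h (real (Suc n))) < e" if "M \<le> m" "M \<le> n" for m n
      using *[of m n] *[of n m] that by (cases "m \<le> n") (auto simp: dist_commute)
    then show "\<exists>M. \<forall>m\<ge>M. \<forall>n\<ge>M. dist (h (real (Suc m))) (h (real (Suc n))) < e" by blast
  qed
  then obtain c where c: "(\<lambda>n. h (real (Suc n))) \<longlonglongrightarrow> c" using Cauchy_convergent convergent_def by blast
  have "\<bar>h X - c\<bar> \<le> B / X" if X: "X \<ge> 1" for X
  proof (rule tendsto_upperbound)
    show "(\<lambda>n. \<bar>h X - h (real (Suc n))\<bar>) \<longlonglongrightarrow> \<bar>h X - c\<bar>" by (intro tendsto_intros c)
    obtain M :: nat where M: "X < real M" using reals_Archimedean2 by blast
    show "\<forall>\<^sub>F n in sequentially. \<bar>h X - h (real (Suc n))\<bar> \<le> B / X"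
    proof (rule eventually_sequentiallyI[of M])
      fix n assume "n \<ge> M"
      then have "X \<le> real (Suc n)" using M by linarith
      from osc[OF X this] show "\<bar>h X - h (real (Suc n))\<bar> \<le> B / X" by linarith
    qed
  qed simp
  then show thesis using that by blast
qed

lemma log_kernel_asymp: "\<exists>c. \<forall>X\<ge>1. \<bar>log_kernel X - ln X - c\<bar> \<le> 1 / (2 * X)"
proof -
  obtain c where "\<And>X. X \<ge> 1 \<Longrightarrow> \<bar>(log_kernel X - ln X) - c\<bar> \<le> (1/2) / X"
    by (rule tendsto_of_oscillation[of "\<lambda>X. log_kernel X - ln X" "1/2"]) (use log_kernel_diff in auto)
  then show ?thesis by (intro exI[of _ c]) auto
qed

lemma diagonal_sum_1:
  assumes N: "N > 0" shows "diagonal_sum 1 N = - ln (1 - exp (- 2 / N))"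
proof -
  define q where "q = exp (- 2 / N)"
  have q: "0 < q" "q < 1" using N by (auto simp: q_def)
  have qp: "q ^ Suc n = exp (- 2 * real (Suc n) / N)" for n
    unfolding q_def by (subst exp_of_nat_mult[symmetric]) (simp only: times_divide_eq_right mult.commute)
  have "ln (1 - q) = (\<Sum>n. (-1) ^ n * (1 / real (n + 1)) * (1 - q - 1) ^ Suc n)"
    by (rule ln_series) (use q in auto)
  also have "\<dots> = (\<Sum>n. - (real (Suc n) powr (- 1) * exp (- 2 * real (Suc n) / N)))"
  proof (rule suminf_cong)
    fix n
    have "(1 - q - 1) ^ Suc n = (-1) ^ Suc n * q ^ Suc n" using power_mult_distrib[of "-1" q "Suc n"]
      by (metis add_diff_cancel_left' diff_add_cancel mult_minus1 minus_diff_eq)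
    moreover have "q ^ Suc n = exp (- 2 * real (Suc n) / N)" by (rule qp)
    moreover have "(-1) ^ n * (1 / real (n + 1)) * ((-1) ^ Suc n * Q) = - (real (Suc n) powr (- 1) * Q)" for Q :: real
    proof -
      have "(-1) ^ n * (1 / real (n + 1)) * ((-1) ^ Suc n * Q) = ((-1) ^ n * (-1) ^ Suc n) * (1 / real (n + 1) * Q)" by (simp only: mult_ac)
      also have "(-1) ^ n * (-1) ^ Suc n = (- 1 :: real)" by (simp flip: power_mult_distrib)
      finally show ?thesis by (simp add: powr_minus_divide)
    qed
    ultimately show "(-1) ^ n * (1 / real (n + 1)) * (1 - q - 1) ^ Suc n = - (real (Suc n) powr (- 1) * exp (- 2 * real (Suc n) / N))"
      by presburger
  qed
  also have "\<dots> = - diagonal_sum 1 N"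
  proof -
    have "summable (\<lambda>n. real (Suc n) powr (- 1) * exp (- 2 * real (Suc n) / N))"
    proof (rule summable_comparison_test')
      show "summable (\<lambda>n. q ^ n)" using q by simp
      show "norm (real (Suc n) powr (- 1) * exp (- 2 * real (Suc n) / N)) \<le> q ^ n" for n
      proof -
        have "exp (- 2 * real (Suc n) / N) = q ^ Suc n" by (rule qp[symmetric])
        moreover have "real (Suc n) powr (- 1) \<le> 1" by (simp add: powr_minus_divide)
        moreover have "q ^ Suc n \<le> q ^ n" using q by (simp add: mult_left_le_one_le)
        ultimately show ?thesis using mult_mono[of "real (Suc n) powr (- 1)" 1 "q ^ Suc n" "q ^ n"] q by simp
      qed
    qed
    then show ?thesis unfolding diagonal_sum_def by (rule suminf_minus)
  qed
  finally show ?thesis by (simp add: q_def)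
qed

text \<open>A is the cut point in the variable \<tau> y. It is held fixed while \<tau> grows, so
  that in the end only the tail error 4/A survives.\<close>

lemma rest_part_1_approx:
  assumes N: "N > 0" and G: "G \<ge> 1" and \<tau>: "\<tau> > 0" and A: "A > 0"
  shows "\<bar>2 * rest_part 1 N \<tau> G - (cosine_deficit A + log_kernel (N / (2 * \<tau>) * A))\<bar>
     \<le> G\<^sup>2 * A\<^sup>2 / (2 * \<tau>\<^sup>2) + A / \<tau> + \<tau> * A / (2 * N) + 4 / A"
proof -
  define f where "f = (\<lambda>y. cos (\<tau> * y) * crit_weight N G y)"
  have i: "set_integrable lborel {0<..} f" unfolding f_def by (rule rest_part_1(2)[OF N G])
  have a: "A / \<tau> > 0" using A \<tau> by simp
  have "(LBINT w:{0<..<A / \<tau>} \<union> {A / \<tau>..}. f w) = (LBINT w:{0<..<A / \<tau>}. f w) + (LBINT w:{A / \<tau>..}. f w)"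
    by (rule set_integral_Un) (use a in \<open>auto intro!: set_integrable_subset[OF i] intro: less_le_trans[OF a]\<close>)
  moreover have "{0<..<A / \<tau>} \<union> {A / \<tau>..} = {0<..}" using a by auto
  ultimately have 1: "rest_part 1 N \<tau> G = (LBINT w:{0<..<A / \<tau>}. f w) + (LBINT w:{A / \<tau>..}. f w)"
    unfolding rest_part_1(1)[OF N G] f_def by simp
  have "\<bar>LBINT w:{A / \<tau>..}. f w\<bar> \<le> 2 / (\<tau> * (A / \<tau>))" unfolding f_def by (rule crit_tail_bound[OF N G \<tau> a])
  then have "\<bar>LBINT w:{A / \<tau>..}. f w\<bar> \<le> 2 / A" using \<tau> by simp
  with crit_head_approx[OF N G \<tau> A] show ?thesis unfolding 1 f_def[symmetric] distrib_left by linarith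
qed

lemma window_filter_neq_bot: "window_filter \<noteq> bot"
proof
  assume "window_filter = bot"
  then have "eventually (\<lambda>_. False) window_filter" by simp
  then obtain \<tau>0 where "\<forall>\<tau>\<ge>\<tau>0. \<forall>G\<in>width_range \<tau>. False" unfolding eventually_window_filter by blast
  moreover have "(max \<tau>0 0) powr (3/5) \<in> width_range (max \<tau>0 0)" by (simp add: width_range_def)
  ultimately show False by (meson max.cobounded1)
qed

text \<open>An iterated limit, first \<tau> and then A. For fixed A the normalised quantity R is
  eventually within 5/A of h A; comparing two cut points at a common point of the filter shows that
  h converges, and R has the same limit C. As h does not involve k, one C serves both N = \<tau>^3
  and N = 2 \<tau>^3. The subtracted logarithm is that of N / (2 \<tau>).\<close>

lemma rest_part_1_limit:
  "\<exists>C. \<forall>k\<in>{1, 2}. ((\<lambda>(\<tau>, G). 2 * rest_part 1 (k * \<tau> ^ 3) \<tau> G - ln (k * \<tau>\<^sup>2 / 2)) \<longlongrightarrow> C) window_filter"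
proof -
  obtain c where c: "\<And>X. X \<ge> 1 \<Longrightarrow> \<bar>log_kernel X - ln X - c\<bar> \<le> 1 / (2 * X)" using log_kernel_asymp by blast
  define R where "R = (\<lambda>k (i :: real \<times> real). 2 * rest_part 1 (k * fst i ^ 3) (fst i) (snd i) - ln (k * (fst i)\<^sup>2 / 2))"
  define h where "h = (\<lambda>A. cosine_deficit A + ln A + c)"
  have ev: "eventually (\<lambda>i. \<bar>R k i - h A\<bar> \<le> 5 / A) window_filter" if A: "A \<ge> 1" and k: "k \<in> {1, 2}" for A k
  proof -
    define g where "g = (\<lambda>\<tau>. (2 * \<tau> powr (3/5))\<^sup>2 * A\<^sup>2 / (2 * \<tau>\<^sup>2) + A / \<tau> + \<tau> * A / (2 * \<tau> ^ 3) + 1 / (A * \<tau>\<^sup>2))"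
    have "(g \<longlongrightarrow> 0) at_top" unfolding g_def using A by real_asymp
    then have "eventually (\<lambda>\<tau>. g \<tau> < 1 / A) at_top" by (rule order_tendstoD) (use A in simp)
    then obtain \<tau>1 where \<tau>1: "\<And>\<tau>. \<tau> \<ge> \<tau>1 \<Longrightarrow> g \<tau> < 1 / A" unfolding eventually_at_top_linorder by blast
    have "\<bar>R k (\<tau>, G) - h A\<bar> \<le> 5 / A" if \<tau>: "\<tau> \<ge> max 32 \<tau>1" and Gw: "G \<in> width_range \<tau>" for \<tau> G
    proof -
      have t: "\<tau> \<ge> 32" "\<tau> > 0" "\<tau> \<ge> \<tau>1" using \<tau> by auto
      define N where "N = k * \<tau> ^ 3"
      have N: "N > 0" "N \<ge> \<tau> ^ 3" using k t by (auto simp: N_def)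
      have G: "G \<ge> 1" "G \<le> 2 * \<tau> powr (3/5)" using width_range_ge_1[OF t(1) Gw] Gw by (auto simp: width_range_def)
      define X where "X = N / (2 * \<tau>) * A"
      have X: "X = (k * \<tau>\<^sup>2 / 2) * A" using t by (simp add: X_def N_def power2_eq_square power3_eq_cube)
      have kt: "k * \<tau>\<^sup>2 / 2 > 0" "k * \<tau>\<^sup>2 / 2 \<ge> \<tau>\<^sup>2 / 2" using k t by auto
      have "\<tau>\<^sup>2 / 2 * A \<le> X" unfolding X using kt A by (intro mult_right_mono) auto
      moreover have "32\<^sup>2 \<le> \<tau>\<^sup>2" using t by (intro power_mono) auto
      ultimately have X1: "X \<ge> \<tau>\<^sup>2 * A / 2" "X \<ge> 1" using A mult_mono[of 1 "\<tau>\<^sup>2 / 2" 1 A] by auto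
      have lnX: "ln X = ln (k * \<tau>\<^sup>2 / 2) + ln A" unfolding X using kt A by (intro ln_mult_pos) auto
      have "1 / (2 * X) \<le> 1 / (2 * (\<tau>\<^sup>2 * A / 2))" using X1 t A by (intro divide_left_mono mult_pos_pos) auto
      then have X2: "1 / (2 * X) \<le> 1 / (A * \<tau>\<^sup>2)" by (simp add: mult.commute)
      have g1: "G\<^sup>2 * A\<^sup>2 / (2 * \<tau>\<^sup>2) \<le> (2 * \<tau> powr (3/5))\<^sup>2 * A\<^sup>2 / (2 * \<tau>\<^sup>2)"
        using G by (intro divide_right_mono mult_right_mono power_mono) auto
      have g2: "\<tau> * A / (2 * N) \<le> \<tau> * A / (2 * \<tau> ^ 3)" using N t A by (intro divide_left_mono mult_pos_pos) auto
      have "\<bar>2 * rest_part 1 N \<tau> G - (cosine_deficit A + log_kernel X)\<bar>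
           \<le> G\<^sup>2 * A\<^sup>2 / (2 * \<tau>\<^sup>2) + A / \<tau> + \<tau> * A / (2 * N) + 4 / A"
        unfolding X_def by (rule rest_part_1_approx) (use N G t A in auto)
      moreover have "R k (\<tau>, G) - h A = (2 * rest_part 1 N \<tau> G - (cosine_deficit A + log_kernel X)) + (log_kernel X - ln X - c)"
        unfolding R_def h_def lnX N_def by simp
      ultimately have "\<bar>R k (\<tau>, G) - h A\<bar> \<le> g \<tau> + 4 / A"
        using c[OF X1(2)] X2 g1 g2 unfolding g_def by linarith
      then show ?thesis using \<tau>1[OF t(3)] by simp
    qed
    then show ?thesis unfolding eventually_window_filter by blast
  qed
  \<comment> \<open>h X and h Y are both close to the same value R 1 i, which exists because the
    filter is not trivial.\<close>
  have osc: "\<bar>h Y - h X\<bar> \<le> 10 / X" if X: "1 \<le> X" "X \<le> Y" for X Y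
  proof -
    have "eventually (\<lambda>i. \<bar>R 1 i - h X\<bar> \<le> 5 / X \<and> \<bar>R 1 i - h Y\<bar> \<le> 5 / Y) window_filter"
      by (rule eventually_conj[OF ev ev]) (use X in auto)
    then obtain i where i: "\<bar>R 1 i - h X\<bar> \<le> 5 / X" "\<bar>R 1 i - h Y\<bar> \<le> 5 / Y"
      using eventually_happens window_filter_neq_bot by blast
    have "5 / Y \<le> 5 / X" using X by (intro divide_left_mono) auto
    with i show ?thesis by (simp add: abs_le_iff)
  qed
  obtain C where C: "\<And>X. X \<ge> 1 \<Longrightarrow> \<bar>h X - C\<bar> \<le> 10 / X" by (rule tendsto_of_oscillation[OF osc]) auto
  have "(R k \<longlongrightarrow> C) window_filter" if k: "k \<in> {1, 2}" for k
  proof (rule tendstoI)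
    fix e :: real assume e: "e > 0"
    \<comment> \<open>The two distances 5/A and 10/A add up to 15/A, which must be smaller than
      e.\<close>
    define A where "A = max 1 (16 / e)"
    have A: "A \<ge> 1" "16 / e \<le> A" by (auto simp: A_def)
    have "16 / A \<le> e" using A e by (simp add: field_simps)
    then have "15 / A < e" using A e by (simp add: divide_less_eq divide_le_eq)
    from ev[OF A(1) k] show "eventually (\<lambda>i. dist (R k i) C < e) window_filter"
    proof eventually_elim
      case (elim i)
      then show ?case using C[OF A(1)] \<open>15 / A < e\<close> by (simp add: dist_real_def abs_le_iff abs_less_iff)
    qed
  qed
  then show ?thesis unfolding R_def case_prod_unfold by (intro exI[of _ C] ballI) blast
qed

text \<open>The diagonal contributes ln (N / 2) = ln (k \<tau>^3 / 2) and twice the rest part takes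
  away ln (k \<tau>^2 / 2) + C. What remains is ln \<tau> - C, independent of k.\<close>

lemma local_mean_critical:
  "\<exists>C. ((\<lambda>(\<tau>, G). gauss_mean (\<lambda>t. (norm (zeta (Complex (1/2) t)))\<^sup>2) \<tau> G - (ln \<tau> + C)) \<longlongrightarrow> 0) window_filter"
proof -
  obtain C where C: "\<And>k. k \<in> {1, 2} \<Longrightarrow> ((\<lambda>(\<tau>, G). 2 * rest_part 1 (k * \<tau> ^ 3) \<tau> G - ln (k * \<tau>\<^sup>2 / 2)) \<longlongrightarrow> C) window_filter"
    using rest_part_1_limit by blast
  have "((\<lambda>(\<tau>, G). gauss_mean (\<lambda>t. (norm (zeta (Complex (1/2) t)))\<^sup>2) \<tau> G - (ln \<tau> - C)) \<longlongrightarrow> 0) window_filter"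
  proof (rule local_mean_limit)
    show "((\<lambda>\<tau>. \<tau> powr (-1/10) * (ln \<tau> - C)) \<longlongrightarrow> 0) at_top" by real_asymp
    fix k :: real assume k: "k \<in> {1, 2}"
    then have k0: "k > 0" by auto
    have "((\<lambda>\<tau>::real. - ln (1 - exp (- 2 / (k * \<tau> ^ 3))) - ln (k * \<tau>\<^sup>2 / 2) - ln \<tau>) \<longlongrightarrow> 0) at_top"
      using k0 by real_asymp (simp add: ln_mult_pos ln_div ln_inverse)
    moreover have "eventually (\<lambda>\<tau>::real. - ln (1 - exp (- 2 / (k * \<tau> ^ 3))) - ln (k * \<tau>\<^sup>2 / 2) - ln \<tau>
        = diagonal_sum 1 (k * \<tau> ^ 3) - ln (k * \<tau>\<^sup>2 / 2) - ln \<tau>) at_top"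
      using eventually_gt_at_top[of 0] by eventually_elim (use k0 in \<open>simp add: diagonal_sum_1\<close>)
    ultimately have "((\<lambda>\<tau>::real. diagonal_sum 1 (k * \<tau> ^ 3) - ln (k * \<tau>\<^sup>2 / 2) - ln \<tau>) \<longlongrightarrow> 0) at_top"
      by (rule Lim_transform_eventually)
    from tendsto_diff[OF window_filter_fst[OF this] tendsto_diff[OF C[OF k] tendsto_const[of C]]]
    show "((\<lambda>(\<tau>, G). diagonal_sum (2 * (1/2)) (k * \<tau> ^ 3) - 2 * rest_part (2 * (1/2)) (k * \<tau> ^ 3) \<tau> G - (ln \<tau> - C)) \<longlongrightarrow> 0) window_filter"
      by (simp add: case_prod_unfold algebra_simps)
  qed auto
  then show ?thesis by (intro exI[of _ "- C"]) simp
qed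

section \<open>Mean squares over short intervals\<close>

lemma gauss_mean_interval:
  fixes w :: "real \<Rightarrow> real" and K G P Q :: real
  assumes cont: "continuous_on UNIV w" and w0: "\<And>t. 0 \<le> w t" and wK: "\<And>t. w t \<le> K * (1 + t\<^sup>2)"
    and PQ: "0 \<le> P" "P \<le> Q"
  shows "integral {P..Q} (\<lambda>\<tau>. w (\<tau> + G * x)) \<le> (Q - P) * (K * (1 + 2 * Q\<^sup>2 + 2 * G\<^sup>2 * x\<^sup>2))"
    and "integrable gauss (\<lambda>x. integral {P..Q} (\<lambda>\<tau>. w (\<tau> + G * x)))"
    and "(\<lambda>\<tau>. gauss_mean w \<tau> G) integrable_on {P..Q}"
    and "integral {P..Q} (\<lambda>\<tau>. gauss_mean w \<tau> G) = (\<integral>x. integral {P..Q} (\<lambda>\<tau>. w (\<tau> + G * x)) \<partial>gauss)"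
proof -
  have K: "K \<ge> 0" using w0[of 0] wK[of 0] by simp
  have cw: "continuous_on A (\<lambda>\<tau>. w (\<tau> + c))" for A c
    by (rule continuous_on_compose2[OF cont]) (auto intro!: continuous_intros)
  have bd: "w (\<tau> + G * x) \<le> K * (1 + 2 * Q\<^sup>2 + 2 * G\<^sup>2 * x\<^sup>2)" if "\<tau> \<in> {P..Q}" for \<tau> x
  proof -
    have "w (\<tau> + G * x) \<le> K * (1 + (\<tau> + G * x)\<^sup>2)" by (rule wK)
    also have "(\<tau> + G * x)\<^sup>2 \<le> 2 * \<tau>\<^sup>2 + 2 * (G * x)\<^sup>2"
      using zero_le_power2[of "\<tau> - G * x"] by (simp add: power2_sum power2_diff)
    also have "\<tau>\<^sup>2 \<le> Q\<^sup>2" using that PQ by (intro power_mono) auto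
    finally show ?thesis using K by (simp add: mult_left_mono power_mult_distrib mult.assoc add.assoc)
  qed
  show 1: "integral {P..Q} (\<lambda>\<tau>. w (\<tau> + G * x)) \<le> (Q - P) * (K * (1 + 2 * Q\<^sup>2 + 2 * G\<^sup>2 * x\<^sup>2))" for x
  proof -
    have "integral {P..Q} (\<lambda>\<tau>. w (\<tau> + G * x)) \<le> integral {P..Q} (\<lambda>\<tau>. K * (1 + 2 * Q\<^sup>2 + 2 * G\<^sup>2 * x\<^sup>2))"
      by (rule integral_le) (use bd in \<open>auto intro!: integrable_continuous_interval cw\<close>)
    also have "\<dots> = (Q - P) * (K * (1 + 2 * Q\<^sup>2 + 2 * G\<^sup>2 * x\<^sup>2))" using PQ(2) by (simp only: integral_const_real) simp
    finally show ?thesis .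
  qed
  have [measurable]: "w \<in> borel_measurable borel" using cont by (rule borel_measurable_continuous_onI)
  define f where "f = (\<lambda>(x, \<tau>). indicator {P..Q} \<tau> * w (\<tau> + G * x))"
  have fm: "f \<in> borel_measurable (gauss \<Otimes>\<^sub>M lborel)" unfolding f_def by measurable
  have fi: "integrable lborel (\<lambda>\<tau>. f (x, \<tau>))" for x
    using borel_integrable_atLeastAtMost'[OF cw, of P Q "G * x"] by (simp add: f_def set_integrable_def)
  have fx: "(\<integral>\<tau>. f (x, \<tau>) \<partial>lborel) = integral {P..Q} (\<lambda>\<tau>. w (\<tau> + G * x))" for x
    using set_borel_integral_eq_integral(2)[OF borel_integrable_atLeastAtMost'[OF cw, of P Q "G * x"]]
    by (simp add: f_def set_lebesgue_integral_def)
  have f\<tau>: "(\<integral>x. f (x, \<tau>) \<partial>gauss) = indicator {P..Q} \<tau> * gauss_mean w \<tau> G" for \<tau>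
    by (simp add: f_def gauss_mean_def)
  have nf: "norm (f p) = f p" for p using w0 by (auto simp: f_def split: prod.split)
  have Im: "(\<lambda>x. integral {P..Q} (\<lambda>\<tau>. w (\<tau> + G * x))) \<in> borel_measurable borel"
    unfolding fx[symmetric] f_def by measurable
  show 2: "integrable gauss (\<lambda>x. integral {P..Q} (\<lambda>\<tau>. w (\<tau> + G * x)))"
  proof (rule gauss_integrable_poly[OF Im])
    fix x
    have "0 \<le> integral {P..Q} (\<lambda>\<tau>. w (\<tau> + G * x))"
      by (rule integral_nonneg) (use w0 in \<open>auto intro!: integrable_continuous_interval cw\<close>)
    then show "\<bar>integral {P..Q} (\<lambda>\<tau>. w (\<tau> + G * x))\<bar> \<le> (Q - P) * (K * (1 + 2 * Q\<^sup>2)) + ((Q - P) * K * (2 * G\<^sup>2)) * x ^ 2"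
      using 1[of x] by (simp add: algebra_simps)
  qed
  interpret pair_sigma_finite gauss lborel ..
  have fI: "integrable (gauss \<Otimes>\<^sub>M lborel) f"
    by (rule Fubini_integrable[OF fm]) (simp_all only: nf fx 2 fi AE_I2)
  have si: "set_integrable lborel {P..Q} (\<lambda>\<tau>. gauss_mean w \<tau> G)"
    using integrable_snd[of "\<lambda>x \<tau>. f (x, \<tau>)"] fI by (simp add: f\<tau> set_integrable_def)
  show "(\<lambda>\<tau>. gauss_mean w \<tau> G) integrable_on {P..Q}"
    by (rule set_borel_integral_eq_integral(1)[OF si])
  have "integral {P..Q} (\<lambda>\<tau>. gauss_mean w \<tau> G) = (\<integral>\<tau>. (\<integral>x. f (x, \<tau>) \<partial>gauss) \<partial>lborel)"
    unfolding f\<tau> set_borel_integral_eq_integral(2)[OF si, symmetric] by (simp add: set_lebesgue_integral_def)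
  also have "\<dots> = (\<integral>x. (\<integral>\<tau>. f (x, \<tau>) \<partial>lborel) \<partial>gauss)"
    by (rule Fubini_integral) (use fI in simp)
  finally show "integral {P..Q} (\<lambda>\<tau>. gauss_mean w \<tau> G) = (\<integral>x. integral {P..Q} (\<lambda>\<tau>. w (\<tau> + G * x)) \<partial>gauss)"
    unfolding fx .
qed

lemma integral_translate:
  fixes w :: "real \<Rightarrow> real"
  shows "integral {P..Q} (\<lambda>\<tau>. w (\<tau> + c)) = integral {P + c..Q + c} w"
  using integral_shift_real_ivl[of "P + c" c "Q + c" w] by simp

text \<open>The moment of order 14 is used because, with \<open>G = T\<^sup>3\<^sup>/\<^sup>5\<close> and \<open>H = T\<^sup>9\<^sup>/\<^sup>1\<^sup>0\<close>, the factor
  \<open>(G/H)\<^sup>1\<^sup>4 = T\<^sup>-\<^sup>2\<^sup>1\<^sup>/\<^sup>5\<close> beats the trivial bound \<open>O(T\<^sup>3)\<close> of the integral.\<close>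

lemma unsmooth_upper:
  fixes w :: "real \<Rightarrow> real" and K G H T1 T2 :: real
  assumes cont: "continuous_on UNIV w" and w0: "\<And>t. 0 \<le> w t" and wK: "\<And>t. w t \<le> K * (1 + t\<^sup>2)"
    and H: "H > 0" "H \<le> T1" "T1 \<le> T2" and G: "G > 0"
  shows "integral {T1..T2} w \<le> integral {T1 - H..T2 + H} (\<lambda>\<tau>. gauss_mean w \<tau> G)
     + (T2 - T1) * (K * (1 + 2 * T2\<^sup>2)) * (G / H) ^ 14 * (\<integral>x. x ^ 14 \<partial>gauss)"
proof -
  have wi: "w integrable_on {a..b}" for a b
    by (intro integrable_continuous_interval continuous_on_subset[OF cont]) auto
  have PQ: "0 \<le> T1 - H" "T1 - H \<le> T2 + H" "0 \<le> T1" using H by auto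
  note I = gauss_mean_interval[OF cont w0 wK PQ(1,2), of G]
  define B where "B = (T2 - T1) * (K * (1 + 2 * T2\<^sup>2))"
  have B: "integral {T1..T2} w \<le> B"
    using gauss_mean_interval(1)[OF cont w0 wK PQ(3) H(3), of 0 0] by (simp add: B_def)
  have B0: "B \<ge> 0" using B integral_nonneg[OF wi, of T1 T2] w0 by force
  \<comment> \<open>As long as |G x| \<le> H the shifted enlarged interval still covers [T1, T2];
    beyond that, (G x / H)^14 \<ge> 1 pays for the trivial bound B.\<close>
  have pt: "integral {T1..T2} w \<le> integral {T1 - H..T2 + H} (\<lambda>\<tau>. w (\<tau> + G * x)) + B * (G / H) ^ 14 * x ^ 14" for x
  proof (cases "\<bar>G * x\<bar> \<le> H")
    case True
    then have "integral {T1..T2} w \<le> integral {T1 - H + G * x..T2 + H + G * x} w"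
      by (intro integral_subset_le wi) (use w0 in auto)
    moreover have "0 \<le> B * (G / H) ^ 14 * x ^ 14" using B0 G H by (auto intro!: mult_nonneg_nonneg zero_le_even_power)
    ultimately show ?thesis unfolding integral_translate by linarith
  next
    case False
    have "1 \<le> \<bar>G * x / H\<bar> ^ 14" using False H by (intro one_le_power) (simp add: abs_divide)
    then have "1 \<le> (G / H) ^ 14 * x ^ 14" by (simp add: power_mult_distrib power_divide)
    from mult_left_mono[OF this B0] have "B \<le> B * (G / H) ^ 14 * x ^ 14" by (simp add: mult.assoc)
    moreover have "0 \<le> integral {T1 - H..T2 + H} (\<lambda>\<tau>. w (\<tau> + G * x))"
      unfolding integral_translate by (rule integral_nonneg[OF wi]) (use w0 in auto)
    ultimately show ?thesis using B by linarith
  qed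
  have "(\<integral>x. integral {T1..T2} w \<partial>gauss) \<le> (\<integral>x. integral {T1 - H..T2 + H} (\<lambda>\<tau>. w (\<tau> + G * x)) + B * (G / H) ^ 14 * x ^ 14 \<partial>gauss)"
  proof (rule integral_mono)
    show "integrable gauss (\<lambda>x. integral {T1 - H..T2 + H} (\<lambda>\<tau>. w (\<tau> + G * x)) + B * (G / H) ^ 14 * x ^ 14)"
      by (intro Bochner_Integration.integrable_add I(2) integrable_mult_right integrable_std_normal_distribution_moment)
  qed (use pt in \<open>auto simp: gauss.integrable_const\<close>)
  also have "(\<integral>x. integral {T1..T2} w \<partial>gauss) = integral {T1..T2} w" by (simp add: gauss.prob_space[simplified])
  also have "(\<integral>x. integral {T1 - H..T2 + H} (\<lambda>\<tau>. w (\<tau> + G * x)) + B * (G / H) ^ 14 * x ^ 14 \<partial>gauss)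
      = integral {T1 - H..T2 + H} (\<lambda>\<tau>. gauss_mean w \<tau> G) + B * (G / H) ^ 14 * (\<integral>x. x ^ 14 \<partial>gauss)"
    unfolding I(4) by (subst Bochner_Integration.integral_add[OF I(2)])
      (auto intro!: integrable_mult_right integrable_std_normal_distribution_moment)
  finally show ?thesis unfolding B_def .
qed

text \<open>For |G x| \<le> H the shifted shrunken interval stays inside [T1, T2]. Otherwise the
  quadratic growth of w at \<tau> + G x brings in G^2 x^2, whence the additional moment of order
  16.\<close>

lemma unsmooth_lower:
  fixes w :: "real \<Rightarrow> real" and K G H T1 T2 :: real
  assumes cont: "continuous_on UNIV w" and w0: "\<And>t. 0 \<le> w t" and wK: "\<And>t. w t \<le> K * (1 + t\<^sup>2)"
    and H: "H > 0" "0 \<le> T1" "T1 + H \<le> T2 - H" and G: "G > 0"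
  shows "integral {T1 + H..T2 - H} (\<lambda>\<tau>. gauss_mean w \<tau> G) \<le> integral {T1..T2} w
     + (T2 - T1) * (K * (1 + 2 * T2\<^sup>2)) * (G / H) ^ 14 * (\<integral>x. x ^ 14 \<partial>gauss)
     + (T2 - T1) * (K * (2 * G\<^sup>2)) * (G / H) ^ 14 * (\<integral>x. x ^ 16 \<partial>gauss)"
proof -
  have K: "K \<ge> 0" using w0[of 0] wK[of 0] by simp
  have wi: "w integrable_on {a..b}" for a b
    by (intro integrable_continuous_interval continuous_on_subset[OF cont]) auto
  have PQ: "0 \<le> T1 + H" "T1 + H \<le> T2 - H" "T1 \<le> T2" using H by auto
  note I = gauss_mean_interval[OF cont w0 wK PQ(1,2), of G]
  define B1 B2 where "B1 = (T2 - T1) * (K * (1 + 2 * T2\<^sup>2))" and "B2 = (T2 - T1) * (K * (2 * G\<^sup>2))"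
  have B0: "B1 \<ge> 0" "B2 \<ge> 0" unfolding B1_def B2_def using K PQ by auto
  have pt: "integral {T1 + H..T2 - H} (\<lambda>\<tau>. w (\<tau> + G * x)) \<le> integral {T1..T2} w + (B1 * (G / H) ^ 14 * x ^ 14 + B2 * (G / H) ^ 14 * x ^ 16)" for x
  proof (cases "\<bar>G * x\<bar> \<le> H")
    case True
    then have "integral {T1 + H + G * x..T2 - H + G * x} w \<le> integral {T1..T2} w"
      by (intro integral_subset_le wi) (use w0 in auto)
    moreover have "0 \<le> B1 * (G / H) ^ 14 * x ^ 14" "0 \<le> B2 * (G / H) ^ 14 * x ^ 16"
      using B0 G H by (auto intro!: mult_nonneg_nonneg zero_le_even_power)
    ultimately show ?thesis unfolding integral_translate by linarith
  next
    case False
    have "1 \<le> \<bar>G * x / H\<bar> ^ 14" using False H by (intro one_le_power) (simp add: abs_divide)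
    then have g: "1 \<le> (G / H) ^ 14 * x ^ 14" by (simp add: power_mult_distrib power_divide)
    have "integral {T1 + H..T2 - H} (\<lambda>\<tau>. w (\<tau> + G * x)) \<le> (T2 - H - (T1 + H)) * (K * (1 + 2 * (T2 - H)\<^sup>2 + 2 * G\<^sup>2 * x\<^sup>2))" by (rule I(1))
    also have "\<dots> \<le> (T2 - T1) * (K * (1 + 2 * T2\<^sup>2 + 2 * G\<^sup>2 * x\<^sup>2))"
    proof (rule mult_mono)
      have "(T2 - H)\<^sup>2 \<le> T2\<^sup>2" using H by (intro power_mono) auto
      then show "K * (1 + 2 * (T2 - H)\<^sup>2 + 2 * G\<^sup>2 * x\<^sup>2) \<le> K * (1 + 2 * T2\<^sup>2 + 2 * G\<^sup>2 * x\<^sup>2)" using K by (intro mult_left_mono) auto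
      show "0 \<le> K * (1 + 2 * (T2 - H)\<^sup>2 + 2 * G\<^sup>2 * x\<^sup>2)" using K by (intro mult_nonneg_nonneg add_nonneg_nonneg) auto
    qed (use H in auto)
    also have "\<dots> = B1 + B2 * x\<^sup>2" by (simp add: B1_def B2_def algebra_simps)
    also have "\<dots> \<le> (B1 + B2 * x\<^sup>2) * ((G / H) ^ 14 * x ^ 14)"
      using mult_left_mono[OF g, of "B1 + B2 * x\<^sup>2"] B0 by simp
    also have "\<dots> = B1 * (G / H) ^ 14 * x ^ 14 + B2 * (G / H) ^ 14 * x ^ 16"
      by (simp add: algebra_simps flip: power_add)
    finally have "integral {T1 + H..T2 - H} (\<lambda>\<tau>. w (\<tau> + G * x)) \<le> B1 * (G / H) ^ 14 * x ^ 14 + B2 * (G / H) ^ 14 * x ^ 16" .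
    moreover have "0 \<le> integral {T1..T2} w" by (rule integral_nonneg[OF wi]) (use w0 in auto)
    ultimately show ?thesis by linarith
  qed
  have i: "integrable gauss (\<lambda>x. B1 * (G / H) ^ 14 * x ^ 14)" "integrable gauss (\<lambda>x. B2 * (G / H) ^ 14 * x ^ 16)"
      "integrable gauss (\<lambda>x. integral {T1..T2} w)"
    by (auto intro!: integrable_mult_right integrable_std_normal_distribution_moment gauss.integrable_const)
  have "integral {T1 + H..T2 - H} (\<lambda>\<tau>. gauss_mean w \<tau> G) = (\<integral>x. integral {T1 + H..T2 - H} (\<lambda>\<tau>. w (\<tau> + G * x)) \<partial>gauss)"
    by (rule I(4))
  also have "\<dots> \<le> (\<integral>x. integral {T1..T2} w + (B1 * (G / H) ^ 14 * x ^ 14 + B2 * (G / H) ^ 14 * x ^ 16) \<partial>gauss)"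
    by (rule integral_mono) (use pt in \<open>auto intro!: i I(2) Bochner_Integration.integrable_add\<close>)
  also have "\<dots> = integral {T1..T2} w + (B1 * (G / H) ^ 14 * (\<integral>x. x ^ 14 \<partial>gauss) + B2 * (G / H) ^ 14 * (\<integral>x. x ^ 16 \<partial>gauss))"
    by (subst Bochner_Integration.integral_add[OF i(3) Bochner_Integration.integrable_add[OF i(1,2)]],
        subst Bochner_Integration.integral_add[OF i(1,2)])
      (simp add: gauss.prob_space[simplified])
  finally show ?thesis unfolding B1_def B2_def by simp
qed

text \<open>The error is relative to the length plus a fixed power below T, so the law is
  informative for intervals as short as T / ln T. It is restricted to dyadic ranges because a single
  width G is used for all centres of size T.\<close>

definition mean_law :: "(real \<Rightarrow> real) \<Rightarrow> real \<Rightarrow> real \<Rightarrow> bool" where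
  "mean_law w a b \<longleftrightarrow> (\<forall>e>0. \<exists>T0. \<forall>T\<ge>T0. \<forall>T1 T2. T \<le> T1 \<longrightarrow> T1 \<le> T2 \<longrightarrow> T2 \<le> 2 * T \<longrightarrow>
     \<bar>integral {T1..T2} w - integral {T1..T2} (\<lambda>t. a * ln t + b)\<bar> \<le> e * (T2 - T1) + T powr (19/20))"

text \<open>The factors 1/2 and 2 in \<open>width_range\<close> are there for this: changing \<tau>
  within [T/2, 3 T] changes \<tau>^(3/5) by at most 3^(3/5) \<le> 2, as 27 \<le> 32.\<close>

lemma width_range_dyadic:
  assumes "T > 0" "T / 2 \<le> \<tau>" "\<tau> \<le> 3 * T"
  shows "T powr (3/5) \<in> width_range \<tau>"
proof -
  have c: "(3::real) powr (3/5) \<le> 2"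
  proof -
    have "(3::real) powr (3/5) = (3 powr 3) powr (1/5)" unfolding powr_powr by simp
    also have "\<dots> \<le> (2 powr 5) powr (1/5)" by (intro powr_mono2) (auto simp: powr_numeral)
    also have "\<dots> = 2" unfolding powr_powr by simp
    finally show ?thesis .
  qed
  have "\<tau> powr (3/5) \<le> (3 * T) powr (3/5)" using assms by (intro powr_mono2) auto
  also have "\<dots> \<le> 2 * T powr (3/5)" unfolding powr_mult using c by (intro mult_right_mono) auto
  finally have "\<tau> powr (3/5) / 2 \<le> T powr (3/5)" by simp
  moreover have "T powr (3/5) \<le> (2 * \<tau>) powr (3/5)" using assms by (intro powr_mono2) auto
  moreover have "(2 * \<tau>) powr (3/5) \<le> 2 * \<tau> powr (3/5)"
    unfolding powr_mult by (intro mult_right_mono) (use powr_mono[of "3/5" 1 "2::real"] in auto)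
  ultimately show ?thesis unfolding width_range_def by auto
qed

text \<open>The integral of w is enclosed between integrals of Gaussian means over the interval
  shrunk or enlarged by H = T^(9/10) at both ends. H is large against G = T^(3/5), so shifts beyond
  H are negligible, and small against T^(19/20), so the overhangs of length H cost little even with
  a logarithmic integrand.\<close>

lemma mean_law_of_local_mean:
  fixes w :: "real \<Rightarrow> real" and K a b :: real
  assumes cont: "continuous_on UNIV w" and w0: "\<And>t. 0 \<le> w t" and wK: "\<And>t. w t \<le> K * (1 + t\<^sup>2)" and a: "a \<ge> 0"
    and lim: "((\<lambda>(\<tau>, G). gauss_mean w \<tau> G - (a * ln \<tau> + b)) \<longlongrightarrow> 0) window_filter"
  shows "mean_law w a b"
  unfolding mean_law_def
proof (intro allI impI)
  fix e :: real assume e: "e > 0"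
  have K: "K \<ge> 0" using w0[of 0] wK[of 0] by simp
  have wi: "w integrable_on {a..b}" for a b
    by (intro integrable_continuous_interval continuous_on_subset[OF cont]) auto
  define l where "l = (\<lambda>t. a * ln t + b)"
  have li: "l integrable_on {x..y}" if "x > 0" for x y
    unfolding l_def using that by (intro integrable_continuous_interval continuous_intros) auto
  have lsplit: "integral {x..z'} l = integral {x..y} l + integral {y..z} l + integral {z..z'} l"
    if "0 < x" "x \<le> y" "y \<le> z" "z \<le> z'" for x y z z'
    using Henstock_Kurzweil_Integration.integral_combine[of x y z' l] Henstock_Kurzweil_Integration.integral_combine[of y z z' l]
      li[of x z'] li[of y z'] that by simp
  from tendstoD[OF lim e] obtain \<tau>0 where \<tau>0: "\<And>\<tau> G. \<tau> \<ge> \<tau>0 \<Longrightarrow> G \<in> width_range \<tau> \<Longrightarrow> \<bar>gauss_mean w \<tau> G - l \<tau>\<bar> < e"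
    unfolding eventually_window_filter l_def by (auto simp: dist_real_def)
  define m14 m16 where "m14 = (\<integral>x. x ^ 14 \<partial>gauss)" and "m16 = (\<integral>x. x ^ 16 \<partial>gauss)"
  have m: "m14 \<ge> 0" "m16 \<ge> 0" unfolding m14_def m16_def by (auto intro!: Bochner_Integration.integral_nonneg zero_le_even_power)
  define L where "L = (\<lambda>T. a * ln (3 * T) + \<bar>b\<bar>)"
  define R where "R = (\<lambda>T. 2 * T powr (9/10) * (L T + e) + T * (K * (1 + 8 * T\<^sup>2)) * (T powr (3/5) / T powr (9/10)) ^ 14 * m14
     + T * (K * (2 * (T powr (3/5))\<^sup>2)) * (T powr (3/5) / T powr (9/10)) ^ 14 * m16)"
  have l1: "((\<lambda>T::real. 2 * T powr (9/10) * ln (3 * T) / T powr (19/20)) \<longlongrightarrow> 0) at_top" by real_asymp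
  have l2: "((\<lambda>T::real. 2 * T powr (9/10) / T powr (19/20)) \<longlongrightarrow> 0) at_top" by real_asymp
  have l3: "((\<lambda>T::real. T * (1 + 8 * T\<^sup>2) * (T powr (3/5) / T powr (9/10)) ^ 14 / T powr (19/20)) \<longlongrightarrow> 0) at_top" by real_asymp
  have l4: "((\<lambda>T::real. T * (2 * (T powr (3/5))\<^sup>2) * (T powr (3/5) / T powr (9/10)) ^ 14 / T powr (19/20)) \<longlongrightarrow> 0) at_top" by real_asymp
  have "((\<lambda>T. a * (2 * T powr (9/10) * ln (3 * T) / T powr (19/20)) + (\<bar>b\<bar> + e) * (2 * T powr (9/10) / T powr (19/20))
      + (K * m14) * (T * (1 + 8 * T\<^sup>2) * (T powr (3/5) / T powr (9/10)) ^ 14 / T powr (19/20))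
      + (K * m16) * (T * (2 * (T powr (3/5))\<^sup>2) * (T powr (3/5) / T powr (9/10)) ^ 14 / T powr (19/20)))
      \<longlongrightarrow> a * 0 + (\<bar>b\<bar> + e) * 0 + (K * m14) * 0 + (K * m16) * 0) at_top"
    by (intro tendsto_add tendsto_mult_left l1 l2 l3 l4)
  also have "(\<lambda>T. a * (2 * T powr (9/10) * ln (3 * T) / T powr (19/20)) + (\<bar>b\<bar> + e) * (2 * T powr (9/10) / T powr (19/20))
      + (K * m14) * (T * (1 + 8 * T\<^sup>2) * (T powr (3/5) / T powr (9/10)) ^ 14 / T powr (19/20))
      + (K * m16) * (T * (2 * (T powr (3/5))\<^sup>2) * (T powr (3/5) / T powr (9/10)) ^ 14 / T powr (19/20)))
      = (\<lambda>T. R T / T powr (19/20))"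
    unfolding R_def L_def by (intro ext) (simp add: add_divide_distrib algebra_simps)
  finally have "eventually (\<lambda>T. R T / T powr (19/20) < 1) at_top" by (rule order_tendstoD) simp
  moreover have "eventually (\<lambda>T::real. T powr (9/10) \<le> T / 2) at_top" by real_asymp
  moreover have "eventually (\<lambda>T::real. T \<ge> max 1 (2 * \<tau>0)) at_top" by (rule eventually_ge_at_top)
  ultimately have "eventually (\<lambda>T. R T \<le> T powr (19/20) \<and> T powr (9/10) \<le> T / 2 \<and> T \<ge> 1 \<and> T \<ge> 2 * \<tau>0) at_top"
    by eventually_elim (auto simp: divide_less_eq)
  then obtain T0 where T0: "\<And>T. T \<ge> T0 \<Longrightarrow> R T \<le> T powr (19/20) \<and> T powr (9/10) \<le> T / 2 \<and> T \<ge> 1 \<and> T \<ge> 2 * \<tau>0"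
    unfolding eventually_at_top_linorder by blast
  have "\<bar>integral {T1..T2} w - integral {T1..T2} l\<bar> \<le> e * (T2 - T1) + T powr (19/20)"
    if T: "T \<ge> T0" "T \<le> T1" "T1 \<le> T2" "T2 \<le> 2 * T" for T T1 T2
  proof -
    define H G where "H = T powr (9/10)" and "G = T powr (3/5)"
    have R: "R T \<le> T powr (19/20)" and H: "H \<le> T / 2" and T1: "T \<ge> 1" "T \<ge> 2 * \<tau>0" using T0[OF T(1)] by (auto simp: H_def)
    have HG: "H > 0" "G > 0" using T1 by (auto simp: H_def G_def)
    define q where "q = (G / H) ^ 14"
    have q: "q \<ge> 0" using HG by (simp add: q_def)
    have Req: "R T = 2 * H * (L T + e) + T * (K * (1 + 8 * T\<^sup>2)) * q * m14 + T * (K * (2 * G\<^sup>2)) * q * m16"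
      by (simp add: R_def H_def G_def q_def)
    have J: "\<bar>gauss_mean w \<tau> G - l \<tau>\<bar> < e" if "T / 2 \<le> \<tau>" "\<tau> \<le> 3 * T" for \<tau>
    proof (rule \<tau>0)
      show "\<tau>0 \<le> \<tau>" using that T1 by linarith
      show "G \<in> width_range \<tau>" unfolding G_def by (rule width_range_dyadic) (use that T1 in auto)
    qed
    have lL: "l t \<le> L T" if "T / 2 \<le> t" "t \<le> 3 * T" for t
      unfolding l_def L_def using that a T1 by (intro add_mono mult_left_mono) auto
    have L0: "L T \<ge> 0" unfolding L_def using a T1 by simp
    have lint: "integral {x..y} l \<le> (y - x) * L T" if "T / 2 \<le> x" "x \<le> y" "y \<le> 3 * T" for x y
    proof -
      have "integral {x..y} l \<le> integral {x..y} (\<lambda>_. L T)"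
        by (rule integral_le) (use that T1 lL in \<open>auto intro!: li\<close>)
      then show ?thesis using that by simp
    qed
    define S where "S = T * (K * (1 + 8 * T\<^sup>2)) * q * m14"
    define S' where "S' = T * (K * (2 * G\<^sup>2)) * q * m16"
    have SS: "S \<ge> 0" "S' \<ge> 0" unfolding S_def S'_def using T1 K q m by auto
    have TT: "(T2 - T1) * (K * (1 + 2 * T2\<^sup>2)) * q * m14 \<le> S"
    proof -
      have "T2\<^sup>2 \<le> (2 * T)\<^sup>2" using T T1 by (intro power_mono) auto
      then show ?thesis unfolding S_def using T T1 K q m by (intro mult_right_mono mult_mono) auto
    qed
    have TT': "(T2 - T1) * (K * (2 * G\<^sup>2)) * q * m16 \<le> S'"
      unfolding S'_def using T T1 K q m by (intro mult_right_mono) auto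
    have ci: "(\<lambda>\<tau>. l \<tau> + c) integrable_on {x..y}" if "x > 0" for x y c using li[OF that] by (intro integrable_add) auto
    have up: "integral {T1..T2} w \<le> integral {T1..T2} l + e * (T2 - T1) + (2 * H * (L T + e) + S)"
    proof -
      have "integral {T1..T2} w \<le> integral {T1 - H..T2 + H} (\<lambda>\<tau>. gauss_mean w \<tau> G) + (T2 - T1) * (K * (1 + 2 * T2\<^sup>2)) * q * m14"
        unfolding q_def m14_def by (rule unsmooth_upper[OF cont w0 wK]) (use HG H T T1 in auto)
      also have "integral {T1 - H..T2 + H} (\<lambda>\<tau>. gauss_mean w \<tau> G) \<le> integral {T1 - H..T2 + H} (\<lambda>\<tau>. l \<tau> + e)"
      proof (rule integral_le)
        show "(\<lambda>\<tau>. gauss_mean w \<tau> G) integrable_on {T1 - H..T2 + H}"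
          by (rule gauss_mean_interval(3)[OF cont w0 wK]) (use HG H T T1 in auto)
        show "(\<lambda>\<tau>. l \<tau> + e) integrable_on {T1 - H..T2 + H}" by (rule ci) (use H T T1 in auto)
        show "gauss_mean w \<tau> G \<le> l \<tau> + e" if "\<tau> \<in> {T1 - H..T2 + H}" for \<tau>
          using J[of \<tau>] that H T by auto
      qed
      also have "\<dots> = integral {T1 - H..T2 + H} l + e * (T2 - T1 + 2 * H)"
        by (subst integral_add) (use H T T1 HG in \<open>auto intro!: li simp: algebra_simps\<close>)
      also have "integral {T1 - H..T2 + H} l = integral {T1 - H..T1} l + integral {T1..T2} l + integral {T2..T2 + H} l"
        using H T T1 HG by (intro lsplit) auto
      also have "integral {T1 - H..T1} l \<le> H * L T" using lint[of "T1 - H" T1] H T HG by simp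
      also have "integral {T2..T2 + H} l \<le> H * L T" using lint[of T2 "T2 + H"] H T HG by simp
      finally show ?thesis using TT by (simp add: algebra_simps)
    qed
    have low: "integral {T1..T2} w \<ge> integral {T1..T2} l - e * (T2 - T1) - (2 * H * (L T + e) + S + S')"
    \<comment> \<open>If the interval is too short to be shrunk, the integral of l over it is at
      most 2 H L(T), and nonnegativity of w is enough.\<close>
    proof (cases "T1 + H \<le> T2 - H")
      case False
      have "0 \<le> integral {T1..T2} w" by (rule integral_nonneg[OF wi]) (use w0 in auto)
      moreover have "integral {T1..T2} l \<le> (T2 - T1) * L T" using lint[of T1 T2] T T1 by simp
      moreover have "(T2 - T1) * L T \<le> 2 * H * L T" using False L0 by (intro mult_right_mono) auto
      moreover have "0 \<le> e * (T2 - T1)" "0 \<le> 2 * H * e" using e T HG by auto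
      ultimately show ?thesis using SS unfolding distrib_left by linarith
    next
      case True
      have "integral {T1 + H..T2 - H} (\<lambda>\<tau>. l \<tau> + - e) \<le> integral {T1 + H..T2 - H} (\<lambda>\<tau>. gauss_mean w \<tau> G)"
      proof (rule integral_le)
        show "(\<lambda>\<tau>. gauss_mean w \<tau> G) integrable_on {T1 + H..T2 - H}"
          by (rule gauss_mean_interval(3)[OF cont w0 wK]) (use HG True T T1 in auto)
        show "(\<lambda>\<tau>. l \<tau> + - e) integrable_on {T1 + H..T2 - H}" by (rule ci) (use HG T T1 in auto)
        show "l \<tau> + - e \<le> gauss_mean w \<tau> G" if "\<tau> \<in> {T1 + H..T2 - H}" for \<tau>
          using J[of \<tau>] that H T HG T1 by auto
      qed
      also have "\<dots> \<le> integral {T1..T2} w + (T2 - T1) * (K * (1 + 2 * T2\<^sup>2)) * q * m14 + (T2 - T1) * (K * (2 * G\<^sup>2)) * q * m16"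
        unfolding q_def m14_def m16_def by (rule unsmooth_lower[OF cont w0 wK]) (use HG T T1 True in auto)
      also have "integral {T1 + H..T2 - H} (\<lambda>\<tau>. l \<tau> + - e) = integral {T1 + H..T2 - H} l + - e * (T2 - T1 - 2 * H)"
        by (subst integral_add) (use True T T1 HG in \<open>auto intro!: li simp: algebra_simps\<close>)
      finally have "integral {T1 + H..T2 - H} l + - e * (T2 - T1 - 2 * H) \<le> integral {T1..T2} w + S + S'" using TT TT' by linarith
      moreover have "integral {T1..T2} l = integral {T1..T1 + H} l + integral {T1 + H..T2 - H} l + integral {T2 - H..T2} l"
        using True T T1 HG by (intro lsplit) auto
      moreover have "integral {T1..T1 + H} l \<le> H * L T" using lint[of T1 "T1 + H"] H T HG T1 by simp
      moreover have "integral {T2 - H..T2} l \<le> H * L T" using lint[of "T2 - H" T2] True T HG T1 by simp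
      moreover have "0 \<le> H * e" using e HG by simp
      ultimately show ?thesis by (simp add: algebra_simps)
    qed
    have "2 * H * (L T + e) + S + S' \<le> T powr (19/20)" using R unfolding Req S_def S'_def .
    then show ?thesis using up low SS by linarith
  qed
  then show "\<exists>T0. \<forall>T\<ge>T0. \<forall>T1 T2. T \<le> T1 \<longrightarrow> T1 \<le> T2 \<longrightarrow> T2 \<le> 2 * T \<longrightarrow>
     \<bar>integral {T1..T2} w - integral {T1..T2} (\<lambda>t. a * ln t + b)\<bar> \<le> e * (T2 - T1) + T powr (19/20)"
    unfolding l_def by blast
qed

lemma mean_square_growth:
  assumes "1/2 \<le> \<sigma>" "\<sigma> < 1"
  shows "(norm (zeta (Complex \<sigma> t)))\<^sup>2 \<le> 2 * (3 + 2 / (1 - \<sigma>))\<^sup>2 * (1 + t\<^sup>2)"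
proof -
  have "(norm (zeta (Complex \<sigma> t)))\<^sup>2 \<le> ((3 + 2 / (1 - \<sigma>)) * (1 + \<bar>t\<bar>))\<^sup>2"
    by (intro power_mono zeta_line_growth assms) auto
  also have "\<dots> = (3 + 2 / (1 - \<sigma>))\<^sup>2 * (1 + \<bar>t\<bar>)\<^sup>2" by (rule power_mult_distrib)
  also have "\<dots> \<le> (3 + 2 / (1 - \<sigma>))\<^sup>2 * (2 * (1 + t\<^sup>2))"
    using zero_le_power2[of "1 - \<bar>t\<bar>"] by (intro mult_left_mono zero_le_power2) (auto simp: power2_sum power2_diff)
  finally show ?thesis by (simp only: mult_ac)
qed

lemma mean_law_critical: "\<exists>b. mean_law (\<lambda>t. (norm (zeta (Complex (1/2) t)))\<^sup>2) 1 b"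
proof -
  obtain b where b: "((\<lambda>(\<tau>, G). gauss_mean (\<lambda>t. (norm (zeta (Complex (1/2) t)))\<^sup>2) \<tau> G - (ln \<tau> + b)) \<longlongrightarrow> 0) window_filter"
    using local_mean_critical by blast
  have "mean_law (\<lambda>t. (norm (zeta (Complex (1/2) t)))\<^sup>2) 1 b"
    by (rule mean_law_of_local_mean[OF _ _ mean_square_growth])
       (use b in \<open>auto intro!: continuous_intros continuous_on_zeta_line\<close>)
  then show ?thesis ..
qed

lemma mean_law_off_critical:
  assumes "1/2 < \<sigma>" "\<sigma> < 1"
  shows "mean_law (\<lambda>t. (norm (zeta (Complex \<sigma> t)))\<^sup>2) 0 (\<Sum>m. real (Suc m) powr (- 2 * \<sigma>))"
  by (rule mean_law_of_local_mean[OF _ _ mean_square_growth])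
     (use assms local_mean_off_critical[OF assms] in \<open>auto intro!: continuous_intros continuous_on_zeta_line\<close>)

section \<open>Mean squares on the lines to the right of the critical strip\<close>

definition dirichlet_poly :: "nat \<Rightarrow> complex \<Rightarrow> complex" where
  "dirichlet_poly N s = (\<Sum>n<N. of_nat (Suc n) powr (-s))"

lemma norm_dirichlet_poly_sq:
  "(norm (dirichlet_poly N (Complex \<sigma> t)))\<^sup>2
     = (\<Sum>m<N. \<Sum>n<N. real (Suc m) powr (-\<sigma>) * real (Suc n) powr (-\<sigma>) * cos ((ln (real (Suc m)) - ln (real (Suc n))) * t))"
proof -
  define z where "z = (\<lambda>n. of_real (real (Suc n) powr (- \<sigma>)) * cis (- ln (real (Suc n)) * t))"
  have re: "Re (z m * cnj (z n)) = real (Suc m) powr (-\<sigma>) * real (Suc n) powr (-\<sigma>) * cos ((ln (real (Suc m)) - ln (real (Suc n))) * t)" for m n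
    by (simp add: z_def algebra_simps cos_diff)
  have "dirichlet_poly N (Complex \<sigma> t) = sum z {..<N}" unfolding dirichlet_poly_def of_nat_powr_line z_def ..
  then have "(norm (dirichlet_poly N (Complex \<sigma> t)))\<^sup>2 = Re (sum z {..<N} * cnj (sum z {..<N}))"
    by (simp only: complex_norm_square[symmetric] Re_complex_of_real)
  also have "\<dots> = (\<Sum>m<N. \<Sum>n<N. Re (z m * cnj (z n)))" by (simp only: cnj_sum sum_product Re_sum)
  finally show ?thesis unfolding re .
qed

lemma sum_inverse_distance_le:
  assumes "m < N"
  shows "(\<Sum>n\<in>{..<N} - {m}. 1 / \<bar>real m - real n\<bar>) \<le> 2 * harm N"
proof -
  have split: "{..<N} - {m} = {..<m} \<union> {Suc m..<N}" using assms by auto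
  have "(\<Sum>n\<in>{..<N} - {m}. 1 / \<bar>real m - real n\<bar>) = (\<Sum>n<m. 1 / \<bar>real m - real n\<bar>) + (\<Sum>n=Suc m..<N. 1 / \<bar>real m - real n\<bar>)"
    unfolding split by (rule sum.union_disjoint) auto
  also have "(\<Sum>n<m. 1 / \<bar>real m - real n\<bar>) = harm m"
    unfolding harm_def
    by (rule sum.reindex_bij_witness[of _ "\<lambda>k. m - k" "\<lambda>n. m - n"]) (auto simp: inverse_eq_divide of_nat_diff)
  also have "(\<Sum>n=Suc m..<N. 1 / \<bar>real m - real n\<bar>) = harm (N - Suc m)"
    unfolding harm_def
    by (rule sum.reindex_bij_witness[of _ "\<lambda>k. m + k" "\<lambda>n. n - m"]) (auto simp: inverse_eq_divide of_nat_diff)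
  also have "harm m + harm (N - Suc m) \<le> harm N + (harm N :: real)" by (intro add_mono harm_mono) (use assms in auto)
  finally show ?thesis by simp
qed

lemma harm_le_ln: "n > 0 \<Longrightarrow> harm n \<le> 1 + ln (real n)"
  using euler_mascheroni_sequence_decreasing[of 1 n] by (simp add: harm_def)

lemma cos_frequency_integral_bound:
  assumes "m \<noteq> n" "a \<le> b"
  shows "\<bar>integral {a..b} (\<lambda>t. cos ((ln (real (Suc m)) - ln (real (Suc n))) * t))\<bar>
      \<le> 2 * max (real (Suc m)) (real (Suc n)) / \<bar>real m - real n\<bar>"
proof -
  have *: "ln (real (Suc n)) - ln (real (Suc m)) \<ge> (real n - real m) / real (Suc n)" if "m < n" for m n
  proof -
    have "ln (real (Suc m) / real (Suc n)) \<le> real (Suc m) / real (Suc n) - 1" by (rule ln_le_minus_one) simp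
    moreover have "ln (real (Suc m) / real (Suc n)) = ln (real (Suc m)) - ln (real (Suc n))" by (rule ln_divide_pos) auto
    moreover have "(real n - real m) / real (Suc n) = 1 - real (Suc m) / real (Suc n)" using diff_divide_distrib[of "real (Suc n)" "real (Suc m)" "real (Suc n)"] by simp
    ultimately show ?thesis by linarith
  qed
  define d where "d = \<bar>ln (real (Suc m)) - ln (real (Suc n))\<bar>"
  have d: "d \<ge> \<bar>real m - real n\<bar> / max (real (Suc m)) (real (Suc n))"
    using *[of m n] *[of n m] assms(1) by (cases "m < n") (auto simp: d_def max_def)
  have p: "\<bar>real m - real n\<bar> / max (real (Suc m)) (real (Suc n)) > 0" using assms(1) by (auto intro!: divide_pos_pos)
  have "cos ((ln (real (Suc m)) - ln (real (Suc n))) * t) = cos (d * t)" for t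
    unfolding d_def
    using cos_abs_real[of "(ln (real (Suc m)) - ln (real (Suc n))) * t"] cos_abs_real[of "\<bar>ln (real (Suc m)) - ln (real (Suc n))\<bar> * t"]
    by (simp add: abs_mult del: cos_abs_real)
  then have "\<bar>integral {a..b} (\<lambda>t. cos ((ln (real (Suc m)) - ln (real (Suc n))) * t))\<bar> \<le> 2 / d"
    using cos_integral_bound[OF _ assms(2), of d] d p by simp
  also have "\<dots> \<le> 2 / (\<bar>real m - real n\<bar> / max (real (Suc m)) (real (Suc n)))"
    using d p by (intro divide_left_mono mult_pos_pos) auto
  finally show ?thesis by simp
qed

text \<open>An off-diagonal pair contributes at most a constant times max (m, n) / (m n |m - n|),
  and the maximum is bounded by m + n. This splits the sum into two symmetric ones of 1 / (m |m -
  n|), each a product of harmonic sums; the loss of ln^2 N is affordable.\<close>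

lemma dirichlet_poly_mean_square:
  assumes \<sigma>: "\<sigma> \<ge> 1" and ab: "a \<le> b"
  shows "\<bar>integral {a..b} (\<lambda>t. (norm (dirichlet_poly N (Complex \<sigma> t)))\<^sup>2) - (b - a) * (\<Sum>n<N. real (Suc n) powr (- 2 * \<sigma>))\<bar>
     \<le> 8 * (harm N)\<^sup>2"
proof -
  define c where "c = (\<lambda>m n. real (Suc m) powr (-\<sigma>) * real (Suc n) powr (-\<sigma>))"
  define I where "I = (\<lambda>m n. integral {a..b} (\<lambda>t. cos ((ln (real (Suc m)) - ln (real (Suc n))) * t)))"
  have "integral {a..b} (\<lambda>t. (norm (dirichlet_poly N (Complex \<sigma> t)))\<^sup>2) = (\<Sum>m<N. \<Sum>n<N. c m n * I m n)"
    unfolding norm_dirichlet_poly_sq c_def I_def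
    by (subst integral_sum, simp, intro integrable_continuous_interval continuous_intros,
        rule sum.cong[OF refl], subst integral_sum, simp, intro integrable_continuous_interval continuous_intros) simp
  also have "\<dots> = (\<Sum>m<N. c m m * I m m + (\<Sum>n\<in>{..<N} - {m}. c m n * I m n))"
    by (intro sum.cong refl sum.remove) auto
  also have "\<dots> = (b - a) * (\<Sum>n<N. real (Suc n) powr (- 2 * \<sigma>)) + (\<Sum>m<N. \<Sum>n\<in>{..<N} - {m}. c m n * I m n)"
  proof -
    have "c m m * I m m = (b - a) * real (Suc m) powr (- 2 * \<sigma>)" for m
      using ab by (simp add: c_def I_def flip: powr_add)
    then show ?thesis by (simp add: sum.distrib sum_distrib_left)
  qed
  finally have "integral {a..b} (\<lambda>t. (norm (dirichlet_poly N (Complex \<sigma> t)))\<^sup>2) - (b - a) * (\<Sum>n<N. real (Suc n) powr (- 2 * \<sigma>))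
     = (\<Sum>m<N. \<Sum>n\<in>{..<N} - {m}. c m n * I m n)" by simp
  moreover have "\<bar>\<Sum>m<N. \<Sum>n\<in>{..<N} - {m}. c m n * I m n\<bar> \<le> 8 * (harm N)\<^sup>2"
  proof -
    define g where "g = (\<lambda>m n. 2 / real (Suc m) * (1 / \<bar>real m - real n\<bar>))"
    have le: "\<bar>c m n * I m n\<bar> \<le> g m n + g n m" if "m \<noteq> n" for m n
    proof -
      have x: "x powr (-\<sigma>) \<le> 1 / x" if "x \<ge> 1" for x :: real
        using powr_mono[of "-\<sigma>" "-1" x] \<sigma> that by (simp add: powr_minus_divide)
      have "c m n \<le> 1 / real (Suc m) * (1 / real (Suc n))"
        unfolding c_def by (intro mult_mono x) auto
      then have "\<bar>c m n * I m n\<bar> \<le> 1 / real (Suc m) * (1 / real (Suc n)) * (2 * max (real (Suc m)) (real (Suc n)) / \<bar>real m - real n\<bar>)"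
        unfolding abs_mult I_def using cos_frequency_integral_bound[OF that ab]
        by (intro mult_mono) (auto simp: c_def)
      also have "\<dots> \<le> 1 / real (Suc m) * (1 / real (Suc n)) * (2 * (real (Suc m) + real (Suc n)) / \<bar>real m - real n\<bar>)"
        by (intro mult_left_mono divide_right_mono) auto
      also have "\<dots> = g m n + g n m"
      proof -
        have *: "1 / x * (1 / y) * (2 * (x + y) / d) = 2 / x * (1 / d) + 2 / y * (1 / d)" if "x > 0" "y > 0" for x y d :: real
        proof -
          have "1 / x * (1 / y) * (2 * (x + y) / d) = (2 * ((x + y) / (x * y))) * (1 / d)" by simp
          also have "(x + y) / (x * y) = 1 / x + 1 / y" using that by (simp add: add_divide_distrib)
          finally show ?thesis by (simp add: add_divide_distrib)
        qed
        show ?thesis unfolding g_def abs_minus_commute[of "real n" "real m"] by (rule *) auto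
      qed
      finally show ?thesis .
    qed
    have row: "(\<Sum>m<N. \<Sum>n\<in>{..<N} - {m}. g m n) \<le> 4 * (harm N)\<^sup>2"
    proof -
      have "(\<Sum>m<N. \<Sum>n\<in>{..<N} - {m}. g m n) \<le> (\<Sum>m<N. 2 / real (Suc m) * (2 * harm N))"
        unfolding g_def sum_distrib_left[symmetric]
        by (intro sum_mono mult_left_mono sum_inverse_distance_le) auto
      also have "\<dots> = 4 * harm N * (\<Sum>m<N. 1 / real (Suc m))" by (simp add: sum_distrib_left mult_ac)
      also have "(\<Sum>m<N. 1 / real (Suc m)) = harm N" by (simp add: harm_altdef inverse_eq_divide)
      finally show ?thesis by (simp add: power2_eq_square mult.assoc)
    qed
    have swap: "(\<Sum>m<N. \<Sum>n\<in>{..<N} - {m}. g n m) = (\<Sum>m<N. \<Sum>n\<in>{..<N} - {m}. g m n)"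
    proof -
      have "(\<Sum>m<N. \<Sum>n\<in>{..<N} - {m}. g n m) = (\<Sum>m\<in>{..<N}. \<Sum>n\<in>{n \<in> {..<N}. n \<noteq> m}. g n m)"
        by (intro sum.cong) auto
      also have "\<dots> = (\<Sum>n\<in>{..<N}. \<Sum>m\<in>{m \<in> {..<N}. n \<noteq> m}. g n m)" by (rule sum.swap_restrict) auto
      also have "\<dots> = (\<Sum>m<N. \<Sum>n\<in>{..<N} - {m}. g m n)" by (intro sum.cong) auto
      finally show ?thesis .
    qed
    have "\<bar>\<Sum>m<N. \<Sum>n\<in>{..<N} - {m}. c m n * I m n\<bar> \<le> (\<Sum>m<N. \<Sum>n\<in>{..<N} - {m}. g m n + g n m)"
      by (intro order_trans[OF sum_abs] sum_mono le) auto
    also have "\<dots> \<le> 8 * (harm N)\<^sup>2" unfolding sum.distrib swap using row by simp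
    finally show ?thesis .
  qed
  ultimately show ?thesis by simp
qed

lemma continuous_on_zeta_line_pos: "continuous_on {0<..} (\<lambda>t. zeta (Complex \<sigma> t))"
proof (rule continuous_on_compose2[OF holomorphic_on_imp_continuous_on[OF zeta_holomorphic]])
  have "(\<lambda>t. Complex \<sigma> t) = (\<lambda>t. of_real \<sigma> + \<i> * of_real t)" by (simp add: complex_eq_iff fun_eq_iff)
  then show "continuous_on {0<..} (\<lambda>t. Complex \<sigma> t)" by (simp add: continuous_intros)
qed (auto simp: complex_eq_iff)

text \<open>With N \<ge> T^2 terms the Euler remainder |s| / N is of order 1/T, and so is the main
  term (N + 1)^(1 - s) / (1 - s), since |Im s| \<ge> T.\<close>

lemma zeta_dirichlet_poly:
  assumes \<sigma>: "\<sigma> \<ge> 1" and T: "T \<ge> 1" "T \<le> t" "t \<le> 2 * T" and N: "real N \<ge> T\<^sup>2"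
  shows "\<bar>(norm (zeta (Complex \<sigma> t)))\<^sup>2 - (norm (dirichlet_poly N (Complex \<sigma> t)))\<^sup>2\<bar>
    \<le> 2 * harm N * ((\<sigma> + 3) / T) + ((\<sigma> + 3) / T)\<^sup>2"
proof -
  define s where "s = Complex \<sigma> t"
  have N1: "real N \<ge> 1" using N T one_le_power[of T 2] by linarith
  then have N0: "N > 0" by (cases N) auto
  have s: "Re s \<ge> 1" "s \<noteq> 1" using \<sigma> T by (auto simp: s_def complex_eq_iff)
  have ns: "norm s \<le> (\<sigma> + 2) * T"
  proof -
    have "norm s \<le> \<sigma> + t" using cmod_le[of s] \<sigma> T by (simp add: s_def)
    also have "\<dots> \<le> \<sigma> * T + 2 * T" using T \<sigma> by (intro add_mono) auto
    finally show ?thesis by (simp add: algebra_simps)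
  qed
  have n1: "norm (1 - s) \<ge> T" using abs_Im_le_cmod[of "1 - s"] T by (simp add: s_def)
  define S where "S = dirichlet_poly N s"
  define D where "D = S - zeta s"
  have "D = zeta_error N s + of_nat (Suc N) powr (1 - s) / (1 - s)" by (simp add: D_def S_def dirichlet_poly_def zeta_error_def)
  then have "norm D \<le> norm (zeta_error N s) + norm (of_nat (Suc N) powr (1 - s) / (1 - s))" by (simp add: norm_triangle_ineq)
  also have "norm (zeta_error N s) \<le> norm s / real N" by (rule zeta_error_bound_1) (use s N0 in auto)
  also have "norm s / real N \<le> (\<sigma> + 2) * T / T\<^sup>2" using ns N T N1 \<sigma> by (intro frac_le) auto
  also have "(\<sigma> + 2) * T / T\<^sup>2 = (\<sigma> + 2) / T" using T by (simp add: power2_eq_square)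
  also have "norm (of_nat (Suc N) powr (1 - s) / (1 - s)) \<le> 1 / T"
  proof -
    have "real (Suc N) powr (1 - \<sigma>) \<le> real (Suc N) powr 0" using \<sigma> by (intro powr_mono) auto
    then show ?thesis unfolding norm_divide norm_Suc_powr using n1 T by (intro frac_le) (auto simp: s_def)
  qed
  finally have D: "norm D \<le> (\<sigma> + 3) / T" by (simp add: add_divide_distrib)
  have S: "norm S \<le> harm N"
  proof -
    have "norm S \<le> (\<Sum>n<N. norm ((of_nat (Suc n) :: complex) powr (- s)))" unfolding S_def dirichlet_poly_def by (rule norm_sum)
    also have "\<dots> \<le> (\<Sum>n<N. 1 / real (Suc n))"
    proof (rule sum_mono)
      fix n
      have "real (Suc n) powr (- \<sigma>) \<le> real (Suc n) powr (- 1)" using \<sigma> by (intro powr_mono) auto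
      then show "norm ((of_nat (Suc n) :: complex) powr (- s)) \<le> 1 / real (Suc n)"
        unfolding norm_Suc_powr by (simp add: s_def powr_minus_divide)
    qed
    finally show ?thesis by (simp add: harm_altdef inverse_eq_divide)
  qed
  have "norm (zeta s) = norm (S - D)" by (simp add: D_def)
  then have ab: "\<bar>norm (zeta s) - norm S\<bar> \<le> norm D" using norm_triangle_ineq3[of "S - D" S] by simp
  have "(norm (zeta s))\<^sup>2 - (norm S)\<^sup>2 = 2 * norm S * (norm (zeta s) - norm S) + (norm (zeta s) - norm S)\<^sup>2"
    by (simp add: power2_eq_square algebra_simps)
  then have "\<bar>(norm (zeta s))\<^sup>2 - (norm S)\<^sup>2\<bar> \<le> 2 * norm S * \<bar>norm (zeta s) - norm S\<bar> + \<bar>norm (zeta s) - norm S\<bar>\<^sup>2"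
    by (simp add: abs_mult order_trans[OF abs_triangle_ineq])
  also have "\<dots> \<le> 2 * harm N * ((\<sigma> + 3) / T) + ((\<sigma> + 3) / T)\<^sup>2"
    using ab D S harm_nonneg[of N, where ?'a = real] by (intro add_mono mult_mono power_mono) (auto intro: order_trans)
  finally show ?thesis by (simp add: s_def S_def)
qed

text \<open>Here N = T^2 rounded up. The approximation error integrates to order ln T and the
  off-diagonal terms to ln^2 T, both far below T^(19/20). Only positive t are met, so the
  discontinuity of \<open>zeta\<close> at 1 does no harm when \<sigma> = 1.\<close>

lemma mean_law_right:
  assumes \<sigma>: "\<sigma> \<ge> 1"
  shows "mean_law (\<lambda>t. (norm (zeta (Complex \<sigma> t)))\<^sup>2) 0 (\<Sum>m. real (Suc m) powr (- 2 * \<sigma>))"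
  unfolding mean_law_def
proof (intro allI impI)
  fix e :: real assume e: "e > 0"
  define w where "w = (\<lambda>t. (norm (zeta (Complex \<sigma> t)))\<^sup>2)"
  define Z where "Z = (\<Sum>m. real (Suc m) powr (- 2 * \<sigma>))"
  define N where "N = (\<lambda>T::real. nat \<lceil>T\<^sup>2\<rceil>)"
  define q where "q = (\<lambda>T::real. 1 + ln (2 * T\<^sup>2))"
  have sm: "summable (\<lambda>m. real (Suc m) powr (- 2 * \<sigma>))" by (rule summable_Suc_powr) (use \<sigma> in auto)
  then have "(\<lambda>N. \<Sum>n<N. real (Suc n) powr (- 2 * \<sigma>)) \<longlonglongrightarrow> Z" unfolding Z_def by (rule summable_LIMSEQ)
  moreover have "filterlim N sequentially at_top"
    unfolding filterlim_at_top
  proof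
    fix k
    show "eventually (\<lambda>T. k \<le> N T) at_top"
      using eventually_ge_at_top[of "max 1 (real k)"]
    proof eventually_elim
      case (elim T)
      then have "real k \<le> T\<^sup>2" using self_le_power[of T 2] by simp
      then show ?case unfolding N_def by linarith
    qed
  qed
  ultimately have "((\<lambda>T. \<Sum>n<N T. real (Suc n) powr (- 2 * \<sigma>)) \<longlongrightarrow> Z) at_top" by (rule filterlim_compose)
  from tendstoD[OF this e] have e1: "eventually (\<lambda>T. \<bar>(\<Sum>n<N T. real (Suc n) powr (- 2 * \<sigma>)) - Z\<bar> < e) at_top"
    by (simp add: dist_real_def)
  have "eventually (\<lambda>T. 8 * (q T)\<^sup>2 + (2 * q T * (\<sigma> + 3) + (\<sigma> + 3)\<^sup>2) \<le> T powr (19/20)) at_top"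
    unfolding q_def by real_asymp
  with e1 have "eventually (\<lambda>T. \<bar>(\<Sum>n<N T. real (Suc n) powr (- 2 * \<sigma>)) - Z\<bar> < e \<and>
      8 * (q T)\<^sup>2 + (2 * q T * (\<sigma> + 3) + (\<sigma> + 3)\<^sup>2) \<le> T powr (19/20) \<and> T \<ge> 1) at_top"
    using eventually_ge_at_top[of 1] by eventually_elim auto
  then obtain T0 where T0: "\<And>T. T \<ge> T0 \<Longrightarrow> \<bar>(\<Sum>n<N T. real (Suc n) powr (- 2 * \<sigma>)) - Z\<bar> < e \<and>
      8 * (q T)\<^sup>2 + (2 * q T * (\<sigma> + 3) + (\<sigma> + 3)\<^sup>2) \<le> T powr (19/20) \<and> T \<ge> 1"
    unfolding eventually_at_top_linorder by blast
  have "\<bar>integral {T1..T2} w - integral {T1..T2} (\<lambda>t. 0 * ln t + Z)\<bar> \<le> e * (T2 - T1) + T powr (19/20)"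
    if T: "T \<ge> T0" "T \<le> T1" "T1 \<le> T2" "T2 \<le> 2 * T" for T T1 T2
  proof -
    note t = T0[OF T(1)]
    have T1: "T \<ge> 1" using t by simp
    have NT: "real (N T) \<ge> T\<^sup>2" "real (N T) \<le> 2 * T\<^sup>2" "real (N T) \<ge> 1"
      using one_le_power[of T 2] T1 unfolding N_def by linarith+
    have Np: "N T > 0" using NT(3) by (cases "N T") auto
    have hq: "harm (N T) \<le> q T"
    proof -
      have "harm (N T) \<le> 1 + ln (real (N T))" by (rule harm_le_ln[OF Np])
      also have "\<dots> \<le> q T" unfolding q_def using NT by (intro add_left_mono ln_mono) auto
      finally show ?thesis .
    qed
    have h0: "0 \<le> (harm (N T) :: real)" by (rule harm_nonneg)
    define p where "p = (\<lambda>t. (norm (dirichlet_poly (N T) (Complex \<sigma> t)))\<^sup>2)"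
    define D where "D = 2 * harm (N T) * ((\<sigma> + 3) / T) + ((\<sigma> + 3) / T)\<^sup>2"
    have wi: "w integrable_on {T1..T2}" unfolding w_def
      by (intro integrable_continuous_interval continuous_intros continuous_on_subset[OF continuous_on_zeta_line_pos]) (use T T1 in auto)
    have pi: "p integrable_on {T1..T2}" unfolding p_def norm_dirichlet_poly_sq
      by (intro integrable_continuous_interval continuous_intros)
    have "\<bar>integral {T1..T2} (\<lambda>t. w t - p t)\<bar> \<le> integral {T1..T2} (\<lambda>_. D)"
      unfolding real_norm_def[symmetric]
    proof (rule integral_norm_bound_integral)
      show "(\<lambda>t. w t - p t) integrable_on {T1..T2}" by (intro integrable_diff wi pi)
      show "norm (w t - p t) \<le> D" if "t \<in> {T1..T2}" for t
        unfolding w_def p_def D_def real_norm_def by (rule zeta_dirichlet_poly[OF \<sigma> T1]) (use that T NT in auto)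
    qed auto
    then have 1: "\<bar>integral {T1..T2} w - integral {T1..T2} p\<bar> \<le> (T2 - T1) * D"
      using T wi pi by (simp add: integral_diff)
    have D0: "D \<ge> 0" unfolding D_def using h0 \<sigma> T1 by auto
    have "(T2 - T1) * D \<le> T * D" using T D0 by (intro mult_right_mono) auto
    also have "T * D = 2 * harm (N T) * (\<sigma> + 3) + (\<sigma> + 3)\<^sup>2 / T" unfolding D_def using T1 by (simp add: distrib_left[of T] power2_eq_square)
    also have "\<dots> \<le> 2 * q T * (\<sigma> + 3) + (\<sigma> + 3)\<^sup>2"
    proof (intro add_mono mult_right_mono mult_left_mono hq)
      show "(\<sigma> + 3)\<^sup>2 / T \<le> (\<sigma> + 3)\<^sup>2" using T1 mult_left_mono[of 1 T "(\<sigma> + 3)\<^sup>2"] by (simp add: divide_le_eq)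
    qed (use \<sigma> in auto)
    finally have 2: "(T2 - T1) * D \<le> 2 * q T * (\<sigma> + 3) + (\<sigma> + 3)\<^sup>2" .
    have "\<bar>integral {T1..T2} p - (T2 - T1) * (\<Sum>n<N T. real (Suc n) powr (- 2 * \<sigma>))\<bar> \<le> 8 * (harm (N T))\<^sup>2"
      unfolding p_def by (rule dirichlet_poly_mean_square[OF \<sigma> T(3)])
    also have "\<dots> \<le> 8 * (q T)\<^sup>2" using hq h0 by (intro mult_left_mono power_mono) auto
    finally have 3: "\<bar>integral {T1..T2} p - (T2 - T1) * (\<Sum>n<N T. real (Suc n) powr (- 2 * \<sigma>))\<bar> \<le> 8 * (q T)\<^sup>2" .
    have "\<bar>(T2 - T1) * (\<Sum>n<N T. real (Suc n) powr (- 2 * \<sigma>)) - (T2 - T1) * Z\<bar> = (T2 - T1) * \<bar>(\<Sum>n<N T. real (Suc n) powr (- 2 * \<sigma>)) - Z\<bar>"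
      using T by (simp add: abs_mult flip: right_diff_distrib)
    also have "\<dots> \<le> (T2 - T1) * e" using t T by (intro mult_left_mono) auto
    finally have 4: "\<bar>(T2 - T1) * (\<Sum>n<N T. real (Suc n) powr (- 2 * \<sigma>)) - (T2 - T1) * Z\<bar> \<le> e * (T2 - T1)" by (simp add: mult.commute)
    have "integral {T1..T2} (\<lambda>t. 0 * ln t + Z) = (T2 - T1) * Z" using T by simp
    then show ?thesis using 1 2 3 4 t by linarith
  qed
  then show "\<exists>T0. \<forall>T\<ge>T0. \<forall>T1 T2. T \<le> T1 \<longrightarrow> T1 \<le> T2 \<longrightarrow> T2 \<le> 2 * T \<longrightarrow>
     \<bar>integral {T1..T2} (\<lambda>t. (norm (zeta (Complex \<sigma> t)))\<^sup>2) - integral {T1..T2} (\<lambda>t. 0 * ln t + (\<Sum>m. real (Suc m) powr (- 2 * \<sigma>)))\<bar>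
       \<le> e * (T2 - T1) + T powr (19/20)"
    unfolding w_def Z_def by blast
qed

lemma mean_law_zeta:
  assumes "\<sigma> > 1/2"
  shows "mean_law (\<lambda>t. (norm (zeta (Complex \<sigma> t)))\<^sup>2) 0 (\<Sum>m. real (Suc m) powr (- 2 * \<sigma>))"
  using mean_law_off_critical[of \<sigma>] mean_law_right[of \<sigma>] assms by (cases "\<sigma> < 1") auto

section \<open>Jacob's ladders\<close>

definition hardy_moment :: "real \<Rightarrow> real" where
  "hardy_moment T = integral {0..T} hardy_Z_sq"

lemma hardy_Z_sq_nonneg: "0 \<le> hardy_Z_sq t" by (simp add: hardy_Z_sq_def)

lemma continuous_on_hardy_Z_sq: "continuous_on A hardy_Z_sq"
  unfolding hardy_Z_sq_def[abs_def] by (intro continuous_intros continuous_on_zeta_line) auto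

lemma hardy_Z_sq_integrable: "hardy_Z_sq integrable_on {a..b}"
  by (intro integrable_continuous_interval continuous_on_hardy_Z_sq)

lemma hardy_Z_sq_mean_law: "\<exists>b. mean_law hardy_Z_sq 1 b"
  using mean_law_critical unfolding hardy_Z_sq_def[abs_def] .

lemma hardy_moment_diff: "0 \<le> s \<Longrightarrow> s \<le> t \<Longrightarrow> hardy_moment t - hardy_moment s = integral {s..t} hardy_Z_sq"
  using Henstock_Kurzweil_Integration.integral_combine[of 0 s t hardy_Z_sq] hardy_Z_sq_integrable
  by (simp add: hardy_moment_def)

lemma hardy_moment_mono: "0 \<le> s \<Longrightarrow> s \<le> t \<Longrightarrow> hardy_moment s \<le> hardy_moment t"
  using hardy_moment_diff[of s t] integral_nonneg[OF hardy_Z_sq_integrable, of s t] hardy_Z_sq_nonneg by force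

lemma hardy_moment_nonneg: "0 \<le> hardy_moment t"
  unfolding hardy_moment_def by (rule integral_nonneg[OF hardy_Z_sq_integrable]) (rule hardy_Z_sq_nonneg)

lemma integral_log_plus:
  fixes p q b :: real
  assumes "0 < p" "p \<le> q"
  shows "integral {p..q} (\<lambda>t. ln t + b) = (q * ln q + (b - 1) * q) - (p * ln p + (b - 1) * p)"
proof (rule integral_unique, rule fundamental_theorem_of_calculus[OF assms(2)])
  fix x assume "x \<in> {p..q}"
  then have "((\<lambda>x. x * ln x + (b - 1) * x) has_real_derivative ln x + b) (at x within {p..q})"
    using assms by (auto intro!: derivative_eq_intros)
  then show "((\<lambda>x. x * ln x + (b - 1) * x) has_vector_derivative ln x + b) (at x within {p..q})"
    by (simp add: has_real_derivative_iff_has_vector_derivative)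
qed

lemma abs_mult_ln_le:
  fixes t :: real
  assumes "0 \<le> t" shows "\<bar>t * ln t\<bar> \<le> 1 + t\<^sup>2"
proof (cases "t = 0")
  case False
  then have t: "t > 0" using assms by simp
  have "t * ln t \<le> t * t" using ln_le_minus_one[OF t] t by (intro mult_left_mono) auto
  moreover have "- ln t \<le> 1 / t" using ln_le_minus_one[of "1 / t"] t by (simp add: ln_divide_pos)
  then have "t * (- ln t) \<le> t * (1 / t)" using t by (intro mult_left_mono) auto
  ultimately show ?thesis using t by (auto simp: abs_le_iff power2_eq_square intro: order_trans[of _ 1] add_increasing)
qed auto

text \<open>With \<alpha> = b - 1 the deviation h changes by at most e t from t to 2 t, and these
  dyadic increments form a geometric series. The additive K makes the estimate valid down to t = 0,
  as its use under the Laplace integral demands.\<close>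

lemma hardy_moment_asymp:
  "\<exists>\<alpha>. \<forall>e>0. \<exists>K\<ge>0. \<forall>t\<ge>0. \<bar>hardy_moment t - (t * ln t + \<alpha> * t)\<bar> \<le> e * t + K"
proof -
  obtain b where b: "mean_law hardy_Z_sq 1 b" using hardy_Z_sq_mean_law by blast
  define h where "h = (\<lambda>t. hardy_moment t - (t * ln t + (b - 1) * t))"
  have "\<exists>K\<ge>0. \<forall>t\<ge>0. \<bar>h t\<bar> \<le> e * t + K" if e: "e > 0" for e
  proof -
    obtain T1 where T1: "\<And>T p q. T \<ge> T1 \<Longrightarrow> T \<le> p \<Longrightarrow> p \<le> q \<Longrightarrow> q \<le> 2 * T \<Longrightarrow>
        \<bar>integral {p..q} hardy_Z_sq - integral {p..q} (\<lambda>t. 1 * ln t + b)\<bar> \<le> e / 2 * (q - p) + T powr (19/20)"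
      using b e unfolding mean_law_def by (metis half_gt_zero)
    have "((\<lambda>T::real. T powr (19/20) / T) \<longlongrightarrow> 0) at_top" by real_asymp
    then have "eventually (\<lambda>T::real. T powr (19/20) / T < e / 2) at_top" by (rule order_tendstoD) (use e in simp)
    with eventually_gt_at_top[of 0] have "eventually (\<lambda>T::real. T powr (19/20) \<le> e / 2 * T) at_top"
      by eventually_elim (auto simp: divide_less_eq)
    then obtain T2 where T2: "\<And>T::real. T \<ge> T2 \<Longrightarrow> T powr (19/20) \<le> e / 2 * T" unfolding eventually_at_top_linorder by blast
    define T0 where "T0 = max 1 (max T1 T2)"
    have T0: "T0 \<ge> 1" "T0 \<ge> T1" "T0 \<ge> T2" by (auto simp: T0_def)
    define K where "K = hardy_moment (2 * T0) + (1 + (2 * T0)\<^sup>2) + \<bar>b - 1\<bar> * (2 * T0)"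
    have K0: "K \<ge> 0" unfolding K_def using hardy_moment_nonneg[of "2 * T0"] T0 by (intro add_nonneg_nonneg) auto
    have small: "\<bar>h t\<bar> \<le> K" if t: "0 \<le> t" "t \<le> 2 * T0" for t
    proof -
      have "\<bar>t * ln t\<bar> \<le> 1 + t\<^sup>2" by (rule abs_mult_ln_le[OF t(1)])
      moreover have "t\<^sup>2 \<le> (2 * T0)\<^sup>2" using t by (intro power_mono) auto
      moreover have "\<bar>(b - 1) * t\<bar> \<le> \<bar>b - 1\<bar> * (2 * T0)" using t by (simp add: abs_mult mult_left_mono)
      moreover have "0 \<le> hardy_moment t" "hardy_moment t \<le> hardy_moment (2 * T0)"
        using hardy_moment_nonneg hardy_moment_mono t by auto
      ultimately show ?thesis unfolding h_def K_def by linarith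
    qed
    have step: "\<bar>h (2 * t) - h t\<bar> \<le> e * t" if t: "t \<ge> T0" for t
    proof -
      have "\<bar>integral {t..2 * t} hardy_Z_sq - integral {t..2 * t} (\<lambda>t. 1 * ln t + b)\<bar> \<le> e / 2 * (2 * t - t) + t powr (19/20)"
        by (rule T1) (use t T0 in auto)
      moreover have "t powr (19/20) \<le> e / 2 * t" by (rule T2) (use t T0 in auto)
      moreover have "integral {t..2 * t} hardy_Z_sq = hardy_moment (2 * t) - hardy_moment t"
        using hardy_moment_diff[of t "2 * t"] t T0 by simp
      moreover have "integral {t..2 * t} (\<lambda>t. 1 * ln t + b) = (2 * t * ln (2 * t) + (b - 1) * (2 * t)) - (t * ln t + (b - 1) * t)"
        using integral_log_plus[of t "2 * t" b] t T0 by simp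
      moreover have "e / 2 * (2 * t - t) + e / 2 * t = e * t" by simp
      ultimately show ?thesis unfolding h_def by linarith
    qed
    have dyadic: "0 \<le> t \<Longrightarrow> t \<le> 2 ^ n * (2 * T0) \<Longrightarrow> \<bar>h t\<bar> \<le> e * t + K" for n t
    proof (induction n arbitrary: t)
      case 0
      then have "\<bar>h t\<bar> \<le> K" by (intro small) auto
      moreover have "0 \<le> e * t" using e 0 by simp
      ultimately show ?case by linarith
    next
      case (Suc n)
      show ?case
      proof (cases "t \<le> 2 * T0")
        case True
        then have "\<bar>h t\<bar> \<le> K" using Suc by (intro small) auto
        moreover have "0 \<le> e * t" using e Suc by simp
        ultimately show ?thesis by linarith
      next
        case False
        have "\<bar>h (t / 2)\<bar> \<le> e * (t / 2) + K" using Suc by (intro Suc.IH) auto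
        moreover have "\<bar>h t - h (t / 2)\<bar> \<le> e * (t / 2)" using step[of "t / 2"] False by simp
        moreover have "e * (t / 2) + e * (t / 2) = e * t" by simp
        ultimately show ?thesis by linarith
      qed
    qed
    have "\<bar>h t\<bar> \<le> e * t + K" if t: "t \<ge> 0" for t
    proof -
      obtain n where "t < 2 ^ n" using real_arch_pow[of 2 t] by auto
      moreover have "2 ^ n * 1 \<le> 2 ^ n * (2 * T0)" using T0 by (intro mult_left_mono) auto
      ultimately have "t \<le> 2 ^ n * (2 * T0)" unfolding mult_1_right by linarith
      then show ?thesis by (rule dyadic[OF t])
    qed
    then show ?thesis using K0 by blast
  qed
  then show ?thesis unfolding h_def by blast
qed

section \<open>The truncated Laplace transform in the ladder's equation\<close>

lemma hardy_moment_derivative: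
  assumes "x \<in> {0..M}" shows "(hardy_moment has_real_derivative hardy_Z_sq x) (at x within {0..M})"
  unfolding hardy_moment_def has_real_derivative_iff_has_vector_derivative
  using integral_has_vector_derivative[OF continuous_on_hardy_Z_sq assms] .

lemma laplace_by_parts:
  assumes u: "u > 0" and M: "M \<ge> 0"
  shows "((\<lambda>t. hardy_moment t * exp (- t / u) / u) has_integral
     (integral {0..M} (\<lambda>t. hardy_Z_sq t * exp (- t / u)) - hardy_moment M * exp (- M / u))) {0..M}"
proof -
  have "((\<lambda>t. hardy_Z_sq t * exp (- t / u) - hardy_moment t * exp (- t / u) / u) has_integral
     hardy_moment M * exp (- M / u) - hardy_moment 0 * exp (- 0 / u)) {0..M}"
  proof (rule fundamental_theorem_of_calculus[OF M])
    fix x assume x: "x \<in> {0..M}"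
    have "((\<lambda>t. hardy_moment t * exp (- t / u)) has_real_derivative hardy_Z_sq x * exp (- x / u) - hardy_moment x * exp (- x / u) / u) (at x within {0..M})"
      using u by (auto intro!: derivative_eq_intros hardy_moment_derivative[OF x])
    then show "((\<lambda>t. hardy_moment t * exp (- t / u)) has_vector_derivative hardy_Z_sq x * exp (- x / u) - hardy_moment x * exp (- x / u) / u) (at x within {0..M})"
      by (simp add: has_real_derivative_iff_has_vector_derivative)
  qed
  moreover have "((\<lambda>t. hardy_Z_sq t * exp (- t / u)) has_integral integral {0..M} (\<lambda>t. hardy_Z_sq t * exp (- t / u))) {0..M}"
    using u by (intro integrable_integral integrable_continuous_interval continuous_intros continuous_on_hardy_Z_sq) auto
  ultimately show ?thesis
    using has_integral_diff[of "\<lambda>t. hardy_Z_sq t * exp (- t / u)" _ "{0..M}" "\<lambda>t. hardy_Z_sq t * exp (- t / u) - hardy_moment t * exp (- t / u) / u"]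
    by (fastforce simp: hardy_moment_def)
qed

text \<open>-Q(s) e^-s is an antiderivative of (Q - Q') e^-s. To integrate a polynomial P against
  e^-s one solves Q - Q' = P; then Q 0 is the integral over the half-line.\<close>

lemma exp_polynomial_has_integral:
  fixes Q Q' :: "real \<Rightarrow> real"
  assumes u: "u > 0" and M: "M \<ge> 0" and Q: "\<And>s. (Q has_real_derivative Q' s) (at s)"
  shows "((\<lambda>t. (Q (t / u) - Q' (t / u)) * exp (- t / u) / u) has_integral (Q 0 - Q (M / u) * exp (- M / u))) {0..M}"
proof -
  have "((\<lambda>t. (Q (t / u) - Q' (t / u)) * exp (- t / u) / u) has_integral (- Q (M / u) * exp (- M / u) - - Q (0 / u) * exp (- 0 / u))) {0..M}"
  proof (rule fundamental_theorem_of_calculus[OF M])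
    fix x
    have "((\<lambda>t. Q (t / u)) has_real_derivative Q' (x / u) * (1 / u)) (at x within {0..M})"
      by (rule DERIV_chain2[OF Q]) (use u in \<open>auto intro!: derivative_eq_intros\<close>)
    then have "((\<lambda>t. - Q (t / u) * exp (- t / u)) has_real_derivative (Q (x / u) - Q' (x / u)) * exp (- x / u) / u) (at x within {0..M})"
      using u by (auto intro!: derivative_eq_intros simp: field_simps)
    then show "((\<lambda>t. - Q (t / u) * exp (- t / u)) has_vector_derivative (Q (x / u) - Q' (x / u)) * exp (- x / u) / u) (at x within {0..M})"
      by (simp add: has_real_derivative_iff_has_vector_derivative)
  qed
  then show ?thesis by simp
qed

text \<open>The minorant is the cubic Taylor polynomial at 1, and the fourth derivative 2 / s^3 is
  positive. Concretely, the derivative d' of the difference vanishes at 1 and is increasing, because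
  its own derivative is (s - 1)^2 / s; so the difference has its minimum 0 at 1.\<close>

lemma mult_ln_ge_cubic:
  fixes s :: real
  assumes s: "s > 0"
  shows "(s - 1) + (s - 1)\<^sup>2 / 2 - (s - 1) ^ 3 / 6 \<le> s * ln s"
proof -
  define d d' where "d = (\<lambda>s::real. s * ln s - ((s - 1) + (s - 1)\<^sup>2 / 2 - (s - 1) ^ 3 / 6))"
    and "d' = (\<lambda>s::real. ln s - (s - 1) + (s - 1)\<^sup>2 / 2)"
  have D: "(d has_real_derivative d' x) (at x)" if "x > 0" for x
    unfolding d_def d'_def using that by (auto intro!: derivative_eq_intros simp: diff_divide_distrib)
  have D': "(d' has_real_derivative (x - 1)\<^sup>2 / x) (at x)" if "x > 0" for x
  proof -
    have "(d' has_real_derivative 1 / x - 1 + (x - 1)) (at x)"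
      unfolding d'_def using that by (auto intro!: derivative_eq_intros simp: diff_divide_distrib)
    moreover have "1 / x - 1 + (x - 1) = (x - 1)\<^sup>2 / x" using that by (simp add: divide_simps power2_eq_square) (simp add: algebra_simps)
    ultimately show ?thesis by simp
  qed
  have mono: "d' x \<le> d' y" if "0 < x" "x \<le> y" for x y
  proof (rule DERIV_nonneg_imp_nondecreasing[OF that(2)])
    fix z assume "x \<le> z"
    then show "\<exists>D. (d' has_real_derivative D) (at z) \<and> 0 \<le> D"
      using D'[of z] that by (intro exI[of _ "(z - 1)\<^sup>2 / z"]) auto
  qed
  have d1: "d 1 = 0" "d' 1 = 0" by (auto simp: d_def d'_def)
  have "d 1 \<le> d s"
  proof (cases "s \<ge> 1")
    case True
    show ?thesis
    proof (rule DERIV_nonneg_imp_nondecreasing[OF True])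
      fix z :: real assume "1 \<le> z"
      then show "\<exists>D. (d has_real_derivative D) (at z) \<and> 0 \<le> D"
        using D[of z] mono[of 1 z] d1 by (intro exI[of _ "d' z"]) auto
    qed
  next
    case False
    then have "s \<le> 1" by simp
    then show ?thesis
    proof (rule DERIV_nonpos_imp_nonincreasing)
      fix z :: real assume "s \<le> z" "z \<le> 1"
      then show "\<exists>D. (d has_real_derivative D) (at z) \<and> D \<le> 0"
        using D[of z] mono[of z 1] d1 s by (intro exI[of _ "d' z"]) auto
    qed
  qed
  then show ?thesis by (simp add: d1 d_def)
qed

text \<open>The cubic minorant \<open>p\<close> of \<open>s ln s\<close> (its Taylor polynomial at 1) satisfies \<open>\<integral>\<^sub>0\<^sup>\<infinity> p(s) e\<^sup>-\<^sup>s ds = 1/6 > 0\<close>;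
  this surplus is what pushes the value of the ladder's inverse above \<open>u\<close>.\<close>

lemma laplace_lower:
  assumes u: "u > 0" and M: "M \<ge> 0"
    and F: "\<And>t. t \<ge> 0 \<Longrightarrow> hardy_moment t \<ge> t * ln t + \<beta> * t - K"
    and X: "ln u + \<beta> \<le> (M / u - 1)\<^sup>2 / 2 - 1"
    and K: "K \<ge> 0"
  shows "integral {0..M} (\<lambda>t. hardy_Z_sq t * exp (- t / u)) \<ge> u * (ln u + \<beta> + 1/6) - K"
proof -
  define c where "c = ln u + \<beta>"
  \<comment> \<open>With t = u s one has t ln t + \<beta> t = u (c s + s ln s). Q is the polynomial
    with Q - Q' = u (c s + p(s)) - K for the cubic minorant p, and Q 0 = u (c + 1/6) - K.\<close>
  define Q Q' where "Q = (\<lambda>s. u * (c * (s + 1) + (- ((s - 1) ^ 3) / 6 + (s - 1) + 1)) - K)"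
    and "Q' = (\<lambda>s. u * (c + (1 - (s - 1)\<^sup>2 / 2)))"
  have Q: "(Q has_real_derivative Q' s) (at s)" for s
    unfolding Q_def Q'_def by (auto intro!: derivative_eq_intros simp: algebra_simps)
  have P: "Q s - Q' s = u * (c * s + ((s - 1) + (s - 1)\<^sup>2 / 2 - (s - 1) ^ 3 / 6)) - K" for s
    unfolding Q_def Q'_def by (simp add: algebra_simps)
  have le: "Q (t / u) - Q' (t / u) \<le> hardy_moment t" if t: "t > 0" for t
  proof -
    define s where "s = t / u"
    have s: "s > 0" "t = u * s" using t u by (auto simp: s_def)
    have "Q s - Q' s \<le> u * (c * s + s * ln s) - K"
      unfolding P using mult_ln_ge_cubic[OF s(1)] u by (intro diff_right_mono mult_left_mono add_left_mono) auto
    also have "\<dots> = t * ln t + \<beta> * t - K"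
      unfolding s(2) c_def ln_mult_pos[OF u s(1)] by (simp add: algebra_simps)
    also have "\<dots> \<le> hardy_moment t" using t by (intro F) auto
    finally show ?thesis by (simp add: s_def)
  qed
  have le0: "Q (t / u) - Q' (t / u) \<le> hardy_moment t" if t: "t \<ge> 0" for t
  proof (cases "t = 0")
    case True
    have "Q 0 - Q' 0 = - u / 3 - K" unfolding P by simp
    also have "\<dots> \<le> hardy_moment 0" using K u hardy_moment_nonneg[of 0] by linarith
    finally show ?thesis using True by simp
  qed (use le t in auto)
  have "Q 0 - Q (M / u) * exp (- M / u) \<le> integral {0..M} (\<lambda>t. hardy_Z_sq t * exp (- t / u)) - hardy_moment M * exp (- M / u)"
  proof (rule has_integral_le[OF exp_polynomial_has_integral[OF u M Q] laplace_by_parts[OF u M]])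
    fix t assume "t \<in> {0..M}"
    then show "(Q (t / u) - Q' (t / u)) * exp (- t / u) / u \<le> hardy_moment t * exp (- t / u) / u"
      using le0 u by (intro divide_right_mono mult_right_mono) auto
  qed
  moreover have "Q (M / u) * exp (- M / u) \<le> hardy_moment M * exp (- M / u)"
  proof (rule mult_right_mono)
    have "Q' (M / u) \<le> 0" unfolding Q'_def c_def using X u by (intro mult_nonneg_nonpos) auto
    then show "Q (M / u) \<le> hardy_moment M" using le0[OF M] by linarith
  qed simp
  moreover have "Q 0 = u * (ln u + \<beta> + 1/6) - K" by (simp add: Q_def c_def)
  ultimately show ?thesis by linarith
qed

text \<open>The crude majorant s^2 of s ln s suffices, with integral 2 against e^-s: the result is
  only compared with the moment at 2 u, whose leading term is twice as large.\<close>

lemma laplace_upper: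
  assumes u: "u > 0" and M: "M \<ge> 0"
    and F: "\<And>t. t \<ge> 0 \<Longrightarrow> hardy_moment t \<le> t * ln t + \<beta> * t + K"
    and c: "ln u + \<beta> \<ge> 0"
  shows "integral {0..M} (\<lambda>t. hardy_Z_sq t * exp (- t / u)) \<le> u * (ln u + \<beta> + 2) + K"
proof -
  define c where "c = ln u + \<beta>"
  define Q Q' where "Q = (\<lambda>s. u * (c * (s + 1) + (s\<^sup>2 + 2 * s + 2)) + K)"
    and "Q' = (\<lambda>s. u * (c + (2 * s + 2)))"
  have Q: "(Q has_real_derivative Q' s) (at s)" for s
    unfolding Q_def Q'_def by (auto intro!: derivative_eq_intros simp: algebra_simps)
  have P: "Q s - Q' s = u * (c * s + s\<^sup>2) + K" for s
    unfolding Q_def Q'_def by (simp add: algebra_simps)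
  have le: "hardy_moment t \<le> Q (t / u) - Q' (t / u)" if t: "t \<ge> 0" for t
  proof (cases "t = 0")
    case True
    then show ?thesis unfolding P using F[of 0] by simp
  next
    case False
    define s where "s = t / u"
    have s: "s > 0" "t = u * s" using t False u by (auto simp: s_def)
    have "hardy_moment t \<le> t * ln t + \<beta> * t + K" using t by (intro F) auto
    also have "\<dots> = u * (c * s + s * ln s) + K"
      unfolding s(2) c_def ln_mult_pos[OF u s(1)] by (simp add: algebra_simps)
    also have "s * ln s \<le> s\<^sup>2"
      using ln_le_minus_one[OF s(1)] s(1) by (auto simp: power2_eq_square intro!: mult_left_mono)
    then have "u * (c * s + s * ln s) + K \<le> u * (c * s + s\<^sup>2) + K" using u by simp
    finally show ?thesis unfolding P s_def[symmetric] .
  qed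
  have "integral {0..M} (\<lambda>t. hardy_Z_sq t * exp (- t / u)) - hardy_moment M * exp (- M / u) \<le> Q 0 - Q (M / u) * exp (- M / u)"
  proof (rule has_integral_le[OF laplace_by_parts[OF u M] exp_polynomial_has_integral[OF u M Q]])
    fix t assume "t \<in> {0..M}"
    then show "hardy_moment t * exp (- t / u) / u \<le> (Q (t / u) - Q' (t / u)) * exp (- t / u) / u"
      using le u by (intro divide_right_mono mult_right_mono) auto
  qed
  moreover have "hardy_moment M * exp (- M / u) \<le> Q (M / u) * exp (- M / u)"
  proof (rule mult_right_mono)
    have "Q' (M / u) \<ge> 0" unfolding Q'_def c_def using c u M by auto
    then show "hardy_moment M \<le> Q (M / u)" using le[OF M] by linarith
  qed simp
  moreover have "Q 0 = u * (ln u + \<beta> + 2) + K" by (simp add: Q_def c_def)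
  ultimately show ?thesis by linarith
qed

section \<open>The inverse of the ladder\<close>

lemma continuous_on_hardy_moment: "continuous_on {0..b} hardy_moment"
  unfolding hardy_moment_def[abs_def]
  by (rule indefinite_integral_continuous_1[OF hardy_Z_sq_integrable])

lemma damped_integrable: "(\<lambda>t. hardy_Z_sq t * exp (- c * t)) integrable_on {a..b}"
  by (intro integrable_continuous_interval continuous_intros continuous_on_hardy_Z_sq)

text \<open>Enlarging y increases both the damping factor, strictly for t > 0, and the range of
  integration. Equal values are therefore possible only if the Hardy function vanishes on (0,
  M].\<close>

lemma laplace_strict:
  assumes y: "0 < y" "y < y'" and M: "M \<le> M'"
    and eq: "integral {0..M} (\<lambda>t. hardy_Z_sq t * exp (- (2 / y) * t)) = integral {0..M'} (\<lambda>t. hardy_Z_sq t * exp (- (2 / y') * t))"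
  shows "integral {0..M} (\<lambda>t. hardy_Z_sq t * exp (- (2 / y) * t)) = 0"
proof (cases "M > 0")
  case M0: True
  define g where "g = (\<lambda>t. hardy_Z_sq t * exp (- (2 / y') * t) - hardy_Z_sq t * exp (- (2 / y) * t))"
  have cg: "continuous_on {0..M} g" unfolding g_def by (intro continuous_intros continuous_on_hardy_Z_sq)
  have less: "- (2 / y) * t < - (2 / y') * t" if "t > 0" for t
    using y that by (simp add: frac_less2)
  have g0: "g t \<ge> 0" if "t \<in> {0..M}" for t
    using less[of t] that hardy_Z_sq_nonneg[of t] unfolding g_def right_diff_distrib[symmetric]
    by (cases "t = 0") auto
  have "integral {0..M} (\<lambda>t. hardy_Z_sq t * exp (- (2 / y') * t)) \<le> integral {0..M'} (\<lambda>t. hardy_Z_sq t * exp (- (2 / y') * t))"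
    by (intro integral_subset_le damped_integrable) (use M hardy_Z_sq_nonneg in auto)
  then have "integral {0..M} g \<le> 0" unfolding g_def integral_diff[OF damped_integrable damped_integrable] eq by linarith
  moreover have "integral {0..M} g \<ge> 0" by (rule integral_nonneg) (use g0 cg in \<open>auto intro!: integrable_continuous_interval\<close>)
  ultimately have gz: "g t = 0" if "t \<in> {0..M}" for t
    using integral_eq_0_iff[OF cg M0 g0] that by auto
  have wz: "hardy_Z_sq t = 0" if "t \<in> {0..M}" "t \<noteq> 0" for t
    using gz[OF that(1)] less[of t] that unfolding g_def right_diff_distrib[symmetric] by auto
  have "integral {0..M} (\<lambda>t. hardy_Z_sq t * exp (- (2 / y) * t)) = integral {0..M} (\<lambda>t. 0 :: real)"
    by (rule integral_spike[of "{0}"]) (use wz in auto)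
  then show ?thesis by simp
next
  case False
  then show ?thesis by (cases "M = 0") auto
qed

text \<open>14 u ln (2 u) is the ladder's bound 7 y ln y at y = 2 u, the value of \<phi> when
  \<phi>_1 equals u. Then M / u exceeds 14 ln (2 u), whose square beats ln u, so the truncation
  condition of \<open>laplace_lower\<close> holds.\<close>

lemma eventually_laplace_lower:
  assumes F: "\<And>t. t \<ge> 0 \<Longrightarrow> hardy_moment t \<ge> t * ln t + \<beta> * t - K" and K: "K \<ge> 0"
  shows "eventually (\<lambda>u. \<forall>M \<ge> 14 * u * ln (2 * u). M \<ge> 0 \<and>
     integral {0..M} (\<lambda>t. hardy_Z_sq t * exp (- t / u)) \<ge> u * (ln u + \<beta> + 1/6) - K) at_top"
proof -
  have "eventually (\<lambda>u::real. ln u + \<beta> \<le> (14 * ln (2 * u) - 1)\<^sup>2 / 2 - 1) at_top" by real_asymp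
  moreover have "eventually (\<lambda>u::real. ln (2 * u) \<ge> 1) at_top" by real_asymp
  ultimately show ?thesis using eventually_gt_at_top[of 0]
  proof eventually_elim
    case (elim u)
    show ?case
    proof (intro allI impI)
      fix M assume M: "M \<ge> 14 * u * ln (2 * u)"
      have "14 * u * ln (2 * u) \<ge> 0" using elim(2,3) by (intro mult_nonneg_nonneg) linarith+
      then have M0: "M \<ge> 0" using M by linarith
      have "M / u \<ge> 14 * ln (2 * u)" using M elim by (simp add: le_divide_eq mult_ac)
      then have "(14 * ln (2 * u) - 1)\<^sup>2 \<le> (M / u - 1)\<^sup>2" using elim by (intro power_mono) auto
      then have X: "ln u + \<beta> \<le> (M / u - 1)\<^sup>2 / 2 - 1" using elim by linarith
      show "M \<ge> 0 \<and> integral {0..M} (\<lambda>t. hardy_Z_sq t * exp (- t / u)) \<ge> u * (ln u + \<beta> + 1/6) - K"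
        using M0 laplace_lower[OF elim(3) M0 F X K] by blast
    qed
  qed
qed

text \<open>\<open>inv_into\<close> is meaningful only if u is attained. The intermediate value
  theorem gives some T \<ge> T0 whose moment equals the transform \<Psi> (2 u); the ladder's
  equation then says \<Psi> (\<phi> T) = \<Psi> (2 u), and injectivity of \<Psi> forces \<phi> T = 2
  u. So surjectivity onto large u is obtained without continuity of the ladder.\<close>

lemma ladder_inv_equation:
  assumes ladder: "jacobs_ladder T0 \<phi>\<^sub>1"
  shows "eventually (\<lambda>u. ladder_inv T0 \<phi>\<^sub>1 u \<ge> 0 \<and> (\<exists>M \<ge> 14 * u * ln (2 * u).
     hardy_moment (ladder_inv T0 \<phi>\<^sub>1 u) = integral {0..M} (\<lambda>t. hardy_Z_sq t * exp (- t / u)))) at_top"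
proof -
  obtain \<mu> \<phi> :: "real \<Rightarrow> real" and y0 :: real where T0: "T0 \<ge> 0" and y0: "y0 > 0" and mono: "mono_on {y0..} \<mu>"
    and \<mu>': "\<forall>y\<ge>y0. \<mu> y \<ge> 7 * y * ln y"
    and sol: "\<forall>T\<ge>T0. \<phi> T \<ge> y0 \<and>
           integral {0..\<mu> (\<phi> T)} (\<lambda>t. hardy_Z_sq t * exp (- (2 / \<phi> T) * t)) = integral {0..T} hardy_Z_sq \<and>
           \<phi>\<^sub>1 T = \<phi> T / 2"
    using ladder unfolding jacobs_ladder_def by blast
  have \<mu>: "\<mu> y \<ge> 7 * y * ln y" if "y \<ge> y0" for y using \<mu>' that by blast
  have \<phi>: "\<phi> T \<ge> y0" and eq: "integral {0..\<mu> (\<phi> T)} (\<lambda>t. hardy_Z_sq t * exp (- (2 / \<phi> T) * t)) = hardy_moment T"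
    and \<phi>1: "\<phi>\<^sub>1 T = \<phi> T / 2" if "T \<ge> T0" for T
    using sol that unfolding hardy_moment_def by blast+
  obtain \<alpha> K where K: "K \<ge> 0" and F: "\<And>t. t \<ge> 0 \<Longrightarrow> \<bar>hardy_moment t - (t * ln t + \<alpha> * t)\<bar> \<le> 1 * t + K"
    using hardy_moment_asymp zero_less_one by metis
  have Fl: "hardy_moment t \<ge> t * ln t + (\<alpha> - 1) * t - K" if "t \<ge> 0" for t
    using F[OF that] by (simp add: abs_le_iff algebra_simps)
  define \<Psi> where "\<Psi> = (\<lambda>y. integral {0..\<mu> y} (\<lambda>t. hardy_Z_sq t * exp (- (2 / y) * t)))"
  \<comment> \<open>Monotonicity of \<mu> orders the upper limits as \<open>laplace_strict\<close>
    requires; positivity of \<Psi> y excludes its degenerate case.\<close>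
  have inj: "y = y'" if "y \<ge> y0" "y' \<ge> y0" "\<Psi> y = \<Psi> y'" "\<Psi> y > 0" for y y'
  proof -
    have *: "\<Psi> y = 0" if "y \<ge> y0" "y < y'" "\<Psi> y = \<Psi> y'" for y y'
      unfolding \<Psi>_def by (rule laplace_strict[of y y']) (use that y0 mono in \<open>auto simp: \<Psi>_def intro: mono_onD\<close>)
    show ?thesis using *[of y y'] *[of y' y] that by (cases y y' rule: linorder_cases) auto
  qed
  have \<Psi>eq: "\<Psi> (2 * u) = integral {0..\<mu> (2 * u)} (\<lambda>t. hardy_Z_sq t * exp (- t / u))" for u
    by (simp add: \<Psi>_def)
  have lower: "eventually (\<lambda>u. \<forall>M \<ge> 14 * u * ln (2 * u). M \<ge> 0 \<and>
     integral {0..M} (\<lambda>t. hardy_Z_sq t * exp (- t / u)) \<ge> u * (ln u + (\<alpha> - 1) + 1/6) - K) at_top"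
    using Fl K by (rule eventually_laplace_lower)
  have "eventually (\<lambda>u. hardy_moment T0 + 1 \<le> u * (ln u + (\<alpha> - 1) + 1/6) - K) at_top" by real_asymp
  with lower eventually_ge_at_top[of y0]
  show ?thesis
  proof eventually_elim
    case (elim u)
    have u: "2 * u \<ge> y0" using elim y0 by simp
    have M: "\<mu> (2 * u) \<ge> 14 * u * ln (2 * u)" using \<mu>[OF u] by simp
    have big: "\<Psi> (2 * u) \<ge> hardy_moment T0 + 1" unfolding \<Psi>eq using elim M by force
    have pos: "\<Psi> (2 * u) > 0" using big hardy_moment_nonneg[of T0] by linarith
    have "eventually (\<lambda>t. t * ln t + (\<alpha> - 1) * t - K \<ge> \<Psi> (2 * u)) at_top" by real_asymp
    then have "eventually (\<lambda>t. t * ln t + (\<alpha> - 1) * t - K \<ge> \<Psi> (2 * u) \<and> t \<ge> T0) at_top"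
      using eventually_ge_at_top[of T0] by (rule eventually_conj)
    then obtain S where S: "S * ln S + (\<alpha> - 1) * S - K \<ge> \<Psi> (2 * u)" "S \<ge> T0"
      using eventually_happens'[OF trivial_limit_at_top_linorder] by blast
    have "\<exists>T\<ge>T0. T \<le> S \<and> hardy_moment T = \<Psi> (2 * u)"
    proof (rule IVT')
      show "hardy_moment T0 \<le> \<Psi> (2 * u)" using big by simp
      show "\<Psi> (2 * u) \<le> hardy_moment S" using S(1) Fl[OF order_trans[OF T0 S(2)]] by (rule order_trans)
      show "continuous_on {T0..S} hardy_moment"
        by (rule continuous_on_subset[OF continuous_on_hardy_moment[of S]]) (use T0 in auto)
    qed (use S in auto)
    then obtain T where T: "T \<ge> T0" "hardy_moment T = \<Psi> (2 * u)" by blast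
    have "\<Psi> (\<phi> T) = \<Psi> (2 * u)" using eq[OF T(1)] T(2) by (simp add: \<Psi>_def)
    with pos have "\<phi> T = 2 * u" using inj[OF \<phi>[OF T(1)] u] by simp
    then have "\<phi>\<^sub>1 T = u" using \<phi>1[OF T(1)] by simp
    then have "u \<in> \<phi>\<^sub>1 ` {T0..}" using T(1) by force
    define V where "V = ladder_inv T0 \<phi>\<^sub>1 u"
    have V: "V \<ge> T0" "\<phi>\<^sub>1 V = u"
      using inv_into_into[OF \<open>u \<in> \<phi>\<^sub>1 ` {T0..}\<close>] f_inv_into_f[OF \<open>u \<in> \<phi>\<^sub>1 ` {T0..}\<close>] by (auto simp: V_def ladder_inv_def)
    have "\<phi> V = 2 * u" using V \<phi>1[OF V(1)] by simp
    then have "hardy_moment V = \<Psi> (2 * u)" using eq[OF V(1)] by (simp add: \<Psi>_def)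
    then show ?case using M V T0 unfolding \<Psi>eq V_def by auto
  qed
qed

text \<open>\<open>laplace_lower\<close> puts the moment at V at least u / 6 above u ln u + \<alpha>
  u, up to small errors, while the moment at u has just that size. The surplus must be collected on
  [u, V], where the density is about ln u.\<close>

lemma ladder_inv_gap:
  assumes ladder: "jacobs_ladder T0 \<phi>\<^sub>1"
  shows "eventually (\<lambda>u. u < ladder_inv T0 \<phi>\<^sub>1 u \<and> ladder_inv T0 \<phi>\<^sub>1 u \<le> 2 * u \<and>
     u / (40 * ln u) \<le> ladder_inv T0 \<phi>\<^sub>1 u - u) at_top"
proof -
  obtain \<alpha> K where K: "K \<ge> 0" and F: "\<And>t. t \<ge> 0 \<Longrightarrow> \<bar>hardy_moment t - (t * ln t + \<alpha> * t)\<bar> \<le> 1 / 60 * t + K"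
    using hardy_moment_asymp by (metis zero_less_divide_1_iff zero_less_numeral)
  have Fl: "hardy_moment t \<ge> t * ln t + (\<alpha> - 1 / 60) * t - K" and Fu: "hardy_moment t \<le> t * ln t + (\<alpha> + 1 / 60) * t + K"
    if "t \<ge> 0" for t
    using F[OF that] by (auto simp: abs_le_iff algebra_simps)
  obtain b where b: "mean_law hardy_Z_sq 1 b" using hardy_Z_sq_mean_law by blast
  then obtain T1 where T1: "\<And>T p q. T \<ge> T1 \<Longrightarrow> T \<le> p \<Longrightarrow> p \<le> q \<Longrightarrow> q \<le> 2 * T \<Longrightarrow>
      \<bar>integral {p..q} hardy_Z_sq - integral {p..q} (\<lambda>t. 1 * ln t + b)\<bar> \<le> 1 * (q - p) + T powr (19/20)"
    unfolding mean_law_def by (metis zero_less_one)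
  have e1: "eventually (\<lambda>u. 2 * u * ln (2 * u) + (\<alpha> - 1 / 60) * (2 * u) - K > u * (ln u + (\<alpha> + 1 / 60) + 2) + K) at_top"
    by real_asymp
  have e2: "eventually (\<lambda>u::real. ln u + (\<alpha> + 1 / 60) \<ge> 0) at_top" by real_asymp
  have e3: "eventually (\<lambda>u::real. ln (2 * u) + b + 1 \<le> 2 * ln u) at_top" by real_asymp
  have e4: "eventually (\<lambda>u::real. u powr (19/20) \<le> u / 20) at_top" by real_asymp
  have e5: "eventually (\<lambda>u::real. ln u > 0) at_top" by real_asymp
  have e6: "eventually (\<lambda>u. u > 0 \<and> u \<ge> 60 * K \<and> u \<ge> T1) at_top"
    by (intro eventually_conj eventually_ge_at_top eventually_gt_at_top)
  have lower: "eventually (\<lambda>u. \<forall>M \<ge> 14 * u * ln (2 * u). M \<ge> 0 \<and>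
     integral {0..M} (\<lambda>t. hardy_Z_sq t * exp (- t / u)) \<ge> u * (ln u + (\<alpha> - 1 / 60) + 1/6) - K) at_top"
    using Fl K by (rule eventually_laplace_lower)
  from ladder_inv_equation[OF ladder] lower e1 e2 e3 e4 e5 e6
  show ?thesis
  proof eventually_elim
    case (elim u)
    define V where "V = ladder_inv T0 \<phi>\<^sub>1 u"
    have V0: "V \<ge> 0" using elim by (simp add: V_def)
    have u: "u > 0" "u \<ge> 60 * K" "u \<ge> T1" using elim by auto
    obtain M where M: "M \<ge> 14 * u * ln (2 * u)" "hardy_moment V = integral {0..M} (\<lambda>t. hardy_Z_sq t * exp (- t / u))"
      using elim(1) unfolding V_def by blast
    have lo: "hardy_moment V \<ge> u * (ln u + (\<alpha> - 1 / 60) + 1/6) - K" and M0: "M \<ge> 0"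
      using elim(2) M by auto
    \<comment> \<open>This bounds V by 2 u, which is needed to apply the mean law on [u, V].\<close>
    have "hardy_moment V \<le> u * (ln u + (\<alpha> + 1 / 60) + 2) + K"
      unfolding M(2) by (rule laplace_upper[OF u(1) M0 Fu elim(4)])
    also have "\<dots> < 2 * u * ln (2 * u) + (\<alpha> - 1 / 60) * (2 * u) - K" by (rule elim(3))
    also have "\<dots> \<le> hardy_moment (2 * u)" using Fl[of "2 * u"] u by simp
    finally have "hardy_moment V < hardy_moment (2 * u)" .
    then have V2: "V \<le> 2 * u" using hardy_moment_mono[of "2 * u" V] u by (cases "V \<le> 2 * u") auto
    \<comment> \<open>With accuracy 1/60 on both sides the surplus 1/6 shrinks to 2/15, and 2 K
      \<le> u / 30 leaves u / 10. Half of that later covers the term u^(19/20), and density at most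
      2 ln u on the remaining u / 20 gives the constant 40.\<close>
    have "u * (ln u + (\<alpha> - 1 / 60) + 1/6) - K - (u * ln u + (\<alpha> + 1 / 60) * u + K) = u * (2 / 15) - 2 * K"
      by (simp add: algebra_simps)
    then have diff: "hardy_moment V - hardy_moment u \<ge> u / 10" using lo Fu[of u] u by linarith
    then have "hardy_moment V > hardy_moment u" using u by linarith
    then have V1: "u < V" using hardy_moment_mono[OF V0, of u] by (cases "u < V") auto
    have "hardy_moment V - hardy_moment u = integral {u..V} hardy_Z_sq" using V1 u by (intro hardy_moment_diff) auto
    also have "\<dots> \<le> integral {u..V} (\<lambda>t. 1 * ln t + b) + 1 * (V - u) + u powr (19/20)"
      using T1[of u u V] V1 V2 u by (auto simp: abs_le_iff)
    also have "integral {u..V} (\<lambda>t. 1 * ln t + b) \<le> integral {u..V} (\<lambda>t. ln (2 * u) + b)"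
      by (rule integral_le) (use u V1 V2 in \<open>auto intro!: integrable_continuous_interval continuous_intros\<close>)
    also have "\<dots> = (V - u) * (ln (2 * u) + b)" using V1 by simp
    finally have "u / 10 \<le> (V - u) * (ln (2 * u) + b + 1) + u powr (19/20)" using diff by (simp add: algebra_simps)
    also have "(V - u) * (ln (2 * u) + b + 1) \<le> (V - u) * (2 * ln u)" using V1 elim by (intro mult_left_mono) auto
    finally have "u / 20 \<le> (V - u) * (2 * ln u)" using elim by linarith
    then have "u / (40 * ln u) \<le> V - u" using elim by (simp add: divide_le_eq mult_ac)
    then show ?case using V1 V2 by (simp add: V_def)
  qed
qed

text \<open>u^(19/20) is negligible against the length, which is at least of order u / ln u, and ln
  t varies by at most ln 2 on [u, 2 u]. For a = 0 the second error disappears and a limit results;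
  for a = 1 it is bounded, hence small against ln u.\<close>

lemma mean_law_short_interval:
  assumes law: "mean_law w a b" and e: "e > 0"
    and V: "eventually (\<lambda>u. u < V u \<and> V u \<le> 2 * u \<and> u / (40 * ln u) \<le> V u - u) at_top"
  shows "eventually (\<lambda>u. \<bar>integral {u..V u} w / (V u - u) - (a * ln u + b)\<bar> \<le> e + \<bar>a\<bar> * ln 2) at_top"
proof -
  obtain T1 where T1: "\<And>T p q. T \<ge> T1 \<Longrightarrow> T \<le> p \<Longrightarrow> p \<le> q \<Longrightarrow> q \<le> 2 * T \<Longrightarrow>
      \<bar>integral {p..q} w - integral {p..q} (\<lambda>t. a * ln t + b)\<bar> \<le> e / 2 * (q - p) + T powr (19/20)"
    using law e unfolding mean_law_def by (metis half_gt_zero)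
  have "((\<lambda>u::real. u powr (19/20) / (u / (40 * ln u))) \<longlongrightarrow> 0) at_top" by real_asymp
  then have e1: "eventually (\<lambda>u::real. u powr (19/20) / (u / (40 * ln u)) < e / 2) at_top" by (rule order_tendstoD) (use e in simp)
  have e2: "eventually (\<lambda>u::real. u / (40 * ln u) > 0) at_top" by real_asymp
  from V e1 e2 eventually_ge_at_top[of T1] eventually_gt_at_top[of 0]
  show ?thesis
  proof eventually_elim
    case (elim u)
    define d where "d = V u - u"
    have d: "d > 0" "u / (40 * ln u) \<le> d" using elim by (auto simp: d_def)
    define l where "l = (\<lambda>t. a * ln t + b)"
    have "u powr (19/20) / d \<le> u powr (19/20) / (u / (40 * ln u))" using d elim by (intro divide_left_mono mult_pos_pos) auto
    then have "u powr (19/20) / d \<le> e / 2" using elim by linarith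
    then have p: "u powr (19/20) \<le> e / 2 * d" using d by (simp add: divide_le_eq)
    have 1: "\<bar>integral {u..V u} w - integral {u..V u} l\<bar> \<le> e / 2 * d + u powr (19/20)"
      unfolding l_def d_def by (rule T1) (use elim in auto)
    have li: "l integrable_on {u..V u}" unfolding l_def using elim
      by (intro integrable_continuous_interval continuous_intros) auto
    have nb: "norm (integral {u..V u} (\<lambda>t. l t - l u)) \<le> integral {u..V u} (\<lambda>_. \<bar>a\<bar> * ln 2)"
    proof (rule integral_norm_bound_integral)
      fix t assume t: "t \<in> {u..V u}"
      have "ln t \<le> ln (2 * u)" "ln u \<le> ln t" using t elim by auto
      moreover have "ln (2 * u) = ln 2 + ln u" using elim by (intro ln_mult_pos) auto
      ultimately have "\<bar>ln t - ln u\<bar> \<le> ln 2" by linarith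
      then show "norm (l t - l u) \<le> \<bar>a\<bar> * ln 2"
        by (simp add: l_def abs_mult mult_left_mono flip: right_diff_distrib)
    qed (auto intro!: integrable_diff li)
    have 2: "\<bar>integral {u..V u} l - d * l u\<bar> \<le> d * (\<bar>a\<bar> * ln 2)"
    proof -
      have "integral {u..V u} (\<lambda>t. l t - l u) = integral {u..V u} l - d * l u"
        by (subst integral_diff[OF li]) (use d in \<open>auto simp: d_def\<close>)
      moreover have "integral {u..V u} (\<lambda>_. \<bar>a\<bar> * ln 2) = d * (\<bar>a\<bar> * ln 2)" using d by (simp add: d_def)
      ultimately show ?thesis using nb by (simp only: real_norm_def)
    qed
    have "\<bar>integral {u..V u} w - d * l u\<bar> \<le> d * (e + \<bar>a\<bar> * ln 2)"
      using 1 2 p by (simp add: distrib_left mult.commute)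
    moreover have "integral {u..V u} w / d - l u = (integral {u..V u} w - d * l u) / d" using d by (simp add: diff_divide_distrib)
    ultimately have "\<bar>integral {u..V u} w / d - l u\<bar> \<le> e + \<bar>a\<bar> * ln 2"
      using d(1) by (simp add: abs_divide divide_le_eq mult.commute)
    then show ?case unfolding l_def d_def .
  qed
qed

lemma mean_law_short_interval_const:
  assumes "mean_law w 0 b"
    and "eventually (\<lambda>u. u < V u \<and> V u \<le> 2 * u \<and> u / (40 * ln u) \<le> V u - u) at_top"
  shows "((\<lambda>u. integral {u..V u} w / (V u - u)) \<longlongrightarrow> b) at_top"
proof (rule tendstoI)
  fix e :: real assume "e > 0"
  then have "e / 2 > 0" by simp
  from mean_law_short_interval[OF assms(1) this assms(2)]
  show "eventually (\<lambda>u. dist (integral {u..V u} w / (V u - u)) b < e) at_top"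
    by eventually_elim (use \<open>e > 0\<close> in \<open>simp add: dist_real_def\<close>)
qed

lemma mean_law_short_interval_log:
  assumes "mean_law w 1 b"
    and V: "eventually (\<lambda>u. u < V u \<and> V u \<le> 2 * u \<and> u / (40 * ln u) \<le> V u - u) at_top"
  shows "((\<lambda>u. integral {u..V u} w / ((V u - u) * ln u)) \<longlongrightarrow> 1) at_top"
proof -
  have "((\<lambda>u. integral {u..V u} w / ((V u - u) * ln u) - 1) \<longlongrightarrow> 0) at_top"
  proof (rule Lim_null_comparison)
    show "((\<lambda>u::real. (1 + ln 2 + \<bar>b\<bar>) / ln u) \<longlongrightarrow> 0) at_top" by real_asymp
    have "eventually (\<lambda>u::real. ln u > 0) at_top" by real_asymp
    with mean_law_short_interval[OF assms(1) zero_less_one V]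
    show "\<forall>\<^sub>F u in at_top. norm (integral {u..V u} w / ((V u - u) * ln u) - 1) \<le> (1 + ln 2 + \<bar>b\<bar>) / ln u"
    proof eventually_elim
      case (elim u)
      have "integral {u..V u} w / ((V u - u) * ln u) - 1 = (integral {u..V u} w / (V u - u) - ln u) / ln u"
        using elim(2) by (simp add: diff_divide_distrib)
      moreover have "\<bar>integral {u..V u} w / (V u - u) - ln u\<bar> \<le> 1 + ln 2 + \<bar>b\<bar>"
        using elim(1) unfolding abs_one mult_1 by linarith
      ultimately show ?case using elim(2) by (simp add: abs_divide divide_right_mono)
    qed
  qed
  from tendsto_add[OF this tendsto_const[of 1]] show ?thesis by simp
qed

section \<open>The leading fourth moment and the final limit\<close>

lemma zeta_real_axis:
  assumes "p > 1" shows "Re (zeta (of_real p)) = (\<Sum>m. real (Suc m) powr (- p))" "Re (zeta (of_real p)) \<ge> 1"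
proof -
  have s: "summable (\<lambda>m. real (Suc m) powr (- p))" by (rule summable_Suc_powr) (use assms in auto)
  have eq: "(of_nat (Suc n) :: complex) powr (- of_real p) = of_real (real (Suc n) powr (- p))" for n
    by (subst powr_of_real[symmetric]) auto
  have "zeta (of_real p) = (\<Sum>n. of_nat (Suc n) powr (- of_real p))"
    using zeta_eq_dirichlet[of "of_real p"] assms by (simp add: dirichlet_zeta_def)
  also have "\<dots> = of_real (\<Sum>m. real (Suc m) powr (- p))" unfolding eq by (rule suminf_of_real[symmetric, OF s])
  finally show 1: "Re (zeta (of_real p)) = (\<Sum>m. real (Suc m) powr (- p))" by simp
  have "sum (\<lambda>m. real (Suc m) powr (- p)) {..<1} \<le> (\<Sum>m. real (Suc m) powr (- p))"
    by (rule sum_le_suminf[OF s]) auto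
  then show "Re (zeta (of_real p)) \<ge> 1" unfolding 1 by simp
qed

lemma fourth_moment_leading:
  fixes a :: "nat \<Rightarrow> real"
  assumes "(\<lambda>T. zeta_moment 4 (1/2) 0 T - T * (\<Sum>s=0..4. a s * ln T ^ (4 - s))) \<in> O[at_top](\<lambda>T. T powr \<theta>)" "\<theta> < 1"
  shows "((\<lambda>T. zeta_moment 4 (1/2) 0 T / (T * ln T ^ 4)) \<longlongrightarrow> a 0) at_top"
proof -
  have "(\<lambda>T::real. T powr \<theta>) \<in> o(\<lambda>T. T * ln T ^ 4)" using assms(2) by real_asymp
  with assms(1) have "(\<lambda>T. zeta_moment 4 (1/2) 0 T - T * (\<Sum>s=0..4. a s * ln T ^ (4 - s))) \<in> o(\<lambda>T. T * ln T ^ 4)"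
    by (rule landau_o.big_small_trans)
  from smalloD_tendsto[OF this]
  have 1: "((\<lambda>T. (zeta_moment 4 (1/2) 0 T - T * (\<Sum>s=0..4. a s * ln T ^ (4 - s))) / (T * ln T ^ 4)) \<longlongrightarrow> 0) at_top" .
  have "((\<lambda>T. \<Sum>s=0..4. a s * (1 / ln T) ^ s) \<longlongrightarrow> (\<Sum>s=0..4. a s * 0 ^ s)) at_top"
  proof (intro tendsto_intros)
    show "((\<lambda>T::real. 1 / ln T) \<longlongrightarrow> 0) at_top" by real_asymp
  qed
  from tendsto_add[OF 1 this]
  have "((\<lambda>T. (zeta_moment 4 (1/2) 0 T - T * (\<Sum>s=0..4. a s * ln T ^ (4 - s))) / (T * ln T ^ 4) + (\<Sum>s=0..4. a s * (1 / ln T) ^ s)) \<longlongrightarrow> a 0) at_top"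
    by (simp add: power_0_left sum.atLeast_Suc_atMost)
  moreover have "eventually (\<lambda>T::real. T > 0 \<and> ln T > 0) at_top"
    by (intro eventually_conj eventually_gt_at_top) real_asymp
  then have "eventually (\<lambda>T. (zeta_moment 4 (1/2) 0 T - T * (\<Sum>s=0..4. a s * ln T ^ (4 - s))) / (T * ln T ^ 4) + (\<Sum>s=0..4. a s * (1 / ln T) ^ s)
      = zeta_moment 4 (1/2) 0 T / (T * ln T ^ 4)) at_top"
  proof eventually_elim
    case (elim T)
    have "a s * (1 / ln T) ^ s = T * (a s * ln T ^ (4 - s)) / (T * ln T ^ 4)" if "s \<in> {0..4}" for s
    proof -
      have L: "ln T ^ 4 = ln T ^ (4 - s) * ln T ^ s" using that by (simp flip: power_add)
      have "y * (1 / q) = T * (y * p) / (T * (p * q))" if "p \<noteq> 0" "q \<noteq> 0" for y p q :: real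
        using that elim by simp
      note * = this[of "ln T ^ (4 - s)" "ln T ^ s" "a s"]
      show ?thesis unfolding L power_divide power_one by (rule *) (use elim in auto)
    qed
    then have "(\<Sum>s=0..4. a s * (1 / ln T) ^ s) = T * (\<Sum>s=0..4. a s * ln T ^ (4 - s)) / (T * ln T ^ 4)"
      by (simp add: sum_distrib_left sum_divide_distrib)
    then show ?case by (simp add: diff_divide_distrib)
  qed
  ultimately show ?thesis by (rule Lim_transform_eventually)
qed

theorem theorem1:
  fixes \<epsilon> \<sigma> x T0 :: real
    and \<phi>\<^sub>1 u :: "real \<Rightarrow> real"
    and a c :: "nat \<Rightarrow> real"
  assumes eps: "\<epsilon> > 0"
    and sigma: "\<sigma> \<ge> 1/2 + \<epsilon>"
    and x: "x > 0"
    and ladder: "jacobs_ladder T0 \<phi>\<^sub>1"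
    and a0: "a 0 = 1 / (2 * pi\<^sup>2)"
    and fourth_moment: "\<And>\<delta>. \<delta> > 0 \<Longrightarrow>
          (\<lambda>T. zeta_moment 4 (1/2) 0 T - T * (\<Sum>s=0..4. a s * ln T ^ (4 - s)))
            \<in> O[at_top](\<lambda>T. T powr (7/8 + \<delta>))"
    and c0: "c 0 = 1"
    and c: "\<And>s. s \<in> {1..4} \<Longrightarrow> c s = 2 * pi\<^sup>2 * inverse (Re (zeta (of_real (2 * \<sigma>))) ^ s) * a s"
    and u: "\<And>\<tau>. u \<tau> = 2 * pi\<^sup>2 / Re (zeta (of_real (2 * \<sigma>))) ^ 4 * x * \<tau>"
  shows "((\<lambda>\<tau>. 1 / \<tau> *
           (zeta_moment 2 \<sigma> (u \<tau>) (ladder_inv T0 \<phi>\<^sub>1 (u \<tau>)) ^ 4 * zeta_moment 4 (1/2) 0 (u \<tau>) /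
            (\<Sum>s=0..4. c s * zeta_moment 2 (1/2) (u \<tau>) (ladder_inv T0 \<phi>\<^sub>1 (u \<tau>)) ^ (4 - s)
                           * zeta_moment 2 \<sigma> (u \<tau>) (ladder_inv T0 \<phi>\<^sub>1 (u \<tau>)) ^ s)))
          \<longlongrightarrow> x) at_top"
proof -
  define Z where "Z = Re (zeta (of_real (2 * \<sigma>)))"
  have \<sigma>: "\<sigma> > 1/2" using eps sigma by linarith
  have Zs: "Z = (\<Sum>m. real (Suc m) powr (- 2 * \<sigma>))" and Z1: "Z \<ge> 1"
    using zeta_real_axis[of "2 * \<sigma>"] \<sigma> by (auto simp: Z_def)
  define V where "V = ladder_inv T0 \<phi>\<^sub>1"
  have V: "eventually (\<lambda>v. v < V v \<and> V v \<le> 2 * v \<and> v / (40 * ln v) \<le> V v - v) at_top"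
    unfolding V_def by (rule ladder_inv_gap[OF ladder])
  define A B M where "A = (\<lambda>v. zeta_moment 2 \<sigma> v (V v))" and "B = (\<lambda>v. zeta_moment 2 (1/2) v (V v))"
    and "M = zeta_moment 4 (1/2) 0"
  \<comment> \<open>Normalised by the interval length d = V v - v and by ln v these have finite
    limits: Z, 1 and a 0.\<close>
  define rA rB rM where "rA = (\<lambda>v. A v / (V v - v))" and "rB = (\<lambda>v. B v / ((V v - v) * ln v))"
    and "rM = (\<lambda>v. M v / (v * ln v ^ 4))"
  have A: "(rA \<longlongrightarrow> Z) at_top"
    unfolding rA_def A_def zeta_moment_def Zs
    by (rule mean_law_short_interval_const[OF mean_law_zeta[OF \<sigma>] V])
  obtain b where "mean_law hardy_Z_sq 1 b" using hardy_Z_sq_mean_law by blast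
  from mean_law_short_interval_log[OF this V]
  have B: "(rB \<longlongrightarrow> 1) at_top" unfolding rB_def B_def zeta_moment_def hardy_Z_sq_def[abs_def] .
  have M: "(rM \<longlongrightarrow> a 0) at_top"
    unfolding rM_def M_def by (rule fourth_moment_leading[OF fourth_moment[of "1/16"]]) auto
  \<comment> \<open>In these quantities the powers of d and of L = ln v cancel: numerator and
    denominator both carry d^4 L^4, and a single factor v is left over. Each factor A in place of B
    costs 1 / ln v, so only the term with s = 0 survives in the denominator.\<close>
  have "((\<lambda>v. rA v ^ 4 * rM v / (\<Sum>s=0..4. c s * rB v ^ (4 - s) * (rA v * (1 / ln v)) ^ s))
      \<longlongrightarrow> Z ^ 4 * a 0 / (\<Sum>s=0..4. c s * 1 ^ (4 - s) * (Z * 0) ^ s)) at_top"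
  proof (intro tendsto_intros A B M)
    show "((\<lambda>v::real. 1 / ln v) \<longlongrightarrow> 0) at_top" by real_asymp
    show "(\<Sum>s=0..4. c s * 1 ^ (4 - s) * (Z * 0) ^ s) \<noteq> 0" using c0 by (simp add: power_0_left sum.atLeast_Suc_atMost)
  qed
  then have "((\<lambda>v. rA v ^ 4 * rM v / (\<Sum>s=0..4. c s * rB v ^ (4 - s) * (rA v * (1 / ln v)) ^ s)) \<longlongrightarrow> Z ^ 4 * a 0) at_top"
    using c0 by (simp add: power_0_left sum.atLeast_Suc_atMost)
  moreover have "eventually (\<lambda>v::real. v > 0 \<and> ln v > 0) at_top"
    by (intro eventually_conj eventually_gt_at_top) real_asymp
  with V have "eventually (\<lambda>v. rA v ^ 4 * rM v / (\<Sum>s=0..4. c s * rB v ^ (4 - s) * (rA v * (1 / ln v)) ^ s)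
      = (A v ^ 4 * M v / (\<Sum>s=0..4. c s * B v ^ (4 - s) * A v ^ s)) / v) at_top"
  proof eventually_elim
    case (elim v)
    define d L where "d = V v - v" and "L = ln v"
    have p: "d > 0" "L > 0" "v > 0" using elim by (auto simp: d_def L_def)
    have eq: "A v = rA v * d" "B v = rB v * (d * L)" "M v = rM v * (v * L ^ 4)"
      using p by (auto simp: rA_def rB_def rM_def d_def L_def)
    have "c s * B v ^ (4 - s) * A v ^ s = (d ^ 4 * L ^ 4) * (c s * rB v ^ (4 - s) * (rA v * (1 / L)) ^ s)" if "s \<in> {0..4}" for s
    proof -
      have "d ^ 4 = d ^ (4 - s) * d ^ s" "L ^ 4 = L ^ (4 - s) * L ^ s" using that by (simp_all flip: power_add)
      then show ?thesis unfolding eq power_mult_distrib power_divide using p by simp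
    qed
    then have D: "(\<Sum>s=0..4. c s * B v ^ (4 - s) * A v ^ s) = (d ^ 4 * L ^ 4) * (\<Sum>s=0..4. c s * rB v ^ (4 - s) * (rA v * (1 / L)) ^ s)"
      unfolding sum_distrib_left by (intro sum.cong) auto
    have "r ^ 4 * q / S = ((r * d) ^ 4 * (q * (v * L ^ 4)) / ((d ^ 4 * L ^ 4) * S)) / v" for r q S :: real
      using p by (simp add: power_mult_distrib)
    then show ?case unfolding D L_def[symmetric] unfolding eq .
  qed
  ultimately have lim: "((\<lambda>v. (A v ^ 4 * M v / (\<Sum>s=0..4. c s * B v ^ (4 - s) * A v ^ s)) / v) \<longlongrightarrow> Z ^ 4 * a 0) at_top"
    by (rule Lim_transform_eventually)
  \<comment> \<open>The slope of u; it is chosen so that k times the limit Z^4 / (2 pi^2) is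
    x.\<close>
  define k where "k = 2 * pi\<^sup>2 / Z ^ 4 * x"
  have k: "k > 0" using x Z1 by (simp add: k_def)
  have uk: "u = (\<lambda>\<tau>. k * \<tau>)" by (rule ext) (simp add: u k_def Z_def)
  have "filterlim u at_top at_top" unfolding uk by (rule filterlim_tendsto_pos_mult_at_top[OF tendsto_const k filterlim_ident])
  from tendsto_mult_left[OF filterlim_compose[OF lim this], of k]
  have "((\<lambda>\<tau>. k * ((A (u \<tau>) ^ 4 * M (u \<tau>) / (\<Sum>s=0..4. c s * B (u \<tau>) ^ (4 - s) * A (u \<tau>) ^ s)) / u \<tau>)) \<longlongrightarrow> k * (Z ^ 4 * a 0)) at_top" .
  also have "k * (Z ^ 4 * a 0) = x" using Z1 by (simp add: k_def a0)
  also have "(\<lambda>\<tau>. k * ((A (u \<tau>) ^ 4 * M (u \<tau>) / (\<Sum>s=0..4. c s * B (u \<tau>) ^ (4 - s) * A (u \<tau>) ^ s)) / u \<tau>))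
      = (\<lambda>\<tau>. 1 / \<tau> * (A (u \<tau>) ^ 4 * M (u \<tau>) / (\<Sum>s=0..4. c s * B (u \<tau>) ^ (4 - s) * A (u \<tau>) ^ s)))"
  proof
    fix \<tau>
    have "k * (E / u \<tau>) = 1 / \<tau> * E" for E using k by (simp add: uk)
    then show "k * ((A (u \<tau>) ^ 4 * M (u \<tau>) / (\<Sum>s=0..4. c s * B (u \<tau>) ^ (4 - s) * A (u \<tau>) ^ s)) / u \<tau>)
      = 1 / \<tau> * (A (u \<tau>) ^ 4 * M (u \<tau>) / (\<Sum>s=0..4. c s * B (u \<tau>) ^ (4 - s) * A (u \<tau>) ^ s))" .
  qed
  finally show ?thesis unfolding A_def B_def M_def V_def .
qed

end
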